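(* Let $M=[0,1]$, let $D_\epsilon$, $p_1$, $w_1$ be the operator and coefficients on $[0,1]$ given in the context (with $\epsilon>0$ sufficiently small), let $M_+=\{x\in[0,1]:p_1(x)>0\}$, and set $$V=\left\{v\in L^2(M_+,w_1):\int_{M_+}p_1(x)|v'(x)|^2\,dx<\infty\right\}.$$ If the eigenfunctions $u$ of $D_\epsilon$ on $M$ satisfy $\lim_{x\to y}p_1(x)u'(x)=0$ for every $y\in\partial M_+$, then the eigenvalues $\{\lambda_j\}_j$ satisfy $$\lambda_j=\max_{\substack{V_j\subseteq L^2(M_+,w_1),\\ |V_j|=j-1}}\left\{\min_{v\in V\cap V_j^\perp\setminus\{0\}}\frac{\displaystyle\int_{M_+}p_1(x)|v'(x)|^2\,dx}{\displaystyle\int_{M_+}w_1(x)|v(x)|^2\,dx}\right\}$$ for all $j\ge1$.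
   Context: For small $\epsilon>0$, $D_\epsilon$ is the operator on $[0,1]$ given by $D_\epsilon f(x)=\phi_2(x)f''(x)+\phi_1(x)f'(x)$, where $$\phi_2(x)=\begin{cases}\frac1{12}\left(1-4\frac{x}{\epsilon}+\left(\frac{x}{\epsilon}\right)^2\right), & x\in[0,\epsilon],\\ -\frac16, & x\in[\epsilon,1-\epsilon],\\ \frac1{12}\left(1-4\frac{1-x}{\epsilon}+\left(\frac{1-x}{\epsilon}\right)^2\right), & x\in[1-\epsilon,1],\end{cases}$$ $$\phi_1(x)=\begin{cases}-6\left(1-\frac{x}{\epsilon}\right)\left(1+\frac{x}{\epsilon}\right)^{-3}, & x\in[0,\epsilon],\\ 0,& x\in[\epsilon,1-\epsilon],\\ 6\left(1-\frac{1-x}{\epsilon}\right)\left(1+\frac{1-x}{\epsilon}\right)^{-3}, & x\in[1-\epsilon,1].\end{cases}$$ Set $x_0=(2-\sqrt3)\epsilon$ and, for $x\in[0,\epsilon]$, $$g(x)=\operatorname{sgn}(x-x_0)\,|x-x_0|^{(4+2\sqrt3)\epsilon}\,|x-4\epsilon+x_0|^{(4-2\sqrt3)\epsilon}\,(x+\epsilon)^{-8\epsilon}\,e^{\frac{12\epsilon^3}{(\epsilon+x)^2}+\frac{12\epsilon^2}{\epsilon+x}}.$$ Define $p_1(x)=\frac{g(x)}{6g(\epsilon)}$ on $[0,\epsilon]$, $p_1(x)=\frac16$ on $[\epsilon,1-\epsilon]$, $p_1(x)=\frac{g(1-x)}{6g(\epsilon)}$ on $[1-\epsilon,1]$, and $w_1(x)=-p_1(x)/\phi_2(x)$.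 Almost everywhere on $[0,1]$, $D_\epsilon u=\lambda u$ is equivalent to $-(p_1u')'=\lambda w_1u$; eigenfunctions are nontrivial solutions in the usual Sturm–Liouville sense ($u$ and $p_1u'$ absolutely continuous). One has $M_+=(x_0,1-x_0)$ and $\partial M_+=\{x_0,1-x_0\}$. $L^2(M_+,w_1)$ has inner product $\int_{M_+}u\overline v\,w_1\,dx$, and $\perp$ refers to this inner product. $|V_j|$ is the number of elements of the subset $V_j$. Derivatives in $V$ are weak derivatives. The eigenvalues (with the stated quasi-Neumann condition imposed) are listed in nondecreasing order with multiplicity, starting at $j=1$. *)

theory Defs
  imports "HOL-Analysis.Analysis" "HOL-Library.Function_Algebras"
begin

section \<open>The coefficients\<close>

definition phi2 :: "real \<Rightarrow> real \<Rightarrow> real" where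
  "phi2 \<epsilon> x =
     (if x \<le> \<epsilon> then 1/12 * (1 - 4 * (x/\<epsilon>) + (x/\<epsilon>)^2)
      else if x \<le> 1 - \<epsilon> then - 1/6
      else 1/12 * (1 - 4 * ((1-x)/\<epsilon>) + ((1-x)/\<epsilon>)^2))"

definition phi1 :: "real \<Rightarrow> real \<Rightarrow> real" where
  "phi1 \<epsilon> x =
     (if x \<le> \<epsilon> then - 6 * (1 - x/\<epsilon>) / (1 + x/\<epsilon>)^3
      else if x \<le> 1 - \<epsilon> then 0
      else 6 * (1 - (1-x)/\<epsilon>) / (1 + (1-x)/\<epsilon>)^3)"

definition x0 :: "real \<Rightarrow> real" where
  "x0 \<epsilon> = (2 - sqrt 3) * \<epsilon>"

definition g :: "real \<Rightarrow> real \<Rightarrow> real" where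
  "g \<epsilon> x = sgn (x - x0 \<epsilon>)
     * \<bar>x - x0 \<epsilon>\<bar> powr ((4 + 2 * sqrt 3) * \<epsilon>)
     * \<bar>x - 4 * \<epsilon> + x0 \<epsilon>\<bar> powr ((4 - 2 * sqrt 3) * \<epsilon>)
     * (x + \<epsilon>) powr (- 8 * \<epsilon>)
     * exp (12 * \<epsilon>^3 / (\<epsilon> + x)^2 + 12 * \<epsilon>^2 / (\<epsilon> + x))"

definition p1 :: "real \<Rightarrow> real \<Rightarrow> real" where
  "p1 \<epsilon> x =
     (if x \<le> \<epsilon> then g \<epsilon> x / (6 * g \<epsilon> \<epsilon>)
      else if x \<le> 1 - \<epsilon> then 1/6
      else g \<epsilon> (1 - x) / (6 * g \<epsilon> \<epsilon>))"

definition w1 :: "real \<Rightarrow> real \<Rightarrow> real" where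
  "w1 \<epsilon> x = - p1 \<epsilon> x / phi2 \<epsilon> x"

definition M_plus :: "real \<Rightarrow> real set" where
  "M_plus \<epsilon> = {x \<in> {0..1}. p1 \<epsilon> x > 0}"


section \<open>Eigenfunctions and eigenvalues\<close>

text \<open>The usual epsilon-delta notion: a division consists of finitely many nonempty compact
  intervals with disjoint interiors.\<close>

definition abs_continuous_on :: "real set \<Rightarrow> (real \<Rightarrow> complex) \<Rightarrow> bool" where
  "abs_continuous_on S f \<longleftrightarrow>
     (\<forall>e>0. \<exists>\<delta>>0. \<forall>\<D> T. \<D> division_of T \<and> T \<subseteq> S \<and> (\<Sum>K\<in>\<D>. Sup K - Inf K) < \<delta>
        \<longrightarrow> (\<Sum>K\<in>\<D>. norm (f (Sup K) - f (Inf K))) < e)"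

abbreviation vderiv :: "(real \<Rightarrow> complex) \<Rightarrow> real \<Rightarrow> complex" where
  "vderiv u \<equiv> (\<lambda>x. vector_derivative u (at x))"

definition D_op :: "real \<Rightarrow> (real \<Rightarrow> complex) \<Rightarrow> real \<Rightarrow> complex" where
  "D_op \<epsilon> u x = phi2 \<epsilon> x *\<^sub>R vderiv (vderiv u) x + phi1 \<epsilon> x *\<^sub>R vderiv u x"

text \<open>Solutions of \<open>D u = \<mu> u\<close> on \<open>[0,1]\<close> in the Sturm--Liouville sense. As \<open>u'\<close> exists only
  almost everywhere, absolute continuity of \<open>p\<^sub>1 u'\<close> means that it agrees almost everywhere with
  an absolutely continuous function \<open>q\<close>.\<close>

definition SL_solution :: "real \<Rightarrow> complex \<Rightarrow> (real \<Rightarrow> complex) \<Rightarrow> bool" where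
  "SL_solution \<epsilon> \<mu> u \<longleftrightarrow>
     abs_continuous_on {0..1} u \<and>
     (\<exists>q. abs_continuous_on {0..1} q \<and>
          (AE x in lebesgue_on {0..1}.
             u differentiable (at x) \<and> q x = p1 \<epsilon> x *\<^sub>R vderiv u x)) \<and>
     (AE x in lebesgue_on {0..1}.
        vderiv u differentiable (at x) \<and> D_op \<epsilon> u x = \<mu> * u x)"

definition quasi_Neumann :: "real \<Rightarrow> (real \<Rightarrow> complex) \<Rightarrow> bool" where
  "quasi_Neumann \<epsilon> u \<longleftrightarrow>
     (\<forall>y \<in> frontier (M_plus \<epsilon>). ((\<lambda>x. p1 \<epsilon> x *\<^sub>R vderiv u x) \<longlongrightarrow> 0) (at y))"

text \<open>Functions on \<open>[0,1]\<close> are represented by total functions vanishing outside \<open>[0,1]\<close>, so that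
  \<open>0\<close> is the zero function and linear independence is that of functions on \<open>[0,1]\<close>.\<close>

definition eigenspace :: "real \<Rightarrow> complex \<Rightarrow> (real \<Rightarrow> complex) set" where
  "eigenspace \<epsilon> \<mu> =
     {u. (\<forall>x. x \<notin> {0..1} \<longrightarrow> u x = 0) \<and> SL_solution \<epsilon> \<mu> u \<and> quasi_Neumann \<epsilon> u}"

definition is_eigenvalue :: "real \<Rightarrow> complex \<Rightarrow> bool" where
  "is_eigenvalue \<epsilon> \<mu> \<longleftrightarrow> (\<exists>u \<in> eigenspace \<epsilon> \<mu>. u \<noteq> 0)"

definition fscale :: "complex \<Rightarrow> (real \<Rightarrow> complex) \<Rightarrow> real \<Rightarrow> complex" where
  "fscale c u = (\<lambda>x. c * u x)"

lemma vector_space_fscale: "vector_space fscale"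
  by unfold_locales (auto simp: fscale_def fun_eq_iff algebra_simps)

definition multiplicity :: "real \<Rightarrow> complex \<Rightarrow> nat" where
  "multiplicity \<epsilon> \<mu> = vector_space.dim fscale (eigenspace \<epsilon> \<mu>)"

text \<open>\<open>lam 1 \<le> lam 2 \<le> \<dots>\<close> lists all (a priori complex) eigenvalues, each as often as its
  multiplicity; \<open>lam 0\<close> is irrelevant.\<close>

definition eigenvalue_listing :: "real \<Rightarrow> (nat \<Rightarrow> real) \<Rightarrow> bool" where
  "eigenvalue_listing \<epsilon> lam \<longleftrightarrow>
     (\<forall>i j. 1 \<le> i \<and> i \<le> j \<longrightarrow> lam i \<le> lam j) \<and>
     (\<lambda>j. complex_of_real (lam j)) ` {1..} = {\<mu>. is_eigenvalue \<epsilon> \<mu>} \<and>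
     (\<forall>\<mu>. is_eigenvalue \<epsilon> \<mu> \<longrightarrow>
        finite {j \<in> {1..}. complex_of_real (lam j) = \<mu>} \<and>
        card {j \<in> {1..}. complex_of_real (lam j) = \<mu>} = multiplicity \<epsilon> \<mu>)"


section \<open>The weighted space and the form domain\<close>

text \<open>Elements of \<open>L\<^sup>2(M\<^sub>+, w\<^sub>1)\<close> are given by representatives; equality of elements is
  almost-everywhere equality on \<open>M\<^sub>+\<close>.\<close>

definition L2w :: "real \<Rightarrow> (real \<Rightarrow> complex) set" where
  "L2w \<epsilon> = {f \<in> borel_measurable (lebesgue_on (M_plus \<epsilon>)).
              integrable (lebesgue_on (M_plus \<epsilon>)) (\<lambda>x. w1 \<epsilon> x * (norm (f x))^2)}"

definition L2_eq :: "real \<Rightarrow> (real \<Rightarrow> complex) \<Rightarrow> (real \<Rightarrow> complex) \<Rightarrow> bool" where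
  "L2_eq \<epsilon> u v \<longleftrightarrow> (AE x in lebesgue_on (M_plus \<epsilon>). u x = v x)"

definition L2_inner :: "real \<Rightarrow> (real \<Rightarrow> complex) \<Rightarrow> (real \<Rightarrow> complex) \<Rightarrow> complex" where
  "L2_inner \<epsilon> u v =
     (LINT x|lebesgue_on (M_plus \<epsilon>). u x * cnj (v x) * complex_of_real (w1 \<epsilon> x))"

definition L2_perp :: "real \<Rightarrow> (real \<Rightarrow> complex) set \<Rightarrow> (real \<Rightarrow> complex) set" where
  "L2_perp \<epsilon> A = {v \<in> L2w \<epsilon>. \<forall>h\<in>A. L2_inner \<epsilon> v h = 0}"

text \<open>Subsets with exactly \<open>n\<close> elements; representatives of the same class are not counted twice.\<close>

definition L2_subsets :: "real \<Rightarrow> nat \<Rightarrow> (real \<Rightarrow> complex) set set" where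
  "L2_subsets \<epsilon> n =
     {A. A \<subseteq> L2w \<epsilon> \<and> finite A \<and> card A = n \<and> pairwise (\<lambda>u v. \<not> L2_eq \<epsilon> u v) A}"

definition locally_integrable_on :: "real set \<Rightarrow> (real \<Rightarrow> complex) \<Rightarrow> bool" where
  "locally_integrable_on S f \<longleftrightarrow> (\<forall>K. compact K \<and> K \<subseteq> S \<longrightarrow> set_integrable lebesgue K f)"

definition test_function :: "real set \<Rightarrow> (real \<Rightarrow> real) \<Rightarrow> bool" where
  "test_function S \<phi> \<longleftrightarrow>
     (\<forall>k. (deriv ^^ k) \<phi> differentiable_on UNIV) \<and>
     compact (closure {x. \<phi> x \<noteq> 0}) \<and> closure {x. \<phi> x \<noteq> 0} \<subseteq> S"

definition has_weak_deriv :: "real set \<Rightarrow> (real \<Rightarrow> complex) \<Rightarrow> (real \<Rightarrow> complex) \<Rightarrow> bool" where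
  "has_weak_deriv S v d \<longleftrightarrow>
     locally_integrable_on S v \<and> locally_integrable_on S d \<and>
     (\<forall>\<phi>. test_function S \<phi> \<longrightarrow>
        (LINT x|lebesgue_on S. deriv \<phi> x *\<^sub>R v x) = - (LINT x|lebesgue_on S. \<phi> x *\<^sub>R d x))"

definition weak_deriv :: "real set \<Rightarrow> (real \<Rightarrow> complex) \<Rightarrow> real \<Rightarrow> complex" where
  "weak_deriv S v = (SOME d. has_weak_deriv S v d)"

definition V_space :: "real \<Rightarrow> (real \<Rightarrow> complex) set" where
  "V_space \<epsilon> =
     {v \<in> L2w \<epsilon>. (\<exists>d. has_weak_deriv (M_plus \<epsilon>) v d) \<and>
        integrable (lebesgue_on (M_plus \<epsilon>))
          (\<lambda>x. p1 \<epsilon> x * (norm (weak_deriv (M_plus \<epsilon>) v x))^2)}"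

definition rayleigh :: "real \<Rightarrow> (real \<Rightarrow> complex) \<Rightarrow> real" where
  "rayleigh \<epsilon> v =
     (LINT x|lebesgue_on (M_plus \<epsilon>). p1 \<epsilon> x * (norm (weak_deriv (M_plus \<epsilon>) v x))^2)
     / (LINT x|lebesgue_on (M_plus \<epsilon>). w1 \<epsilon> x * (norm (v x))^2)"


section \<open>Attained extrema of possibly infinite sets of reals\<close>

definition is_minimum :: "real set \<Rightarrow> real \<Rightarrow> bool" where
  "is_minimum S m \<longleftrightarrow> m \<in> S \<and> (\<forall>s\<in>S. m \<le> s)"

definition is_maximum :: "real set \<Rightarrow> real \<Rightarrow> bool" where
  "is_maximum S m \<longleftrightarrow> m \<in> S \<and> (\<forall>s\<in>S. s \<le> m)"

end

theory Submission
  imports Defs "HOL-Complex_Analysis.Great_Picard"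
begin

text \<open>Both \<open>1 / p\<^sub>1\<close> and \<open>w\<^sub>1\<close> are integrable on \<open>[0,1]\<close>, since near the zeros of \<open>p\<^sub>1\<close> they behave
  like powers of the distance with exponents \<open>- \<alpha>\<close> and \<open>\<alpha> - 1\<close>, where \<open>0 < \<alpha> < 1\<close>. On \<open>M\<^sub>+\<close> the forms
  \<open>\<integral> p\<^sub>1 u' cnj v'\<close> and \<open>\<integral> w\<^sub>1 u cnj v\<close> are positive semidefinite and the energy ball is relatively compact in
  \<open>L\<^sup>2(M\<^sub>+, w\<^sub>1)\<close>; successive constrained minimisation yields eigenvectors and the max--min principle.
  An eigenfunction on \<open>[0,1]\<close> has \<open>p\<^sub>1 u' = 0\<close> on \<open>\<partial>M\<^sub>+\<close>, so it restricts to a weak eigenvector on \<open>M\<^sub>+\<close>,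
  where the condition is the natural boundary condition. Conversely, \<open>u' = q / p\<^sub>1\<close>, \<open>q' = - \<lambda> w\<^sub>1 u\<close> is a
  regular Volterra system across \<open>\<partial>M\<^sub>+\<close>, so a weak eigenvector extends uniquely to \<open>[0,1]\<close>. Uniqueness for
  the same system makes every eigenvalue simple, and the two spectra coincide with multiplicity.\<close>

section \<open>Absolutely continuous functions\<close>

text \<open>On all of \<open>[0,1]\<close> the energy form is indefinite, because
  \<open>p\<^sub>1\<close> is negative near both ends. The variational argument can be confined to
  \<open>M\<^sub>+\<close> because zero flux at both points of \<open>\<partial>M\<^sub>+\<close>
  decouples the outer intervals: there a solution exists for every \<lambda> and every boundary
  value, so these intervals put no condition on \<lambda>. Zero flux at one such point leaves a
  single free number, the value of \<open>u\<close> there, whence simplicity. The bound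
  \<open>\<epsilon> < 1/8\<close> comes from
  \<open>\<alpha> = (4 + 2 * sqrt 3) * \<epsilon> < 8 * \<epsilon>\<close>, which has to stay below
  1. Functions are handled as representatives, so the forms are only semidefinite; instead of
  passing to quotients, the abstract part reads "nonzero" as "of positive \<open>N\<close>-norm".
  Solutions are given by equations holding almost everywhere, which say little without absolute
  continuity; hence the detour through integral equations, from which regularity is then recovered.
  Reality and discreteness of the eigenvalues are not assumed but come out of the comparison with
  the minimisation values.\<close>

lemma division_of_real_interval:
  assumes "\<D> division_of T" "K \<in> \<D>" "T \<subseteq> {a..b::real}"
  shows "K = {Inf K..Sup K}" "Inf K \<le> Sup K" "a \<le> Inf K" "Sup K \<le> b"
proof -
  obtain s t where st: "K = cbox s t" "K \<noteq> {}" "K \<subseteq> T"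
    using assms(1,2) using division_ofD(2,3,4)[OF assms(1)] by metis
  then have "s \<le> t" by auto
  with st show "K = {Inf K..Sup K}" "Inf K \<le> Sup K" by auto
  with st(3) assms(3) show "a \<le> Inf K" "Sup K \<le> b" by fastforce+
qed

text \<open>Truncation at height \<open>n\<close>: by dominated convergence the excess of
  \<open>norm (f x)\<close> over \<open>n\<close> has integral below \<open>e / 2\<close> for some
  \<open>n\<close>, and the truncated part contributes at most \<open>n\<close> times the total
  length of the division.\<close>

lemma integral_small_on_small_sets:
  fixes f :: "real \<Rightarrow> complex"
  assumes f: "f absolutely_integrable_on {a..b}" and e: "e > 0"
  shows "\<exists>\<delta>>0. \<forall>\<D> T. \<D> division_of T \<and> T \<subseteq> {a..b} \<and> (\<Sum>K\<in>\<D>. Sup K - Inf K) < \<delta>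
           \<longrightarrow> (\<Sum>K\<in>\<D>. integral K (\<lambda>x. norm (f x))) < e"
proof -
  let ?M = "lebesgue_on {a..b}"
  have fi: "integrable ?M (\<lambda>x. norm (f x))"
    using f by (intro integrable_norm absolutely_integrable_imp_integrable) auto
  have "(\<lambda>n. LINT x|?M. norm (f x) - min (norm (f x)) (real n)) \<longlonglongrightarrow> (LINT x|?M. 0)"
  proof (rule integral_dominated_convergence[where w = "\<lambda>x. norm (f x)"])
    show "AE x in ?M. (\<lambda>n. norm (f x) - min (norm (f x)) (real n)) \<longlonglongrightarrow> 0"
    proof (rule AE_I2, rule tendsto_eventually)
      fix x
      obtain N where "norm (f x) \<le> real N" using real_arch_simple by blast
      then show "\<forall>\<^sub>F n in sequentially. norm (f x) - min (norm (f x)) (real n) = 0"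
        by (intro eventually_sequentiallyI[of N]) (auto simp: min_def)
    qed
  qed (use fi in \<open>auto intro!: borel_measurable_diff borel_measurable_min\<close>)
  then have "\<forall>\<^sub>F n in sequentially. (LINT x|?M. norm (f x) - min (norm (f x)) (real n)) < e / 2"
    using e by (intro order_tendstoD(2)) auto
  then obtain n where n: "(LINT x|?M. norm (f x) - min (norm (f x)) (real n)) < e / 2"
    by (auto simp: eventually_sequentially)
  define h where "h x = norm (f x) - min (norm (f x)) (real n)" for x
  have hi: "integrable ?M h" unfolding h_def using fi
    by (rule Bochner_Integration.integrable_bound)
       (use fi in \<open>auto intro!: borel_measurable_diff borel_measurable_min\<close>)
  have h: "h integrable_on {a..b}" using hi by (rule integrable_on_lebesgue_on) auto
  have hI: "integral {a..b} h < e / 2" using n lebesgue_integral_eq_integral[OF hi] by (simp add: h_def[abs_def])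
  have nfi: "(\<lambda>x. norm (f x)) integrable_on {a..b}"
    using f by (simp add: absolutely_integrable_on_def)
  show ?thesis
  proof (intro exI[of _ "e / (2 * (real n + 1))"] conjI allI impI)
    show "0 < e / (2 * (real n + 1))" using e by simp
    fix \<D> T assume D: "\<D> division_of T \<and> T \<subseteq> {a..b} \<and> (\<Sum>K\<in>\<D>. Sup K - Inf K) < e / (2 * (real n + 1))"
    have "integral K (\<lambda>x. norm (f x)) \<le> integral K h + (Sup K - Inf K) * real n" if "K \<in> \<D>" for K
    proof -
      note K = division_of_real_interval[of \<D> T K a b]
      have Keq: "K = {Inf K..Sup K}" "Inf K \<le> Sup K" "K \<subseteq> {a..b}"
        using K D that by auto
      have int: "h integrable_on K" "(\<lambda>x. norm (f x)) integrable_on K"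
        using h nfi Keq integrable_on_subinterval by metis+
      have "integral K (\<lambda>x. norm (f x)) \<le> integral K (\<lambda>x. h x + real n)"
        by (intro integral_le int integrable_add, subst Keq(1)) (auto simp: h_def intro: integrable_const_ivl)
      also have "\<dots> = integral K h + integral K (\<lambda>x. real n)"
        using int Keq(1) by (intro Henstock_Kurzweil_Integration.integral_add) (auto, metis integrable_const_ivl)
      also have "integral K (\<lambda>x. real n) = (Sup K - Inf K) * real n"
        using Keq by (metis content_real integral_const_real real_scaleR_def)
      finally show ?thesis .
    qed
    then have "(\<Sum>K\<in>\<D>. integral K (\<lambda>x. norm (f x))) \<le> (\<Sum>K\<in>\<D>. integral K h + (Sup K - Inf K) * real n)"
      by (rule sum_mono)
    also have "\<dots> = (\<Sum>K\<in>\<D>. integral K h) + (\<Sum>K\<in>\<D>. Sup K - Inf K) * real n"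
      by (simp add: sum.distrib sum_distrib_right)
    also have "(\<Sum>K\<in>\<D>. integral K h) = integral T h"
      using D h by (intro integral_combine_division_topdown[symmetric])
         (auto intro: integrable_on_subdivision)
    also have "\<dots> \<le> integral {a..b} h"
      using D h by (intro integral_subset_le) (auto intro: integrable_on_subdivision simp: h_def)
    also have "integral {a..b} h + (\<Sum>K\<in>\<D>. Sup K - Inf K) * real n < e"
    proof -
      have "(\<Sum>K\<in>\<D>. Sup K - Inf K) * real n \<le> e / (2 * (real n + 1)) * real n"
        using D by (intro mult_right_mono) auto
      also have "\<dots> \<le> e / 2" using e by (simp add: field_simps)
      finally show ?thesis using hI by linarith
    qed
    finally show "(\<Sum>K\<in>\<D>. integral K (\<lambda>x. norm (f x))) < e" by simp
  qed
qed

lemma abs_continuous_on_indefinite_integral: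
  fixes f :: "real \<Rightarrow> complex"
  assumes f: "f absolutely_integrable_on {a..b}"
  shows "abs_continuous_on {a..b} (\<lambda>x. c + integral {a..x} f)"
  unfolding abs_continuous_on_def
proof (intro allI impI)
  fix e :: real assume "e > 0"
  from integral_small_on_small_sets[OF f this] obtain \<delta> where \<delta>: "\<delta> > 0"
    "\<And>\<D> T. \<D> division_of T \<Longrightarrow> T \<subseteq> {a..b} \<Longrightarrow> (\<Sum>K\<in>\<D>. Sup K - Inf K) < \<delta>
           \<Longrightarrow> (\<Sum>K\<in>\<D>. integral K (\<lambda>x. norm (f x))) < e" by blast
  have fi: "f integrable_on {a..b}" "(\<lambda>x. norm (f x)) integrable_on {a..b}"
    using f by (simp_all add: absolutely_integrable_on_def)
  show "\<exists>\<delta>>0. \<forall>\<D> T. \<D> division_of T \<and> T \<subseteq> {a..b} \<and> (\<Sum>K\<in>\<D>. Sup K - Inf K) < \<delta> \<longrightarrow>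
     (\<Sum>K\<in>\<D>. norm (c + integral {a..Sup K} f - (c + integral {a..Inf K} f))) < e"
  proof (intro exI[of _ \<delta>] conjI allI impI \<delta>(1))
    fix \<D> T assume D: "\<D> division_of T \<and> T \<subseteq> {a..b} \<and> (\<Sum>K\<in>\<D>. Sup K - Inf K) < \<delta>"
    have "norm (c + integral {a..Sup K} f - (c + integral {a..Inf K} f)) \<le> integral K (\<lambda>x. norm (f x))"
      if "K \<in> \<D>" for K
    proof -
      have K: "K = {Inf K..Sup K}" "Inf K \<le> Sup K" "a \<le> Inf K" "Sup K \<le> b"
        using division_of_real_interval[of \<D> T K a b] D that by auto
      have "integral {a..Inf K} f + integral {Inf K..Sup K} f = integral {a..Sup K} f"
        using K by (intro Henstock_Kurzweil_Integration.integral_combine integrable_on_subinterval[OF fi(1)]) auto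
      then have "c + integral {a..Sup K} f - (c + integral {a..Inf K} f) = integral K f"
        using K(1) by (simp add: algebra_simps)
      moreover have "norm (integral K f) \<le> integral K (\<lambda>x. norm (f x))"
      proof (rule integral_norm_bound_integral)
        have sub: "{Inf K..Sup K} \<subseteq> {a..b}" using K(3,4) by (intro subsetI) (metis atLeastAtMost_iff order.trans)
        show "f integrable_on K" "(\<lambda>x. norm (f x)) integrable_on K"
          using integrable_on_subinterval[OF fi(1) sub] integrable_on_subinterval[OF fi(2) sub] K(1) by simp_all
      qed simp
      ultimately show ?thesis by simp
    qed
    then have "(\<Sum>K\<in>\<D>. norm (c + integral {a..Sup K} f - (c + integral {a..Inf K} f)))
        \<le> (\<Sum>K\<in>\<D>. integral K (\<lambda>x. norm (f x)))" by (rule sum_mono)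
    also have "\<dots> < e" using \<delta>(2) D by blast
    finally show "(\<Sum>K\<in>\<D>. norm (c + integral {a..Sup K} f - (c + integral {a..Inf K} f))) < e" .
  qed
qed

lemma abs_continuous_onE:
  assumes "abs_continuous_on S f" "e > 0"
  obtains d where "d > 0" "\<And>\<D> T. \<D> division_of T \<Longrightarrow> T \<subseteq> S \<Longrightarrow> (\<Sum>K\<in>\<D>. Sup K - Inf K) < d
      \<Longrightarrow> (\<Sum>K\<in>\<D>. norm (f (Sup K) - f (Inf K))) < e"
proof -
  from assms(1)[unfolded abs_continuous_on_def, rule_format, OF assms(2)] obtain d where
    "d > 0" "\<forall>\<D> T. \<D> division_of T \<and> T \<subseteq> S \<and> (\<Sum>K\<in>\<D>. Sup K - Inf K) < d
      \<longrightarrow> (\<Sum>K\<in>\<D>. norm (f (Sup K) - f (Inf K))) < e" by (elim exE conjE)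
  then show ?thesis by (intro that) (assumption, metis)
qed

lemma abs_continuous_on_subset:
  assumes "abs_continuous_on S f" "S' \<subseteq> S"
  shows "abs_continuous_on S' f"
  unfolding abs_continuous_on_def
proof (intro allI impI)
  fix e :: real assume "e > 0"
  then obtain d where "d > 0" "\<And>\<D> T. \<D> division_of T \<Longrightarrow> T \<subseteq> S \<Longrightarrow> (\<Sum>K\<in>\<D>. Sup K - Inf K) < d
      \<Longrightarrow> (\<Sum>K\<in>\<D>. norm (f (Sup K) - f (Inf K))) < e"
    using abs_continuous_onE[OF assms(1)] by blast
  with assms(2) show "\<exists>d>0. \<forall>\<D> T. \<D> division_of T \<and> T \<subseteq> S' \<and> (\<Sum>K\<in>\<D>. Sup K - Inf K) < d
      \<longrightarrow> (\<Sum>K\<in>\<D>. norm (f (Sup K) - f (Inf K))) < e"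
    by (meson subset_trans)
qed

lemma abs_continuous_on_diff:
  assumes "abs_continuous_on S f" "abs_continuous_on S h"
  shows "abs_continuous_on S (\<lambda>x. f x - h x)"
  unfolding abs_continuous_on_def
proof (intro allI impI)
  fix e :: real assume "e > 0"
  then have e2: "e / 2 > 0" by simp
  obtain d1 where d1: "d1 > 0"
    and 1: "\<And>\<D> T. \<D> division_of T \<Longrightarrow> T \<subseteq> S \<Longrightarrow> (\<Sum>K\<in>\<D>. Sup K - Inf K) < d1
      \<Longrightarrow> (\<Sum>K\<in>\<D>. norm (f (Sup K) - f (Inf K))) < e / 2"
    using abs_continuous_onE[OF assms(1) e2] by blast
  obtain d2 where d2: "d2 > 0"
    and 2: "\<And>\<D> T. \<D> division_of T \<Longrightarrow> T \<subseteq> S \<Longrightarrow> (\<Sum>K\<in>\<D>. Sup K - Inf K) < d2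
      \<Longrightarrow> (\<Sum>K\<in>\<D>. norm (h (Sup K) - h (Inf K))) < e / 2"
    using abs_continuous_onE[OF assms(2) e2] by blast
  show "\<exists>\<delta>>0. \<forall>\<D> T. \<D> division_of T \<and> T \<subseteq> S \<and> (\<Sum>K\<in>\<D>. Sup K - Inf K) < \<delta> \<longrightarrow>
     (\<Sum>K\<in>\<D>. norm (f (Sup K) - h (Sup K) - (f (Inf K) - h (Inf K)))) < e"
  proof (intro exI[of _ "min d1 d2"] conjI allI impI)
    fix \<D> T assume D: "\<D> division_of T \<and> T \<subseteq> S \<and> (\<Sum>K\<in>\<D>. Sup K - Inf K) < min d1 d2"
    have "(\<Sum>K\<in>\<D>. norm (f (Sup K) - h (Sup K) - (f (Inf K) - h (Inf K))))
      \<le> (\<Sum>K\<in>\<D>. norm (f (Sup K) - f (Inf K)) + norm (h (Sup K) - h (Inf K)))"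
    proof (rule sum_mono)
      fix K show "norm (f (Sup K) - h (Sup K) - (f (Inf K) - h (Inf K)))
        \<le> norm (f (Sup K) - f (Inf K)) + norm (h (Sup K) - h (Inf K))"
        using norm_triangle_ineq4[of "f (Sup K) - f (Inf K)" "h (Sup K) - h (Inf K)"] by (simp add: algebra_simps)
    qed
    also have "\<dots> < e" unfolding sum.distrib using 1[of \<D> T] 2[of \<D> T] D by simp
    finally show "(\<Sum>K\<in>\<D>. norm (f (Sup K) - h (Sup K) - (f (Inf K) - h (Inf K)))) < e" .
  qed (use d1 d2 in simp)
qed

lemma abs_continuous_on_imp_continuous_on:
  assumes "abs_continuous_on {a..b} f"
  shows "continuous_on {a..b} f"
  unfolding continuous_on_iff
proof (intro ballI allI impI)
  fix x e assume x: "x \<in> {a..b}" and "(e::real) > 0"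
  then obtain d where d: "d > 0" and *: "\<And>\<D> T. \<D> division_of T \<Longrightarrow> T \<subseteq> {a..b} \<Longrightarrow> (\<Sum>K\<in>\<D>. Sup K - Inf K) < d
      \<Longrightarrow> (\<Sum>K\<in>\<D>. norm (f (Sup K) - f (Inf K))) < e"
    using abs_continuous_onE[OF assms] by blast
  have key: "norm (f t - f s) < e" if "s \<le> t" "s \<in> {a..b}" "t \<in> {a..b}" "t - s < d" for s t
    using *[of "{{s..t}}" "{s..t}"] that division_of_self[of s t] by auto
  show "\<exists>d>0. \<forall>x'\<in>{a..b}. dist x' x < d \<longrightarrow> dist (f x') (f x) < e"
  proof (intro exI[of _ d] conjI ballI impI d)
    fix y assume y: "y \<in> {a..b}" "dist y x < d"
    show "dist (f y) (f x) < e"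
      using key[of x y] key[of y x] x y by (cases "x \<le> y") (auto simp: dist_norm norm_minus_commute)
  qed
qed

text \<open>Serves the covering argument below: intervals tagged in a null set lie in an open set of
  small measure. A pair-indexed sum can be read as a sum over intervals, since an interval occurring
  with two tags has empty interior and content 0.\<close>

lemma sum_content_tagged:
  assumes "p tagged_partial_division_of cbox a (b::real)"
    and "\<And>x K. (x, K) \<in> p \<Longrightarrow> K \<subseteq> U" "U \<in> lmeasurable"
  shows "(\<Sum>(x,K)\<in>p. measure lborel K) \<le> measure lebesgue U"
proof -
  have td: "p tagged_division_of \<Union>(snd ` p)" by (rule tagged_partial_division_of_Union_self[OF assms(1)])
  then have d: "snd ` p division_of \<Union>(snd ` p)" by (rule division_of_tagged_division)
  have "(\<Sum>(x,K)\<in>p. measure lborel K) = (\<Sum>K\<in>snd ` p. measure lborel K)"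
    by (rule sum.over_tagged_division_lemma[OF td]) (simp add: content_eq_0_interior interior_cbox)
  also have "\<dots> = measure lebesgue (\<Union>(snd ` p))"
  proof -
    have "measure lborel K = measure lebesgue K" if "K \<in> snd ` p" for K
      using division_ofD(4)[OF d that] by (metis measure_completion lborelD borel_closed closed_cbox sets_lborel)
    then show ?thesis by (simp only: content_division[OF d, symmetric] cong: sum.cong)
  qed
  also have "\<dots> \<le> measure lebesgue U"
  proof (rule measure_mono_fmeasurable)
    show "\<Union>(snd ` p) \<subseteq> U" using assms(2) by fastforce
    show "\<Union>(snd ` p) \<in> sets lebesgue" using d by (simp add: fmeasurableD lmeasurable_division)
  qed (rule assms(3))
  finally show ?thesis .
qed

text \<open>Distinct tags can share an interval only if it is a single point, where \<open>d\<close>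
  vanishes. The auxiliary \<open>d'\<close> is patched at the empty set, because the general
  rewriting lemma also asks for the value 0 there, while an expression like
  \<open>Sup K - Inf K\<close> is unspecified at it.\<close>

lemma sum_tagged_division_real:
  assumes "p tagged_division_of (i::real set)" "\<And>x. d {x} = (0::real)"
  shows "(\<Sum>(x,K)\<in>p. d K) = (\<Sum>K\<in>snd ` p. d K)"
proof -
  define d' where "d' K = (if K = {} then 0 else d K)" for K
  have ne: "K \<noteq> {}" if "(x, K) \<in> p" for x K using tagged_division_ofD(2)[OF assms(1) that] by auto
  have "(\<Sum>(x,K)\<in>p. d' K) = (\<Sum>K\<in>snd ` p. d' K)"
    by (rule sum.over_tagged_division_lemma[OF assms(1)]) (auto simp: d'_def not_less le_less assms(2))
  moreover have "(\<Sum>(x,K)\<in>p. d' K) = (\<Sum>(x,K)\<in>p. d K)"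
    using ne by (intro sum.cong) (auto simp: d'_def)
  moreover have "(\<Sum>K\<in>snd ` p. d' K) = (\<Sum>K\<in>snd ` p. d K)"
    using ne by (intro sum.cong) (auto simp: d'_def)
  ultimately show ?thesis by simp
qed

text \<open>Cousin covering: the tags in the exceptional null set are controlled by absolute continuity,
  the other tags by the vanishing derivative.\<close>

lemma abs_continuous_on_AE_deriv_zero:
  assumes ac: "abs_continuous_on {a..b} f" and ab: "a \<le> b"
    and deriv: "AE x in lebesgue_on {a..b}. (f has_vector_derivative 0) (at x)"
  shows "f b = f a"
proof -
  define N where "N = {x \<in> {a..b}. \<not> (f has_vector_derivative 0) (at x)}"
  obtain N' where N': "N \<subseteq> N'" "N' \<in> null_sets (lebesgue_on {a..b})"
    using deriv by (auto simp: eventually_ae_filter N_def)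
  then have null: "N' \<in> null_sets lebesgue" by (simp add: null_sets_restrict_space)
  have "norm (f b - f a) \<le> e" if e: "e > 0" for e
  proof -
    have "e / 2 > 0" using e by simp
    with ac obtain \<delta> where \<delta>: "\<delta> > 0" and ac': "\<And>\<D> T. \<D> division_of T \<Longrightarrow> T \<subseteq> {a..b} \<Longrightarrow> (\<Sum>K\<in>\<D>. Sup K - Inf K) < \<delta>
      \<Longrightarrow> (\<Sum>K\<in>\<D>. norm (f (Sup K) - f (Inf K))) < e / 2" using abs_continuous_onE by blast
    \<comment> \<open>Intervals tagged in the null set will be forced into \<open>U\<close>, so
      their total length stays below \<open>\<delta>\<close> and absolute continuity bounds the
      increments over them.\<close>
    obtain U where U: "open U" "N' \<subseteq> U" "U - N' \<in> lmeasurable" "emeasure lebesgue (U - N') < ennreal \<delta>"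
      using sets_lebesgue_outer_open[OF _ \<delta>, of N'] null by (auto dest: null_setsD2)
    have Um: "U \<in> lmeasurable" "measure lebesgue U < \<delta>"
    proof -
      have "U = (U - N') \<union> N'" using U by auto
      then show "U \<in> lmeasurable" using U(3) null by (metis fmeasurable.Un fmeasurableI_null_sets)
      have "measure lebesgue U = measure lebesgue (U - N')"
        using null U(1) by (intro measure_Diff_null_set[symmetric]) (auto intro: fmeasurableD)
      also have "\<dots> < \<delta>" using U(3,4) \<delta> by (metis emeasure_eq_measure2 ennreal_less_iff fmeasurable_def measure_nonneg)
      finally show "measure lebesgue U < \<delta>" .
    qed
    \<comment> \<open>The added 1 avoids a division by zero when \<open>a = b\<close>.\<close>
    define \<epsilon> where "\<epsilon> = e / (2 * (b - a + 1))"
    have \<epsilon>: "\<epsilon> > 0" using e ab by (simp add: \<epsilon>_def)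
    have "\<exists>d>0. \<forall>y. \<bar>y - x\<bar> < d \<longrightarrow> norm (f y - f x) \<le> \<epsilon> * \<bar>y - x\<bar>" if "x \<in> {a..b}" "x \<notin> N" for x
    proof -
      have "(f has_derivative (\<lambda>h. h *\<^sub>R 0)) (at x)" using that by (simp add: N_def has_vector_derivative_def)
      then show ?thesis using \<epsilon> unfolding has_derivative_at_alt by (force simp: dist_norm)
    qed
    then obtain d where d: "\<And>x. x \<in> {a..b} \<Longrightarrow> x \<notin> N \<Longrightarrow> d x > 0"
      "\<And>x y. x \<in> {a..b} \<Longrightarrow> x \<notin> N \<Longrightarrow> \<bar>y - x\<bar> < d x \<Longrightarrow> norm (f y - f x) \<le> \<epsilon> * \<bar>y - x\<bar>" by metis
    \<comment> \<open>No tag lies outside \<open>{a..b}\<close>; the value \<open>ball x 1\<close>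
      there only completes \<open>\<gamma>\<close> to a gauge.\<close>
    define \<gamma> where "\<gamma> x = (if x \<in> N then U else if x \<in> {a..b} then ball x (d x) else ball x 1)" for x
    have "gauge \<gamma>" using U N' d(1) by (auto simp: gauge_def \<gamma>_def)
    then obtain p where p: "p tagged_division_of {a..b}" "\<gamma> fine p" by (rule fine_division_exists_real)
    have pp: "p tagged_partial_division_of cbox a b" using p(1) by (simp add: tagged_division_of_def)
    have fp: "finite p" using p(1) by (rule tagged_division_of_finite)
    have K: "K = {Inf K..Sup K} \<and> Inf K \<le> Sup K \<and> x \<in> K \<and> K \<subseteq> {a..b} \<and> measure lborel K = Sup K - Inf K" if xK: "(x, K) \<in> p" for x K
    proof -
      obtain s t where "K = cbox s t" "x \<in> K" "K \<subseteq> {a..b}"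
        using tagged_division_ofD(2,3,4)[OF p(1) xK] by metis
      then show ?thesis by auto
    qed
    define p1 where "p1 = {xK \<in> p. fst xK \<in> N}"
    define p2 where "p2 = {xK \<in> p. fst xK \<notin> N}"
    have p12: "p = p1 \<union> p2" "p1 \<inter> p2 = {}" "finite p1" "finite p2" using fp by (auto simp: p1_def p2_def)
    have pp1: "p1 tagged_partial_division_of cbox a b"
      by (rule tagged_partial_division_subset[OF pp]) (auto simp: p1_def)
    have c1: "(\<Sum>(x,K)\<in>p1. measure lborel K) < \<delta>"
    proof -
      have "(\<Sum>(x,K)\<in>p1. measure lborel K) \<le> measure lebesgue U"
        using p(2) by (intro sum_content_tagged[OF pp1 _ Um(1)]) (force simp: p1_def fine_def \<gamma>_def)
      then show ?thesis using Um(2) by linarith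
    qed
    have td1: "p1 tagged_division_of \<Union>(snd ` p1)" by (rule tagged_partial_division_of_Union_self[OF pp1])
    then have dd1: "snd ` p1 division_of \<Union>(snd ` p1)" by (rule division_of_tagged_division)
    have "(\<Sum>(x,K)\<in>p1. norm (f (Sup K) - f (Inf K))) = (\<Sum>K\<in>snd ` p1. norm (f (Sup K) - f (Inf K)))"
      by (rule sum_tagged_division_real[OF td1]) auto
    also have "\<dots> < e / 2"
    proof (rule ac')
      show "snd ` p1 division_of \<Union>(snd ` p1)" by (rule dd1)
      show "\<Union>(snd ` p1) \<subseteq> {a..b}" using K by (force simp: p1_def)
      have "(\<Sum>(x,K)\<in>p1. Sup K - Inf K) = (\<Sum>K\<in>snd ` p1. Sup K - Inf K)"
        by (rule sum_tagged_division_real[OF td1]) auto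
      moreover have "(\<Sum>(x,K)\<in>p1. Sup K - Inf K) = (\<Sum>(x,K)\<in>p1. measure lborel K)"
        using K by (intro sum.cong) (auto simp: p1_def)
      ultimately show "(\<Sum>K\<in>snd ` p1. Sup K - Inf K) < \<delta>" using c1 by simp
    qed
    finally have s1: "(\<Sum>(x,K)\<in>p1. norm (f (Sup K) - f (Inf K))) < e / 2" .
    have "(\<Sum>(x,K)\<in>p2. norm (f (Sup K) - f (Inf K))) \<le> (\<Sum>(x,K)\<in>p2. \<epsilon> * (Sup K - Inf K))"
    proof (rule sum_mono, clarify)
      fix x K assume xK: "(x, K) \<in> p2"
      then have "(x, K) \<in> p" "x \<notin> N" by (auto simp: p2_def)
      note K' = K[OF this(1)]
      have x: "x \<in> {a..b}" using K' by auto
      have "K \<subseteq> ball x (d x)" using p(2) \<open>(x,K) \<in> p\<close> \<open>x \<notin> N\<close> x by (force simp: fine_def \<gamma>_def)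
      moreover have "Sup K \<in> K" "Inf K \<in> K" using K' by (metis atLeastAtMost_iff order_refl)+
      ultimately have "\<bar>Sup K - x\<bar> < d x" "\<bar>Inf K - x\<bar> < d x" by (auto simp: dist_real_def)
      then have "norm (f (Sup K) - f x) \<le> \<epsilon> * \<bar>Sup K - x\<bar>" "norm (f (Inf K) - f x) \<le> \<epsilon> * \<bar>Inf K - x\<bar>"
        using d(2) x \<open>x \<notin> N\<close> by auto
      moreover have "Inf K \<le> x" "x \<le> Sup K" using K' by (metis atLeastAtMost_iff)+
      \<comment> \<open>The tag lies between the two endpoints, so the two linear errors add up to
        exactly \<open>\<epsilon>\<close> times the length of \<open>K\<close>.\<close>
      moreover have "norm (f (Sup K) - f (Inf K)) \<le> norm (f (Sup K) - f x) + norm (f (Inf K) - f x)"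
        using norm_triangle_ineq4[of "f (Sup K) - f x" "f (Inf K) - f x"] by simp
      ultimately show "norm (f (Sup K) - f (Inf K)) \<le> \<epsilon> * (Sup K - Inf K)" by (simp add: algebra_simps)
    qed
    also have "\<dots> \<le> (\<Sum>(x,K)\<in>p. \<epsilon> * (Sup K - Inf K))"
      using fp K \<epsilon> by (intro sum_mono2) (auto simp: p2_def)
    also have "\<dots> = \<epsilon> * (b - a)"
      using additive_tagged_division_1[OF ab p(1), of "\<lambda>x. x"]
      by (simp add: sum_distrib_left[symmetric] case_prod_unfold)
    also have "\<dots> \<le> e / 2" using e ab by (simp add: \<epsilon>_def field_simps)
    finally have s2: "(\<Sum>(x,K)\<in>p2. norm (f (Sup K) - f (Inf K))) \<le> e / 2" .
    have "norm (f b - f a) = norm (\<Sum>(x,K)\<in>p. f (Sup K) - f (Inf K))"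
      using additive_tagged_division_1[OF ab p(1), of f] by simp
    also have "\<dots> \<le> (\<Sum>(x,K)\<in>p. norm (f (Sup K) - f (Inf K)))"
      by (rule order.trans[OF norm_sum]) (simp add: case_prod_unfold)
    also have "\<dots> = (\<Sum>(x,K)\<in>p1. norm (f (Sup K) - f (Inf K))) + (\<Sum>(x,K)\<in>p2. norm (f (Sup K) - f (Inf K)))"
      unfolding p12(1) by (rule sum.union_disjoint[OF p12(3,4,2)])
    also have "\<dots> \<le> e" using s1 s2 by simp
    finally show ?thesis .
  qed
  then have "norm (f b - f a) \<le> 0 + e" if "e > 0" for e using that by simp
  then have "norm (f b - f a) \<le> 0" by (rule field_le_epsilon)
  then show ?thesis by simp
qed

lemma has_vector_derivative_integral_interior:
  fixes h :: "real \<Rightarrow> 'a::banach"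
  assumes h: "h integrable_on {a..b}" and "x \<in> {a<..<b}" "isCont h x"
  shows "((\<lambda>y. integral {a..y} h) has_vector_derivative h x) (at x)"
proof -
  have "((\<lambda>u. integral {a..u} h) has_vector_derivative h x) (at x within ({a..b} - {}))"
    using assms by (intro integral_has_vector_derivative_continuous_at) (auto simp: continuous_at_imp_continuous_at_within)
  then show ?thesis using assms(2) at_within_Icc_at[of a x b] by simp
qed

text \<open>The difference of \<open>f\<close> and the indefinite integral of \<open>h\<close> has
  derivative 0 almost everywhere. Continuity of \<open>h\<close> off a finite set takes the place of
  Lebesgue's differentiation theorem; in the application the exceptional points are the two zeros of
  \<open>p\<^sub>1\<close>.\<close>

lemma abs_continuous_on_eq_integral:
  assumes ac: "abs_continuous_on {a..b} f" and h: "h absolutely_integrable_on {a..b}"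
    and F: "finite F" "continuous_on ({a..b} - F) h"
    and deriv: "AE x in lebesgue_on {a..b}. (f has_vector_derivative h x) (at x)"
    and st: "a \<le> s" "s \<le> t" "t \<le> b"
  shows "f t - f s = integral {s..t} h"
proof -
  have hi: "h integrable_on {a..b}" using h by (simp add: absolutely_integrable_on_def)
  define k where "k = (\<lambda>x. f x - integral {a..x} h)"
  have ack: "abs_continuous_on {a..b} k"
    unfolding k_def using abs_continuous_on_diff[OF ac abs_continuous_on_indefinite_integral[OF h, of 0]] by simp
  have "AE x in lebesgue_on {a..b}. x \<notin> F \<union> {a, b}"
  proof (subst AE_restrict_space_iff)
    have "AE x in lebesgue. x \<notin> F \<union> {a, b}"
      using F(1) by (intro AE_not_in null_sets_completionI finite_imp_null_set_lborel) auto
    then show "AE x in lebesgue. x \<in> {a..b} \<longrightarrow> x \<notin> F \<union> {a, b}" by eventually_elim simp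
  qed simp
  with deriv AE_space have dk: "AE x in lebesgue_on {a..b}. (k has_vector_derivative 0) (at x)"
  proof (eventually_elim)
    case (elim x)
    then have x: "x \<in> {a<..<b} - F" by auto
    have "open ({a<..<b} - F)" using F(1) by (intro open_Diff finite_imp_closed) auto
    moreover have "continuous_on ({a<..<b} - F) h" using F(2) by (rule continuous_on_subset) auto
    ultimately have "isCont h x" using x by (simp add: continuous_on_eq_continuous_at)
    then have "((\<lambda>x. integral {a..x} h) has_vector_derivative h x) (at x)"
      using x by (intro has_vector_derivative_integral_interior[OF hi]) auto
    then have "(k has_vector_derivative h x - h x) (at x)" unfolding k_def using elim by (intro has_vector_derivative_diff)
    then show ?case by simp
  qed
  have k: "k y = k a" if y: "a \<le> y" "y \<le> b" for y
  proof (rule abs_continuous_on_AE_deriv_zero[OF _ y(1)])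
    show "abs_continuous_on {a..y} k" using abs_continuous_on_subset[OF ack] y by simp
    show "AE x in lebesgue_on {a..y}. (k has_vector_derivative 0) (at x)"
      using dk y by (auto simp: AE_restrict_space_iff elim!: eventually_mono)
  qed
  have "k s = k t" using k[of s] k[of t] st by (metis order.trans)
  moreover have "integral {a..s} h + integral {s..t} h = integral {a..t} h"
    using st by (intro Henstock_Kurzweil_Integration.integral_combine integrable_on_subinterval[OF hi]) auto
  ultimately have "f s - integral {a..s} h = f t - (integral {a..s} h + integral {s..t} h)"
    by (simp add: k_def)
  then show ?thesis by (simp add: algebra_simps)
qed

section \<open>Pairs of Hermitian forms with a compactness property\<close>

text \<open>Gaussian elimination by induction on the equations. Equations are indexed by an
  arbitrary set, because later \<open>L\<close> is a set of linear functionals.\<close>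

lemma homogeneous_system_nontrivial:
  fixes f :: "'l \<Rightarrow> 'i \<Rightarrow> 'k::field"
  assumes "finite L" "finite I" "card L < card I"
  shows "\<exists>c. (\<exists>i\<in>I. c i \<noteq> 0) \<and> (\<forall>l\<in>L. (\<Sum>i\<in>I. c i * f l i) = 0)"
  using assms
proof (induction L arbitrary: I f rule: finite_induct)
  case empty
  then obtain i where "i \<in> I" by fastforce
  then show ?case by (intro exI[of _ "\<lambda>_. 1"]) auto
next
  case (insert l L)
  show ?case
  proof (cases "\<forall>i\<in>I. f l i = 0")
    case True
    have "card L < card I" using insert by simp
    from insert.IH[OF insert.prems(1) this, of f] obtain c
      where "\<exists>i\<in>I. c i \<noteq> 0" "\<forall>l\<in>L. (\<Sum>i\<in>I. c i * f l i) = 0" by blast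
    with True show ?thesis by (intro exI[of _ c]) auto
  next
    case False
    then obtain k where k: "k \<in> I" "f l k \<noteq> 0" by blast
    define J where "J = I - {k}"
    \<comment> \<open>The remaining equations after solving equation \<open>l\<close> for the
      unknown \<open>k\<close> and substituting.\<close>
    define f' where "f' = (\<lambda>m i. f m i - f m k / f l k * f l i)"
    have J: "finite J" "k \<notin> J" "I = insert k J" "card L < card J"
      using insert k by (auto simp: J_def card_Diff_singleton)
    from insert.IH[OF J(1) J(4), of f'] obtain c
      where c: "\<exists>i\<in>J. c i \<noteq> 0" "\<And>m. m\<in>L \<Longrightarrow> (\<Sum>i\<in>J. c i * f' m i) = 0" by blast
    define s where "s = (\<Sum>i\<in>J. c i * f l i)"
    define c' where "c' = c(k := - s / f l k)"
    have sum: "(\<Sum>i\<in>I. c' i * f m i) = - s / f l k * f m k + (\<Sum>i\<in>J. c i * f m i)" for m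
    proof -
      have "(\<Sum>i\<in>J. c' i * f m i) = (\<Sum>i\<in>J. c i * f m i)"
        using J(2) by (intro sum.cong) (auto simp: c'_def)
      then show ?thesis using J by (simp add: c'_def)
    qed
    have "(\<Sum>i\<in>I. c' i * f m i) = 0" if "m \<in> insert l L" for m
    proof (cases "m = l")
      case True then show ?thesis using k by (simp add: sum s_def)
    next
      case False
      then have "0 = (\<Sum>i\<in>J. c i * f m i - f m k / f l k * (c i * f l i))"
        using c(2)[of m] that by (simp add: f'_def algebra_simps)
      also have "\<dots> = (\<Sum>i\<in>J. c i * f m i) - f m k / f l k * s"
        by (simp add: sum_subtractf s_def sum_distrib_left)
      finally show ?thesis by (simp add: sum algebra_simps)
    qed
    moreover have "\<exists>i\<in>I. c' i \<noteq> 0" using c(1) J by (auto simp: c'_def)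
    ultimately show ?thesis by blast
  qed
qed

text \<open>Semidefinite and not definite: the elements will be functions, and those vanishing
  almost everywhere have \<open>B x x = 0\<close> without being 0. The laws are required on
  \<open>S\<close> only, since the integrals behind \<open>B\<close> are meaningful only for
  square-integrable arguments.\<close>

locale psd_form = vector_space scale
  for scale :: "complex \<Rightarrow> 'a::ab_group_add \<Rightarrow> 'a" +
  fixes S :: "'a set" and B :: "'a \<Rightarrow> 'a \<Rightarrow> complex"
  assumes sub: "subspace S"
    and add_left: "\<lbrakk>x \<in> S; y \<in> S; z \<in> S\<rbrakk> \<Longrightarrow> B (x + y) z = B x z + B y z"
    and scale_left: "\<lbrakk>x \<in> S; z \<in> S\<rbrakk> \<Longrightarrow> B (scale c x) z = c * B x z"
    and herm: "\<lbrakk>x \<in> S; y \<in> S\<rbrakk> \<Longrightarrow> B y x = cnj (B x y)"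
    and nonneg: "x \<in> S \<Longrightarrow> 0 \<le> Re (B x x)"
begin

lemma minus_mem: "x \<in> S \<Longrightarrow> - x \<in> S"
  using subspace_scale[OF sub, of x "-1"] by simp

lemmas memI = subspace_add[OF sub] subspace_diff[OF sub] subspace_scale[OF sub] subspace_0[OF sub]
  subspace_sum[OF sub] minus_mem

abbreviation Q where "Q x \<equiv> Re (B x x)"

lemma self: "x \<in> S \<Longrightarrow> B x x = of_real (Q x)"
  by (metis complex_cnj_cancel_iff complex_is_Real_iff herm complex_eq_iff cnj.sel(2) Im_complex_of_real Re_complex_of_real neg_equal_zero)

lemma add_right: "\<lbrakk>x \<in> S; y \<in> S; z \<in> S\<rbrakk> \<Longrightarrow> B z (x + y) = B z x + B z y"
  using herm[of "x + y" z] herm[of x z] herm[of y z] add_left[of x y z] memI by simp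

lemma scale_right: "\<lbrakk>x \<in> S; z \<in> S\<rbrakk> \<Longrightarrow> B z (scale c x) = cnj c * B z x"
  using herm[of "scale c x" z] herm[of x z] scale_left[of x z c] memI by simp

lemma minus_left: "\<lbrakk>x \<in> S; z \<in> S\<rbrakk> \<Longrightarrow> B (- x) z = - B x z"
  using scale_left[of x z "-1"] by simp

lemma minus_right: "\<lbrakk>x \<in> S; z \<in> S\<rbrakk> \<Longrightarrow> B z (- x) = - B z x"
  using scale_right[of x z "-1"] by simp

lemma diff_left: "\<lbrakk>x \<in> S; y \<in> S; z \<in> S\<rbrakk> \<Longrightarrow> B (x - y) z = B x z - B y z"
  using add_left[of x "- y" z] minus_left[of y z] memI by simp

lemma diff_right: "\<lbrakk>x \<in> S; y \<in> S; z \<in> S\<rbrakk> \<Longrightarrow> B z (x - y) = B z x - B z y"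
  using add_right[of x "- y" z] minus_right[of y z] memI by simp

lemma zero_left: "z \<in> S \<Longrightarrow> B 0 z = 0"
  using diff_left[of z z z] by simp

lemma zero_right: "z \<in> S \<Longrightarrow> B z 0 = 0"
  using diff_right[of z z z] by simp

lemma sum_left: "\<lbrakk>finite I; \<And>i. i \<in> I \<Longrightarrow> x i \<in> S; z \<in> S\<rbrakk> \<Longrightarrow> B (\<Sum>i\<in>I. x i) z = (\<Sum>i\<in>I. B (x i) z)"
proof (induction I rule: finite_induct)
  case empty then show ?case by (simp add: zero_left)
next
  case (insert i I)
  then have "(\<Sum>i\<in>I. x i) \<in> S" by (intro memI) auto
  with insert show ?case by (simp add: add_left)
qed

lemma sum_right: "\<lbrakk>finite I; \<And>i. i \<in> I \<Longrightarrow> x i \<in> S; z \<in> S\<rbrakk> \<Longrightarrow> B z (\<Sum>i\<in>I. x i) = (\<Sum>i\<in>I. B z (x i))"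
proof (induction I rule: finite_induct)
  case empty then show ?case by (simp add: zero_right)
next
  case (insert i I)
  then have "(\<Sum>i\<in>I. x i) \<in> S" by (intro memI) auto
  with insert show ?case by (simp add: add_right)
qed

lemma Q_scale: "x \<in> S \<Longrightarrow> Q (scale c x) = (cmod c)\<^sup>2 * Q x"
proof -
  assume x: "x \<in> S"
  have "B (scale c x) (scale c x) = (c * cnj c) * B x x"
    using x by (simp add: scale_left scale_right memI)
  also have "\<dots> = of_real ((cmod c)\<^sup>2 * Q x)"
    unfolding of_real_mult complex_norm_square using self[OF x] by metis
  finally show ?thesis by simp
qed

lemma Q_add: "\<lbrakk>x \<in> S; y \<in> S\<rbrakk> \<Longrightarrow> Q (x + y) = Q x + Q y + 2 * Re (B x y)"
  using herm[of x y] by (simp add: add_left add_right memI)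

lemma Q_diff: "\<lbrakk>x \<in> S; y \<in> S\<rbrakk> \<Longrightarrow> Q (x - y) = Q x + Q y - 2 * Re (B x y)"
  using herm[of x y] by (simp add: diff_left diff_right memI)

lemma parallelogram: "\<lbrakk>x \<in> S; y \<in> S\<rbrakk> \<Longrightarrow> Q (x + y) + Q (x - y) = 2 * Q x + 2 * Q y"
  by (simp add: Q_add Q_diff)

text \<open>Positivity of \<open>x - c y\<close> with \<open>c\<close> a real multiple
  \<open>t\<close> of \<open>B x y\<close>, which makes the cross term real. For
  \<open>Q y > 0\<close> the minimising \<open>t\<close> is taken; for \<open>Q y = 0\<close> the
  expression is affine in \<open>t\<close> and a large \<open>t\<close> gives a
  contradiction.\<close>

lemma Cauchy_Schwarz:
  assumes x: "x \<in> S" and y: "y \<in> S"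
  shows "(cmod (B x y))\<^sup>2 \<le> Q x * Q y"
proof -
  have main: "0 \<le> Q x + t\<^sup>2 * (cmod (B x y))\<^sup>2 * Q y - 2 * t * (cmod (B x y))\<^sup>2" for t :: real
  proof -
    define c where "c = of_real t * B x y"
    have "0 \<le> Q (x - scale c y)" using x y by (intro nonneg memI)
    also have "\<dots> = Q x + (cmod c)\<^sup>2 * Q y - 2 * Re (cnj c * B x y)"
      using Q_diff[OF x memI(3)[OF y]] Q_scale[OF y] scale_right[OF y x] by simp
    also have "cnj c * B x y = of_real (t * (cmod (B x y))\<^sup>2)"
      unfolding c_def of_real_mult complex_norm_square by simp
    also have "(cmod c)\<^sup>2 = t\<^sup>2 * (cmod (B x y))\<^sup>2" by (simp add: c_def norm_mult power_mult_distrib)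
    finally show ?thesis by simp
  qed
  define k where "k = (cmod (B x y))\<^sup>2"
  have k: "k \<ge> 0" by (simp add: k_def)
  show ?thesis
  proof (cases "Q y = 0")
    case True
    have "k \<le> 0"
    proof (rule ccontr)
      assume "\<not> k \<le> 0"
      \<comment> \<open>For this parameter the right-hand side equals -1.\<close>
      moreover have "0 \<le> Q x - 2 * ((Q x + 1) / (2 * k)) * k"
        using main[of "(Q x + 1) / (2 * k)"] True by (simp add: k_def)
      ultimately show False by simp
    qed
    with True show ?thesis by (simp add: k_def)
  next
    case False
    then have Qy: "Q y > 0" using nonneg[OF y] by simp
    have "0 \<le> Q x + (1 / Q y)\<^sup>2 * k * Q y - 2 * (1 / Q y) * k"
      using main[of "1 / Q y"] by (simp add: k_def)
    also have "\<dots> = Q x - k / Q y" using Qy by (simp add: power2_eq_square field_simps)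
    finally show ?thesis using Qy by (simp add: k_def field_simps)
  qed
qed

lemma null_orthogonal:
  assumes "x \<in> S" "y \<in> S" "Q x = 0" shows "B x y = 0"
  using Cauchy_Schwarz[OF assms(1,2)] assms(3) by simp

lemma tendsto_left:
  assumes x: "\<And>n. x n \<in> S" and z: "z \<in> S" and u: "u \<in> S"
    and lim: "(\<lambda>n. Q (x n - z)) \<longlonglongrightarrow> 0"
  shows "(\<lambda>n. B (x n) u) \<longlonglongrightarrow> B z u"
proof -
  have "(\<lambda>n. (cmod (B (x n) u - B z u))\<^sup>2) \<longlonglongrightarrow> 0"
  proof (rule tendsto_sandwich[of "\<lambda>_. 0" _ _ "\<lambda>n. Q (x n - z) * Q u"])
    show "(\<lambda>n. Q (x n - z) * Q u) \<longlonglongrightarrow> 0" using tendsto_mult_right[OF lim, of "Q u"] by simp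
    show "\<forall>\<^sub>F n in sequentially. (cmod (B (x n) u - B z u))\<^sup>2 \<le> Q (x n - z) * Q u"
    proof (rule always_eventually, rule allI)
      fix n show "(cmod (B (x n) u - B z u))\<^sup>2 \<le> Q (x n - z) * Q u"
        using Cauchy_Schwarz[of "x n - z" u] x z u by (simp add: diff_left memI)
    qed
  qed auto
  then have "(\<lambda>n. sqrt ((cmod (B (x n) u - B z u))\<^sup>2)) \<longlonglongrightarrow> sqrt 0" by (intro tendsto_real_sqrt)
  then have "(\<lambda>n. B (x n) u - B z u) \<longlonglongrightarrow> 0" by (simp add: tendsto_norm_zero_iff)
  then show ?thesis using LIM_zero_iff by blast
qed

lemma tendsto_Q:
  assumes x: "\<And>n. x n \<in> S" and z: "z \<in> S"
    and lim: "(\<lambda>n. Q (x n - z)) \<longlonglongrightarrow> 0"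
  shows "(\<lambda>n. Q (x n)) \<longlonglongrightarrow> Q z"
proof -
  have "(\<lambda>n. Re (B (x n) z)) \<longlonglongrightarrow> Q z" by (intro tendsto_intros tendsto_left assms)
  then have "(\<lambda>n. Q (x n - z) - Q z + 2 * Re (B (x n) z)) \<longlonglongrightarrow> 0 - Q z + 2 * Q z"
    using lim by (intro tendsto_diff tendsto_add tendsto_mult tendsto_const)
  moreover have "Q (x n) = Q (x n - z) - Q z + 2 * Re (B (x n) z)" for n
    using Q_diff[OF x z, of n] by simp
  ultimately show ?thesis by simp
qed

end

text \<open>\<open>E\<close> is the energy and \<open>N\<close> the mass. Compactness delivers only
  an \<open>N\<close>-Cauchy subsequence and no limit; a limit is available once a sequence is
  Cauchy for both forms, because completeness is that of the energy norm. The last assumption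
  ensures that finitely many linear constraints always leave a vector of positive mass.\<close>

locale compact_form_pair =
  E: psd_form scale S E + N: psd_form scale S N
  for scale :: "complex \<Rightarrow> 'a::ab_group_add \<Rightarrow> 'a" and S :: "'a set" and E N :: "'a \<Rightarrow> 'a \<Rightarrow> complex" +
  assumes compactness: "\<And>x C. (\<And>n. x n \<in> S \<and> Re (E (x n) (x n)) \<le> C \<and> Re (N (x n) (x n)) \<le> C) \<Longrightarrow>
      \<exists>r. strict_mono (r :: nat \<Rightarrow> nat) \<and>
        (\<forall>e>0. \<exists>M. \<forall>m\<ge>M. \<forall>n\<ge>M. Re (N (x (r m) - x (r n)) (x (r m) - x (r n))) < e)"
    and completeness: "\<And>x. (\<And>n. x n \<in> S) \<Longrightarrow>
      (\<And>e. e > 0 \<Longrightarrow> \<exists>M. \<forall>m\<ge>M. \<forall>n\<ge>M. Re (E (x m - x n) (x m - x n)) < e \<and> Re (N (x m - x n) (x m - x n)) < e) \<Longrightarrow>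
      \<exists>y\<in>S. (\<lambda>n. Re (E (x n - y) (x n - y))) \<longlonglongrightarrow> 0 \<and> (\<lambda>n. Re (N (x n - y) (x n - y))) \<longlonglongrightarrow> 0"
    and infinite_dim: "\<And>n. \<exists>e :: nat \<Rightarrow> 'a. (\<forall>i. e i \<in> S) \<and>
      (\<forall>c. (\<exists>i<n. c i \<noteq> 0) \<longrightarrow> 0 < Re (N (\<Sum>i<n. scale (c i) (e i)) (\<Sum>i<n. scale (c i) (e i))))"
begin

abbreviation "QE \<equiv> E.Q"
abbreviation "QN \<equiv> N.Q"

definition functional :: "('a \<Rightarrow> complex) \<Rightarrow> bool" where
  "functional l \<longleftrightarrow> (\<forall>x\<in>S. \<forall>y\<in>S. l (x + y) = l x + l y) \<and> (\<forall>x\<in>S. \<forall>c. l (scale c x) = c * l x) \<and>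
     (\<exists>C. \<forall>x\<in>S. (cmod (l x))\<^sup>2 \<le> C * QN x)"

definition ker :: "('a \<Rightarrow> complex) set \<Rightarrow> 'a set" where
  "ker L = {x \<in> S. \<forall>l\<in>L. l x = 0}"

lemma functional_zero: "functional l \<Longrightarrow> l 0 = 0"
  unfolding functional_def using E.memI(4) E.scale_zero_left by (metis mult_zero_left)

lemma subspace_ker:
  assumes "\<And>l. l \<in> L \<Longrightarrow> functional l"
  shows "E.subspace (ker L)"
  by (rule E.subspaceI) (use assms in \<open>fastforce simp: ker_def functional_zero E.memI functional_def\<close>)+

lemma functional_sum:
  assumes "functional l" "finite I" "\<And>i. i \<in> I \<Longrightarrow> x i \<in> S"
  shows "l (\<Sum>i\<in>I. scale (c i) (x i)) = (\<Sum>i\<in>I. c i * l (x i))"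
  using assms(2,3)
proof (induction I rule: finite_induct)
  case empty then show ?case using functional_zero[OF assms(1)] by simp
next
  case (insert i I)
  then have "(\<Sum>i\<in>I. scale (c i) (x i)) \<in> S" "scale (c i) (x i) \<in> S" by (auto intro!: E.memI)
  with insert assms(1) show ?case by (simp add: functional_def)
qed

lemma functional_N: "u \<in> S \<Longrightarrow> functional (\<lambda>x. N x u)"
  unfolding functional_def using N.Cauchy_Schwarz[of _ u]
  by (auto simp: N.add_left N.scale_left intro!: exI[of _ "QN u"] simp: mult.commute)

text \<open>Boundedness of the functionals with respect to \<open>N\<close> alone is what lets an
  \<open>N\<close>-limit inherit the constraints.\<close>

lemma ker_closed:
  assumes L: "\<And>l. l \<in> L \<Longrightarrow> functional l" and x: "\<And>n. x n \<in> ker L" and z: "z \<in> S"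
    and lim: "(\<lambda>n. QN (x n - z)) \<longlonglongrightarrow> 0"
  shows "z \<in> ker L"
proof -
  have "l z = 0" if l: "l \<in> L" for l
  proof -
    from L[OF l] obtain C where C: "\<And>x. x\<in>S \<Longrightarrow> (cmod (l x))\<^sup>2 \<le> C * QN x"
      unfolding functional_def by blast
    have xS: "x n \<in> S" for n using x by (simp add: ker_def)
    have "(cmod (l z))\<^sup>2 \<le> C * QN (x n - z)" for n
    proof -
      have "x n = (x n - z) + z" by simp
      then have "l (x n) = l (x n - z) + l z" using L[OF l] E.memI(2)[OF xS z] z unfolding functional_def by metis
      moreover have "l (x n) = 0" using x l by (auto simp: ker_def)
      ultimately have "l z = - l (x n - z)" by (simp add: eq_neg_iff_add_eq_0 add.commute)
      then show ?thesis using C[OF E.memI(2)[OF xS z], of n] by simp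
    qed
    moreover have "(\<lambda>n. C * QN (x n - z)) \<longlonglongrightarrow> C * 0" by (intro tendsto_intros lim)
    ultimately have "(cmod (l z))\<^sup>2 \<le> 0"
      by (intro LIMSEQ_le_const[of "\<lambda>n. C * QN (x n - z)"]) auto
    then show ?thesis by simp
  qed
  then show ?thesis using z by (simp add: ker_def)
qed

text \<open>\<open>card L\<close> homogeneous equations in \<open>card L + 1\<close> unknown
  coefficients.\<close>

lemma ker_nontrivial:
  assumes L: "\<And>l. l \<in> L \<Longrightarrow> functional l" "finite L"
  shows "\<exists>x\<in>ker L. QN x > 0"
proof -
  let ?n = "Suc (card L)"
  obtain e :: "nat \<Rightarrow> 'a" where e: "\<And>i. e i \<in> S"
    "\<And>c. (\<exists>i<?n. c i \<noteq> 0) \<Longrightarrow> 0 < QN (\<Sum>i<?n. scale (c i) (e i))"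
    using infinite_dim[of ?n] by blast
  obtain c where c: "\<exists>i\<in>{..<?n}. c i \<noteq> 0" "\<And>l. l\<in>L \<Longrightarrow> (\<Sum>i<?n. c i * l (e i)) = 0"
    using homogeneous_system_nontrivial[OF L(2), of "{..<?n}" "\<lambda>l i. l (e i)"] by auto
  have "(\<Sum>i<?n. scale (c i) (e i)) \<in> ker L"
    unfolding ker_def using c(2) e(1) L(1)
    by (auto intro!: E.memI simp: functional_sum simp del: sum.lessThan_Suc)
  moreover have "QN (\<Sum>i<?n. scale (c i) (e i)) > 0" using e(2)[of c] c(1) by blast
  ultimately show ?thesis by blast
qed

text \<open>A minimising sequence is \<open>N\<close>-Cauchy along a subsequence by compactness; the parallelogram
  law and minimality then make it \<open>E\<close>-Cauchy as well.\<close>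

lemma minimizer_exists:
  assumes L: "\<And>l. l \<in> L \<Longrightarrow> functional l" "finite L"
  shows "\<exists>v\<in>ker L. QN v = 1 \<and> (\<forall>u\<in>ker L. QE v * QN u \<le> QE u)"
proof -
  let ?W = "ker L"
  have sub: "E.subspace ?W" by (rule subspace_ker[OF L(1)])
  have WS: "x \<in> S" if "x \<in> ?W" for x using that by (simp add: ker_def)
  define A where "A = {QE x | x. x \<in> ?W \<and> QN x = 1}"
  have norm1: "\<exists>c>0. QN (scale (of_real c) x) = 1 \<and> QE (scale (of_real c) x) = QE x / QN x"
    if "x \<in> ?W" "QN x > 0" for x
  proof (intro exI conjI)
    show "0 < 1 / sqrt (QN x)" using that by simp
    show "QN (scale (of_real (1 / sqrt (QN x))) x) = 1"
      "QE (scale (of_real (1 / sqrt (QN x))) x) = QE x / QN x"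
      using that WS[OF that(1)] by (simp_all add: N.Q_scale E.Q_scale norm_divide power_divide)
  qed
  obtain x1 where "x1 \<in> ?W" "QN x1 > 0" using ker_nontrivial[OF L] by blast
  then have ne: "A \<noteq> {}" using norm1[of x1] E.subspace_scale[OF sub] unfolding A_def by blast
  have bdd: "bdd_below A" by (rule bdd_belowI[of _ 0]) (auto simp: A_def intro!: E.nonneg WS)
  define R where "R = Inf A"
  have R0: "R \<ge> 0" unfolding R_def using ne by (intro cInf_greatest) (auto simp: A_def intro!: E.nonneg WS)
  have Rle: "R * QN u \<le> QE u" if u: "u \<in> ?W" for u
  proof (cases "QN u = 0")
    case True then show ?thesis using E.nonneg[OF WS[OF u]] by simp
  next
    case False
    then have pos: "QN u > 0" using N.nonneg[OF WS[OF u]] by simp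
    obtain c :: real where "QN (scale (of_real c) u) = 1" "QE (scale (of_real c) u) = QE u / QN u"
      using norm1[OF u pos] by blast
    then have "QE u / QN u \<in> A" unfolding A_def using E.subspace_scale[OF sub u] by force
    then have "R \<le> QE u / QN u" unfolding R_def using bdd by (intro cInf_lower)
    then show ?thesis using pos by (simp add: field_simps)
  qed
  have "\<exists>x. x \<in> ?W \<and> QN x = 1 \<and> QE x < R + 1 / real (Suc n)" for n
  proof -
    have "Inf A < R + 1 / real (Suc n)" by (simp add: R_def)
    then obtain y where "y \<in> A" "y < R + 1 / real (Suc n)"
      using cInf_less_iff[OF ne bdd] by blast
    then show ?thesis by (auto simp: A_def)
  qed
  then obtain x where x: "\<And>n. x n \<in> ?W" "\<And>n. QN (x n) = 1" "\<And>n. QE (x n) < R + 1 / real (Suc n)"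
    by metis
  have bound: "x n \<in> S \<and> QE (x n) \<le> R + 1 \<and> QN (x n) \<le> R + 1" for n
  proof -
    have "1 / real (Suc n) \<le> 1" by simp
    then have "QE (x n) \<le> R + 1" using x(3)[of n] by linarith
    then show ?thesis using x(1,2)[of n] R0 WS by auto
  qed
  obtain r :: "nat \<Rightarrow> nat" where r: "strict_mono r"
    and Cau: "\<And>e. e > 0 \<Longrightarrow> \<exists>M. \<forall>m\<ge>M. \<forall>n\<ge>M. QN (x (r m) - x (r n)) < e"
    using compactness[of x "R + 1"] bound by metis
  define y where "y n = x (r n)" for n
  have y: "y n \<in> ?W" "y n \<in> S" "QN (y n) = 1" "QE (y n) \<le> R + 1 / real (Suc n)" for n
  proof -
    show "y n \<in> ?W" "QN (y n) = 1" by (simp_all add: y_def x)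
    then show "y n \<in> S" by (auto dest: WS)
    have "1 / real (Suc (r n)) \<le> 1 / real (Suc n)"
      using seq_suble[OF r, of n] by (simp add: frac_le)
    then show "QE (y n) \<le> R + 1 / real (Suc n)" using x(3)[of "r n"] by (simp add: y_def)
  qed
  have ECau: "QE (y m - y n) \<le> 2 / real (Suc m) + 2 / real (Suc n) + R * QN (y m - y n)" for m n
  proof -
    have "QN (y m + y n) = 4 - QN (y m - y n)" using N.parallelogram[OF y(2,2), of m n] y(3) by simp
    then have "R * (4 - QN (y m - y n)) \<le> QE (y m + y n)"
      using Rle[OF E.subspace_add[OF sub y(1,1)], of m n] by simp
    then show ?thesis using E.parallelogram[OF y(2,2), of m n] y(4)[of m] y(4)[of n]
      by (simp add: algebra_simps)
  qed
  have "\<exists>M. \<forall>m\<ge>M. \<forall>n\<ge>M. QE (y m - y n) < e \<and> QN (y m - y n) < e" if e: "e > 0" for e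
  proof -
    \<comment> \<open>With this choice the mass term in \<open>ECau\<close> contributes at most
      \<open>e / 4\<close>, and each of the two remaining terms less than
      \<open>e / 4\<close>.\<close>
    define e' where "e' = min e (e / (4 * (R + 1)))"
    have e': "e' > 0" using e R0 by (simp add: e'_def)
    obtain M1 where M1: "\<And>m n. m \<ge> M1 \<Longrightarrow> n \<ge> M1 \<Longrightarrow> QN (y m - y n) < e'"
      using Cau[OF e'] unfolding y_def by blast
    obtain M2 where M2: "1 / real (Suc M2) < e / 8" using e nat_approx_posE[of "e / 8"] by auto
    have "QE (y m - y n) < e \<and> QN (y m - y n) < e" if mn: "m \<ge> max M1 M2" "n \<ge> max M1 M2" for m n
    proof
      have "1 / real (Suc m) \<le> 1 / real (Suc M2)" "1 / real (Suc n) \<le> 1 / real (Suc M2)"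
        using mn by (auto simp: frac_le)
      with M2 have a: "1 / real (Suc m) < e / 8" "1 / real (Suc n) < e / 8" by linarith+
      have b: "QN (y m - y n) < e'" using M1 mn by simp
      then have "R * QN (y m - y n) \<le> (R + 1) * e'" using R0 N.nonneg[of "y m - y n"] N.memI(2)[OF y(2,2), of m n]
        by (intro mult_mono) auto
      also have "\<dots> \<le> (R + 1) * (e / (4 * (R + 1)))" using R0 by (intro mult_left_mono) (auto simp: e'_def)
      also have "\<dots> = e / 4" using R0 by (simp add: field_simps)
      finally show "QE (y m - y n) < e" using ECau[of m n] a e by linarith
      show "QN (y m - y n) < e" using b by (simp add: e'_def)
    qed
    then show ?thesis by blast
  qed
  then obtain z where z: "z \<in> S" "(\<lambda>n. QE (y n - z)) \<longlonglongrightarrow> 0" "(\<lambda>n. QN (y n - z)) \<longlonglongrightarrow> 0"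
    using completeness[of y, OF y(2)] by blast
  have zW: "z \<in> ?W" by (rule ker_closed[OF L(1) y(1) z(1) z(3)])
  have "(\<lambda>n. QN (y n)) \<longlonglongrightarrow> QN z" by (rule N.tendsto_Q[OF y(2) z(1) z(3)])
  then have Nz: "QN z = 1" by (simp add: y(3) LIMSEQ_const_iff)
  have lim: "(\<lambda>n. QE (y n)) \<longlonglongrightarrow> QE z" by (rule E.tendsto_Q[OF y(2) z(1) z(2)])
  have "(\<lambda>n. R + 1 / real (Suc n)) \<longlonglongrightarrow> R + 0"
    by (intro tendsto_intros LIMSEQ_Suc[OF lim_const_over_n])
  then have "QE z \<le> R" using lim y(4) by (intro LIMSEQ_le[OF lim]) auto
  then have "QE z * QN u \<le> QE u" if "u \<in> ?W" for u
    using Rle[OF that] mult_right_mono[of "QE z" R "QN u"] N.nonneg[OF WS[OF that]] by linarith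
  then show ?thesis using zW Nz by blast
qed

text \<open>Minimality says that \<open>E - QE v * N\<close> is semidefinite on \<open>W\<close> and
  that \<open>v\<close> is a null vector of it. By Cauchy--Schwarz a null vector is orthogonal to
  everything, so no derivative of the quotient has to be taken.\<close>

lemma Euler_Lagrange:
  assumes W: "E.subspace W" "W \<subseteq> S" and v: "v \<in> W" "QN v = 1"
    and min: "\<And>u. u \<in> W \<Longrightarrow> QE v * QN u \<le> QE u" and \<eta>: "\<eta> \<in> W"
  shows "E v \<eta> = of_real (QE v) * N v \<eta>"
proof -
  define B where "B x y = E x y - of_real (QE v) * N x y" for x y
  interpret B: psd_form scale W B
  proof (unfold_locales)
    show "E.subspace W" by (rule W(1))
    fix x y z :: 'a assume xyz: "x \<in> W" "y \<in> W" "z \<in> W"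
    with W(2) have "x \<in> S" "y \<in> S" "z \<in> S" by auto
    then show "B (x + y) z = B x z + B y z"
      by (simp add: B_def E.add_left N.add_left algebra_simps)
  next
    fix x z c assume "x \<in> W" "z \<in> W"
    with W(2) have "x \<in> S" "z \<in> S" by auto
    then show "B (scale c x) z = c * B x z"
      by (simp add: B_def E.scale_left N.scale_left algebra_simps)
  next
    fix x y assume "x \<in> W" "y \<in> W"
    with W(2) have "x \<in> S" "y \<in> S" by auto
    then show "B y x = cnj (B x y)" using E.herm[of x y] N.herm[of x y] by (simp add: B_def)
  next
    fix x assume "x \<in> W" then show "0 \<le> Re (B x x)" using min[of x] by (simp add: B_def)
  qed
  have "B v \<eta> = 0" by (rule B.null_orthogonal[OF v(1) \<eta>]) (simp add: B_def v(2))
  then show ?thesis by (simp add: B_def)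
qed

section \<open>Eigenvectors by successive constrained minimisation\<close>

definition orth :: "'a set \<Rightarrow> 'a set" where "orth A = ker ((\<lambda>u x. N x u) ` A)"

lemma mem_orth: "x \<in> orth A \<longleftrightarrow> x \<in> S \<and> (\<forall>u\<in>A. N x u = 0)"
  by (auto simp: orth_def ker_def)

definition next_eig :: "'a list \<Rightarrow> 'a" where
  "next_eig us = (SOME v. v \<in> orth (set us) \<and> QN v = 1 \<and> (\<forall>u\<in>orth (set us). QE v * QN u \<le> QE u))"

text \<open>Each step depends on all earlier vectors, so the recursion carries their list as its
  state.\<close>

primrec eigs :: "nat \<Rightarrow> 'a list" where
  "eigs 0 = []" | "eigs (Suc n) = eigs n @ [next_eig (eigs n)]"

definition eigvec :: "nat \<Rightarrow> 'a" where "eigvec n = next_eig (eigs n)"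
definition eigval :: "nat \<Rightarrow> real" where "eigval n = QE (eigvec n)"

lemma set_eigs: "set (eigs n) = eigvec ` {..<n}"
  by (induction n) (auto simp: eigvec_def lessThan_Suc)

text \<open>A minimiser is known to exist only when the earlier vectors lie in \<open>S\<close>,
  where their inner products are bounded functionals; \<open>eigvec_mem\<close> removes this proviso
  by induction.\<close>

lemma eigvec_choice:
  assumes "eigvec ` {..<n} \<subseteq> S"
  shows "eigvec n \<in> orth (eigvec ` {..<n})" "QN (eigvec n) = 1"
    "u \<in> orth (eigvec ` {..<n}) \<Longrightarrow> eigval n * QN u \<le> QE u"
proof -
  have "\<exists>v\<in>orth (eigvec ` {..<n}). QN v = 1 \<and> (\<forall>u\<in>orth (eigvec ` {..<n}). QE v * QN u \<le> QE u)"
    unfolding orth_def using assms by (intro minimizer_exists) (auto intro: functional_N)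
  then have "\<exists>v. v \<in> orth (eigvec ` {..<n}) \<and> QN v = 1 \<and> (\<forall>u\<in>orth (eigvec ` {..<n}). QE v * QN u \<le> QE u)"
    by blast
  from someI_ex[OF this] have "eigvec n \<in> orth (eigvec ` {..<n}) \<and> QN (eigvec n) = 1 \<and> (\<forall>u\<in>orth (eigvec ` {..<n}). QE (eigvec n) * QN u \<le> QE u)"
    unfolding eigvec_def[of n] next_eig_def set_eigs .
  then show "eigvec n \<in> orth (eigvec ` {..<n})" "QN (eigvec n) = 1"
    "u \<in> orth (eigvec ` {..<n}) \<Longrightarrow> eigval n * QN u \<le> QE u"
    by (auto simp: eigval_def)
qed

lemma eigvec_mem: "eigvec n \<in> S"
proof (induction n rule: less_induct)
  case (less n)
  then have "eigvec ` {..<n} \<subseteq> S" by auto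
  from eigvec_choice(1)[OF this] show ?case by (simp add: mem_orth)
qed

lemma eigvec_minimizer:
  shows "eigvec n \<in> orth (eigvec ` {..<n})" "QN (eigvec n) = 1"
    "u \<in> orth (eigvec ` {..<n}) \<Longrightarrow> eigval n * QN u \<le> QE u"
  using eigvec_choice eigvec_mem by (metis image_subsetI)+

lemma eigvec_orthonormal: "N (eigvec i) (eigvec j) = (if i = j then 1 else 0)"
proof -
  have *: "N (eigvec i) (eigvec j) = 0" if "j < i" for i j
    using eigvec_minimizer(1)[of i] that by (auto simp: mem_orth)
  have "N (eigvec i) (eigvec j) = 0" if "i \<noteq> j"
  proof (cases "j < i")
    case False
    then have "N (eigvec j) (eigvec i) = 0" using * that by simp
    then show ?thesis using N.herm[OF eigvec_mem eigvec_mem, of j i] by simp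
  qed (rule *)
  then show ?thesis using eigvec_minimizer(2)[of i] N.self[OF eigvec_mem, of i] by auto
qed

lemma subspace_orth: "A \<subseteq> S \<Longrightarrow> E.subspace (orth A)"
  unfolding orth_def by (intro subspace_ker) (auto intro: functional_N)

text \<open>Minimality gives the equation only for test vectors orthogonal to the earlier
  eigenvectors. For general \<eta> the projection onto those is subtracted; it contributes to
  neither side, because by the induction hypothesis and symmetry the earlier eigenvectors are also
  \<open>E\<close>-orthogonal to the new one.\<close>

lemma eigvec_weak: "\<eta> \<in> S \<Longrightarrow> E (eigvec n) \<eta> = of_real (eigval n) * N (eigvec n) \<eta>"
proof (induction n arbitrary: \<eta> rule: less_induct)
  case (less n)
  let ?s = "\<Sum>i<n. scale (N \<eta> (eigvec i)) (eigvec i)"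
  have s: "?s \<in> S" by (intro N.memI eigvec_mem)
  have "N (\<eta> - ?s) (eigvec j) = 0" if "j < n" for j
  proof -
    have "N ?s (eigvec j) = (\<Sum>i<n. N \<eta> (eigvec i) * N (eigvec i) (eigvec j))"
      by (subst N.sum_left) (auto intro!: N.memI eigvec_mem simp: N.scale_left eigvec_mem)
    also have "\<dots> = N \<eta> (eigvec j)" using that by (simp add: eigvec_orthonormal if_distrib cong: if_cong)
    finally show ?thesis using less.prems s eigvec_mem by (simp add: N.diff_left)
  qed
  then have orth: "\<eta> - ?s \<in> orth (eigvec ` {..<n})" using less.prems s N.memI(2) by (auto simp: mem_orth)
  have W: "E.subspace (orth (eigvec ` {..<n}))" by (rule subspace_orth) (auto intro: eigvec_mem)
  have "E (eigvec n) (\<eta> - ?s) = of_real (QE (eigvec n)) * N (eigvec n) (\<eta> - ?s)"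
    by (rule Euler_Lagrange[OF W _ eigvec_minimizer(1,2) _ orth])
       (use eigvec_minimizer(3) in \<open>auto simp: mem_orth eigval_def\<close>)
  moreover have "E (eigvec n) ?s = 0" "N (eigvec n) ?s = 0"
  proof -
    have "E (eigvec n) (eigvec i) = 0" if "i < n" for i
      using less.IH[OF that eigvec_mem, of n] E.herm[OF eigvec_mem eigvec_mem, of i n] that
      by (simp add: eigvec_orthonormal)
    then show "E (eigvec n) ?s = 0"
      by (subst E.sum_right) (auto intro!: N.memI eigvec_mem simp: E.scale_right eigvec_mem)
    show "N (eigvec n) ?s = 0"
      by (subst N.sum_right) (auto intro!: N.memI eigvec_mem simp: N.scale_right eigvec_mem eigvec_orthonormal)
  qed
  ultimately show ?case using less.prems s eigvec_mem by (simp add: E.diff_right N.diff_right eigval_def)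
qed

text \<open>A later eigenvector is a competitor in every earlier minimisation problem.\<close>

lemma eigval_mono: "i \<le> j \<Longrightarrow> eigval i \<le> eigval j"
proof -
  assume "i \<le> j"
  then have "eigvec j \<in> orth (eigvec ` {..<i})" using eigvec_minimizer(1)[of j] by (auto simp: mem_orth)
  from eigvec_minimizer(3)[OF this] show ?thesis by (simp add: eigvec_minimizer(2) eigval_def)
qed

text \<open>Orthonormal vectors have squared mutual distance 2, so no subsequence is
  \<open>N\<close>-Cauchy, which compactness would provide under an energy bound.\<close>

lemma eigval_unbounded: "\<exists>n. C < eigval n"
proof (rule ccontr)
  assume "\<not> ?thesis"
  then have "eigvec n \<in> S \<and> QE (eigvec n) \<le> max C 1 \<and> QN (eigvec n) \<le> max C 1" for n
    using eigvec_mem eigvec_minimizer(2) by (auto simp: eigval_def not_less intro: order.trans[OF _ max.cobounded1])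
  from compactness[of eigvec, OF this] obtain r :: "nat \<Rightarrow> nat" where r: "strict_mono r"
    "\<And>e. e > 0 \<Longrightarrow> \<exists>M. \<forall>m\<ge>M. \<forall>n\<ge>M. QN (eigvec (r m) - eigvec (r n)) < e" by blast
  from r(2)[of 1] obtain M where "\<forall>m\<ge>M. \<forall>n\<ge>M. QN (eigvec (r m) - eigvec (r n)) < 1" by auto
  then have "QN (eigvec (r M) - eigvec (r (Suc M))) < 1" using le_SucI by blast
  moreover have "r M \<noteq> r (Suc M)" using r(1) by (metis strict_mono_eq n_not_Suc_n)
  ultimately show False by (simp add: N.Q_diff eigvec_mem eigvec_orthonormal)
qed

text \<open>Otherwise \<open>u\<close> is orthogonal to every \<open>eigvec n\<close>, hence
  admissible in every minimisation, and its Rayleigh quotient bounds all \<open>eigval n\<close>.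
  Since \<mu> is an arbitrary complex number, this is also where reality of the eigenvalues comes
  from.\<close>

lemma weak_eigenvalue_listed:
  assumes u: "u \<in> S" "QN u > 0" and weak: "\<And>\<eta>. \<eta> \<in> S \<Longrightarrow> E u \<eta> = \<mu> * N u \<eta>"
  shows "\<exists>n. \<mu> = of_real (eigval n)"
proof (rule ccontr)
  assume ne: "\<not> ?thesis"
  have "N u (eigvec n) = 0" for n
  proof -
    have "E u (eigvec n) = of_real (eigval n) * N u (eigvec n)"
      using eigvec_weak[OF u(1), of n] E.herm[OF eigvec_mem u(1), of n] N.herm[OF eigvec_mem u(1), of n] by simp
    then have "(\<mu> - of_real (eigval n)) * N u (eigvec n) = 0" using weak[OF eigvec_mem, of n] by (simp add: algebra_simps)
    then show ?thesis using ne by auto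
  qed
  then have "u \<in> orth (eigvec ` {..<n})" for n using u by (auto simp: mem_orth)
  then have "eigval n * QN u \<le> QE u" for n using eigvec_minimizer(3) by blast
  moreover obtain n where "QE u / QN u < eigval n" using eigval_unbounded by blast
  ultimately show False using u(2) by (metis divide_less_eq not_less)
qed

text \<open>The \<open>n + 1\<close> eigenvectors with indices \<open>0..n\<close> outnumber the
  constraints, so some nontrivial combination satisfies them all; its Rayleigh quotient is a
  weighted mean of \<open>eigval 0, ..., eigval n\<close>.\<close>

lemma minmax_upper:
  assumes L: "\<And>l. l \<in> L \<Longrightarrow> functional l" "finite L" "card L \<le> n"
  shows "\<exists>x\<in>ker L. 0 < QN x \<and> QE x \<le> eigval n * QN x"
proof -
  obtain c where c: "\<exists>i\<in>{..n}. c i \<noteq> 0" "\<And>l. l\<in>L \<Longrightarrow> (\<Sum>i\<le>n. c i * l (eigvec i)) = 0"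
    using homogeneous_system_nontrivial[OF L(2), of "{..n}" "\<lambda>l i. l (eigvec i)"] L(3) by auto
  let ?x = "\<Sum>i\<le>n. scale (c i) (eigvec i)"
  have x: "?x \<in> S" by (intro N.memI eigvec_mem)
  have ker: "?x \<in> ker L"
    unfolding ker_def using c(2) L(1) x
    by (auto simp: functional_sum eigvec_mem)
  have Nx: "N (eigvec i) ?x = cnj (c i)" if "i \<le> n" for i
    using that by (subst N.sum_right) (auto intro!: N.memI eigvec_mem simp: N.scale_right eigvec_mem eigvec_orthonormal if_distrib cong: if_cong)
  have "N ?x ?x = (\<Sum>i\<le>n. c i * N (eigvec i) ?x)"
    by (subst N.sum_left) (auto intro!: N.memI eigvec_mem x simp: N.scale_left eigvec_mem x)
  also have "\<dots> = of_real (\<Sum>i\<le>n. (cmod (c i))\<^sup>2)" by (simp add: Nx complex_norm_square del: of_real_power)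
  finally have QN: "QN ?x = (\<Sum>i\<le>n. (cmod (c i))\<^sup>2)" by simp
  have "E ?x ?x = (\<Sum>i\<le>n. c i * E (eigvec i) ?x)"
    by (subst E.sum_left) (auto intro!: N.memI eigvec_mem x simp: E.scale_left eigvec_mem x)
  also have "\<dots> = of_real (\<Sum>i\<le>n. eigval i * (cmod (c i))\<^sup>2)"
    by (simp add: Nx eigvec_weak x complex_norm_square mult_ac del: of_real_power)
  finally have QE: "QE ?x = (\<Sum>i\<le>n. eigval i * (cmod (c i))\<^sup>2)" by simp
  have "QE ?x \<le> eigval n * QN ?x"
    unfolding QE QN sum_distrib_left by (intro sum_mono mult_right_mono eigval_mono) auto
  moreover have "QN ?x > 0" unfolding QN using c(1) by (auto intro: sum_pos2)
  ultimately show ?thesis using ker by blast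
qed

end

section \<open>Weak derivatives on an interval\<close>

definition flat :: "real \<Rightarrow> nat \<Rightarrow> real \<Rightarrow> real" where
  "flat k m x = (if x > 0 then exp (- k / x) / x ^ m else 0)"

text \<open>From \<open>exp t \<ge> (1 + t/n)^n \<ge> (t/n)^n\<close> with \<open>n = m + 1\<close>
  and \<open>t = k/x\<close>: one power of \<open>x\<close> is left over after dividing by
  \<open>x^m\<close>. Applied to \<open>m + 1\<close> instead of \<open>m\<close>, this shows that
  the difference quotient of \<open>flat k m\<close> at 0 tends to 0.\<close>

lemma flat_bound:
  assumes k: "k > 0"
  shows "\<bar>flat k m x\<bar> \<le> (real (Suc m) / k) ^ Suc m * \<bar>x\<bar>"
proof (cases "x > 0")
  case True
  let ?n = "Suc m"
  have "(k / x / real ?n) ^ ?n \<le> (1 + (k / x) / real ?n) ^ ?n"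
    using k True by (intro power_mono) auto
  also have "\<dots> \<le> exp (k / x)"
    using k True by (intro exp_ge_one_plus_x_over_n_power_n) (auto intro: order.trans[of _ 0])
  finally have "inverse (exp (k / x)) \<le> inverse ((k / x / real ?n) ^ ?n)"
    using k True by (intro le_imp_inverse_le zero_less_power) auto
  also have "inverse ((k / x / real ?n) ^ ?n) = (inverse (k / x / real ?n)) ^ ?n" by (rule power_inverse[symmetric])
  also have "inverse (k / x / real ?n) = x * real ?n / k" by (simp add: divide_inverse mult_ac)
  finally have "exp (- k / x) \<le> (x * real ?n / k) ^ ?n" by (simp add: exp_minus[symmetric])
  then have "exp (- k / x) / x ^ m \<le> (x * real ?n / k) ^ ?n / x ^ m" using True by (intro divide_right_mono) auto
  also have "\<dots> = (real ?n / k) ^ ?n * x" using True k by (simp add: power_divide power_mult_distrib)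
  finally show ?thesis using True by (simp add: flat_def)
next
  case False
  have "0 \<le> (real (Suc m) / k) ^ Suc m * \<bar>x\<bar>" using k by (intro mult_nonneg_nonneg zero_le_power) auto
  with False show ?thesis by (simp add: flat_def del: power_Suc)
qed

lemma flat_deriv:
  assumes k: "k > 0"
  shows "(flat k m has_real_derivative k * flat k (m + 2) x - real m * flat k (m + 1) x) (at x)"
proof -
  consider "x < 0" | "x = 0" | "x > 0" by linarith
  then show ?thesis
  proof cases
    case 1
    have "\<forall>\<^sub>F y in nhds x. y \<in> {..<0}" using 1 by (intro eventually_nhds_in_open) auto
    then have "\<forall>\<^sub>F y in nhds x. flat k m y = (\<lambda>_. 0) y" by eventually_elim (simp add: flat_def)
    from DERIV_cong_ev[OF refl this refl, THEN iffD2, OF DERIV_const]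
    have "(flat k m has_real_derivative 0) (at x)" .
    moreover have "k * flat k (m + 2) x - real m * flat k (m + 1) x = 0" using 1 by (simp add: flat_def)
    ultimately show ?thesis by simp
  next
    case 2
    have "((\<lambda>h. flat k m h / h) \<longlongrightarrow> 0) (at 0)"
    proof (rule Lim_null_comparison)
      show "\<forall>\<^sub>F h in at 0. norm (flat k m h / h) \<le> (real (Suc (Suc m)) / k) ^ Suc (Suc m) * \<bar>h\<bar>"
      proof (rule always_eventually, rule allI)
        fix h :: real
        have "flat k m h / h = flat k (Suc m) h" by (simp add: flat_def)
        then show "norm (flat k m h / h) \<le> (real (Suc (Suc m)) / k) ^ Suc (Suc m) * \<bar>h\<bar>"
          using flat_bound[OF k, of "Suc m" h] by (simp only: real_norm_def)
      qed
      show "((\<lambda>h. (real (Suc (Suc m)) / k) ^ Suc (Suc m) * \<bar>h\<bar>) \<longlongrightarrow> 0) (at 0)"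
        by (rule tendsto_eq_intros refl | simp)+
    qed
    then have "(flat k m has_real_derivative 0) (at 0)" by (simp add: DERIV_def flat_def)
    then show ?thesis using 2 by (simp add: flat_def)
  next
    case 3
    have "\<forall>\<^sub>F y in nhds x. y \<in> {0<..}" using 3 by (intro eventually_nhds_in_open) auto
    then have ev: "\<forall>\<^sub>F y in nhds x. flat k m y = (\<lambda>y. exp (- k / y) * inverse (y ^ m)) y"
      by eventually_elim (simp add: flat_def divide_inverse)
    have d1: "((\<lambda>y. exp (- k / y)) has_real_derivative exp (- k / x) * (k / x ^ 2)) (at x)"
      using 3 by (auto intro!: derivative_eq_intros simp: power2_eq_square)
    have d2: "((\<lambda>y. inverse (y ^ m)) has_real_derivative - (real m / x ^ (m + 1))) (at x)"
    proof (cases m)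
      case (Suc l)
      have "((\<lambda>y. inverse (y ^ m)) has_real_derivative - (inverse (x ^ m) * (real m * x ^ (m - 1)) * inverse (x ^ m))) (at x)"
        using 3 by (auto intro!: derivative_eq_intros)
      also have "inverse (x ^ m) * (real m * x ^ (m - 1)) * inverse (x ^ m) = real m / x ^ (m + 1)"
        using 3 Suc by (simp add: field_simps)
      finally show ?thesis .
    qed simp
    have "((\<lambda>y. exp (- k / y) * inverse (y ^ m)) has_real_derivative
       exp (- k / x) * (k / x ^ 2) * inverse (x ^ m) + (- (real m / x ^ (m + 1))) * exp (- k / x)) (at x)"
      by (rule DERIV_mult[OF d1 d2])
    also have "exp (- k / x) * (k / x ^ 2) * inverse (x ^ m) + (- (real m / x ^ (m + 1))) * exp (- k / x)
       = k * flat k (m + 2) x - real m * flat k (m + 1) x"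
      using 3 by (simp add: flat_def field_simps power_add power2_eq_square)
    finally show ?thesis using DERIV_cong_ev[OF refl ev refl] by blast
  qed
qed

text \<open>Derivatives of \<open>flat k m\<close> are combinations of \<open>flat k (m + 1)\<close> and \<open>flat k (m + 2)\<close>, so the following
  class is closed under differentiation; this gives smoothness of all its members at once.\<close>

inductive_set bumps :: "(real \<Rightarrow> real) set" where
  base: "k > 0 \<Longrightarrow> (\<lambda>x. flat k m (x - s) * flat k n (t - x)) \<in> bumps"
| add: "f \<in> bumps \<Longrightarrow> h \<in> bumps \<Longrightarrow> (\<lambda>x. f x + h x) \<in> bumps"
| cmult: "f \<in> bumps \<Longrightarrow> (\<lambda>x. c * f x) \<in> bumps"

lemma bumps_deriv: "f \<in> bumps \<Longrightarrow> \<exists>f'\<in>bumps. \<forall>x. (f has_real_derivative f' x) (at x)"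
proof (induction rule: bumps.induct)
  case (base k m s n t)
  define B where "B m n x = flat k m (x - s) * flat k n (t - x)" for m n x
  have B: "B m n \<in> bumps" for m n unfolding B_def[abs_def] using base by (rule bumps.base)
  define f' where "f' x = (k * B (m + 2) n x + (- real m) * B (m + 1) n x) + ((- k) * B m (n + 2) x + real n * B m (n + 1) x)" for x
  have "f' \<in> bumps" unfolding f'_def[abs_def] by (intro bumps.add bumps.cmult B)
  moreover have "((\<lambda>x. flat k m (x - s) * flat k n (t - x)) has_real_derivative f' x) (at x)" for x
  proof -
    have 1: "((\<lambda>x. flat k m (x - s)) has_real_derivative (k * flat k (m + 2) (x - s) - real m * flat k (m + 1) (x - s)) * 1) (at x)"
      by (rule DERIV_chain2[OF flat_deriv[OF base]]) (auto intro!: derivative_eq_intros)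
    have 2: "((\<lambda>x. flat k n (t - x)) has_real_derivative (k * flat k (n + 2) (t - x) - real n * flat k (n + 1) (t - x)) * (- 1)) (at x)"
      by (rule DERIV_chain2[OF flat_deriv[OF base]]) (auto intro!: derivative_eq_intros)
    show ?thesis using DERIV_mult[OF 1 2] by (rule DERIV_cong) (simp add: f'_def B_def algebra_simps)
  qed
  ultimately show ?case by blast
next
  case (add f h)
  then obtain f' h' where "f' \<in> bumps" "h' \<in> bumps" "\<And>x. (f has_real_derivative f' x) (at x)" "\<And>x. (h has_real_derivative h' x) (at x)"
    by blast
  then show ?case by (intro bexI[of _ "\<lambda>x. f' x + h' x"]) (auto intro: bumps.add DERIV_add)
next
  case (cmult f c)
  then obtain f' where "f' \<in> bumps" "\<And>x. (f has_real_derivative f' x) (at x)" by blast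
  then show ?case by (intro bexI[of _ "\<lambda>x. c * f' x"]) (auto intro: bumps.cmult DERIV_cmult)
qed

lemma bumps_deriv_mem: "f \<in> bumps \<Longrightarrow> deriv f \<in> bumps"
  using bumps_deriv[of f] DERIV_imp_deriv by (metis ext)

lemma bumps_differentiable: "f \<in> bumps \<Longrightarrow> f differentiable_on UNIV"
  using bumps_deriv[of f] real_differentiable_def by (fastforce simp: differentiable_on_def)

lemma bumps_smooth: "f \<in> bumps \<Longrightarrow> (deriv ^^ k) f differentiable_on UNIV"
proof -
  assume "f \<in> bumps"
  then have "(deriv ^^ k) f \<in> bumps" by (induction k) (auto intro: bumps_deriv_mem)
  then show ?thesis by (rule bumps_differentiable)
qed

lemma bumps_continuous: "f \<in> bumps \<Longrightarrow> continuous_on A f"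
  by (meson bumps_differentiable continuous_on_subset differentiable_imp_continuous_on subset_UNIV)

text \<open>A smooth approximation of the indicator of \<open>{s<..<t}\<close>: as the parameter
  \<open>1 / (n + 1)\<close> tends to 0, the factor \<open>exp (- k / y)\<close> tends to 1 for
  every \<open>y > 0\<close>.\<close>

definition bump :: "real \<Rightarrow> real \<Rightarrow> nat \<Rightarrow> real \<Rightarrow> real" where
  "bump s t n x = flat (1 / real (Suc n)) 0 (x - s) * flat (1 / real (Suc n)) 0 (t - x)"

lemma bump_mem: "bump s t n \<in> bumps"
  unfolding bump_def[abs_def] by (rule bumps.base) simp

lemma bump_bounds: "0 \<le> bump s t n x" "bump s t n x \<le> 1"
proof -
  have "0 \<le> flat (1 / real (Suc n)) 0 y \<and> flat (1 / real (Suc n)) 0 y \<le> 1" for y by (simp add: flat_def)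
  then show "0 \<le> bump s t n x" "bump s t n x \<le> 1" unfolding bump_def by (auto intro: mult_le_one)
qed

lemma bump_zero: "x \<notin> {s<..<t} \<Longrightarrow> bump s t n x = 0"
  by (auto simp: bump_def flat_def)

lemma bump_limit: "(\<lambda>n. bump s t n x) \<longlonglongrightarrow> indicator {s<..<t} x"
proof (cases "x \<in> {s<..<t}")
  case True
  have 1: "(\<lambda>n. flat (1 / real (Suc n)) 0 y) \<longlonglongrightarrow> 1" if "y > 0" for y
  proof -
    have "(\<lambda>n. exp (- (1 / real (Suc n)) / y)) \<longlonglongrightarrow> exp (- 0 / y)"
      using that by (intro tendsto_intros LIMSEQ_Suc[OF lim_const_over_n]) auto
    then show ?thesis using that by (simp add: flat_def)
  qed
  have "(\<lambda>n. bump s t n x) \<longlonglongrightarrow> 1 * 1" unfolding bump_def using True by (intro tendsto_mult 1) auto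
  then show ?thesis using True by simp
qed (simp add: bump_zero)

section \<open>Test functions on an open interval\<close>

lemma test_functionI:
  assumes smooth: "\<And>k. (deriv ^^ k) \<phi> differentiable_on UNIV"
    and zero: "\<And>x. x \<notin> {s..t} \<Longrightarrow> \<phi> x = 0" and st: "a < s" "t < (b::real)"
  shows "test_function {a<..<b} \<phi>"
proof -
  have sub: "closure {x. \<phi> x \<noteq> 0} \<subseteq> {s..t}" by (rule closure_minimal) (use zero in blast, simp)
  then have "compact (closure {x. \<phi> x \<noteq> 0})"
    using compact_Int_closed[OF compact_Icc closed_closure] by (metis inf.absorb_iff2)
  moreover have "closure {x. \<phi> x \<noteq> 0} \<subseteq> {a<..<b}" using sub st by force
  ultimately show ?thesis using smooth unfolding test_function_def by blast
qed

lemma test_function_bump: "a < s \<Longrightarrow> t < b \<Longrightarrow> test_function {a<..<b} (bump s t n)"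
  by (rule test_functionI[of _ s t]) (auto intro: bumps_smooth bump_mem simp: bump_zero)

lemma test_function_support:
  assumes "test_function S \<phi>" "x \<notin> closure {x. \<phi> x \<noteq> 0}"
  shows "\<phi> x = 0" "deriv \<phi> x = 0"
proof -
  show "\<phi> x = 0"
  proof (rule ccontr)
    assume "\<phi> x \<noteq> 0"
    then have "x \<in> closure {x. \<phi> x \<noteq> 0}" by (intro subsetD[OF closure_subset]) simp
    with assms(2) show False by simp
  qed
  have "\<forall>\<^sub>F y in nhds x. y \<in> - closure {x. \<phi> x \<noteq> 0}" using assms by (intro eventually_nhds_in_open) auto
  then have "\<forall>\<^sub>F y in nhds x. \<phi> y = (\<lambda>_. 0) y" by eventually_elim (meson ComplD closure_subset mem_Collect_eq subsetD)
  from DERIV_cong_ev[OF refl this refl, THEN iffD2, OF DERIV_const] show "deriv \<phi> x = 0" by (rule DERIV_imp_deriv)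
qed

lemma test_function_deriv:
  assumes "test_function S \<phi>"
  shows "test_function S (deriv \<phi>)"
proof -
  have "{x. deriv \<phi> x \<noteq> 0} \<subseteq> closure {x. \<phi> x \<noteq> 0}" using test_function_support[OF assms] by blast
  then have sub: "closure {x. deriv \<phi> x \<noteq> 0} \<subseteq> closure {x. \<phi> x \<noteq> 0}" by (intro closure_minimal) auto
  then have "compact (closure {x. deriv \<phi> x \<noteq> 0})"
    using assms by (metis closed_closure compact_Int_closed inf.absorb_iff2 test_function_def)
  moreover have "(deriv ^^ k) (deriv \<phi>) differentiable_on UNIV" for k
    using assms unfolding test_function_def by (metis funpow_Suc_right o_apply)
  ultimately show ?thesis using assms sub unfolding test_function_def by blast
qed

lemma test_function_differentiable:
  assumes "test_function S \<phi>"
  shows "(\<phi> has_real_derivative deriv \<phi> x) (at x)"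
proof -
  have "(deriv ^^ 0) \<phi> differentiable_on UNIV" using assms unfolding test_function_def by blast
  then show ?thesis by (simp add: differentiable_on_def DERIV_deriv_iff_real_differentiable)
qed

lemma test_function_continuous: "test_function S \<phi> \<Longrightarrow> continuous_on A \<phi>"
  by (meson DERIV_isCont continuous_at_imp_continuous_on test_function_differentiable)

lemma test_function_integrable:
  assumes t: "test_function S \<phi>" and h: "locally_integrable_on S h" and S: "open S"
  shows "integrable (lebesgue_on S) (\<lambda>x. \<phi> x *\<^sub>R h x)"
proof -
  define K where "K = closure {x. \<phi> x \<noteq> 0}"
  have K: "compact K" "K \<subseteq> S" using t by (auto simp: test_function_def K_def)
  have Ks: "K \<in> sets lebesgue" using K(1) by (simp add: compact_imp_closed)
  have hK: "h absolutely_integrable_on K" using h K by (simp add: locally_integrable_on_def)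
  have "bounded (\<phi> ` K)" using K test_function_continuous[OF t] by (intro compact_imp_bounded compact_continuous_image)
  then obtain C where C: "\<And>x. x \<in> K \<Longrightarrow> \<bar>\<phi> x\<bar> \<le> C" unfolding bounded_iff by (auto simp: real_norm_def)
  have "(\<lambda>x. \<phi> x *\<^sub>R h x) absolutely_integrable_on K"
  proof (rule measurable_bounded_by_integrable_imp_absolutely_integrable[OF _ Ks])
    show "(\<lambda>x. \<phi> x *\<^sub>R h x) \<in> borel_measurable (lebesgue_on K)"
      using hK Ks test_function_continuous[OF t]
      by (intro borel_measurable_scaleR absolutely_integrable_imp_borel_measurable continuous_imp_measurable_on_sets_lebesgue) auto
    show "(\<lambda>x. C * norm (h x)) integrable_on K"
      using hK by (intro integrable_on_mult_right) (simp add: absolutely_integrable_on_def)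
    fix x assume "x \<in> K" then show "norm (\<phi> x *\<^sub>R h x) \<le> C * norm (h x)" using C by (simp add: mult_right_mono)
  qed
  then have "set_integrable lebesgue K (\<lambda>x. \<phi> x *\<^sub>R h x)" .
  moreover have "(\<lambda>x. indicator K x *\<^sub>R (\<phi> x *\<^sub>R h x)) = (\<lambda>x. indicator S x *\<^sub>R (\<phi> x *\<^sub>R h x))"
  proof (rule ext)
    fix x show "indicator K x *\<^sub>R (\<phi> x *\<^sub>R h x) = indicator S x *\<^sub>R (\<phi> x *\<^sub>R h x)"
      using K(2) test_function_support(1)[OF t, of x] by (cases "x \<in> K") (auto simp: K_def)
  qed
  ultimately have "set_integrable lebesgue S (\<lambda>x. \<phi> x *\<^sub>R h x)" unfolding set_integrable_def by simp
  then show ?thesis using S by (simp add: set_integrable_eq)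
qed

section \<open>Functions determined by their integrals over intervals\<close>

lemma AE_zero_of_integrals_zero:
  fixes h :: "real \<Rightarrow> complex"
  assumes h: "h absolutely_integrable_on {s..t}"
    and zero: "\<And>x y. s \<le> x \<Longrightarrow> x \<le> y \<Longrightarrow> y \<le> t \<Longrightarrow> integral {x..y} h = 0"
  shows "AE x in lebesgue_on {s..t}. h x = 0"
proof -
  have hi: "h integrable_on cbox s t" using h by (simp add: absolutely_integrable_on_def)
  \<comment> \<open>Henstock's lemma bounds the summed local errors between the Riemann terms of
    \<open>h\<close> and the integrals over the pieces. As those integrals vanish, the errors are
    precisely the Riemann terms of \<open>norm (h x)\<close>.\<close>
  have "((\<lambda>x. norm (h x)) has_integral 0) (cbox s t)"
    unfolding has_integral
  proof (intro allI impI)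
    fix e :: real assume "e > 0"
    with hi obtain \<gamma> where \<gamma>: "gauge \<gamma>" and *: "\<And>p. p tagged_partial_division_of cbox s t \<Longrightarrow> \<gamma> fine p \<Longrightarrow>
        (\<Sum>(x,k)\<in>p. norm (measure lborel k *\<^sub>R h x - integral k h)) < e" by (rule Henstock_lemma) blast
    show "\<exists>\<gamma>. gauge \<gamma> \<and> (\<forall>\<D>. \<D> tagged_division_of cbox s t \<and> \<gamma> fine \<D> \<longrightarrow>
        norm ((\<Sum>(x,k)\<in>\<D>. measure lborel k *\<^sub>R norm (h x)) - 0) < e)"
    proof (intro exI[of _ \<gamma>] conjI allI impI \<gamma>)
      fix p assume p: "p tagged_division_of cbox s t \<and> \<gamma> fine p"
      have "(\<Sum>(x,k)\<in>p. measure lborel k *\<^sub>R norm (h x)) = (\<Sum>(x,k)\<in>p. norm (measure lborel k *\<^sub>R h x - integral k h))"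
      proof (rule sum.cong[OF refl], clarify)
        fix x k assume xk: "(x, k) \<in> p"
        then obtain u v where k: "k = cbox u v" "x \<in> k" "k \<subseteq> cbox s t" using p tagged_division_ofD(2,3,4) by metis
        then have "integral k h = 0" using zero[of u v] by auto
        then show "measure lborel k *\<^sub>R norm (h x) = norm (measure lborel k *\<^sub>R h x - integral k h)" by simp
      qed
      also have "\<dots> < e" using * p by (simp add: tagged_division_of_def)
      finally have "(\<Sum>(x,k)\<in>p. measure lborel k *\<^sub>R norm (h x)) < e" .
      moreover have "0 \<le> (\<Sum>(x,k)\<in>p. measure lborel k *\<^sub>R norm (h x))" by (intro sum_nonneg) auto
      ultimately show "norm ((\<Sum>(x,k)\<in>p. measure lborel k *\<^sub>R norm (h x)) - 0) < e" by simp
    qed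
  qed
  then have "integral {s..t} (\<lambda>x. norm (h x)) = 0" by (simp add: integral_unique)
  moreover have i: "integrable (lebesgue_on {s..t}) (\<lambda>x. norm (h x))"
    using h by (intro integrable_norm absolutely_integrable_imp_integrable) auto
  ultimately have "(LINT x|lebesgue_on {s..t}. norm (h x)) = 0" by (simp add: lebesgue_integral_eq_integral)
  then have "AE x in lebesgue_on {s..t}. norm (h x) = 0" using i by (subst (asm) integral_nonneg_eq_0_iff_AE) auto
  then show ?thesis by simp
qed

lemma open_interval_exhaustion:
  assumes "\<And>s t. a < s \<Longrightarrow> s < t \<Longrightarrow> t < b \<Longrightarrow> AE x in lebesgue_on {s..t}. P x"
  shows "AE x in lebesgue_on {a<..<b::real}. P x"
proof -
  define s where "s n = a + 1 / real (Suc n)" for n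
  define t where "t n = b - 1 / real (Suc n)" for n
  have "AE x in lebesgue. x \<in> {s n..t n} \<longrightarrow> P x" for n
  proof (cases "s n < t n")
    case True
    then have "AE x in lebesgue_on {s n..t n}. P x" by (intro assms) (auto simp: s_def t_def)
    then show ?thesis by (simp add: AE_restrict_space_iff)
  next
    case False
    \<comment> \<open>In this case \<open>{s n..t n}\<close> is empty or a single point.\<close>
    then have "AE x in lebesgue. x \<notin> {s n}" by (intro AE_not_in) (auto intro: null_sets_completionI)
    then show ?thesis by eventually_elim (use False in auto)
  qed
  then have "AE x in lebesgue. \<forall>n. x \<in> {s n..t n} \<longrightarrow> P x" by (intro AE_all_countable[THEN iffD2] allI)
  then have "AE x in lebesgue. x \<in> {a<..<b} \<longrightarrow> P x"
  proof eventually_elim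
    case (elim x)
    show ?case
    proof
      assume x: "x \<in> {a<..<b}"
      then obtain n where "1 / real (Suc n) < min (x - a) (b - x)" using nat_approx_posE[of "min (x - a) (b - x)"] by auto
      then have "x \<in> {s n..t n}" by (auto simp: s_def t_def)
      with elim show "P x" by blast
    qed
  qed
  then show ?thesis by (simp add: AE_restrict_space_iff)
qed

lemma locally_integrable_interval:
  "locally_integrable_on {a<..<b} h \<Longrightarrow> a < s \<Longrightarrow> t < b \<Longrightarrow> h absolutely_integrable_on {s..t::real}"
proof -
  assume "locally_integrable_on {a<..<b} h" "a < s" "t < b"
  moreover have "{s..t} \<subseteq> {a<..<b}" using \<open>a < s\<close> \<open>t < b\<close> by auto
  ultimately show ?thesis unfolding locally_integrable_on_def using compact_Icc by blast
qed

lemma AE_zero_on_open_interval: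
  assumes h: "locally_integrable_on {a<..<b} h"
    and zero: "\<And>s t. a < s \<Longrightarrow> s < t \<Longrightarrow> t < b \<Longrightarrow> integral {s..t} h = 0"
  shows "AE x in lebesgue_on {a<..<b}. h x = 0"
proof (rule open_interval_exhaustion)
  fix s t assume st: "a < s" "s < t" "t < b"
  show "AE x in lebesgue_on {s..t}. h x = 0"
  proof (rule AE_zero_of_integrals_zero)
    show "h absolutely_integrable_on {s..t}" using locally_integrable_interval[OF h] st by blast
    show "integral {x..y} h = 0" if "s \<le> x" "x \<le> y" "y \<le> t" for x y
      using zero[of x y] that st by (cases "x = y") auto
  qed
qed

text \<open>Dominated convergence with majorant \<open>norm (h x)\<close> on \<open>{s..t}\<close>.
  This turns any identity tested against bumps into one about integrals over intervals.\<close>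

lemma bump_integral_limit:
  assumes h: "locally_integrable_on {a<..<b} h" and st: "a < s" "s < t" "t < b"
  shows "(\<lambda>n. LINT x|lebesgue_on {a<..<b}. bump s t n x *\<^sub>R h x) \<longlonglongrightarrow> integral {s..t} h"
proof -
  let ?M = "lebesgue_on {a<..<b}"
  have hi: "h absolutely_integrable_on {s..t}" using locally_integrable_interval[OF h] st by blast
  have sub: "{s..t} \<subseteq> {a<..<b}" using st by auto
  have i: "integrable ?M (\<lambda>x. indicator {s..t} x *\<^sub>R h x)"
  proof -
    have "integrable lebesgue (\<lambda>x. indicator {a<..<b} x *\<^sub>R (indicator {s..t} x *\<^sub>R h x))"
    proof -
      have "(\<lambda>x. indicator {a<..<b} x *\<^sub>R (indicator {s..t} x *\<^sub>R h x)) = (\<lambda>x. indicator {s..t} x *\<^sub>R h x)"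
        using sub by (auto simp: fun_eq_iff indicator_def)
      then show ?thesis using hi by (simp add: set_integrable_def)
    qed
    then show ?thesis by (subst integrable_restrict_space) auto
  qed
  have "(\<lambda>n. LINT x|?M. bump s t n x *\<^sub>R h x) \<longlonglongrightarrow> (LINT x|?M. indicator {s<..<t} x *\<^sub>R h x)"
  proof (rule integral_dominated_convergence[where w = "\<lambda>x. norm (indicator {s..t} x *\<^sub>R h x)"])
    show "(\<lambda>x. indicator {s<..<t} x *\<^sub>R h x) \<in> borel_measurable ?M"
    proof -
      have "(\<lambda>x. indicator {s<..<t} x *\<^sub>R (indicator {s..t} x *\<^sub>R h x)) \<in> borel_measurable ?M"
        by (rule borel_measurable_scaleR[OF _ borel_measurable_integrable[OF i]])
           (rule measurable_restrict_space1, rule borel_measurable_indicator, simp)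
      moreover have "(\<lambda>x. indicator {s<..<t} x *\<^sub>R (indicator {s..t} x *\<^sub>R h x)) = (\<lambda>x. indicator {s<..<t} x *\<^sub>R h x)"
        by (auto simp: fun_eq_iff indicator_def)
      ultimately show ?thesis by simp
    qed
    show "(\<lambda>x. bump s t n x *\<^sub>R h x) \<in> borel_measurable ?M" for n
      using test_function_integrable[OF test_function_bump h, of s t n] st by auto
    show "integrable ?M (\<lambda>x. norm (indicator {s..t} x *\<^sub>R h x))" using i by (rule integrable_norm)
    show "AE x in ?M. (\<lambda>n. bump s t n x *\<^sub>R h x) \<longlonglongrightarrow> indicator {s<..<t} x *\<^sub>R h x"
      by (intro AE_I2 tendsto_scaleR bump_limit tendsto_const)
    show "AE x in ?M. norm (bump s t n x *\<^sub>R h x) \<le> norm (indicator {s..t} x *\<^sub>R h x)" for n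
    proof (rule AE_I2)
      fix x show "norm (bump s t n x *\<^sub>R h x) \<le> norm (indicator {s..t} x *\<^sub>R h x)"
        using bump_bounds[of s t n x] bump_zero[of x s t n] by (auto simp: indicator_def mult_left_le_one_le)
    qed
  qed
  also have "(LINT x|?M. indicator {s<..<t} x *\<^sub>R h x) = (LINT x|lebesgue. indicator {s<..<t} x *\<^sub>R h x)"
  proof -
    have "(\<lambda>x. indicator {a<..<b} x *\<^sub>R (indicator {s<..<t} x *\<^sub>R h x)) = (\<lambda>x. indicator {s<..<t} x *\<^sub>R h x)"
      using st by (auto simp: fun_eq_iff indicator_def)
    then show ?thesis by (subst integral_restrict_space) auto
  qed
  also have "\<dots> = (LINT x|lebesgue_on {s<..<t}. h x)" by (subst integral_restrict_space) auto
  also have "\<dots> = integral {s<..<t} h"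
    using hi by (intro lebesgue_integral_eq_integral absolutely_integrable_imp_integrable)
      (auto simp: absolutely_integrable_on_Icc_iff_Ioo)
  also have "\<dots> = integral {s..t} h" by (simp add: integral_open_interval_real)
  finally show ?thesis .
qed

lemma weak_zero_imp_AE_zero:
  assumes h: "locally_integrable_on {a<..<b} h"
    and zero: "\<And>\<phi>. test_function {a<..<b} \<phi> \<Longrightarrow> (LINT x|lebesgue_on {a<..<b}. \<phi> x *\<^sub>R h x) = 0"
  shows "AE x in lebesgue_on {a<..<b}. h x = 0"
proof (rule AE_zero_on_open_interval[OF h])
  fix s t assume st: "a < s" "s < t" "t < b"
  have "(\<lambda>n. 0) \<longlonglongrightarrow> integral {s..t} h"
    using bump_integral_limit[OF h st] zero[OF test_function_bump] st by simp
  then show "integral {s..t} h = 0" by (simp add: LIMSEQ_const_iff)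
qed

text \<open>Mean zero is exactly what makes the primitive vanish to the right of the support as
  well, so that it is again a test function.\<close>

lemma bumps_antiderivative:
  assumes f: "f \<in> bumps" and supp: "\<And>x. x \<notin> {s..t} \<Longrightarrow> f x = 0" and int: "integral {s..t} f = 0"
    and st: "a < s" "s \<le> t" "t < b"
  obtains \<phi> where "test_function {a<..<b} \<phi>" "deriv \<phi> = f"
proof -
  define \<phi> where "\<phi> x = integral {a..x} f" for x
  have int_f: "f integrable_on {x..y}" for x y using bumps_continuous[OF f] by (intro integrable_continuous_real)
  have zero_left: "\<phi> x = 0" if "x \<le> s" for x
  proof -
    have "integral {a..x} f = integral {a..x} (\<lambda>_. 0)"
      by (rule integral_spike[of "{s}"]) (use that supp in auto)
    then show ?thesis by (simp add: \<phi>_def)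
  qed
  have zero_right: "\<phi> x = 0" if "t \<le> x" for x
  proof -
    have "integral {a..s} f + integral {s..t} f = integral {a..t} f" "integral {a..t} f + integral {t..x} f = integral {a..x} f"
      using st that int_f by (auto intro!: Henstock_Kurzweil_Integration.integral_combine)
    moreover have "integral {t..x} f = integral {t..x} (\<lambda>_. 0)"
      by (rule integral_spike[of "{t}"]) (use supp in auto)
    ultimately show ?thesis using zero_left[of s] int by (simp add: \<phi>_def)
  qed
  have d: "(\<phi> has_real_derivative f x) (at x)" for x
  proof (cases "x < s")
    case True
    have "\<forall>\<^sub>F y in nhds x. y \<in> {..<s}" using True by (intro eventually_nhds_in_open) auto
    then have "\<forall>\<^sub>F y in nhds x. \<phi> y = (\<lambda>_. 0) y" by eventually_elim (simp add: zero_left)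
    from DERIV_cong_ev[OF refl this refl, THEN iffD2, OF DERIV_const] show ?thesis using True supp[of x] by simp
  next
    case False
    have "isCont f x" using bumps_continuous[OF f, of UNIV] by (simp add: continuous_on_eq_continuous_at)
    then show ?thesis unfolding \<phi>_def[abs_def] has_real_derivative_iff_has_vector_derivative
      using False st by (intro has_vector_derivative_integral_interior[of f a "x + 1"] int_f) auto
  qed
  have der: "deriv \<phi> = f" using d DERIV_imp_deriv by blast
  have "(deriv ^^ k) \<phi> differentiable_on UNIV" for k
  proof (cases k)
    case 0
    then show ?thesis using d by (auto simp: differentiable_on_def real_differentiable_def)
  next
    case (Suc l)
    then show ?thesis using bumps_smooth[OF f, of l] der by (simp only: funpow_Suc_right o_apply)
  qed
  then have "test_function {a<..<b} \<phi>"
    by (rule test_functionI[of _ s t]) (use zero_left zero_right st in auto)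
  with der that show ?thesis by blast
qed

text \<open>du Bois-Reymond: testing with differences of normalised bumps shows that all interval
  averages of \<open>v\<close> agree.\<close>

lemma weak_deriv_zero_imp_AE_const:
  assumes v: "locally_integrable_on {a<..<b} v" and ab: "a < b"
    and zero: "\<And>\<phi>. test_function {a<..<b} \<phi> \<Longrightarrow> (LINT x|lebesgue_on {a<..<b}. deriv \<phi> x *\<^sub>R v x) = 0"
  shows "\<exists>c. AE x in lebesgue_on {a<..<b}. v x = c"
proof -
  let ?M = "lebesgue_on {a<..<b}"
  \<comment> \<open>The middle third serves as an arbitrary reference interval with which all others
    are compared.\<close>
  define s0 where "s0 = a + (b - a) / 3"
  define t0 where "t0 = a + 2 * (b - a) / 3"
  have st0: "a < s0" "s0 < t0" "t0 < b" using ab by (auto simp: s0_def t0_def field_simps)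
  have one: "locally_integrable_on {a<..<b} (\<lambda>_. 1)"
    unfolding locally_integrable_on_def by (auto intro!: absolutely_integrable_on_const lmeasurable_compact)
  have vi: "v absolutely_integrable_on {s..t}" if "a < s" "t < b" for s t using locally_integrable_interval[OF v that] .
  have eq: "of_real (t0 - s0) * integral {s..t} v = of_real (t - s) * integral {s0..t0} v" if st: "a < s" "s < t" "t < b" for s t
  proof -
    define A where "A n = (LINT x|?M. bump s0 t0 n x)" for n
    define B where "B n = (LINT x|?M. bump s t n x)" for n
    have AB: "(\<lambda>n. A n) \<longlonglongrightarrow> t0 - s0" "(\<lambda>n. B n) \<longlonglongrightarrow> t - s"
    proof -
      have "(\<lambda>n. LINT x|?M. bump s0 t0 n x *\<^sub>R (1::complex)) \<longlonglongrightarrow> of_real (t0 - s0)"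
        "(\<lambda>n. LINT x|?M. bump s t n x *\<^sub>R (1::complex)) \<longlonglongrightarrow> of_real (t - s)"
        using bump_integral_limit[OF one st0] bump_integral_limit[OF one st] st st0 by (auto simp: scaleR_conv_of_real)
      then have "(\<lambda>n. Re (LINT x|?M. bump s0 t0 n x *\<^sub>R (1::complex))) \<longlonglongrightarrow> t0 - s0"
        "(\<lambda>n. Re (LINT x|?M. bump s t n x *\<^sub>R (1::complex))) \<longlonglongrightarrow> t - s"
        by (auto dest!: tendsto_Re)
      then show "(\<lambda>n. A n) \<longlonglongrightarrow> t0 - s0" "(\<lambda>n. B n) \<longlonglongrightarrow> t - s"
        by (auto simp: A_def B_def scaleR_conv_of_real)
    qed
    have "A n *\<^sub>R (LINT x|?M. bump s t n x *\<^sub>R v x) = B n *\<^sub>R (LINT x|?M. bump s0 t0 n x *\<^sub>R v x)" for n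
    proof -
      \<comment> \<open>Weighting each bump with the integral of the other cancels the total
        integral, so \<open>f\<close> is the derivative of a test function.\<close>
      define f where "f x = A n * bump s t n x + (- B n) * bump s0 t0 n x" for x
      have f: "f \<in> bumps" unfolding f_def[abs_def] by (intro bumps.add bumps.cmult bump_mem)
      have supp: "f x = 0" if "x \<notin> {min s s0..max t t0}" for x
      proof -
        have "x \<notin> {s<..<t}" "x \<notin> {s0<..<t0}" using that by auto
        then show ?thesis by (simp add: f_def bump_zero)
      qed
      have iM: "integrable ?M (bump s t n)" "integrable ?M (bump s0 t0 n)"
      proof -
        have "integrable ?M (\<lambda>x. Re (bump s t n x *\<^sub>R (1::complex)))" "integrable ?M (\<lambda>x. Re (bump s0 t0 n x *\<^sub>R (1::complex)))"
          using test_function_integrable[OF test_function_bump one] st st0 by (intro integrable_Re; simp)+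
        then show "integrable ?M (bump s t n)" "integrable ?M (bump s0 t0 n)" by simp_all
      qed
      have iv: "integrable ?M (\<lambda>x. bump s t n x *\<^sub>R v x)" "integrable ?M (\<lambda>x. bump s0 t0 n x *\<^sub>R v x)"
        using test_function_integrable[OF test_function_bump v] st st0 by simp_all
      have "integral {min s s0..max t t0} f = integral {a<..<b} f"
      proof -
        have "integral {min s s0..max t t0} f = integral {min s s0<..<max t t0} f" by (simp add: integral_open_interval_real)
        also have "\<dots> = integral {a<..<b} f"
        proof -
          have z: "f x = 0" if "x \<notin> {min s s0<..<max t t0}" for x
          proof -
            have "x \<notin> {s<..<t}" "x \<notin> {s0<..<t0}" using that by auto
            then show ?thesis by (simp add: f_def bump_zero)
          qed
          have restr: "(\<lambda>x. if x \<in> A then f x else 0) = f" if "{min s s0<..<max t t0} \<subseteq> A" for A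
          proof (rule ext)
            fix x show "(if x \<in> A then f x else 0) = f x"
            proof (cases "x \<in> A")
              case False
              then have "x \<notin> {min s s0<..<max t t0}" using that by blast
              then show ?thesis using z False by simp
            qed simp
          qed
          have "integral {min s s0<..<max t t0} f = integral UNIV f"
            using integral_restrict_UNIV[of "{min s s0<..<max t t0}" f] unfolding restr[OF order_refl] by simp
          moreover have "{min s s0<..<max t t0} \<subseteq> {a<..<b}" using st st0 by auto
          then have "integral {a<..<b} f = integral UNIV f"
            using integral_restrict_UNIV[of "{a<..<b}" f] restr[of "{a<..<b}"] by simp
          ultimately show ?thesis by simp
        qed
        finally show ?thesis .
      qed
      also have "\<dots> = (LINT x|?M. f x)"
        using iM by (intro lebesgue_integral_eq_integral[symmetric]) (auto simp: f_def[abs_def])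
      also have "\<dots> = 0" using iM by (simp add: f_def A_def B_def)
      finally have "integral {min s s0..max t t0} f = 0" .
      moreover have bnd: "a < min s s0" "min s s0 \<le> max t t0" "max t t0 < b" using st st0 by auto
      ultimately obtain \<phi> where "test_function {a<..<b} \<phi>" "deriv \<phi> = f"
        using bumps_antiderivative[OF f supp _ bnd] by blast
      from zero[OF this(1)] this(2) have "0 = (LINT x|?M. A n *\<^sub>R (bump s t n x *\<^sub>R v x) - B n *\<^sub>R (bump s0 t0 n x *\<^sub>R v x))"
        by (simp add: f_def scaleR_diff_left scaleR_scaleR)
      also have "\<dots> = A n *\<^sub>R (LINT x|?M. bump s t n x *\<^sub>R v x) - B n *\<^sub>R (LINT x|?M. bump s0 t0 n x *\<^sub>R v x)"
        using iv by (simp del: scaleR_scaleR)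
      finally show ?thesis by simp
    qed
    moreover have "(\<lambda>n. A n *\<^sub>R (LINT x|?M. bump s t n x *\<^sub>R v x)) \<longlonglongrightarrow> (t0 - s0) *\<^sub>R integral {s..t} v"
      by (intro tendsto_scaleR AB bump_integral_limit v st)
    moreover have "(\<lambda>n. B n *\<^sub>R (LINT x|?M. bump s0 t0 n x *\<^sub>R v x)) \<longlonglongrightarrow> (t - s) *\<^sub>R integral {s0..t0} v"
      by (intro tendsto_scaleR AB bump_integral_limit v st0)
    ultimately show ?thesis using LIMSEQ_unique by (simp add: scaleR_conv_of_real)
  qed
  define c where "c = integral {s0..t0} v / of_real (t0 - s0)"
  have loc: "locally_integrable_on {a<..<b} (\<lambda>x. v x - c)"
    unfolding locally_integrable_on_def
  proof (intro allI impI)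
    fix K assume K: "compact K \<and> K \<subseteq> {a<..<b}"
    then have "set_integrable lebesgue K (\<lambda>_. c)" by (auto intro!: absolutely_integrable_on_const lmeasurable_compact)
    with v K show "set_integrable lebesgue K (\<lambda>x. v x - c)" unfolding locally_integrable_on_def by (intro set_integral_diff(1)) auto
  qed
  have "AE x in ?M. v x - c = 0"
  proof (rule AE_zero_on_open_interval[OF loc])
    fix s t assume st: "a < s" "s < t" "t < b"
    have "integral {s..t} (\<lambda>x. v x - c) = integral {s..t} v - of_real (t - s) * c"
      using vi[of s t] st by (subst integral_diff) (auto simp: absolutely_integrable_on_def scaleR_conv_of_real)
    also have "\<dots> = 0" using eq[OF st] st0 by (simp add: c_def field_simps)
    finally show "integral {s..t} (\<lambda>x. v x - c) = 0" .
  qed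
  then show ?thesis by (intro exI[of _ c]) (auto elim: eventually_mono)
qed

section \<open>Integration by parts\<close>

lemma absolutely_integrable_mult_continuous:
  fixes q G :: "real \<Rightarrow> complex"
  assumes q: "q absolutely_integrable_on {s..t}" and G: "continuous_on {s..t} G"
  shows "(\<lambda>x. q x * G x) absolutely_integrable_on {s..t}"
proof -
  have "bounded (G ` {s..t})" using G by (intro compact_imp_bounded compact_continuous_image) auto
  then obtain C where C: "\<And>x. x \<in> {s..t} \<Longrightarrow> norm (G x) \<le> C" unfolding bounded_iff by blast
  show ?thesis
  proof (rule measurable_bounded_by_integrable_imp_absolutely_integrable)
    show "(\<lambda>x. q x * G x) \<in> borel_measurable (lebesgue_on {s..t})"
      using q G by (intro borel_measurable_times absolutely_integrable_imp_borel_measurable continuous_imp_measurable_on_sets_lebesgue) auto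
    show "(\<lambda>x. norm (q x) * C) integrable_on {s..t}"
      using q by (intro integrable_on_mult_left) (simp add: absolutely_integrable_on_def)
    fix x assume "x \<in> {s..t}" then show "norm (q x * G x) \<le> norm (q x) * C" using C by (simp add: norm_mult mult_left_mono)
  qed simp
qed

text \<open>Fubini for \<open>f x * h y\<close> on the square, split along the diagonal: the part
  \<open>y \<le> x\<close> gives one integral, the part \<open>x < y\<close> the other. In this way
  the primitives need not be differentiable anywhere.\<close>

lemma integration_by_parts_absolutely_integrable:
  fixes f h :: "real \<Rightarrow> complex"
  assumes f: "f absolutely_integrable_on {s..t}" and h: "h absolutely_integrable_on {s..t}"
  defines "F \<equiv> \<lambda>x. integral {s..x} f" and "H \<equiv> \<lambda>x. integral {s..x} h"
  shows "integral {s..t} (\<lambda>x. f x * H x) + integral {s..t} (\<lambda>x. F x * h x) = F t * H t"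
    and "(\<lambda>x. f x * H x) absolutely_integrable_on {s..t}"
    and "(\<lambda>x. F x * h x) absolutely_integrable_on {s..t}"
proof -
  let ?M = "lebesgue_on {s..t}"
  interpret M: finite_measure ?M by (rule finite_measure_lebesgue_on) simp
  interpret P: pair_sigma_finite ?M ?M by unfold_locales
  have fi: "integrable ?M f" and hi: "integrable ?M h"
    using f h by (auto intro: absolutely_integrable_imp_integrable)
  have FH: "continuous_on {s..t} F" "continuous_on {s..t} H"
    unfolding F_def H_def using f h by (auto intro!: indefinite_integral_continuous_1 simp: absolutely_integrable_on_def)
  show ai1: "(\<lambda>x. f x * H x) absolutely_integrable_on {s..t}" by (rule absolutely_integrable_mult_continuous[OF f FH(2)])
  show ai2: "(\<lambda>x. F x * h x) absolutely_integrable_on {s..t}" using absolutely_integrable_mult_continuous[OF h FH(1)] by (simp add: mult.commute)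
  have m1: "(\<lambda>z. f (fst z)) \<in> borel_measurable (?M \<Otimes>\<^sub>M ?M)"
    by (rule measurable_compose[OF measurable_fst borel_measurable_integrable[OF fi]])
  have m2: "(\<lambda>z. h (snd z)) \<in> borel_measurable (?M \<Otimes>\<^sub>M ?M)"
    by (rule measurable_compose[OF measurable_snd borel_measurable_integrable[OF hi]])
  have id: "(\<lambda>x. x) \<in> borel_measurable ?M" using id_borel_measurable_lebesgue_on by (simp add: id_def)
  have p1: "(\<lambda>z. fst z :: real) \<in> borel_measurable (?M \<Otimes>\<^sub>M ?M)" by (rule measurable_compose[OF measurable_fst id])
  have p2: "(\<lambda>z. snd z :: real) \<in> borel_measurable (?M \<Otimes>\<^sub>M ?M)" by (rule measurable_compose[OF measurable_snd id])
  have int: "integrable (?M \<Otimes>\<^sub>M ?M) (\<lambda>z. f (fst z) * h (snd z))"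
  proof (rule P.Fubini_integrable)
    show "(\<lambda>z. f (fst z) * h (snd z)) \<in> borel_measurable (?M \<Otimes>\<^sub>M ?M)" using m1 m2 by (rule borel_measurable_times)
    show "integrable ?M (\<lambda>x. LINT y|?M. norm (f (fst (x, y)) * h (snd (x, y))))"
      using fi by (auto simp: norm_mult)
    show "AE x in ?M. integrable ?M (\<lambda>y. f (fst (x, y)) * h (snd (x, y)))" using hi by auto
  qed
  define L where "L = {z \<in> space (?M \<Otimes>\<^sub>M ?M). snd z \<le> fst z}"
  define U where "U = {z \<in> space (?M \<Otimes>\<^sub>M ?M). fst z < snd z}"
  have LU: "L \<in> sets (?M \<Otimes>\<^sub>M ?M)" "U \<in> sets (?M \<Otimes>\<^sub>M ?M)"
    unfolding L_def U_def by (rule borel_measurable_le[OF p2 p1], rule borel_measurable_less[OF p1 p2])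
  have intL: "integrable (?M \<Otimes>\<^sub>M ?M) (\<lambda>z. indicator L z *\<^sub>R (f (fst z) * h (snd z)))"
    by (rule integrable_mult_indicator[OF LU(1) int])
  have intU: "integrable (?M \<Otimes>\<^sub>M ?M) (\<lambda>z. indicator U z *\<^sub>R (f (fst z) * h (snd z)))"
    by (rule integrable_mult_indicator[OF LU(2) int])
  have restr: "(LINT y|?M. indicator A y *\<^sub>R q y) = integral A q"
    if "A \<subseteq> {s..t}" "A \<in> sets lebesgue" "q absolutely_integrable_on {s..t}" for A and q :: "real \<Rightarrow> complex"
  proof -
    have "(LINT y|?M. indicator A y *\<^sub>R q y) = (LINT y|lebesgue. indicator {s..t} y *\<^sub>R (indicator A y *\<^sub>R q y))"
      by (rule integral_restrict_space) simp
    also have "\<dots> = (LINT y|lebesgue. indicator A y *\<^sub>R q y)"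
      using that(1) by (intro Bochner_Integration.integral_cong) (auto simp: indicator_def)
    also have "\<dots> = (LINT y|lebesgue_on A. q y)" using that(2) by (intro integral_restrict_space[symmetric]) simp
    also have "\<dots> = integral A q"
      using that by (intro lebesgue_integral_eq_integral absolutely_integrable_imp_integrable)
        (auto intro: set_integrable_subset)
    finally show ?thesis .
  qed
  have 1: "(LINT z|(?M \<Otimes>\<^sub>M ?M). indicator L z *\<^sub>R (f (fst z) * h (snd z))) = integral {s..t} (\<lambda>x. f x * H x)"
  proof -
    have "(LINT z|(?M \<Otimes>\<^sub>M ?M). indicator L z *\<^sub>R (f (fst z) * h (snd z))) =
        (LINT x|?M. LINT y|?M. indicator L (x, y) *\<^sub>R (f x * h y))"
      using P.integral_fst'[OF intL] by simp
    also have "\<dots> = (LINT x|?M. f x * H x)"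
    proof (rule Bochner_Integration.integral_cong[OF refl])
      fix x assume "x \<in> space ?M"
      then have x: "x \<in> {s..t}" by simp
      have "(LINT y|?M. indicator L (x, y) *\<^sub>R (f x * h y)) = (LINT y|?M. f x * (indicator {s..x} y *\<^sub>R h y))"
        using x by (intro Bochner_Integration.integral_cong) (auto simp: L_def indicator_def space_pair_measure)
      also have "\<dots> = f x * H x" using x h by (simp add: restr H_def)
      finally show "(LINT y|?M. indicator L (x, y) *\<^sub>R (f x * h y)) = f x * H x" .
    qed
    also have "\<dots> = integral {s..t} (\<lambda>x. f x * H x)"
      using ai1 by (intro lebesgue_integral_eq_integral absolutely_integrable_imp_integrable) auto
    finally show ?thesis .
  qed
  have 2: "(LINT z|(?M \<Otimes>\<^sub>M ?M). indicator U z *\<^sub>R (f (fst z) * h (snd z))) = integral {s..t} (\<lambda>x. F x * h x)"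
  proof -
    have "(LINT z|(?M \<Otimes>\<^sub>M ?M). indicator U z *\<^sub>R (f (fst z) * h (snd z))) =
        (LINT y|?M. LINT x|?M. indicator U (x, y) *\<^sub>R (f x * h y))"
      using P.integral_snd[of "\<lambda>x y. indicator U (x, y) *\<^sub>R (f x * h y)"] intU by (simp add: case_prod_unfold)
    also have "\<dots> = (LINT y|?M. F y * h y)"
    proof (rule Bochner_Integration.integral_cong[OF refl])
      fix y assume "y \<in> space ?M"
      then have y: "y \<in> {s..t}" by simp
      have "(LINT x|?M. indicator U (x, y) *\<^sub>R (f x * h y)) = (LINT x|?M. (indicator {s..<y} x *\<^sub>R f x) * h y)"
        using y by (intro Bochner_Integration.integral_cong) (auto simp: U_def indicator_def space_pair_measure)
      also have "\<dots> = (LINT x|?M. indicator {s..<y} x *\<^sub>R f x) * h y" by (rule integral_mult_left_zero)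
      also have "\<dots> = integral {s..<y} f * h y" using y f by (subst restr) auto
      also have "integral {s..<y} f = F y"
        unfolding F_def by (rule integral_spike_set) (auto intro: negligible_subset[of "{y}"])
      finally show "(LINT x|?M. indicator U (x, y) *\<^sub>R (f x * h y)) = F y * h y" .
    qed
    also have "\<dots> = integral {s..t} (\<lambda>x. F x * h x)"
      using ai2 by (intro lebesgue_integral_eq_integral absolutely_integrable_imp_integrable) auto
    finally show ?thesis .
  qed
  have "(LINT z|(?M \<Otimes>\<^sub>M ?M). indicator L z *\<^sub>R (f (fst z) * h (snd z))) + (LINT z|(?M \<Otimes>\<^sub>M ?M). indicator U z *\<^sub>R (f (fst z) * h (snd z)))
      = (LINT z|(?M \<Otimes>\<^sub>M ?M). indicator L z *\<^sub>R (f (fst z) * h (snd z)) + indicator U z *\<^sub>R (f (fst z) * h (snd z)))"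
    by (rule Bochner_Integration.integral_add[OF intL intU, symmetric])
  also have "\<dots> = (LINT z|(?M \<Otimes>\<^sub>M ?M). f (fst z) * h (snd z))"
    by (rule Bochner_Integration.integral_cong) (auto simp: L_def U_def indicator_def)
  also have "\<dots> = (LINT x|?M. LINT y|?M. f x * h y)" using P.integral_fst'[OF int] by simp
  also have "\<dots> = (LINT x|?M. f x) * (LINT y|?M. h y)" by simp
  also have "\<dots> = F t * H t"
    using lebesgue_integral_eq_integral[OF fi] lebesgue_integral_eq_integral[OF hi] by (simp add: F_def H_def)
  finally show "integral {s..t} (\<lambda>x. f x * H x) + integral {s..t} (\<lambda>x. F x * h x) = F t * H t"
    by (simp add: 1 2)
qed

section \<open>Weak derivatives and indefinite integrals\<close>

lemma locally_integrable_of_absolutely_integrable: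
  "h absolutely_integrable_on {a..b} \<Longrightarrow> locally_integrable_on {a<..<b} h"
  unfolding locally_integrable_on_def
  by (auto intro!: set_integrable_subset[of lebesgue "{a..b}"] simp: compact_imp_closed)

lemma LINT_eq_integral_Icc:
  fixes f :: "real \<Rightarrow> complex"
  assumes "f absolutely_integrable_on {a..b}"
  shows "(LINT x|lebesgue_on {a<..<b}. f x) = integral {a..b} f"
proof -
  have "f absolutely_integrable_on {a<..<b}" using assms by (simp add: absolutely_integrable_on_Icc_iff_Ioo)
  then show ?thesis
    by (simp add: lebesgue_integral_eq_integral absolutely_integrable_imp_integrable integral_open_interval_real)
qed

lemma has_weak_deriv_indefinite_integral:
  assumes ab: "a < b" and d: "d absolutely_integrable_on {a..b}"
    and v: "AE x in lebesgue_on {a<..<b}. v x = c + integral {a..x} d"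
  shows "has_weak_deriv {a<..<b} v d"
proof -
  define V where "V x = c + integral {a..x} d" for x
  have di: "d integrable_on {a..b}" using d by (simp add: absolutely_integrable_on_def)
  have Vc: "continuous_on {a..b} V" unfolding V_def[abs_def] by (intro continuous_intros indefinite_integral_continuous_1 di)
  have Vl: "locally_integrable_on {a<..<b} V"
    by (intro locally_integrable_of_absolutely_integrable absolutely_integrable_continuous_real Vc)
  have vl: "locally_integrable_on {a<..<b} v"
    unfolding locally_integrable_on_def
  proof (intro allI impI)
    fix K assume K: "compact K \<and> K \<subseteq> {a<..<b}"
    then have "V absolutely_integrable_on K" using Vl by (simp add: locally_integrable_on_def)
    moreover have "AE x in lebesgue. x \<in> {a<..<b} \<longrightarrow> v x = V x" using v by (simp add: AE_restrict_space_iff V_def)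
    then obtain N where N: "{x. \<not> (x \<in> {a<..<b} \<longrightarrow> v x = V x)} \<subseteq> N" "negligible N"
      by (auto simp: eventually_ae_filter negligible_iff_null_sets)
    moreover have "v x = V x" if "x \<in> K - N" for x
    proof (rule ccontr)
      assume "v x \<noteq> V x"
      then have "x \<in> {x. \<not> (x \<in> {a<..<b} \<longrightarrow> v x = V x)}" using that K by blast
      then show False using N(1) that by blast
    qed
    ultimately show "v absolutely_integrable_on K"
      using N(2) by (intro absolutely_integrable_spike[of K V N v])
  qed
  have "(LINT x|lebesgue_on {a<..<b}. deriv \<phi> x *\<^sub>R v x) = - (LINT x|lebesgue_on {a<..<b}. \<phi> x *\<^sub>R d x)"
    if t: "test_function {a<..<b} \<phi>" for \<phi>
  proof -
    define f where "f x = complex_of_real (deriv \<phi> x)" for x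
    have sub: "closure {x. \<phi> x \<noteq> 0} \<subseteq> {a<..<b}" using t unfolding test_function_def by blast
    \<comment> \<open>The support is a closed subset of the open interval, so the test function
      vanishes at both ends and no boundary term survives the integration by parts.\<close>
    have na: "a \<notin> closure {x. \<phi> x \<noteq> 0}" by (rule notI, drule subsetD[OF sub]) simp
    have nb: "b \<notin> closure {x. \<phi> x \<noteq> 0}" by (rule notI, drule subsetD[OF sub]) simp
    note zero = test_function_support(1)[OF t na] test_function_support(1)[OF t nb]
    have fc: "continuous_on A f" for A unfolding f_def using test_function_continuous[OF test_function_deriv[OF t]] by (intro continuous_intros)
    have fai: "f absolutely_integrable_on {a..b}" by (intro absolutely_integrable_continuous_real fc)
    have F: "integral {a..x} f = of_real (\<phi> x)" if "a \<le> x" for x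
    proof -
      have "(f has_integral (of_real (\<phi> x) - of_real (\<phi> a))) {a..x}"
        using that test_function_differentiable[OF t] unfolding f_def
        by (intro fundamental_theorem_of_calculus has_vector_derivative_of_real has_vector_derivative_at_within)
           (auto simp: has_real_derivative_iff_has_vector_derivative)
      then show ?thesis using zero by (simp add: integral_unique)
    qed
    note ibp = integration_by_parts_absolutely_integrable[OF fai d]
    have "(LINT x|lebesgue_on {a<..<b}. deriv \<phi> x *\<^sub>R v x) = (LINT x|lebesgue_on {a<..<b}. f x * V x)"
    proof (rule integral_cong_AE)
      show "(\<lambda>x. deriv \<phi> x *\<^sub>R v x) \<in> borel_measurable (lebesgue_on {a<..<b})"
        using test_function_integrable[OF test_function_deriv[OF t] vl] by auto
      show "(\<lambda>x. f x * V x) \<in> borel_measurable (lebesgue_on {a<..<b})"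
        using test_function_integrable[OF test_function_deriv[OF t] Vl] by (auto simp: f_def scaleR_conv_of_real)
      show "AE x in lebesgue_on {a<..<b}. deriv \<phi> x *\<^sub>R v x = f x * V x"
        using v by eventually_elim (simp add: f_def V_def scaleR_conv_of_real)
    qed
    also have "\<dots> = integral {a..b} (\<lambda>x. f x * V x)"
      by (intro LINT_eq_integral_Icc absolutely_integrable_continuous_real continuous_on_mult fc Vc)
    also have "\<dots> = integral {a..b} (\<lambda>x. f x * c + f x * integral {a..x} d)" by (simp add: V_def algebra_simps)
    also have "\<dots> = integral {a..b} (\<lambda>x. f x * c) + integral {a..b} (\<lambda>x. f x * integral {a..x} d)"
      using fai ibp(2) by (intro Henstock_Kurzweil_Integration.integral_add integrable_on_mult_left) (auto simp: absolutely_integrable_on_def)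
    also have "integral {a..b} (\<lambda>x. f x * c) = 0" using F[of b] ab zero by simp
    also have "integral {a..b} (\<lambda>x. f x * integral {a..x} d) = - integral {a..b} (\<lambda>x. integral {a..x} f * d x)"
      using ibp(1) F[of b] ab zero by (simp add: add_eq_0_iff2)
    also have "integral {a..b} (\<lambda>x. integral {a..x} f * d x) = integral {a..b} (\<lambda>x. \<phi> x *\<^sub>R d x)"
      by (intro integral_cong) (simp add: F scaleR_conv_of_real)
    also have "\<dots> = (LINT x|lebesgue_on {a<..<b}. \<phi> x *\<^sub>R d x)"
    proof (rule LINT_eq_integral_Icc[symmetric])
      have "(\<lambda>x. integral {a..x} f * d x) absolutely_integrable_on {a..b}" by (rule ibp(3))
      then show "(\<lambda>x. \<phi> x *\<^sub>R d x) absolutely_integrable_on {a..b}"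
        by (rule absolutely_integrable_spike[of _ _ "{}"]) (auto simp: F scaleR_conv_of_real)
    qed
    finally show ?thesis by simp
  qed
  then show ?thesis unfolding has_weak_deriv_def
    using vl locally_integrable_of_absolutely_integrable[OF d] by blast
qed

text \<open>Since \<open>weak_deriv\<close> is an arbitrary choice made for an arbitrary
  representative, everything built on it depends on this uniqueness up to null sets.\<close>

lemma has_weak_deriv_unique:
  assumes "has_weak_deriv {a<..<b} v d" "has_weak_deriv {a<..<b} v' d'"
    and "AE x in lebesgue_on {a<..<b}. v x = v' x"
  shows "AE x in lebesgue_on {a<..<b}. d x = d' x"
proof -
  let ?S = "{a<..<b}"
  have l: "locally_integrable_on ?S d" "locally_integrable_on ?S d'" "locally_integrable_on ?S v" "locally_integrable_on ?S v'"
    using assms by (auto simp: has_weak_deriv_def)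
  have loc: "locally_integrable_on ?S (\<lambda>x. d x - d' x)"
    using l(1,2) unfolding locally_integrable_on_def by (auto intro: set_integral_diff(1))
  have "AE x in lebesgue_on ?S. d x - d' x = 0"
  proof (rule weak_zero_imp_AE_zero[OF loc])
    fix \<phi> assume t: "test_function ?S \<phi>"
    have "(LINT x|lebesgue_on ?S. deriv \<phi> x *\<^sub>R v x) = (LINT x|lebesgue_on ?S. deriv \<phi> x *\<^sub>R v' x)"
    proof (rule integral_cong_AE)
      show "AE x in lebesgue_on ?S. deriv \<phi> x *\<^sub>R v x = deriv \<phi> x *\<^sub>R v' x" using assms(3) by eventually_elim simp
    qed (use test_function_integrable[OF test_function_deriv[OF t]] l in auto)
    then have "(LINT x|lebesgue_on ?S. \<phi> x *\<^sub>R d x) = (LINT x|lebesgue_on ?S. \<phi> x *\<^sub>R d' x)"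
      using assms(1,2) t by (simp add: has_weak_deriv_def)
    then show "(LINT x|lebesgue_on ?S. \<phi> x *\<^sub>R (d x - d' x)) = 0"
      using test_function_integrable[OF t l(1)] test_function_integrable[OF t l(2)]
      by (simp add: scaleR_diff_right)
  qed
  then show ?thesis by eventually_elim simp
qed

text \<open>Subtracting the primitive of \<open>d\<close> leaves a function with weak derivative 0.
  Integrability of \<open>d\<close> up to the endpoint \<open>a\<close>, not merely locally, allows
  the primitive to start at \<open>a\<close>.\<close>

lemma has_weak_deriv_imp_indefinite_integral:
  assumes w: "has_weak_deriv {a<..<b} v d" and ab: "a < b" and d: "d absolutely_integrable_on {a..b}"
  shows "\<exists>c. AE x in lebesgue_on {a<..<b}. v x = c + integral {a..x} d"
proof -
  let ?S = "{a<..<b}"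
  define V where "V x = 0 + integral {a..x} d" for x
  have V: "has_weak_deriv ?S V d" by (rule has_weak_deriv_indefinite_integral[OF ab d, of V 0]) (simp add: V_def)
  have l: "locally_integrable_on ?S v" "locally_integrable_on ?S V" using w V by (auto simp: has_weak_deriv_def)
  have loc: "locally_integrable_on ?S (\<lambda>x. v x - V x)"
    using l unfolding locally_integrable_on_def by (auto intro: set_integral_diff(1))
  have "\<exists>c. AE x in lebesgue_on ?S. v x - V x = c"
  proof (rule weak_deriv_zero_imp_AE_const[OF loc ab])
    fix \<phi> assume t: "test_function ?S \<phi>"
    have "(LINT x|lebesgue_on ?S. deriv \<phi> x *\<^sub>R v x) = (LINT x|lebesgue_on ?S. deriv \<phi> x *\<^sub>R V x)"
      using w V t by (simp add: has_weak_deriv_def)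
    then show "(LINT x|lebesgue_on ?S. deriv \<phi> x *\<^sub>R (v x - V x)) = 0"
      using test_function_integrable[OF test_function_deriv[OF t] l(1)] test_function_integrable[OF test_function_deriv[OF t] l(2)]
      by (simp add: scaleR_diff_right)
  qed
  then obtain c where "AE x in lebesgue_on ?S. v x - V x = c" by blast
  then have "AE x in lebesgue_on ?S. v x = c + integral {a..x} d" by eventually_elim (simp add: V_def algebra_simps)
  then show ?thesis by blast
qed

section \<open>Volterra integral equations\<close>

lemma absolutely_integrable_scaleR_continuous:
  fixes r :: "real \<Rightarrow> real" and q :: "real \<Rightarrow> 'a::euclidean_space"
  assumes r: "r absolutely_integrable_on {s..t}" and q: "continuous_on {s..t} q"
  shows "(\<lambda>x. r x *\<^sub>R q x) absolutely_integrable_on {s..t}"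
proof -
  have "bounded (q ` {s..t})" using q by (intro compact_imp_bounded compact_continuous_image) auto
  then obtain C where C: "\<And>x. x \<in> {s..t} \<Longrightarrow> norm (q x) \<le> C" unfolding bounded_iff by blast
  show ?thesis
  proof (rule measurable_bounded_by_integrable_imp_absolutely_integrable)
  show "(\<lambda>x. r x *\<^sub>R q x) \<in> borel_measurable (lebesgue_on {s..t})"
    using r q by (intro borel_measurable_scaleR absolutely_integrable_imp_borel_measurable continuous_imp_measurable_on_sets_lebesgue) auto
  show "(\<lambda>x. norm (r x) * C) integrable_on {s..t}"
    using r by (intro integrable_on_mult_left) (simp add: absolutely_integrable_on_def)
  fix x assume "x \<in> {s..t}"
  then show "norm (r x *\<^sub>R q x) \<le> norm (r x) * C" using C by (simp add: mult_left_mono)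
  qed simp
qed

text \<open>With \<open>r = 1 / p\<^sub>1\<close> and \<open>v = w\<^sub>1\<close>, the equation
  \<open>u = c - \<mu> * T u\<close> is the system \<open>u' = q / p\<^sub>1\<close>,
  \<open>q' = - \<mu> w\<^sub>1 u\<close> with initial data \<open>u s = c\<close>,
  \<open>q s = 0\<close>. The coefficients are only integrable, so the weight used for the
  contraction is built from the primitive of \<open>\<bar>v z\<bar>\<close> and not from the
  distance to \<open>s\<close>; continuity of \<open>v\<close> off \<open>F\<close> makes that
  primitive differentiable there.\<close>

locale volterra =
  fixes s t :: real and r v :: "real \<Rightarrow> real" and F :: "real set"
  assumes st: "s \<le> t"
    and r: "r absolutely_integrable_on {s..t}" and v: "v absolutely_integrable_on {s..t}"
    and F: "finite F" and cont: "continuous_on ({s..t} - F) v"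
begin

definition I :: "(real \<Rightarrow> complex) \<Rightarrow> real \<Rightarrow> complex" where
  "I u y = integral {s..y} (\<lambda>z. v z *\<^sub>R u z)"

definition T :: "(real \<Rightarrow> complex) \<Rightarrow> real \<Rightarrow> complex" where
  "T u x = integral {s..x} (\<lambda>y. r y *\<^sub>R I u y)"

definition G :: real where "G = integral {s..t} (\<lambda>x. \<bar>r x\<bar>)"

definition \<Omega> :: "real \<Rightarrow> real" where "\<Omega> x = integral {s..x} (\<lambda>z. \<bar>v z\<bar>)"

lemma integrable_abs: "(\<lambda>z. \<bar>v z\<bar>) integrable_on {s..t}" "(\<lambda>z. \<bar>r z\<bar>) integrable_on {s..t}"
  using v r by (auto simp: absolutely_integrable_on_def)

lemma integrable_sub: "f integrable_on {s..t} \<Longrightarrow> x \<in> {s..t} \<Longrightarrow> f integrable_on {s..x}"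
  for f :: "real \<Rightarrow> 'a::euclidean_space"
  by (rule integrable_on_subinterval) auto

lemma integrable_v: "continuous_on {s..t} u \<Longrightarrow> (\<lambda>z. v z *\<^sub>R u z) integrable_on {s..t}"
  for u :: "real \<Rightarrow> complex"
  using absolutely_integrable_scaleR_continuous[OF v] set_lebesgue_integral_eq_integral(1) by blast

lemma integrable_r: "continuous_on {s..t} u \<Longrightarrow> (\<lambda>z. r z *\<^sub>R u z) integrable_on {s..t}"
  for u :: "real \<Rightarrow> complex"
  using absolutely_integrable_scaleR_continuous[OF r] set_lebesgue_integral_eq_integral(1) by blast

lemma continuous_I: "continuous_on {s..t} u \<Longrightarrow> continuous_on {s..t} (I u)"
  unfolding I_def[abs_def] by (intro indefinite_integral_continuous_1 integrable_v)

lemma continuous_T: "continuous_on {s..t} u \<Longrightarrow> continuous_on {s..t} (T u)"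
  unfolding T_def[abs_def] by (intro indefinite_integral_continuous_1 integrable_r continuous_I)

lemma I_diff:
  assumes "continuous_on {s..t} f" "continuous_on {s..t} h" "y \<in> {s..t}"
  shows "I (\<lambda>x. f x - h x) y = I f y - I h y"
  unfolding I_def scaleR_diff_right
  by (intro integral_diff integrable_sub[OF integrable_v] assms)

lemma T_diff:
  assumes "continuous_on {s..t} f" "continuous_on {s..t} h" "x \<in> {s..t}"
  shows "T (\<lambda>x. f x - h x) x = T f x - T h x"
proof -
  have "T (\<lambda>x. f x - h x) x = integral {s..x} (\<lambda>y. r y *\<^sub>R I f y - r y *\<^sub>R I h y)"
    unfolding T_def using assms by (intro integral_cong) (simp add: I_diff scaleR_diff_right)
  also have "\<dots> = T f x - T h x"
    unfolding T_def by (intro integral_diff integrable_sub[OF integrable_r] continuous_I assms)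
  finally show ?thesis .
qed

lemma G_nonneg: "0 \<le> G" unfolding G_def by (intro integral_nonneg integrable_abs) auto

lemma continuous_\<Omega>: "continuous_on {s..t} \<Omega>"
  unfolding \<Omega>_def[abs_def] by (intro indefinite_integral_continuous_1 integrable_abs)

lemma \<Omega>_mono: "x \<le> y \<Longrightarrow> x \<in> {s..t} \<Longrightarrow> y \<in> {s..t} \<Longrightarrow> \<Omega> x \<le> \<Omega> y"
  unfolding \<Omega>_def by (intro integral_subset_le integrable_sub[OF integrable_abs(1)]) auto

lemma \<Omega>_nonneg: "x \<in> {s..t} \<Longrightarrow> 0 \<le> \<Omega> x"
  using \<Omega>_mono[of s x] by (auto simp: \<Omega>_def)

lemma \<Omega>_deriv: "z \<in> {s<..<t} - F \<Longrightarrow> (\<Omega> has_real_derivative \<bar>v z\<bar>) (at z)"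
proof -
  assume z: "z \<in> {s<..<t} - F"
  have "open ({s<..<t} - F)" using F by (intro open_Diff finite_imp_closed) auto
  moreover have "continuous_on ({s<..<t} - F) v" using cont by (rule continuous_on_subset) auto
  ultimately have "isCont v z" using z by (simp add: continuous_on_eq_continuous_at)
  then have "isCont (\<lambda>z. \<bar>v z\<bar>) z" by (intro continuous_intros)
  then show ?thesis unfolding \<Omega>_def[abs_def] has_real_derivative_iff_has_vector_derivative
    using z by (intro has_vector_derivative_integral_interior[OF integrable_abs(1)]) auto
qed

text \<open>The integrand is the derivative of
  \<open>exp (\<kappa> * \<Omega> z) / \<kappa>\<close>; as this is continuous, the finitely many
  points of \<open>F\<close> do no harm. The gain is the factor \<open>1 / \<kappa>\<close>.\<close>

lemma exp_\<Omega>_integral: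
  assumes "\<kappa> > 0" "y \<in> {s..t}"
  shows "((\<lambda>z. \<bar>v z\<bar> * exp (\<kappa> * \<Omega> z)) has_integral (exp (\<kappa> * \<Omega> y) - 1) / \<kappa>) {s..y}"
proof -
  have "((\<lambda>z. \<bar>v z\<bar> * exp (\<kappa> * \<Omega> z)) has_integral (exp (\<kappa> * \<Omega> y) / \<kappa> - exp (\<kappa> * \<Omega> s) / \<kappa>)) {s..y}"
  proof (rule fundamental_theorem_of_calculus_interior_strong[OF F])
    show "continuous_on {s..y} (\<lambda>x. exp (\<kappa> * \<Omega> x) / \<kappa>)"
      using assms by (intro continuous_intros continuous_on_subset[OF continuous_\<Omega>]) auto
    fix z assume "z \<in> {s<..<y} - F"
    then have "z \<in> {s<..<t} - F" using assms by auto
    note d = \<Omega>_deriv[OF this]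
    have "((\<lambda>x. exp (\<kappa> * \<Omega> x) / \<kappa>) has_real_derivative exp (\<kappa> * \<Omega> z) * (\<kappa> * \<bar>v z\<bar>) / \<kappa>) (at z)"
      by (intro DERIV_cdivide DERIV_fun_exp DERIV_cmult d)
    then show "((\<lambda>x. exp (\<kappa> * \<Omega> x) / \<kappa>) has_vector_derivative \<bar>v z\<bar> * exp (\<kappa> * \<Omega> z)) (at z)"
      using assms(1) by (simp add: has_real_derivative_iff_has_vector_derivative mult.commute)
  qed (use assms in auto)
  then show ?thesis by (simp add: \<Omega>_def diff_divide_distrib)
qed

text \<open>Large enough for \<open>cmod \<mu> * G / \<kappa> \<mu> \<le> 1 / 2\<close>, the
  contraction factor. The added 1s keep it positive when \<open>\<mu>\<close> or \<open>G\<close> is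
  0.\<close>

definition \<kappa> :: "complex \<Rightarrow> real" where "\<kappa> \<mu> = 2 * (cmod \<mu> + 1) * (G + 1)"

definition \<theta> :: "complex \<Rightarrow> real \<Rightarrow> real" where "\<theta> \<mu> x = exp (\<kappa> \<mu> * \<Omega> x)"

lemma \<kappa>_pos: "\<kappa> \<mu> > 0" unfolding \<kappa>_def using G_nonneg by (intro mult_pos_pos) (auto simp: add_nonneg_pos)

lemma \<theta>_ge_1: "x \<in> {s..t} \<Longrightarrow> 1 \<le> \<theta> \<mu> x"
  unfolding \<theta>_def using \<Omega>_nonneg[of x] \<kappa>_pos[of \<mu>] by simp

lemma \<theta>_mono: "x \<le> y \<Longrightarrow> x \<in> {s..t} \<Longrightarrow> y \<in> {s..t} \<Longrightarrow> \<theta> \<mu> x \<le> \<theta> \<mu> y"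
  unfolding \<theta>_def using \<Omega>_mono \<kappa>_pos by simp

text \<open>In the weighted supremum norm with weight \<open>\<theta>\<close>, the operator \<open>\<mu> T\<close> halves norms.\<close>

lemma T_bound:
  assumes u: "continuous_on {s..t} u" and M: "\<And>x. x \<in> {s..t} \<Longrightarrow> norm (u x) \<le> M * \<theta> \<mu> x"
    and x: "x \<in> {s..t}"
  shows "norm (\<mu> * T u x) \<le> M / 2 * \<theta> \<mu> x"
proof -
  have "0 \<le> M * \<theta> \<mu> s" using M[of s] st order.trans[OF norm_ge_zero] by simp
  then have M0: "0 \<le> M" by (simp add: \<theta>_def zero_le_mult_iff)
  \<comment> \<open>Only the inner integral profits from the weight, by the factor
    \<open>1 / \<kappa> \<mu>\<close>; the outer one is then bounded crudely by
    \<open>G\<close>.\<close>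
  have I_le: "norm (I u y) \<le> M / \<kappa> \<mu> * \<theta> \<mu> x" if y: "y \<in> {s..x}" for y
  proof -
    have yt: "y \<in> {s..t}" using y x by auto
    have i: "((\<lambda>z. M * (\<bar>v z\<bar> * exp (\<kappa> \<mu> * \<Omega> z))) has_integral M * ((exp (\<kappa> \<mu> * \<Omega> y) - 1) / \<kappa> \<mu>)) {s..y}"
      by (intro has_integral_mult_right exp_\<Omega>_integral \<kappa>_pos yt)
    have "norm (I u y) \<le> integral {s..y} (\<lambda>z. M * (\<bar>v z\<bar> * exp (\<kappa> \<mu> * \<Omega> z)))"
      unfolding I_def
    proof (rule integral_norm_bound_integral)
      show "(\<lambda>z. v z *\<^sub>R u z) integrable_on {s..y}" by (rule integrable_sub[OF integrable_v[OF u] yt])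
      show "(\<lambda>z. M * (\<bar>v z\<bar> * exp (\<kappa> \<mu> * \<Omega> z))) integrable_on {s..y}" using i by blast
      fix z assume "z \<in> {s..y}"
      then have "norm (u z) \<le> M * \<theta> \<mu> z" using yt by (intro M) auto
      then have "\<bar>v z\<bar> * norm (u z) \<le> \<bar>v z\<bar> * (M * \<theta> \<mu> z)" by (intro mult_left_mono) auto
      then show "norm (v z *\<^sub>R u z) \<le> M * (\<bar>v z\<bar> * exp (\<kappa> \<mu> * \<Omega> z))" by (simp add: \<theta>_def mult_ac)
    qed
    also have "\<dots> = M * ((exp (\<kappa> \<mu> * \<Omega> y) - 1) / \<kappa> \<mu>)" using i by (rule integral_unique)
    also have "\<dots> \<le> M * (\<theta> \<mu> x / \<kappa> \<mu>)"
    proof (intro mult_left_mono divide_right_mono)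
      have "exp (\<kappa> \<mu> * \<Omega> y) \<le> \<theta> \<mu> x" using \<theta>_mono[of y x \<mu>] y yt x by (simp add: \<theta>_def)
      then show "exp (\<kappa> \<mu> * \<Omega> y) - 1 \<le> \<theta> \<mu> x" by linarith
    qed (use M0 \<kappa>_pos[of \<mu>] in auto)
    finally show ?thesis by simp
  qed
  have "norm (T u x) \<le> integral {s..x} (\<lambda>y. \<bar>r y\<bar> * (M / \<kappa> \<mu> * \<theta> \<mu> x))"
    unfolding T_def
  proof (rule integral_norm_bound_integral)
    show "(\<lambda>y. r y *\<^sub>R I u y) integrable_on {s..x}" by (rule integrable_sub[OF integrable_r[OF continuous_I[OF u]] x])
    show "(\<lambda>y. \<bar>r y\<bar> * (M / \<kappa> \<mu> * \<theta> \<mu> x)) integrable_on {s..x}"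
      by (rule integrable_on_mult_left[OF integrable_sub[OF integrable_abs(2) x]])
    fix y assume "y \<in> {s..x}"
    from mult_left_mono[OF I_le[OF this], of "\<bar>r y\<bar>"]
    show "norm (r y *\<^sub>R I u y) \<le> \<bar>r y\<bar> * (M / \<kappa> \<mu> * \<theta> \<mu> x)" by simp
  qed
  also have "\<dots> = integral {s..x} (\<lambda>y. \<bar>r y\<bar>) * (M / \<kappa> \<mu> * \<theta> \<mu> x)" by (rule integral_mult_left)
  also have "\<dots> \<le> G * (M / \<kappa> \<mu> * \<theta> \<mu> x)"
    unfolding G_def using x M0 \<kappa>_pos[of \<mu>]
    by (intro mult_right_mono integral_subset_le integrable_sub[OF integrable_abs(2)] integrable_abs(2)) (auto simp: \<theta>_def)
  finally have "norm (T u x) \<le> G * (M / \<kappa> \<mu> * \<theta> \<mu> x)" .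
  from mult_left_mono[OF this, of "cmod \<mu>"]
  have "norm (\<mu> * T u x) \<le> cmod \<mu> * (G * (M / \<kappa> \<mu> * \<theta> \<mu> x))" by (simp add: norm_mult)
  also have "\<dots> = (cmod \<mu> * G / \<kappa> \<mu>) * (M * \<theta> \<mu> x)" by simp
  also have "\<dots> \<le> (1 / 2) * (M * \<theta> \<mu> x)"
  proof (rule mult_right_mono)
    have "cmod \<mu> * G \<le> (cmod \<mu> + 1) * (G + 1)" using G_nonneg by (intro mult_mono) auto
    then show "cmod \<mu> * G / \<kappa> \<mu> \<le> 1 / 2" using \<kappa>_pos[of \<mu>] by (simp add: \<kappa>_def field_simps)
  qed (use M0 in \<open>auto simp: \<theta>_def\<close>)
  finally show ?thesis by simp
qed

text \<open>The halving estimate applied \<open>n\<close> times to the fixed-point equation. The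
  weight makes this work on the whole interval at once, without subdividing it.\<close>

lemma unique_zero:
  assumes u: "continuous_on {s..t} u" and eq: "\<And>x. x \<in> {s..t} \<Longrightarrow> u x = - \<mu> * T u x" and x: "x \<in> {s..t}"
  shows "u x = 0"
proof -
  have "bounded (u ` {s..t})" using u by (intro compact_imp_bounded compact_continuous_image) auto
  then obtain M where M: "\<And>x. x \<in> {s..t} \<Longrightarrow> norm (u x) \<le> M" unfolding bounded_iff by blast
  have M0: "0 \<le> M" using M[OF x] norm_ge_zero order.trans by blast
  have *: "norm (u x) \<le> (M / 2 ^ n) * \<theta> \<mu> x" if "x \<in> {s..t}" for n x
    using that
  proof (induction n arbitrary: x)
    case 0
    have "norm (u x) \<le> M * 1" using M 0 by simp
    also have "\<dots> \<le> M * \<theta> \<mu> x" using M0 \<theta>_ge_1 0 by (intro mult_left_mono) auto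
    finally show ?case by simp
  next
    case (Suc n)
    have "norm (\<mu> * T u x) \<le> (M / 2 ^ n) / 2 * \<theta> \<mu> x" by (rule T_bound[OF u Suc.IH Suc.prems])
    then show ?case using eq[OF Suc.prems] by (simp add: mult.commute)
  qed
  have "(\<lambda>n. M * \<theta> \<mu> x * (1 / 2) ^ n) \<longlonglongrightarrow> M * \<theta> \<mu> x * 0"
    by (intro tendsto_mult_left LIMSEQ_realpow_zero) auto
  then have "norm (u x) \<le> 0"
    using *[OF x] by (intro LIMSEQ_le_const[of "\<lambda>n. M * \<theta> \<mu> x * (1 / 2) ^ n"]) (auto simp: power_divide)
  then show ?thesis by simp
qed

text \<open>Starting from 0 makes the first difference equal to the constant \<open>c\<close>, which
  is the base case of the geometric estimate.\<close>

primrec picard :: "complex \<Rightarrow> complex \<Rightarrow> nat \<Rightarrow> real \<Rightarrow> complex" where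
  "picard \<mu> c 0 = (\<lambda>_. 0)"
| "picard \<mu> c (Suc n) = (\<lambda>x. c - \<mu> * T (picard \<mu> c n) x)"

lemma continuous_picard: "continuous_on {s..t} (picard \<mu> c n)"
  by (induction n) (auto intro!: continuous_intros continuous_T)

lemma T_zero: "T (\<lambda>_. 0) x = 0"
  by (simp add: T_def I_def)

lemma picard_step: "x \<in> {s..t} \<Longrightarrow> norm (picard \<mu> c (Suc n) x - picard \<mu> c n x) \<le> (norm c / 2 ^ n) * \<theta> \<mu> x"
proof (induction n arbitrary: x)
  case 0
  have "norm c * 1 \<le> norm c * \<theta> \<mu> x" using \<theta>_ge_1[OF 0] by (intro mult_left_mono) auto
  then show ?case by (simp add: T_zero)
next
  case (Suc n)
  let ?d = "\<lambda>x. picard \<mu> c (Suc n) x - picard \<mu> c n x"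
  have "picard \<mu> c (Suc (Suc n)) x - picard \<mu> c (Suc n) x = - (\<mu> * T ?d x)"
    by (subst T_diff[OF continuous_picard continuous_picard Suc.prems]) (simp add: algebra_simps)
  moreover have "norm (\<mu> * T ?d x) \<le> (norm c / 2 ^ n) / 2 * \<theta> \<mu> x"
    by (rule T_bound) (intro continuous_intros continuous_picard, rule Suc.IH, assumption, rule Suc.prems)
  ultimately show ?case by (simp add: mult.commute)
qed

lemma solution_exists:
  "\<exists>u. continuous_on {s..t} u \<and> (\<forall>x\<in>{s..t}. u x = c - \<mu> * T u x)"
proof -
  define d where "d n x = picard \<mu> c (Suc n) x - picard \<mu> c n x" for n x
  have sum_d: "(\<Sum>i<n. d i x) = picard \<mu> c n x" for n x
    unfolding d_def by (subst sum_lessThan_telescope) simp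
  have tt: "t \<in> {s..t}" using st by simp
  define M where "M = norm c * \<theta> \<mu> t"
  have "norm (d n x) \<le> M * (1 / 2) ^ n" if x: "x \<in> {s..t}" for n x
  proof -
    have "norm (d n x) \<le> (norm c / 2 ^ n) * \<theta> \<mu> x" unfolding d_def by (rule picard_step[OF x])
    also have "\<dots> \<le> (norm c / 2 ^ n) * \<theta> \<mu> t" using x \<theta>_mono[of x t \<mu>] tt by (intro mult_left_mono) auto
    finally show ?thesis by (simp add: M_def power_divide)
  qed
  moreover have "summable (\<lambda>n. M * (1 / 2) ^ n)" by (intro summable_mult summable_geometric) simp
  ultimately have "uniform_limit {s..t} (\<lambda>n x. \<Sum>i<n. d i x) (\<lambda>x. suminf (\<lambda>i. d i x)) sequentially"
    by (intro Weierstrass_m_test) auto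
  then obtain u where u: "uniform_limit {s..t} (picard \<mu> c) u sequentially"
    unfolding sum_d by blast
  have cu: "continuous_on {s..t} u"
    by (rule uniform_limit_theorem[OF _ u]) (auto intro: always_eventually continuous_picard simp del: picard.simps)
  have "u x = c - \<mu> * T u x" if x: "x \<in> {s..t}" for x
  proof (rule LIMSEQ_unique)
    show "(\<lambda>n. picard \<mu> c (Suc n) x) \<longlonglongrightarrow> u x"
      by (rule LIMSEQ_Suc) (rule tendsto_uniform_limitI[OF u x])
    \<comment> \<open>Continuity of \<open>T\<close> along the uniform limit, by the same bound
      applied to the error function.\<close>
    have "(\<lambda>n. \<mu> * T (\<lambda>x. picard \<mu> c n x - u x) x) \<longlonglongrightarrow> 0"
    proof (rule LIMSEQ_I)
      fix e :: real assume e: "e > 0"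
      have "e / \<theta> \<mu> x > 0" using e by (simp add: \<theta>_def)
      from uniform_limitD[OF u this] obtain N where
        N: "\<And>n y. n \<ge> N \<Longrightarrow> y \<in> {s..t} \<Longrightarrow> dist (picard \<mu> c n y) (u y) < e / \<theta> \<mu> x"
        unfolding eventually_sequentially by blast
      have "norm (\<mu> * T (\<lambda>x. picard \<mu> c n x - u x) x - 0) < e" if n: "n \<ge> N" for n
      proof -
        have "norm (\<mu> * T (\<lambda>x. picard \<mu> c n x - u x) x) \<le> (e / \<theta> \<mu> x) / 2 * \<theta> \<mu> x"
        proof (rule T_bound[OF _ _ x])
          show "continuous_on {s..t} (\<lambda>x. picard \<mu> c n x - u x)" by (intro continuous_intros continuous_picard cu)
          fix y assume y: "y \<in> {s..t}"
          have "norm (picard \<mu> c n y - u y) \<le> (e / \<theta> \<mu> x) * 1" using N[OF n y] by (simp add: dist_norm)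
          also have "\<dots> \<le> (e / \<theta> \<mu> x) * \<theta> \<mu> y" using e \<theta>_ge_1[OF y] by (intro mult_left_mono) (auto simp: \<theta>_def)
          finally show "norm (picard \<mu> c n y - u y) \<le> (e / \<theta> \<mu> x) * \<theta> \<mu> y" .
        qed
        also have "\<dots> < e" using e by (simp add: \<theta>_def)
        finally show ?thesis by simp
      qed
      then show "\<exists>N. \<forall>n\<ge>N. norm (\<mu> * T (\<lambda>x. picard \<mu> c n x - u x) x - 0) < e" by blast
    qed
    then have "(\<lambda>n. c - \<mu> * T u x - \<mu> * T (\<lambda>x. picard \<mu> c n x - u x) x) \<longlonglongrightarrow> c - \<mu> * T u x - 0"
      by (intro tendsto_diff tendsto_const)
    moreover have "picard \<mu> c (Suc n) x = c - \<mu> * T u x - \<mu> * T (\<lambda>x. picard \<mu> c n x - u x) x" for n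
      by (subst T_diff[OF continuous_picard cu x]) (simp add: algebra_simps)
    ultimately show "(\<lambda>n. picard \<mu> c (Suc n) x) \<longlonglongrightarrow> c - \<mu> * T u x" by (simp only: diff_zero)
  qed
  with cu show ?thesis by blast
qed

end

section \<open>Behaviour of the coefficients\<close>

lemma sqrt3: "17/10 < sqrt 3" "sqrt 3 < 18/10" "sqrt 3 * sqrt 3 = 3"
  by (rule real_less_rsqrt, simp add: power2_eq_square)
     (rule real_less_lsqrt, auto simp: power2_eq_square)

text \<open>For \<open>\<beta> + 1 > 0\<close> the primitive of the power extends continuously to
  \<open>c\<close>, so the fundamental theorem applies on each side of the singularity.\<close>

lemma absolutely_integrable_powr_dist:
  assumes "\<beta> > - 1" "s \<le> c" "c \<le> t"
  shows "(\<lambda>x. \<bar>x - c\<bar> powr \<beta>) absolutely_integrable_on {s..t::real}"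
proof -
  have "((\<lambda>x. \<bar>x - c\<bar> powr \<beta>) has_integral ((t - c) powr (\<beta> + 1) / (\<beta> + 1) - (c - c) powr (\<beta> + 1) / (\<beta> + 1))) {c..t}"
    using assms
    by (intro fundamental_theorem_of_calculus_interior continuous_on_divide continuous_on_minus continuous_on_powr' continuous_on_diff continuous_on_const continuous_on_id)
       (auto intro!: derivative_eq_intros simp: has_real_derivative_iff_has_vector_derivative[symmetric])
  moreover have "((\<lambda>x. \<bar>x - c\<bar> powr \<beta>) has_integral (- ((c - c) powr (\<beta> + 1) / (\<beta> + 1)) - (- ((c - s) powr (\<beta> + 1) / (\<beta> + 1))))) {s..c}"
    using assms
    by (intro fundamental_theorem_of_calculus_interior continuous_on_divide continuous_on_minus continuous_on_powr' continuous_on_diff continuous_on_const continuous_on_id)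
       (auto intro!: derivative_eq_intros simp: has_real_derivative_iff_has_vector_derivative[symmetric])
  ultimately have "(\<lambda>x. \<bar>x - c\<bar> powr \<beta>) integrable_on {s..t}"
    using assms by (intro Henstock_Kurzweil_Integration.integrable_combine[of s c t]) blast+
  then show ?thesis by (intro nonnegative_absolutely_integrable_1) auto
qed

lemma absolutely_integrable_symmetric:
  fixes f :: "real \<Rightarrow> real"
  assumes f: "f absolutely_integrable_on {0..1/2}" and sym: "\<And>x. f (1 - x) = f x"
  shows "f absolutely_integrable_on {0..1}"
proof -
  have "(\<lambda>x. f (- x)) absolutely_integrable_on {-(1/2)..- 0}"
    using f by (subst absolutely_integrable_reflect_real)
  then have "(\<lambda>x. f (- x)) integrable_on {-(1/2)..0}" "(\<lambda>x. \<bar>f (- x)\<bar>) integrable_on {-(1/2)..0}"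
    by (auto simp: absolutely_integrable_on_def)
  then have "((\<lambda>x. f (- x)) \<circ> (+) (-1)) integrable_on {1/2..1}" "((\<lambda>x. \<bar>f (- x)\<bar>) \<circ> (+) (-1)) integrable_on {1/2..1}"
    by (auto simp: integrable_on_shift_Icc_real)
  then have "f absolutely_integrable_on {1/2..1}"
    by (auto simp: o_def sym absolutely_integrable_on_def)
  with f show ?thesis by (rule absolutely_integrable_on_combine) auto
qed

text \<open>Derivatives are kept in the form function times logarithmic derivative, so that for the
  product defining \<open>g\<close> the logarithmic derivatives simply add up.\<close>

lemma has_real_derivative_powr_log:
  assumes "(u has_real_derivative u') (at x)" "0 < u x"
  shows "((\<lambda>y. u y powr r) has_real_derivative u x powr r * (r * u' / u x)) (at x)"
proof -
  have "((\<lambda>y. u y powr r) has_real_derivative (r * u x powr (r - 1)) * u') (at x)"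
    using assms by (intro DERIV_chain2[OF has_real_derivative_powr])
  moreover have "(r * u x powr (r - 1)) * u' = u x powr r * (r * u' / u x)"
    using assms(2) by (simp add: powr_diff)
  ultimately show ?thesis by simp
qed

lemma logderiv_mult:
  assumes "(f has_real_derivative f x * r) (at x)" "(k has_real_derivative k x * t) (at x)"
  shows "((\<lambda>y. f y * k y) has_real_derivative f x * k x * (r + t)) (at x)"
  using DERIV_mult[OF assms] by (simp add: algebra_simps)

text \<open>The bound forces \<open>\<alpha> < 1\<close>, on which all integrability at the zeros of
  \<open>p\<close> rests, and it also separates the two boundary layers.\<close>

locale small_parameter =
  fixes \<epsilon> :: real
  assumes eps: "0 < \<epsilon>" "\<epsilon> < 1 / 8"
begin

abbreviation "a \<equiv> x0 \<epsilon>"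
abbreviation "b \<equiv> 1 - x0 \<epsilon>"
abbreviation "p \<equiv> p1 \<epsilon>"
abbreviation "w \<equiv> w1 \<epsilon>"

lemma x0_bounds: "0 < a" "a < \<epsilon>" "a < 1 / 8" "a < b" "\<epsilon> < 1 - \<epsilon>" "a < 3 * \<epsilon>"
proof -
  show "0 < a" using eps sqrt3 by (simp add: x0_def)
  have "(2 - sqrt 3) * \<epsilon> < 1 * \<epsilon>" using eps sqrt3 by (intro mult_strict_right_mono) auto
  then show 1: "a < \<epsilon>" by (simp add: x0_def)
  with eps show "a < 1 / 8" "a < b" "\<epsilon> < 1 - \<epsilon>" "a < 3 * \<epsilon>" by auto
qed

definition \<alpha> :: real where "\<alpha> = (4 + 2 * sqrt 3) * \<epsilon>"

lemma alpha_bounds: "0 < \<alpha>" "\<alpha> < 1"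
proof -
  show "0 < \<alpha>" using eps sqrt3 by (simp add: \<alpha>_def)
  have "\<alpha> < 8 * \<epsilon>" using eps sqrt3 by (simp add: \<alpha>_def)
  with eps show "\<alpha> < 1" by simp
qed

text \<open>The factor of \<open>g\<close> that stays continuous and positive on
  \<open>{0..\<epsilon>}\<close>; the zero and the change of sign sit entirely in
  \<open>sgn (x - a) * \<bar>x - a\<bar> powr \<alpha>\<close>.\<close>

definition h :: "real \<Rightarrow> real" where
  "h x = \<bar>x - 4 * \<epsilon> + a\<bar> powr ((4 - 2 * sqrt 3) * \<epsilon>) * (x + \<epsilon>) powr (- 8 * \<epsilon>)
     * exp (12 * \<epsilon>^3 / (\<epsilon> + x)^2 + 12 * \<epsilon>^2 / (\<epsilon> + x))"

lemma g_eq: "g \<epsilon> x = sgn (x - a) * \<bar>x - a\<bar> powr \<alpha> * h x"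
  by (simp add: g_def h_def \<alpha>_def)

lemma h_pos: "0 \<le> x \<Longrightarrow> x \<le> \<epsilon> \<Longrightarrow> 0 < h x"
  unfolding h_def using x0_bounds eps by (intro mult_pos_pos) auto

lemma continuous_on_h: "continuous_on {0..\<epsilon>} h"
  unfolding h_def using x0_bounds eps by (intro continuous_intros) (auto simp: add_pos_nonneg add_eq_0_iff2)

lemma h_bounds: obtains c C where "0 < c" "\<And>x. x \<in> {0..\<epsilon>} \<Longrightarrow> c \<le> h x" "\<And>x. x \<in> {0..\<epsilon>} \<Longrightarrow> h x \<le> C" "0 < C"
proof -
  have ne: "{0..\<epsilon>} \<noteq> {}" using eps by simp
  obtain u where u: "u \<in> {0..\<epsilon>}" "\<And>y. y \<in> {0..\<epsilon>} \<Longrightarrow> h u \<le> h y"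
    using continuous_attains_inf[OF compact_Icc ne continuous_on_h] by blast
  obtain v where v: "v \<in> {0..\<epsilon>}" "\<And>y. y \<in> {0..\<epsilon>} \<Longrightarrow> h y \<le> h v"
    using continuous_attains_sup[OF compact_Icc ne continuous_on_h] by blast
  show ?thesis using that[of "h u" "h v"] u v h_pos by auto
qed

lemma g_eps_pos: "g \<epsilon> \<epsilon> > 0"
  using x0_bounds h_pos[of \<epsilon>] eps by (simp add: g_eq)

section \<open>Symmetry, signs and growth of the coefficients\<close>

lemma p_symmetric: "p (1 - x) = p x"
proof -
  consider "x < \<epsilon>" | "x = \<epsilon>" | "\<epsilon> < x" "x < 1 - \<epsilon>" | "x = 1 - \<epsilon>" | "1 - \<epsilon> < x" by linarith
  then show ?thesis
    using x0_bounds eps g_eps_pos by cases (auto simp: p1_def)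
qed

lemma phi2_symmetric: "phi2 \<epsilon> (1 - x) = phi2 \<epsilon> x"
proof -
  consider "x < \<epsilon>" | "x = \<epsilon>" | "\<epsilon> < x" "x < 1 - \<epsilon>" | "x = 1 - \<epsilon>" | "1 - \<epsilon> < x" by linarith
  then show ?thesis
    using x0_bounds eps g_eps_pos by cases (auto simp: phi2_def)
qed

lemma w_symmetric: "w (1 - x) = w x"
  by (simp add: w1_def p_symmetric phi2_symmetric)

lemma phi1_antisymmetric: "phi1 \<epsilon> (1 - x) = - phi1 \<epsilon> x"
proof -
  consider "x < \<epsilon>" | "x = \<epsilon>" | "\<epsilon> < x" "x < 1 - \<epsilon>" | "x = 1 - \<epsilon>" | "1 - \<epsilon> < x" by linarith
  then show ?thesis
    using x0_bounds eps g_eps_pos by cases (auto simp: phi1_def minus_divide_left simp del: minus_divide_left[symmetric])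
qed

lemma p_left: "x \<le> \<epsilon> \<Longrightarrow> p x = sgn (x - a) * \<bar>x - a\<bar> powr \<alpha> * h x / (6 * g \<epsilon> \<epsilon>)"
  by (simp add: p1_def g_eq)

lemma p_middle: "\<epsilon> \<le> x \<Longrightarrow> x \<le> 1 - \<epsilon> \<Longrightarrow> p x = 1 / 6"
  using g_eps_pos by (auto simp: p1_def)

text \<open>The quadratic has the roots \<open>(2 - sqrt 3) * \<epsilon> = a\<close> and
  \<open>(2 + sqrt 3) * \<epsilon> = 4 * \<epsilon> - a\<close>.\<close>

lemma phi2_left: "x \<le> \<epsilon> \<Longrightarrow> phi2 \<epsilon> x = (x - a) * (x - 4 * \<epsilon> + a) / (12 * \<epsilon>\<^sup>2)"
proof -
  assume "x \<le> \<epsilon>"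
  have "(x - a) * (x - 4 * \<epsilon> + a) = x\<^sup>2 - 4 * \<epsilon> * x + (4 * \<epsilon> - a) * a"
    by (simp add: algebra_simps power2_eq_square)
  also have "(4 * \<epsilon> - a) * a = ((2 + sqrt 3) * (2 - sqrt 3)) * \<epsilon>\<^sup>2"
    by (simp add: x0_def algebra_simps power2_eq_square)
  also have "(2 + sqrt 3) * (2 - sqrt 3) = 1" using sqrt3 by (simp add: algebra_simps)
  finally show ?thesis using eps \<open>x \<le> \<epsilon>\<close> by (simp add: phi2_def field_simps power2_eq_square)
qed

lemma phi2_middle: "\<epsilon> \<le> x \<Longrightarrow> x \<le> 1 - \<epsilon> \<Longrightarrow> phi2 \<epsilon> x = - 1 / 6"
  using eps by (auto simp: phi2_def)

lemma p_pos_iff: "x \<in> {0..1} \<Longrightarrow> 0 < p x \<longleftrightarrow> x \<in> {a<..<b}"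
proof -
  have *: "0 < p x \<longleftrightarrow> a < x" if "0 \<le> x" "x \<le> 1 / 2" for x
  proof (cases "x \<le> \<epsilon>")
    case True
    have "0 < h x" using h_pos that True by simp
    then have "0 < p x \<longleftrightarrow> 0 < sgn (x - a) * \<bar>x - a\<bar> powr \<alpha>"
      using True g_eps_pos by (simp add: p_left zero_less_divide_iff zero_less_mult_iff)
    also have "\<dots> \<longleftrightarrow> a < x" by (auto simp: sgn_if zero_less_mult_iff)
    finally show ?thesis .
  next
    case False then show ?thesis using p_middle[of x] that eps x0_bounds by simp
  qed
  assume x: "x \<in> {0..1}"
  show ?thesis
  proof (cases "x \<le> 1 / 2")
    case True then show ?thesis using *[of x] x x0_bounds by auto
  next
    case False then show ?thesis using *[of "1 - x"] x x0_bounds p_symmetric[of x] by auto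
  qed
qed

lemma M_plus_eq: "M_plus \<epsilon> = {a<..<b}"
  using p_pos_iff x0_bounds by (auto simp: M_plus_def)

lemma p_zero: "p a = 0" "p b = 0"
proof -
  show "p a = 0" using x0_bounds by (simp add: p_left)
  then show "p b = 0" by (simp add: p_symmetric)
qed

text \<open>By the symmetry under \<open>x\<close> to \<open>1 - x\<close>, properties of the
  coefficients need checking on the left half only.\<close>

lemma reflect_half:
  assumes "\<And>x. x \<in> {0..1/2} - {a} \<Longrightarrow> P x" "\<And>x. x \<in> {0..1/2} - {a} \<Longrightarrow> P x \<Longrightarrow> P (1 - x)"
    and x: "x \<in> {0..1} - {a, b}"
  shows "P x"
proof (cases "x \<le> 1 / 2")
  case True then show ?thesis using assms(1)[of x] x by auto
next
  case False
  then have "1 - x \<in> {0..1/2} - {a}" using x by auto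
  from assms(2)[OF this assms(1)[OF this]] show ?thesis by simp
qed

text \<open>Near \<open>a\<close> the function \<open>p\<close> behaves like a signed power with
  exponent \<open>\<alpha>\<close>, and the simple zero of \<open>phi2\<close> lowers the exponent
  of \<open>w\<close> by one. The constants come from the extrema of \<open>h\<close> on the compact
  interval \<open>{0..\<epsilon>}\<close>.\<close>

lemma p_half_bounds: obtains c C where "0 < c" "0 < C"
  "\<And>x. x \<in> {0..1/2} - {a} \<Longrightarrow> c * \<bar>x - a\<bar> powr \<alpha> \<le> \<bar>p x\<bar>"
  "\<And>x. x \<in> {0..1/2} \<Longrightarrow> \<bar>p x\<bar> \<le> C"
  "\<And>x. x \<in> {0..1/2} - {a} \<Longrightarrow> \<bar>w x\<bar> \<le> C * \<bar>x - a\<bar> powr (\<alpha> - 1)"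
proof -
  obtain c C where h: "0 < c" "\<And>x. x \<in> {0..\<epsilon>} \<Longrightarrow> c \<le> h x" "\<And>x. x \<in> {0..\<epsilon>} \<Longrightarrow> h x \<le> C" "0 < C"
    by (rule h_bounds) blast
  let ?G = "6 * g \<epsilon> \<epsilon>"
  have G: "?G > 0" using g_eps_pos by simp
  have le1: "\<bar>x - a\<bar> powr \<alpha> \<le> 1" if "x \<in> {0..1/2}" for x
    using that x0_bounds alpha_bounds by (intro powr_le1) auto
  show ?thesis
  proof
    \<comment> \<open>The first entry of each constant is for \<open>{0..\<epsilon>}\<close>, the
      second for the plateau, where \<open>p = 1/6\<close> and \<open>w = 1\<close>. The 12 bounds
      \<open>12 * \<epsilon>\<^sup>2 / \<bar>x - 4 * \<epsilon> + a\<bar>\<close>.\<close>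
    show "0 < min (c / ?G) (1 / 6)" using h G by simp
    show "0 < max (12 * C / ?G) 2" by simp
    fix x assume x: "x \<in> {0..1/2} - {a}"
    show "min (c / ?G) (1 / 6) * \<bar>x - a\<bar> powr \<alpha> \<le> \<bar>p x\<bar>"
    proof (cases "x \<le> \<epsilon>")
      case True
      have "\<bar>p x\<bar> = \<bar>x - a\<bar> powr \<alpha> * (h x / ?G)"
        using True G x h_pos[of x] by (auto simp: p_left abs_mult abs_sgn_eq)
      also have "\<dots> \<ge> \<bar>x - a\<bar> powr \<alpha> * (c / ?G)"
        using h(2)[of x] x True G by (intro mult_left_mono divide_right_mono) auto
      finally have "\<bar>x - a\<bar> powr \<alpha> * (c / ?G) \<le> \<bar>p x\<bar>" .
      moreover have "\<bar>x - a\<bar> powr \<alpha> * min (c / ?G) (1/6) \<le> \<bar>x - a\<bar> powr \<alpha> * (c / ?G)"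
        by (intro mult_left_mono) auto
      ultimately show ?thesis by (simp add: mult.commute)
    next
      case False
      then have "p x = 1 / 6" using x eps by (intro p_middle) auto
      moreover have "min (c / ?G) (1 / 6) * \<bar>x - a\<bar> powr \<alpha> \<le> (1/6) * 1"
        using le1[of x] x h G by (intro mult_mono) auto
      ultimately show ?thesis by simp
    qed
    show "\<bar>w x\<bar> \<le> max (12 * C / ?G) 2 * \<bar>x - a\<bar> powr (\<alpha> - 1)"
    proof (cases "x \<le> \<epsilon>")
      case True
      have abs: "\<bar>x - 4 * \<epsilon> + a\<bar> \<ge> \<epsilon>" using True x0_bounds eps by (simp add: abs_if)
      have "\<bar>w x\<bar> = (\<bar>x - a\<bar> powr \<alpha> / \<bar>x - a\<bar>) * (h x / ?G) * (12 * \<epsilon>\<^sup>2 / \<bar>x - 4 * \<epsilon> + a\<bar>)"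
        using True G x h_pos[of x] by (simp add: w1_def p_left phi2_left abs_mult abs_sgn_eq abs_divide)
      also have "\<bar>x - a\<bar> powr \<alpha> / \<bar>x - a\<bar> = \<bar>x - a\<bar> powr (\<alpha> - 1)"
        using x by (simp add: powr_diff)
      also have "\<bar>x - a\<bar> powr (\<alpha> - 1) * (h x / ?G) * (12 * \<epsilon>\<^sup>2 / \<bar>x - 4 * \<epsilon> + a\<bar>)
          \<le> \<bar>x - a\<bar> powr (\<alpha> - 1) * (C / ?G) * 12"
      proof (intro mult_mono mult_left_mono divide_right_mono)
        have "\<epsilon>\<^sup>2 \<le> 1 * \<bar>x - 4 * \<epsilon> + a\<bar>"
          unfolding power2_eq_square using abs eps by (intro mult_mono) auto
        then show "12 * \<epsilon>\<^sup>2 / \<bar>x - 4 * \<epsilon> + a\<bar> \<le> 12" using abs eps by (simp add: field_simps)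
      qed (use h(3)[of x] h(4) x True G h_pos[of x] in auto)
      also have "\<dots> = (12 * C / ?G) * \<bar>x - a\<bar> powr (\<alpha> - 1)" by simp
      also have "\<dots> \<le> max (12 * C / ?G) 2 * \<bar>x - a\<bar> powr (\<alpha> - 1)" by (intro mult_right_mono) auto
      finally show ?thesis .
    next
      case False
      then have "w x = 1" using x eps p_middle[of x] phi2_middle[of x] by (auto simp: w1_def)
      moreover have "1 \<le> \<bar>x - a\<bar> powr (\<alpha> - 1)"
      proof -
        have "\<bar>x - a\<bar> powr (1 - \<alpha>) \<le> 1" using x x0_bounds alpha_bounds by (intro powr_le1) auto
        moreover have "0 < \<bar>x - a\<bar> powr (1 - \<alpha>)" using x by simp
        ultimately have "1 \<le> inverse (\<bar>x - a\<bar> powr (1 - \<alpha>))" by (simp add: one_le_inverse_iff)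
        then show ?thesis by (simp add: powr_minus[symmetric])
      qed
      then have "2 * 1 \<le> max (12 * C / ?G) 2 * \<bar>x - a\<bar> powr (\<alpha> - 1)"
        by (intro mult_mono) auto
      ultimately show ?thesis by simp
    qed
  next
    fix x :: real assume x: "x \<in> {0..1/2}"
    show "\<bar>p x\<bar> \<le> max (12 * C / ?G) 2"
    proof (cases "x \<le> \<epsilon>")
      case True
      have "\<bar>p x\<bar> = \<bar>sgn (x - a)\<bar> * (\<bar>x - a\<bar> powr \<alpha> * (h x / ?G))"
        using True G x h_pos[of x] by (auto simp: p_left abs_mult)
      also have "\<dots> \<le> 1 * (1 * (C / ?G))"
        using h(3)[of x] h(4) x True G le1 h_pos[of x] by (intro mult_mono divide_right_mono) (auto simp: abs_sgn_eq)
      also have "\<dots> \<le> 12 * C / ?G" using h(4) G by (simp add: field_simps)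
      finally show ?thesis by simp
    next
      case False
      then have "p x = 1 / 6" using x eps by (intro p_middle) auto
      then show ?thesis by simp
    qed
  qed
qed

lemma p_bounded: obtains C where "0 < C" "\<And>x. x \<in> {0..1} \<Longrightarrow> \<bar>p x\<bar> \<le> C"
proof -
  obtain C where C: "0 < C" "\<And>x. x \<in> {0..1/2} \<Longrightarrow> \<bar>p x\<bar> \<le> C" by (rule p_half_bounds) blast
  show ?thesis
  proof (rule that[OF C(1)])
    fix x :: real assume "x \<in> {0..1}"
    then show "\<bar>p x\<bar> \<le> C" using C(2)[of x] C(2)[of "1 - x"] p_symmetric[of x] by (cases "x \<le> 1/2") auto
  qed
qed

lemma p_nonzero: "x \<in> {0..1} - {a, b} \<Longrightarrow> p x \<noteq> 0"
proof (rule reflect_half[where P = "\<lambda>x. p x \<noteq> 0"])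
  obtain c where c: "0 < c" "\<And>x. x \<in> {0..1/2} - {a} \<Longrightarrow> c * \<bar>x - a\<bar> powr \<alpha> \<le> \<bar>p x\<bar>" by (rule p_half_bounds) blast
  show "p x \<noteq> 0" if "x \<in> {0..1/2} - {a}" for x
    using c(2)[OF that] c(1) that by (auto simp: mult_le_0_iff)
qed (simp_all add: p_symmetric)

text \<open>At \<open>a\<close> both functions change sign simultaneously: \<open>p\<close> has the
  sign of \<open>x - a\<close>, and \<open>phi2\<close> the opposite one, because its second linear
  factor is negative on \<open>{0..\<epsilon>}\<close>. Hence the weight \<open>w\<close> is
  positive even where \<open>p\<close> is negative.\<close>

lemma phi2_p_sign: "x \<in> {0..1} - {a, b} \<Longrightarrow> phi2 \<epsilon> x * p x < 0"
proof (rule reflect_half[where P = "\<lambda>x. phi2 \<epsilon> x * p x < 0"])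
  fix x assume x: "x \<in> {0..1/2} - {a}"
  show "phi2 \<epsilon> x * p x < 0"
  proof (cases "x \<le> \<epsilon>")
    case True
    have "0 < h x" using h_pos x True by simp
    moreover have "x - 4 * \<epsilon> + a < 0" using True x0_bounds eps by simp
    moreover have "phi2 \<epsilon> x * p x = (\<bar>x - a\<bar> * \<bar>x - a\<bar> powr \<alpha> * h x) / (12 * \<epsilon>\<^sup>2 * (6 * g \<epsilon> \<epsilon>)) * (x - 4 * \<epsilon> + a)"
    proof -
      have "(x - a) * sgn (x - a) = \<bar>x - a\<bar>" by (rule abs_sgn[symmetric])
      then show ?thesis unfolding phi2_left[OF True] p_left[OF True] by (simp add: mult_ac)
    qed
    moreover have "0 < (\<bar>x - a\<bar> * \<bar>x - a\<bar> powr \<alpha> * h x) / (12 * \<epsilon>\<^sup>2 * (6 * g \<epsilon> \<epsilon>))"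
      using x eps g_eps_pos calculation by (intro divide_pos_pos mult_pos_pos) auto
    ultimately show ?thesis using mult_pos_neg by metis
  next
    case False
    then show ?thesis using x eps p_middle[of x] phi2_middle[of x] by auto
  qed
qed (simp_all add: p_symmetric phi2_symmetric)

lemma phi2_nonzero: "x \<in> {0..1} - {a, b} \<Longrightarrow> phi2 \<epsilon> x \<noteq> 0"
  using phi2_p_sign by force

lemma w_pos: "x \<in> {0..1} - {a, b} \<Longrightarrow> 0 < w x"
  using phi2_p_sign[of x] by (auto simp: w1_def zero_less_divide_iff divide_less_0_iff mult_less_0_iff)

lemma p_pos: "x \<in> {a<..<b} \<Longrightarrow> 0 < p x"
  using p_pos_iff[of x] x0_bounds by auto

lemma continuous_on_phi2: "continuous_on {0..1} (phi2 \<epsilon>)"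
proof -
  have "1 / 12 * (1 - 4 * (x / \<epsilon>) + (x / \<epsilon>)\<^sup>2) = - 1 / 6" if "x = \<epsilon>" for x
    using eps that by simp
  moreover have "1 / 12 * (1 - 4 * ((1 - x) / \<epsilon>) + ((1 - x) / \<epsilon>)\<^sup>2) = - 1 / 6" if "x = 1 - \<epsilon>" for x
    using eps that by simp
  ultimately show ?thesis
    unfolding phi2_def[abs_def] using eps
    by (intro continuous_on_cases_le) (auto intro!: continuous_intros)
qed

lemma continuous_on_p: "continuous_on ({0..1} - {a, b}) p"
proof -
  have gc: "continuous_on ({0..\<epsilon>} - {a}) (g \<epsilon>)"
  proof -
    have "continuous_on ({0..\<epsilon>} - {a}) (\<lambda>x. sgn (x - a) * \<bar>x - a\<bar> powr \<alpha> * h x)"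
      by (intro continuous_intros continuous_on_subset[OF continuous_on_h]) auto
    then show ?thesis by (simp add: g_eq[abs_def])
  qed
  have "continuous_on {x \<in> {x \<in> {0..1} - {a, b}. \<epsilon> \<le> x}. 1 - \<epsilon> \<le> x} (\<lambda>x. g \<epsilon> (1 - x))"
    by (rule continuous_on_compose2[OF gc]) (auto intro!: continuous_intros)
  then show ?thesis
    unfolding p1_def[abs_def] using eps g_eps_pos
    by (intro continuous_on_cases_le continuous_intros continuous_on_subset[OF gc]) auto
qed

lemma continuous_on_w: "continuous_on ({0..1} - {a, b}) w"
  unfolding w1_def[abs_def]
  by (intro continuous_intros continuous_on_p continuous_on_subset[OF continuous_on_phi2]) (use phi2_nonzero in auto)

lemma sing_measurable:
  fixes f :: "real \<Rightarrow> real"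
  assumes "continuous_on ({0..1} - {a, b}) f"
  shows "f \<in> borel_measurable (lebesgue_on {0..1/2})"
proof -
  have "continuous_on ({0..1/2} - {a}) f"
    using x0_bounds by (intro continuous_on_subset[OF assms]) auto
  then have "f \<in> borel_measurable (lebesgue_on ({0..1/2} - {a}))"
    by (intro continuous_imp_measurable_on_sets_lebesgue) auto
  then have "f measurable_on ({0..1/2} - {a})" by (subst measurable_on_iff_borel_measurable) auto
  then have "f measurable_on {0..1/2}" by (rule measurable_on_spike_set) (auto intro: negligible_subset[of "{a}"])
  then show ?thesis by (subst measurable_on_iff_borel_measurable[symmetric]) auto
qed

lemma inverse_p_integrable: "(\<lambda>x. 1 / p x) absolutely_integrable_on {0..1}"
proof (rule absolutely_integrable_symmetric)
  obtain c where c: "0 < c" "\<And>x. x \<in> {0..1/2} - {a} \<Longrightarrow> c * \<bar>x - a\<bar> powr \<alpha> \<le> \<bar>p x\<bar>" by (rule p_half_bounds) blast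
  have "(\<lambda>x. \<bar>x - a\<bar> powr (- \<alpha>)) absolutely_integrable_on {0..1/2}"
    using alpha_bounds x0_bounds by (intro absolutely_integrable_powr_dist) auto
  then have i: "(\<lambda>x. (1 / c) * \<bar>x - a\<bar> powr (- \<alpha>)) integrable_on {0..1/2}"
    by (intro integrable_on_mult_right) (simp add: absolutely_integrable_on_def)
  show "(\<lambda>x. 1 / p x) absolutely_integrable_on {0..1/2}"
  proof (rule measurable_bounded_by_integrable_imp_absolutely_integrable[OF _ _ i])
    show "(\<lambda>x. 1 / p x) \<in> borel_measurable (lebesgue_on {0..1/2})"
      using p_nonzero by (intro sing_measurable continuous_intros continuous_on_p) auto
    fix x :: real assume x: "x \<in> {0..1/2}"
    show "norm (1 / p x) \<le> 1 / c * \<bar>x - a\<bar> powr - \<alpha>"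
    proof (cases "x = a")
      case False
      then have "1 / \<bar>p x\<bar> \<le> 1 / (c * \<bar>x - a\<bar> powr \<alpha>)"
        using c(1) c(2)[of x] x by (intro divide_left_mono) (auto intro!: mult_pos_pos simp: p_zero intro: less_le_trans[rotated, OF c(2)])
      then show ?thesis by (simp add: powr_minus field_simps)
    \<comment> \<open>At \<open>x = a\<close> both sides are 0, since \<open>1 / 0 = 0\<close> and
      \<open>0 powr r = 0\<close>.\<close>
    qed (simp add: p_zero)
  qed simp
qed (simp add: p_symmetric)

lemma w_integrable: "w absolutely_integrable_on {0..1}"
proof (rule absolutely_integrable_symmetric)
  obtain C where C: "0 < C" "\<And>x. x \<in> {0..1/2} - {a} \<Longrightarrow> \<bar>w x\<bar> \<le> C * \<bar>x - a\<bar> powr (\<alpha> - 1)" by (rule p_half_bounds) blast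
  have "(\<lambda>x. \<bar>x - a\<bar> powr (\<alpha> - 1)) absolutely_integrable_on {0..1/2}"
    using alpha_bounds x0_bounds by (intro absolutely_integrable_powr_dist) auto
  then have i: "(\<lambda>x. C * \<bar>x - a\<bar> powr (\<alpha> - 1)) integrable_on {0..1/2}"
    by (intro integrable_on_mult_right) (simp add: absolutely_integrable_on_def)
  show "w absolutely_integrable_on {0..1/2}"
  proof (rule measurable_bounded_by_integrable_imp_absolutely_integrable[OF _ _ i])
    show "w \<in> borel_measurable (lebesgue_on {0..1/2})"
      by (intro sing_measurable continuous_on_w)
    fix x :: real assume x: "x \<in> {0..1/2}"
    show "norm (w x) \<le> C * \<bar>x - a\<bar> powr (\<alpha> - 1)"
      using C(2)[of x] x C(1) by (cases "x = a") (auto simp: w1_def p_zero)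
  qed simp
qed (simp add: w_symmetric)

text \<open>Outside \<open>sing\<close> the coefficients are locally given by smooth formulas.\<close>

definition sing :: "real set" where "sing = {0, a, \<epsilon>, 1 - \<epsilon>, b, 1}"

text \<open>Partial fractions of \<open>phi1 / phi2\<close> give the logarithmic derivative of \<open>g\<close>.\<close>

lemma p_deriv_left:
  assumes x: "0 < x" "x < \<epsilon>" "x \<noteq> a"
  shows "(p has_real_derivative p x * phi1 \<epsilon> x / phi2 \<epsilon> x) (at x)"
proof -
  let ?s3 = "sqrt 3"
  define b' where "b' = (4 - 2 * ?s3) * \<epsilon>"
  \<comment> \<open>The sum of the logarithmic derivatives of the factors of
    \<open>g\<close>.\<close>
  define L where "L = \<alpha> / (x - a) + b' / (x - 4 * \<epsilon> + a) - 8 * \<epsilon> / (x + \<epsilon>)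
     - 24 * \<epsilon>^3 / (x + \<epsilon>)^3 - 12 * \<epsilon>^2 / (x + \<epsilon>)^2"
  have neg: "x - 4 * \<epsilon> + a < 0" using x x0_bounds by simp
  have pos: "x + \<epsilon> > 0" using x eps by simp
  let ?s = "sgn (x - a)"
  have s: "?s * ?s = 1" "?s * (x - a) > 0" using x by (auto simp: sgn_if)
  \<comment> \<open>Near \<open>x\<close> the sign of \<open>y - a\<close> is constant; replacing
    \<open>sgn\<close> and the absolute values accordingly gives an expression that can be
    differentiated termwise.\<close>
  define F where "F y = ?s * (?s * (y - a)) powr \<alpha> * ((4 * \<epsilon> - a - y) powr b' * (y + \<epsilon>) powr (- 8 * \<epsilon>)
     * exp (12 * \<epsilon>^3 / (\<epsilon> + y)^2 + 12 * \<epsilon>^2 / (\<epsilon> + y))) / (6 * g \<epsilon> \<epsilon>)" for y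
  have dF: "(F has_real_derivative F x * L) (at x)"
  proof -
    have d1: "((\<lambda>y. (?s * (y - a)) powr \<alpha>) has_real_derivative (?s * (x - a)) powr \<alpha> * (\<alpha> * ?s / (?s * (x - a)))) (at x)"
      using s by (intro has_real_derivative_powr_log) (auto intro!: derivative_eq_intros)
    have d2: "((\<lambda>y. (4 * \<epsilon> - a - y) powr b') has_real_derivative (4 * \<epsilon> - a - x) powr b' * (b' * (- 1) / (4 * \<epsilon> - a - x))) (at x)"
      using neg by (intro has_real_derivative_powr_log) (auto intro!: derivative_eq_intros)
    have d3: "((\<lambda>y. (y + \<epsilon>) powr (- 8 * \<epsilon>)) has_real_derivative (x + \<epsilon>) powr (- 8 * \<epsilon>) * ((- 8 * \<epsilon>) * 1 / (x + \<epsilon>))) (at x)"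
      using pos by (intro has_real_derivative_powr_log) (auto intro!: derivative_eq_intros)
    define t where "t = \<epsilon> + x"
    have t: "t \<noteq> 0" using pos by (simp add: t_def)
    have "((\<lambda>y. 12 * \<epsilon>^3 / (\<epsilon> + y)^2 + 12 * \<epsilon>^2 / (\<epsilon> + y)) has_real_derivative
        (0 * t^2 - 12 * \<epsilon>^3 * (2 * t)) / (t^2 * t^2) + (0 * t - 12 * \<epsilon>^2 * 1) / (t * t)) (at x)"
      using pos unfolding t_def by (auto intro!: derivative_eq_intros simp: add.commute)
    also have "(0 * t^2 - 12 * \<epsilon>^3 * (2 * t)) / (t^2 * t^2) + (0 * t - 12 * \<epsilon>^2 * 1) / (t * t)
        = - 24 * \<epsilon>^3 / t^3 - 12 * \<epsilon>^2 / t^2"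
      using t by (simp add: power2_eq_square power3_eq_cube)
    finally have d4: "((\<lambda>y. exp (12 * \<epsilon>^3 / (\<epsilon> + y)^2 + 12 * \<epsilon>^2 / (\<epsilon> + y))) has_real_derivative
        exp (12 * \<epsilon>^3 / (\<epsilon> + x)^2 + 12 * \<epsilon>^2 / (\<epsilon> + x)) * (- 24 * \<epsilon>^3 / t^3 - 12 * \<epsilon>^2 / t^2)) (at x)"
      by (rule DERIV_fun_exp)
    have F: "F = (\<lambda>y. (?s / (6 * g \<epsilon> \<epsilon>)) * ((?s * (y - a)) powr \<alpha> * ((4 * \<epsilon> - a - y) powr b' * (y + \<epsilon>) powr (- 8 * \<epsilon>)
        * exp (12 * \<epsilon>^3 / (\<epsilon> + y)^2 + 12 * \<epsilon>^2 / (\<epsilon> + y)))))"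
      by (simp add: F_def fun_eq_iff)
    have "\<alpha> * ?s / (?s * (x - a)) = \<alpha> / (x - a)" "b' * (- 1) / (4 * \<epsilon> - a - x) = b' / (x - 4 * \<epsilon> + a)"
      using s neg by (auto simp: divide_simps) (simp add: algebra_simps)
    then have L: "L = \<alpha> * ?s / (?s * (x - a)) +
         (b' * (- 1) / (4 * \<epsilon> - a - x) + (- 8 * \<epsilon>) * 1 / (x + \<epsilon>) + (- 24 * \<epsilon>^3 / t^3 - 12 * \<epsilon>^2 / t^2))"
      by (simp add: L_def t_def add.commute)
    have "(F has_real_derivative (?s / (6 * g \<epsilon> \<epsilon>)) * ((?s * (x - a)) powr \<alpha> * ((4 * \<epsilon> - a - x) powr b' * (x + \<epsilon>) powr (- 8 * \<epsilon>)
        * exp (12 * \<epsilon>^3 / (\<epsilon> + x)^2 + 12 * \<epsilon>^2 / (\<epsilon> + x))) * L)) (at x)"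
      unfolding F L by (intro DERIV_cmult logderiv_mult d1 d2 d3 d4)
    then show ?thesis by (simp add: F mult.assoc)
  qed
  have ev: "\<forall>\<^sub>F y in nhds x. p y = F y"
  proof -
    have "\<forall>\<^sub>F y in nhds x. y \<in> {..<\<epsilon>}" using x by (intro eventually_nhds_in_open) auto
    moreover have "\<forall>\<^sub>F y in nhds x. y \<in> {0<..}" using x by (intro eventually_nhds_in_open) auto
    moreover have "\<forall>\<^sub>F y in nhds x. ?s * (y - a) > 0"
    proof -
      have "open {y. 0 < ?s * (y - a)}" by (intro open_Collect_less continuous_intros)
      then show ?thesis using s eventually_nhds_in_open[of "{y. 0 < ?s * (y - a)}" x] by simp
    qed
    ultimately show ?thesis
    proof eventually_elim
      case (elim y)
      then have "sgn (y - a) = ?s" "\<bar>y - a\<bar> = ?s * (y - a)"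
        using x by (auto simp: sgn_if mult_less_0_iff zero_less_mult_iff split: if_splits)
      moreover have "\<bar>y - 4 * \<epsilon> + a\<bar> = 4 * \<epsilon> - a - y" using elim x0_bounds by simp
      ultimately show ?case using elim by (simp add: p_left h_def F_def b'_def)
    qed
  qed
  have "(p has_real_derivative F x * L) (at x)"
    using dF ev DERIV_cong_ev by blast
  moreover have "F x = p x" using ev by (auto dest: eventually_nhds_x_imp_x)
  moreover have "L = phi1 \<epsilon> x / phi2 \<epsilon> x"
  proof -
    define q where "q = (x - a) * (x - 4 * \<epsilon> + a)"
    \<comment> \<open>\<open>a\<close> is a root of
      \<open>t\<^sup>2 - 4 * \<epsilon> * t + \<epsilon>\<^sup>2\<close>, which removes the square
      root from the common denominator \<open>q\<close>.\<close>
    have a2: "a * a = 4 * \<epsilon> * a - \<epsilon> * \<epsilon>"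
      using sqrt3(3) by (simp add: x0_def algebra_simps)
    then have q: "q = x * x - 4 * \<epsilon> * x + \<epsilon> * \<epsilon>" by (simp add: q_def algebra_simps)
    have q0: "q \<noteq> 0" using x neg by (simp add: q_def)
    have "\<alpha> * (x - 4 * \<epsilon> + a) + b' * (x - a) = \<epsilon> * (8 * x - 28 * \<epsilon>)"
      using sqrt3(3) by (simp add: \<alpha>_def b'_def x0_def algebra_simps)
    moreover have "\<alpha> / (x - a) + b' / (x - 4 * \<epsilon> + a) = (\<alpha> * (x - 4 * \<epsilon> + a) + b' * (x - a)) / q"
      using x neg by (simp add: q_def add_frac_eq)
    ultimately have "L = \<epsilon> * (8 * x - 28 * \<epsilon>) / q - 8 * \<epsilon> / (x + \<epsilon>) - 24 * \<epsilon>^3 / (x + \<epsilon>)^3 - 12 * \<epsilon>^2 / (x + \<epsilon>)^2"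
      by (simp add: L_def)
    also have "\<dots> = (\<epsilon> * (8 * x - 28 * \<epsilon>) * (x + \<epsilon>)^3 - (8 * \<epsilon> * (x + \<epsilon>)^2 + 24 * \<epsilon>^3 + 12 * \<epsilon>^2 * (x + \<epsilon>)) * q) / (q * (x + \<epsilon>)^3)"
    proof -
      have frac: "A / q - B / t - C / t^3 - D / t^2 = (A * t^3 - (B * t^2 + C + D * t) * q) / (q * t^3)"
        if "t \<noteq> 0" for A B C D t :: real
        using q0 that by (simp add: field_simps power2_eq_square power3_eq_cube)
      show ?thesis using pos by (intro frac) auto
    qed
    \<comment> \<open>All terms of degree two or more in \<open>x\<close> cancel. The coefficients
      in \<open>g\<close> are tuned for this.\<close>
    also have "\<epsilon> * (8 * x - 28 * \<epsilon>) * (x + \<epsilon>)^3 - (8 * \<epsilon> * (x + \<epsilon>)^2 + 24 * \<epsilon>^3 + 12 * \<epsilon>^2 * (x + \<epsilon>)) * q = - 72 * \<epsilon>^4 * (\<epsilon> - x)"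
      unfolding q by (simp add: algebra_simps power2_eq_square power3_eq_cube power4_eq_xxxx)
    also have "- 72 * \<epsilon>^4 * (\<epsilon> - x) / (q * (x + \<epsilon>)^3) = phi1 \<epsilon> x / phi2 \<epsilon> x"
    proof -
      have "phi2 \<epsilon> x = q / (12 * \<epsilon>\<^sup>2)" using x by (simp add: phi2_left q_def)
      moreover have "phi1 \<epsilon> x = - 6 * \<epsilon>^2 * (\<epsilon> - x) / (x + \<epsilon>)^3"
      proof -
        have neg6: "- 6 * u / v = - (6 * u / v)" for u v :: real by simp
        have "1 + x / \<epsilon> = (x + \<epsilon>) / \<epsilon>" "1 - x / \<epsilon> = (\<epsilon> - x) / \<epsilon>" using eps by (auto simp: field_simps)
        then have "phi1 \<epsilon> x = - (6 * ((\<epsilon> - x) / \<epsilon>) / ((x + \<epsilon>) / \<epsilon>)^3)" using x neg6 by (simp only: phi1_def less_imp_le if_True)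
        then show ?thesis using x pos eps by (simp add: power_divide power2_eq_square power3_eq_cube)
      qed
      ultimately show ?thesis using q0 pos eps by (simp add: power2_eq_square power4_eq_xxxx mult_ac)
    qed
    finally show ?thesis .
  qed
  ultimately show ?thesis by simp
qed

text \<open>This says that \<open>p / phi2\<close> is the integrating factor:
  \<open>(p u')' = (p / phi2) * (phi2 u'' + phi1 u') = - w * D u\<close>, the link between the
  operator and its Sturm--Liouville form.\<close>

lemma p_deriv: "x \<in> {0..1} - sing \<Longrightarrow> (p has_real_derivative p x * phi1 \<epsilon> x / phi2 \<epsilon> x) (at x)"
proof -
  assume x: "x \<in> {0..1} - sing"
  consider "x < \<epsilon>" | "\<epsilon> < x" "x < 1 - \<epsilon>" | "1 - \<epsilon> < x" using x by (force simp: sing_def)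
  then show ?thesis
  proof cases
    case 1 then show ?thesis using x by (intro p_deriv_left) (auto simp: sing_def)
  next
    case 2
    have "\<forall>\<^sub>F y in nhds x. y \<in> {\<epsilon><..<1-\<epsilon>}" using 2 by (intro eventually_nhds_in_open) auto
    then have "\<forall>\<^sub>F y in nhds x. p y = (\<lambda>_. 1 / 6) y" by eventually_elim (simp add: p_middle)
    then have "(p has_real_derivative 0) (at x)"
      by (rule DERIV_cong_ev[OF refl _ refl, THEN iffD2]) simp
    moreover have "phi1 \<epsilon> x = 0" using 2 by (simp add: phi1_def)
    ultimately show ?thesis by simp
  next
    case 3
    have "(p has_real_derivative p (1 - x) * phi1 \<epsilon> (1 - x) / phi2 \<epsilon> (1 - x)) (at (1 - x))"
      using x 3 by (intro p_deriv_left) (auto simp: sing_def)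
    then have "((\<lambda>x. p (1 - x)) has_real_derivative (p (1 - x) * phi1 \<epsilon> (1 - x) / phi2 \<epsilon> (1 - x)) * (- 1)) (at x)"
      by (rule DERIV_chain2) (auto intro!: derivative_eq_intros)
    then show ?thesis by (simp add: p_symmetric phi2_symmetric phi1_antisymmetric)
  qed
qed

end

section \<open>Weighted square-integrable functions\<close>

definition wl2 :: "'a measure \<Rightarrow> ('a \<Rightarrow> real) \<Rightarrow> ('a \<Rightarrow> complex) set" where
  "wl2 M \<rho> = {f \<in> borel_measurable M. integrable M (\<lambda>x. \<rho> x * (norm (f x))\<^sup>2)}"

definition wl2_inner :: "'a measure \<Rightarrow> ('a \<Rightarrow> real) \<Rightarrow> ('a \<Rightarrow> complex) \<Rightarrow> ('a \<Rightarrow> complex) \<Rightarrow> complex" where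
  "wl2_inner M \<rho> f h = (LINT x|M. f x * cnj (h x) * complex_of_real (\<rho> x))"

lemma norm_sum_square_le: "(norm (x + y))\<^sup>2 \<le> 2 * (norm x)\<^sup>2 + 2 * (norm (y::complex))\<^sup>2"
proof -
  have "(norm (x + y))\<^sup>2 \<le> (norm x + norm y)\<^sup>2" by (intro power_mono norm_triangle_ineq) auto
  also have "\<dots> \<le> 2 * (norm x)\<^sup>2 + 2 * (norm y)\<^sup>2"
    using sum_squares_bound[of "norm x" "norm y"] by (simp add: power2_sum)
  finally show ?thesis .
qed

text \<open>Used twice, with weight \<open>w\<close> for functions and with weight \<open>p\<close>
  for their derivatives. Strict positivity of the weight makes a null vector the same as a function
  vanishing almost everywhere.\<close>

locale weighted_measure =
  fixes M :: "real measure" and \<rho> :: "real \<Rightarrow> real"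
  assumes \<rho>_meas: "\<rho> \<in> borel_measurable M" and \<rho>_pos: "\<And>x. x \<in> space M \<Longrightarrow> 0 < \<rho> x"
begin

lemma wl2_add: "f \<in> wl2 M \<rho> \<Longrightarrow> h \<in> wl2 M \<rho> \<Longrightarrow> f + h \<in> wl2 M \<rho>"
proof -
  assume f: "f \<in> wl2 M \<rho>" and h: "h \<in> wl2 M \<rho>"
  have meas: "(\<lambda>x. f x + h x) \<in> borel_measurable M" using f h by (auto simp: wl2_def)
  have "integrable M (\<lambda>x. \<rho> x * (norm (f x + h x))\<^sup>2)"
  proof (rule Bochner_Integration.integrable_bound)
    show "integrable M (\<lambda>x. 2 * (\<rho> x * (norm (f x))\<^sup>2) + 2 * (\<rho> x * (norm (h x))\<^sup>2))"
      using f h by (auto simp: wl2_def)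
    show "(\<lambda>x. \<rho> x * (norm (f x + h x))\<^sup>2) \<in> borel_measurable M" using meas \<rho>_meas by auto
    show "AE x in M. norm (\<rho> x * (norm (f x + h x))\<^sup>2) \<le> norm (2 * (\<rho> x * (norm (f x))\<^sup>2) + 2 * (\<rho> x * (norm (h x))\<^sup>2))"
    proof (rule AE_I2)
      fix x assume "x \<in> space M"
      then have r: "0 < \<rho> x" by (rule \<rho>_pos)
      have "\<rho> x * (norm (f x + h x))\<^sup>2 \<le> \<rho> x * (2 * (norm (f x))\<^sup>2 + 2 * (norm (h x))\<^sup>2)"
        using r norm_sum_square_le by (intro mult_left_mono) auto
      then show "norm (\<rho> x * (norm (f x + h x))\<^sup>2) \<le> norm (2 * (\<rho> x * (norm (f x))\<^sup>2) + 2 * (\<rho> x * (norm (h x))\<^sup>2))"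
        using r by (simp add: algebra_simps)
    qed
  qed
  with meas show ?thesis by (simp add: wl2_def plus_fun_def)
qed

lemma wl2_scale: "f \<in> wl2 M \<rho> \<Longrightarrow> fscale c f \<in> wl2 M \<rho>"
proof -
  assume f: "f \<in> wl2 M \<rho>"
  have "(\<lambda>x. \<rho> x * (norm (c * f x))\<^sup>2) = (\<lambda>x. (norm c)\<^sup>2 * (\<rho> x * (norm (f x))\<^sup>2))"
    by (simp add: norm_mult power_mult_distrib mult_ac)
  with f show ?thesis by (auto simp: wl2_def fscale_def)
qed

lemma wl2_zero: "0 \<in> wl2 M \<rho>"
  by (simp add: wl2_def zero_fun_def)

lemma wl2_inner_measurable:
  assumes "f \<in> borel_measurable M" "h \<in> borel_measurable M"
  shows "(\<lambda>x. f x * cnj (h x) * complex_of_real (\<rho> x)) \<in> borel_measurable M"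
proof -
  have "(\<lambda>x. cnj (h x)) \<in> borel_measurable M"
    by (rule borel_measurable_continuous_on[OF _ assms(2)]) (intro continuous_intros)
  moreover have "(\<lambda>x. complex_of_real (\<rho> x)) \<in> borel_measurable M"
    by (rule borel_measurable_continuous_on[OF _ \<rho>_meas]) (intro continuous_intros)
  ultimately show ?thesis using assms(1) by (intro borel_measurable_times)
qed

lemma wl2_inner_integrable:
  assumes f: "f \<in> wl2 M \<rho>" and h: "h \<in> wl2 M \<rho>"
  shows "integrable M (\<lambda>x. f x * cnj (h x) * complex_of_real (\<rho> x))"
proof (rule Bochner_Integration.integrable_bound)
  show "integrable M (\<lambda>x. \<rho> x * (norm (f x))\<^sup>2 + \<rho> x * (norm (h x))\<^sup>2)"
    using f h by (auto simp: wl2_def)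
  show "(\<lambda>x. f x * cnj (h x) * complex_of_real (\<rho> x)) \<in> borel_measurable M"
    using f h by (intro wl2_inner_measurable) (auto simp: wl2_def)
  show "AE x in M. norm (f x * cnj (h x) * complex_of_real (\<rho> x)) \<le> norm (\<rho> x * (norm (f x))\<^sup>2 + \<rho> x * (norm (h x))\<^sup>2)"
  proof (rule AE_I2)
    fix x assume "x \<in> space M"
    then have r: "0 < \<rho> x" by (rule \<rho>_pos)
    have "norm (f x) * norm (h x) \<le> (norm (f x))\<^sup>2 + (norm (h x))\<^sup>2"
      using sum_squares_bound[of "norm (f x)" "norm (h x)"] mult_nonneg_nonneg[OF norm_ge_zero norm_ge_zero, of "f x" "h x"]
      by linarith
    then have "\<rho> x * (norm (f x) * norm (h x)) \<le> \<rho> x * ((norm (f x))\<^sup>2 + (norm (h x))\<^sup>2)"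
      using r by (intro mult_left_mono) auto
    then show "norm (f x * cnj (h x) * complex_of_real (\<rho> x)) \<le> norm (\<rho> x * (norm (f x))\<^sup>2 + \<rho> x * (norm (h x))\<^sup>2)"
      using r by (simp add: norm_mult algebra_simps)
  qed
qed

lemma wl2_inner_self: "wl2_inner M \<rho> f f = of_real (LINT x|M. \<rho> x * (norm (f x))\<^sup>2)"
proof -
  have "f x * cnj (f x) * complex_of_real (\<rho> x) = of_real (\<rho> x * (norm (f x))\<^sup>2)" for x
    unfolding of_real_mult complex_norm_square by (simp add: mult_ac)
  then show ?thesis unfolding wl2_inner_def by (simp only: integral_complex_of_real)
qed

sublocale psd_form fscale "wl2 M \<rho>" "wl2_inner M \<rho>"
proof (intro psd_form.intro psd_form_axioms.intro vector_space_fscale)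
  interpret vector_space fscale by (rule vector_space_fscale)
  show "subspace (wl2 M \<rho>)"
    by (rule subspaceI) (auto intro: wl2_add wl2_scale wl2_zero)
next
  fix x y z assume "x \<in> wl2 M \<rho>" "y \<in> wl2 M \<rho>" "z \<in> wl2 M \<rho>"
  then show "wl2_inner M \<rho> (x + y) z = wl2_inner M \<rho> x z + wl2_inner M \<rho> y z"
    unfolding wl2_inner_def plus_fun_def
    by (simp add: distrib_right wl2_inner_integrable)
next
  fix x z c assume "x \<in> wl2 M \<rho>" "z \<in> wl2 M \<rho>"
  show "wl2_inner M \<rho> (fscale c x) z = c * wl2_inner M \<rho> x z"
    unfolding wl2_inner_def fscale_def by (simp add: mult.assoc)
next
  fix x y assume "x \<in> wl2 M \<rho>" "y \<in> wl2 M \<rho>"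
  have "cnj (wl2_inner M \<rho> x y) = (LINT z|M. cnj (x z * cnj (y z) * complex_of_real (\<rho> z)))"
    unfolding wl2_inner_def by (subst Bochner_Integration.integral_cnj) (rule refl)
  then show "wl2_inner M \<rho> y x = cnj (wl2_inner M \<rho> x y)"
    unfolding wl2_inner_def by (simp add: mult_ac)
next
  fix x assume "x \<in> wl2 M \<rho>"
  show "0 \<le> Re (wl2_inner M \<rho> x x)"
    unfolding wl2_inner_self using \<rho>_pos by (auto intro!: integral_nonneg_AE AE_I2 simp: less_imp_le)
qed

lemma wl2_norm: "Q f = (LINT x|M. \<rho> x * (norm (f x))\<^sup>2)"
  by (simp add: wl2_inner_self)

lemma wl2_norm_zero_iff: "f \<in> wl2 M \<rho> \<Longrightarrow> Q f = 0 \<longleftrightarrow> (AE x in M. f x = 0)"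
proof -
  assume f: "f \<in> wl2 M \<rho>"
  have "Q f = 0 \<longleftrightarrow> (AE x in M. \<rho> x * (norm (f x))\<^sup>2 = 0)"
    unfolding wl2_norm using f \<rho>_pos
    by (intro integral_nonneg_eq_0_iff_AE) (auto simp: wl2_def less_imp_le)
  also have "\<dots> \<longleftrightarrow> (AE x in M. f x = 0)"
  proof (rule AE_cong)
    fix x assume "x \<in> space M"
    with \<rho>_pos[of x] show "\<rho> x * (norm (f x))\<^sup>2 = 0 \<longleftrightarrow> f x = 0" by simp
  qed
  finally show ?thesis .
qed

lemma wl2_inner_cong_AE:
  assumes "f \<in> wl2 M \<rho>" "f' \<in> wl2 M \<rho>" "h \<in> wl2 M \<rho>" "h' \<in> wl2 M \<rho>" "AE x in M. f x = f' x" "AE x in M. h x = h' x"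
  shows "wl2_inner M \<rho> f h = wl2_inner M \<rho> f' h'"
  unfolding wl2_inner_def
proof (rule integral_cong_AE)
  show "AE x in M. f x * cnj (h x) * complex_of_real (\<rho> x) = f' x * cnj (h' x) * complex_of_real (\<rho> x)"
    using assms(5,6) by eventually_elim simp
qed (use assms in \<open>auto intro!: wl2_inner_measurable simp: wl2_def\<close>)

text \<open>Riesz--Fischer. Along a subsequence whose increments have squared norm below
  \<open>4^-k\<close>, the squared increments weighted by \<open>2^k\<close> still have finite total
  integral; hence at almost every point the increments decay like \<open>2^(-k/2)\<close> and the
  subsequence converges. Fatou's lemma then controls the distance to the pointwise limit.\<close>

lemma wl2_complete:
  assumes f: "\<And>n. f n \<in> wl2 M \<rho>"
    and Cau: "\<And>e. e > 0 \<Longrightarrow> \<exists>N. \<forall>m\<ge>N. \<forall>n\<ge>N. Q (f m - f n) < e"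
  shows "\<exists>h\<in>wl2 M \<rho>. (\<lambda>n. Q (f n - h)) \<longlonglongrightarrow> 0"
proof -
  have fm: "f n \<in> borel_measurable M" for n using f by (simp add: wl2_def)
  have Qnn: "(\<integral>\<^sup>+x. ennreal (\<rho> x * (norm (u x - v x))\<^sup>2) \<partial>M) = ennreal (Q (u - v))" if "u \<in> wl2 M \<rho>" "v \<in> wl2 M \<rho>" for u v
  proof -
    have uv: "u - v \<in> wl2 M \<rho>" using memI(2) that by blast
    then have "integrable M (\<lambda>x. \<rho> x * (norm (u x - v x))\<^sup>2)" by (simp add: wl2_def fun_diff_def)
    then show ?thesis unfolding wl2_norm fun_diff_def using \<rho>_pos
      by (intro nn_integral_eq_integral) (auto intro!: AE_I2 simp: less_imp_le)
  qed
  have "\<exists>N. \<forall>m\<ge>N. \<forall>n\<ge>N. Q (f m - f n) < (1 / 4) ^ k" for k by (rule Cau) simp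
  then obtain N where N: "\<And>k m n. m \<ge> N k \<Longrightarrow> n \<ge> N k \<Longrightarrow> Q (f m - f n) < (1 / 4) ^ k" by metis
  \<comment> \<open>Summing makes \<open>r\<close> monotone and at least \<open>N k\<close>; the
    added \<open>k\<close> makes it tend to infinity.\<close>
  define r where "r k = (\<Sum>i\<le>k. N i) + k" for k
  have rN: "N k \<le> r k" "r k \<le> r (Suc k)" "k \<le> r k" for k
  proof -
    have "N k \<le> (\<Sum>i\<le>k. N i)" by (intro member_le_sum) auto
    then show "N k \<le> r k" by (simp add: r_def)
  qed (simp_all add: r_def)
  define h where "h k = f (r k)" for k
  have hstep: "Q (h (Suc k) - h k) < (1 / 4) ^ k" for k
    unfolding h_def using rN[of k] by (intro N) auto
  have h: "h k \<in> wl2 M \<rho>" "h k \<in> borel_measurable M" for k using f fm by (simp_all add: h_def)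
  define s where "s k x = ennreal (2 ^ k * (\<rho> x * (norm (h (Suc k) x - h k x))\<^sup>2))" for k x
  have "(\<integral>\<^sup>+x. (\<Sum>k. s k x) \<partial>M) = (\<Sum>k. \<integral>\<^sup>+x. s k x \<partial>M)"
    using h(2) \<rho>_meas by (intro nn_integral_suminf) (auto simp: s_def)
  also have "\<dots> \<le> (\<Sum>k. ennreal ((1 / 2) ^ k))"
  proof (rule suminf_le)
    fix k
    have "(\<integral>\<^sup>+x. s k x \<partial>M) = 2 ^ k * (\<integral>\<^sup>+x. ennreal (\<rho> x * (norm (h (Suc k) x - h k x))\<^sup>2) \<partial>M)"
    proof -
      have "(\<integral>\<^sup>+x. s k x \<partial>M) = (\<integral>\<^sup>+x. ennreal (2 ^ k) * ennreal (\<rho> x * (norm (h (Suc k) x - h k x))\<^sup>2) \<partial>M)"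
        using \<rho>_pos by (intro nn_integral_cong) (simp add: s_def less_imp_le ennreal_mult del: ennreal_power)
      also have "\<dots> = ennreal (2 ^ k) * (\<integral>\<^sup>+x. ennreal (\<rho> x * (norm (h (Suc k) x - h k x))\<^sup>2) \<partial>M)"
        using h(2) \<rho>_meas by (intro nn_integral_cmult) auto
      finally show ?thesis by (simp add: ennreal_power[symmetric] del: ennreal_power)
    qed
    also have "\<dots> = ennreal (2 ^ k * Q (h (Suc k) - h k))"
      using Qnn[OF h(1) h(1), of "Suc k" k] nonneg[OF memI(2)[OF h(1) h(1)], of "Suc k" k]
      by (simp add: ennreal_mult ennreal_power[symmetric] del: ennreal_power)
    also have "\<dots> \<le> ennreal ((1 / 2) ^ k)"
    proof (rule ennreal_leI)
      have "2 ^ k * Q (h (Suc k) - h k) \<le> 2 ^ k * (1 / 4) ^ k" using hstep[of k] by (intro mult_left_mono) auto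
      also have "\<dots> = (1 / 2) ^ k" by (simp add: power_mult_distrib[symmetric])
      finally show "2 ^ k * Q (h (Suc k) - h k) \<le> (1 / 2) ^ k" .
    qed
    finally show "(\<integral>\<^sup>+x. s k x \<partial>M) \<le> ennreal ((1 / 2) ^ k)" .
  qed auto
  also have "\<dots> = ennreal (\<Sum>k. (1 / 2) ^ k)" by (intro suminf_ennreal2 summable_geometric) auto
  also have "\<dots> < \<infinity>" by simp
  finally have "AE x in M. (\<Sum>k. s k x) \<noteq> \<infinity>"
    using h(2) \<rho>_meas by (intro nn_integral_PInf_AE) (auto simp: s_def)
  then have conv: "AE x in M. convergent (\<lambda>k. h k x)"
    using AE_space
  proof eventually_elim
    case (elim x)
    then have r: "0 < \<rho> x" using \<rho>_pos by blast
    define t where "t k = 2 ^ k * (\<rho> x * (norm (h (Suc k) x - h k x))\<^sup>2)" for k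
    have t0: "0 \<le> t k" for k using r by (simp add: t_def)
    have "(\<Sum>k. s k x) = (\<Sum>k. ennreal (t k))" by (simp add: s_def t_def)
    with elim(1) have fin: "(\<Sum>k. ennreal (t k)) \<noteq> \<infinity>" by simp
    then obtain C where C: "C \<ge> 0" "(\<Sum>k. ennreal (t k)) = ennreal C" by (cases "\<Sum>k. ennreal (t k)") auto
    have tC: "t k \<le> C" for k
    proof -
      have "ennreal (t k) \<le> (\<Sum>k. ennreal (t k))" using sum_le_suminf[of "\<lambda>k. ennreal (t k)" "{k}"] by simp
      then show ?thesis using C by simp
    qed
    have bnd: "norm (h (Suc k) x - h k x) \<le> sqrt (C / \<rho> x) * (sqrt (1 / 2)) ^ k" for k
    proof -
      have "(norm (h (Suc k) x - h k x))\<^sup>2 \<le> (C / \<rho> x) * (1 / 2) ^ k"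
        using tC[of k] r by (simp add: t_def field_simps power_divide)
      then have "norm (h (Suc k) x - h k x) \<le> sqrt ((C / \<rho> x) * (1 / 2) ^ k)" by (rule real_le_rsqrt)
      then show ?thesis by (simp only: real_sqrt_mult real_sqrt_power)
    qed
    have summ: "summable (\<lambda>k. sqrt (C / \<rho> x) * (sqrt (1 / 2)) ^ k)"
      by (intro summable_mult summable_geometric) simp
    have "summable (\<lambda>k. h (Suc k) x - h k x)"
      by (rule summable_comparison_test'[OF summ, of 0]) (rule bnd)
    then have "convergent (\<lambda>n. \<Sum>k<n. h (Suc k) x - h k x)" by (simp add: summable_iff_convergent)
    then have "convergent (\<lambda>n. h n x - h 0 x)" by (subst (asm) sum_lessThan_telescope[of "\<lambda>k. h k x"])
    then have "convergent (\<lambda>n. (h n x - h 0 x) + h 0 x)" by (intro convergent_add convergent_const)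
    then show ?case by simp
  qed
  define l where "l x = lim (\<lambda>k. h k x)" for x
  have lm: "l \<in> borel_measurable M" unfolding l_def[abs_def] using h(2) by (rule borel_measurable_lim_metric)
  have liml: "AE x in M. (\<lambda>k. h k x) \<longlonglongrightarrow> l x"
    using conv by eventually_elim (simp add: l_def convergent_LIMSEQ_iff)
  \<comment> \<open>Fatou runs along the subsequence while the index \<open>n\<close> of the full
    sequence is fixed; it yields both the membership of \<open>l\<close> and the convergence of the
    full sequence.\<close>
  have fatou: "(\<integral>\<^sup>+x. ennreal (\<rho> x * (norm (f n x - l x))\<^sup>2) \<partial>M) \<le> ennreal e" if n: "\<And>m. m \<ge> n0 \<Longrightarrow> Q (f n - f m) \<le> e" for n n0 e
  proof -
    have "(\<integral>\<^sup>+x. ennreal (\<rho> x * (norm (f n x - l x))\<^sup>2) \<partial>M) \<le> (\<integral>\<^sup>+x. liminf (\<lambda>k. ennreal (\<rho> x * (norm (f n x - h k x))\<^sup>2)) \<partial>M)"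
    proof (rule nn_integral_mono_AE)
      show "AE x in M. ennreal (\<rho> x * (norm (f n x - l x))\<^sup>2) \<le> liminf (\<lambda>k. ennreal (\<rho> x * (norm (f n x - h k x))\<^sup>2))"
        using liml
      proof eventually_elim
        case (elim x)
        then have "(\<lambda>k. ennreal (\<rho> x * (norm (f n x - h k x))\<^sup>2)) \<longlonglongrightarrow> ennreal (\<rho> x * (norm (f n x - l x))\<^sup>2)"
          by (intro tendsto_ennrealI tendsto_intros)
        then show ?case by (simp add: lim_imp_Liminf)
      qed
    qed
    also have "\<dots> \<le> liminf (\<lambda>k. \<integral>\<^sup>+x. ennreal (\<rho> x * (norm (f n x - h k x))\<^sup>2) \<partial>M)"
      using h(2) fm \<rho>_meas by (intro nn_integral_liminf) auto
    also have "\<dots> \<le> liminf (\<lambda>k. ennreal e)"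
    proof (rule Liminf_mono)
      show "\<forall>\<^sub>F k in sequentially. (\<integral>\<^sup>+x. ennreal (\<rho> x * (norm (f n x - h k x))\<^sup>2) \<partial>M) \<le> ennreal e"
      proof (rule eventually_sequentiallyI[of n0])
        fix k assume "n0 \<le> k"
        then have "n0 \<le> r k" using rN(3)[of k] by simp
        then show "(\<integral>\<^sup>+x. ennreal (\<rho> x * (norm (f n x - h k x))\<^sup>2) \<partial>M) \<le> ennreal e"
          unfolding Qnn[OF f h(1)] unfolding h_def by (intro ennreal_leI n)
      qed
    qed
    also have "\<dots> = ennreal e" by (simp add: Liminf_const)
    finally show ?thesis .
  qed
  have mem: "f n - l \<in> wl2 M \<rho>" if n: "\<And>m. m \<ge> n0 \<Longrightarrow> Q (f n - f m) \<le> e" for n n0 e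
  proof -
    have "integrable M (\<lambda>x. \<rho> x * (norm (f n x - l x))\<^sup>2)"
    proof (rule integrableI_nonneg)
      show "(\<lambda>x. \<rho> x * (norm (f n x - l x))\<^sup>2) \<in> borel_measurable M" using fm lm \<rho>_meas by auto
      show "AE x in M. 0 \<le> \<rho> x * (norm (f n x - l x))\<^sup>2" using \<rho>_pos by (auto intro!: AE_I2 simp: less_imp_le)
      show "(\<integral>\<^sup>+x. ennreal (\<rho> x * (norm (f n x - l x))\<^sup>2) \<partial>M) < \<infinity>"
        by (rule le_less_trans[OF fatou[OF n]]) auto
    qed
    then show ?thesis using fm lm by (simp add: wl2_def fun_diff_def)
  qed
  obtain N1 where N1: "\<And>m n. m \<ge> N1 \<Longrightarrow> n \<ge> N1 \<Longrightarrow> Q (f m - f n) < 1" using Cau[of 1] by auto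
  have "f N1 - l \<in> wl2 M \<rho>" by (rule mem[of N1 N1 1]) (use N1 in \<open>auto intro: less_imp_le\<close>)
  from memI(2)[OF f[of N1] this] have l: "l \<in> wl2 M \<rho>" by simp
  moreover have "(\<lambda>n. Q (f n - l)) \<longlonglongrightarrow> 0"
  proof (rule LIMSEQ_I)
    fix e :: real assume e: "e > 0"
    then have "e / 2 > 0" by simp
    from Cau[OF this] obtain K where K: "\<And>m n. m \<ge> K \<Longrightarrow> n \<ge> K \<Longrightarrow> Q (f m - f n) < e / 2" by blast
    have "norm (Q (f n - l) - 0) < e" if "n \<ge> K" for n
    proof -
      have "ennreal (Q (f n - l)) \<le> ennreal (e / 2)"
        unfolding Qnn[OF f l, symmetric] by (rule fatou[of K]) (use K that in \<open>auto intro: less_imp_le\<close>)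
      then have "Q (f n - l) \<le> e / 2" using e by (simp add: ennreal_le_iff)
      moreover have "0 \<le> Q (f n - l)" using nonneg[OF memI(2)[OF f l]] .
      ultimately show ?thesis using e by simp
    qed
    then show "\<exists>K. \<forall>n\<ge>K. norm (Q (f n - l) - 0) < e" by blast
  qed
  ultimately show ?thesis by blast
qed

end

section \<open>The form domain\<close>

text \<open>Supplies measurability of a chosen weak derivative, of which only local integrability is
  known.\<close>

lemma locally_integrable_imp_measurable:
  assumes "locally_integrable_on {s<..<t} f"
  shows "f \<in> borel_measurable (lebesgue_on {s<..<t::real})"
proof -
  define A where "A n = {s + 1 / real (Suc n)..t - 1 / real (Suc n)}" for n
  have "(\<lambda>x. indicator (A n) x *\<^sub>R f x) \<in> borel_measurable lebesgue" for n
  proof -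
    have "f absolutely_integrable_on A n" unfolding A_def
      using locally_integrable_interval[OF assms] by simp
    then show ?thesis by (simp add: set_integrable_def borel_measurable_integrable)
  qed
  then have m: "(\<lambda>x. indicator (A n) x *\<^sub>R f x) \<in> borel_measurable (lebesgue_on {s<..<t})" for n
    by (rule measurable_restrict_space1)
  show ?thesis
  proof (rule borel_measurable_LIMSEQ_metric[OF m])
    fix x assume "x \<in> space (lebesgue_on {s<..<t})"
    then have x: "0 < min (x - s) (t - x)" by simp
    then obtain n where n: "1 / real (Suc n) < min (x - s) (t - x)" using nat_approx_posE by metis
    have "indicator (A m) x *\<^sub>R f x = f x" if "m \<ge> n" for m
    proof -
      have "1 / real (Suc m) \<le> 1 / real (Suc n)" using that by (simp add: frac_le)
      with n have "x \<in> A m" by (auto simp: A_def)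
      then show ?thesis by simp
    qed
    then show "(\<lambda>n. indicator (A n) x *\<^sub>R f x) \<longlonglongrightarrow> f x"
      by (intro tendsto_eventually eventually_sequentiallyI[of n])
  qed
qed

lemma LINT_indicator_eq_integral:
  fixes f :: "real \<Rightarrow> 'a::euclidean_space"
  assumes f: "f absolutely_integrable_on {s..t}" and xy: "s \<le> x" "y \<le> t"
  shows "(LINT z|lebesgue_on {s<..<t}. indicator {x..y} z *\<^sub>R f z) = integral {x..y} f"
    and "integrable (lebesgue_on {s<..<t}) (\<lambda>z. indicator {x..y} z *\<^sub>R f z)"
proof -
  have eq: "(\<lambda>z. indicator {s<..<t} z *\<^sub>R (indicator {x..y} z *\<^sub>R f z)) = (\<lambda>z. indicator ({x..y} \<inter> {s<..<t}) z *\<^sub>R f z)"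
    by (auto simp: fun_eq_iff indicator_def)
  have ai: "f absolutely_integrable_on ({x..y} \<inter> {s<..<t})"
    by (rule set_integrable_subset[OF f]) (use xy in auto)
  show "integrable (lebesgue_on {s<..<t}) (\<lambda>z. indicator {x..y} z *\<^sub>R f z)"
    using ai unfolding set_integrable_def eq[symmetric] by (subst integrable_restrict_space) simp_all
  have "(LINT z|lebesgue_on {s<..<t}. indicator {x..y} z *\<^sub>R f z) = (LINT z|lebesgue. indicator {s<..<t} z *\<^sub>R (indicator {x..y} z *\<^sub>R f z))"
    by (rule integral_restrict_space) simp
  also have "\<dots> = (LINT z|lebesgue. indicator ({x..y} \<inter> {s<..<t}) z *\<^sub>R f z)" by (simp only: eq)
  also have "\<dots> = (LINT z|lebesgue_on ({x..y} \<inter> {s<..<t}). f z)"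
    by (rule integral_restrict_space[symmetric]) simp
  also have "\<dots> = integral ({x..y} \<inter> {s<..<t}) f"
    using ai by (intro lebesgue_integral_eq_integral absolutely_integrable_imp_integrable) auto
  also have "\<dots> = integral {x..y} f"
  proof (rule integral_spike_set)
    show "negligible {z \<in> {x..y} \<inter> {s<..<t} - {x..y}. f z \<noteq> 0}" by (rule negligible_subset[of "{}"]) auto
    show "negligible {z \<in> {x..y} - {x..y} \<inter> {s<..<t}. f z \<noteq> 0}" by (rule negligible_subset[of "{s, t}"]) (use xy in auto)
  qed
  finally show "(LINT z|lebesgue_on {s<..<t}. indicator {x..y} z *\<^sub>R f z) = integral {x..y} f" .
qed

lemma absolutely_integrable_cnj: "f absolutely_integrable_on A \<Longrightarrow> (\<lambda>x. cnj (f x)) absolutely_integrable_on A"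
  for f :: "real \<Rightarrow> complex"
  using absolutely_integrable_linear[OF _ bounded_linear_cnj, of A f] by (simp add: o_def)

context small_parameter
begin

abbreviation "J \<equiv> {a<..<b}"
abbreviation "M \<equiv> lebesgue_on J"

lemma J_subset: "J \<subseteq> {0..1} - {a, b}" "{a..b} \<subseteq> {0..1}"
  using x0_bounds by auto

lemma continuous_on_J: "continuous_on J p" "continuous_on J w"
  using continuous_on_subset[OF continuous_on_p J_subset(1)] continuous_on_subset[OF continuous_on_w J_subset(1)] by auto

sublocale W: weighted_measure M w
  using continuous_on_J w_pos J_subset by unfold_locales (auto intro!: continuous_imp_measurable_on_sets_lebesgue)

sublocale P: weighted_measure M p
  using continuous_on_J p_pos by unfold_locales (auto intro!: continuous_imp_measurable_on_sets_lebesgue)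

abbreviation "N \<equiv> wl2_inner M w"

definition wd :: "(real \<Rightarrow> complex) \<Rightarrow> real \<Rightarrow> complex" where "wd u = weak_deriv J u"

definition E :: "(real \<Rightarrow> complex) \<Rightarrow> (real \<Rightarrow> complex) \<Rightarrow> complex" where
  "E u v = wl2_inner M p (wd u) (wd v)"

lemma L2w_eq: "L2w \<epsilon> = wl2 M w"
  by (simp add: L2w_def wl2_def M_plus_eq)

lemma L2_inner_eq: "L2_inner \<epsilon> = N"
  by (simp add: fun_eq_iff L2_inner_def wl2_inner_def M_plus_eq)

lemma ip_integrable: "(\<lambda>x. 1 / p x) absolutely_integrable_on {a..b}"
  using set_integrable_subset[OF inverse_p_integrable _ J_subset(2)] by simp

lemma w_integrable_ab: "w absolutely_integrable_on {a..b}"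
  using set_integrable_subset[OF w_integrable _ J_subset(2)] by simp

text \<open>Dividing \<open>(p * norm d - 1)\<^sup>2 \<ge> 0\<close> by \<open>p\<close> gives
  \<open>2 * norm d \<le> p * (norm d)\<^sup>2 + 1 / p\<close>, and both terms on the right are
  integrable.\<close>

lemma absolutely_integrable_wl2:
  assumes d: "d \<in> wl2 M p"
  shows "d absolutely_integrable_on {a..b}"
proof -
  have "integrable M (\<lambda>x. p x * (norm (d x))\<^sup>2 + 1 / p x)"
    using d ip_integrable
    by (intro Bochner_Integration.integrable_add) (auto simp: wl2_def absolutely_integrable_on_Icc_iff_Ioo intro: absolutely_integrable_imp_integrable)
  then have "integrable M d"
  proof (rule Bochner_Integration.integrable_bound)
    show "d \<in> borel_measurable M" using d by (simp add: wl2_def)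
    show "AE x in M. norm (d x) \<le> norm (p x * (norm (d x))\<^sup>2 + 1 / p x)"
    proof (rule AE_I2)
      fix x assume "x \<in> space M"
      then have px: "0 < p x" using p_pos by simp
      have "0 \<le> (p x * norm (d x) - 1)\<^sup>2" by simp
      then have "2 * (p x * norm (d x)) \<le> (p x * norm (d x))\<^sup>2 + 1" by (simp add: power2_diff)
      then have "(2 * (p x * norm (d x))) / p x \<le> ((p x * norm (d x))\<^sup>2 + 1) / p x" using px by (intro divide_right_mono) auto
      then have "2 * norm (d x) \<le> p x * (norm (d x))\<^sup>2 + 1 / p x" using px by (simp add: add_divide_distrib power2_eq_square mult_ac)
      then show "norm (d x) \<le> norm (p x * (norm (d x))\<^sup>2 + 1 / p x)" using norm_ge_zero[of "d x"] unfolding real_norm_def by linarith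
    qed
  qed
  then have "d absolutely_integrable_on J" by (simp add: set_integrable_eq)
  then show ?thesis by (simp add: absolutely_integrable_on_Icc_iff_Ioo)
qed

text \<open>A member of the form domain is encoded by the boundary value \<open>c\<close> at \<open>a\<close> and the derivative \<open>d\<close>;
  \<open>d\<close> is integrable up to the endpoints because \<open>1 / p\<close> is.\<close>

definition val :: "complex \<Rightarrow> (real \<Rightarrow> complex) \<Rightarrow> real \<Rightarrow> complex" where
  "val c d x = c + integral {a..x} d"

definition rep :: "(real \<Rightarrow> complex) \<Rightarrow> complex \<Rightarrow> (real \<Rightarrow> complex) \<Rightarrow> bool" where
  "rep u c d \<longleftrightarrow> u \<in> wl2 M w \<and> d \<in> wl2 M p \<and> (AE x in M. u x = val c d x)"

lemma continuous_val: "d \<in> wl2 M p \<Longrightarrow> continuous_on {a..b} (val c d)"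
  unfolding val_def[abs_def] using absolutely_integrable_wl2
  by (intro continuous_intros indefinite_integral_continuous_1) (auto simp: absolutely_integrable_on_def)

lemma w_abs_le_integrable:
  assumes "continuous_on {a..b} f"
  shows "f \<in> wl2 M w"
proof -
  have c: "continuous_on {a..b} (\<lambda>x. (norm (f x))\<^sup>2)" using assms by (intro continuous_intros)
  have "(\<lambda>x. w x *\<^sub>R (norm (f x))\<^sup>2) absolutely_integrable_on {a..b}"
    by (rule absolutely_integrable_scaleR_continuous[OF w_integrable_ab c])
  then have "integrable M (\<lambda>x. w x * (norm (f x))\<^sup>2)"
    by (simp add: absolutely_integrable_on_Icc_iff_Ioo absolutely_integrable_imp_integrable)
  moreover have "f \<in> borel_measurable M"
    by (intro continuous_imp_measurable_on_sets_lebesgue continuous_on_subset[OF assms]) auto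
  ultimately show ?thesis by (simp add: wl2_def)
qed

lemma rep_val: "d \<in> wl2 M p \<Longrightarrow> rep (val c d) c d"
  by (simp add: rep_def w_abs_le_integrable continuous_val)

lemma rep_has_weak_deriv: "rep u c d \<Longrightarrow> has_weak_deriv J u d"
  using has_weak_deriv_indefinite_integral[OF x0_bounds(4) absolutely_integrable_wl2, of d u c]
  by (simp add: rep_def val_def)

text \<open>By uniqueness of weak derivatives, \<open>d\<close> may be exchanged for the chosen
  \<open>wd u\<close> in every integral.\<close>

lemma wd_eq:
  assumes "rep u c d"
  shows "has_weak_deriv J u (wd u)" "AE x in M. wd u x = d x" "wd u \<in> wl2 M p" "u \<in> V_space \<epsilon>"
proof -
  show w: "has_weak_deriv J u (wd u)" unfolding wd_def weak_deriv_def by (rule someI[of "has_weak_deriv J u"], rule rep_has_weak_deriv[OF assms])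
  show ae: "AE x in M. wd u x = d x"
    by (rule has_weak_deriv_unique[OF w rep_has_weak_deriv[OF assms]]) simp
  have m: "wd u \<in> borel_measurable M"
    using w by (intro locally_integrable_imp_measurable) (simp add: has_weak_deriv_def)
  have d: "d \<in> wl2 M p" using assms by (simp add: rep_def)
  have "integrable M (\<lambda>x. p x * (norm (wd u x))\<^sup>2)"
  proof (rule integrable_cong_AE_imp)
    show "integrable M (\<lambda>x. p x * (norm (d x))\<^sup>2)" using d by (simp add: wl2_def)
    show "(\<lambda>x. p x * (norm (wd u x))\<^sup>2) \<in> borel_measurable M" using m P.\<rho>_meas by auto
    show "AE x in M. p x * (norm (d x))\<^sup>2 = p x * (norm (wd u x))\<^sup>2" using ae by eventually_elim simp
  qed
  with m show "wd u \<in> wl2 M p" by (simp add: wl2_def)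
  then show "u \<in> V_space \<epsilon>" unfolding V_space_def L2w_eq M_plus_eq wd_def[symmetric]
    using assms w by (auto simp: rep_def wl2_def)
qed

lemma V_rep:
  assumes "u \<in> V_space \<epsilon>"
  shows "\<exists>c. rep u c (wd u)"
proof -
  from assms have u: "u \<in> wl2 M w" "\<exists>d. has_weak_deriv J u d" "integrable M (\<lambda>x. p x * (norm (wd u x))\<^sup>2)"
    unfolding V_space_def L2w_eq M_plus_eq wd_def[symmetric] by auto
  have w: "has_weak_deriv J u (wd u)" unfolding wd_def weak_deriv_def by (rule someI_ex[of "has_weak_deriv J u"], rule u(2))
  then have "wd u \<in> borel_measurable M" by (intro locally_integrable_imp_measurable) (simp add: has_weak_deriv_def)
  with u(3) have d: "wd u \<in> wl2 M p" by (simp add: wl2_def)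
  obtain c where "AE x in M. u x = c + integral {a..x} (wd u)"
    using has_weak_deriv_imp_indefinite_integral[OF w x0_bounds(4) absolutely_integrable_wl2[OF d]] by blast
  with u(1) d show ?thesis by (auto simp: rep_def val_def)
qed

section \<open>Linear structure of the encoded functions\<close>

lemma integrable_wl2: "d \<in> wl2 M p \<Longrightarrow> x \<in> {a..b} \<Longrightarrow> d integrable_on {a..x}"
  using absolutely_integrable_wl2[of d] by (auto simp: absolutely_integrable_on_def intro: integrable_on_subinterval)

lemma val_add: "d \<in> wl2 M p \<Longrightarrow> d' \<in> wl2 M p \<Longrightarrow> x \<in> {a..b} \<Longrightarrow> val (c + c') (d + d') x = val c d x + val c' d' x"
  unfolding val_def plus_fun_def by (subst Henstock_Kurzweil_Integration.integral_add) (auto intro!: integrable_wl2)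

lemma val_diff: "d \<in> wl2 M p \<Longrightarrow> d' \<in> wl2 M p \<Longrightarrow> x \<in> {a..b} \<Longrightarrow> val (c - c') (d - d') x = val c d x - val c' d' x"
  unfolding val_def fun_diff_def by (subst Henstock_Kurzweil_Integration.integral_diff) (auto intro!: integrable_wl2)

lemma val_scale: "val (k * c) (fscale k d) x = k * val c d x"
  by (simp add: val_def fscale_def algebra_simps)

lemma rep_add: "rep u c d \<Longrightarrow> rep v c' d' \<Longrightarrow> rep (u + v) (c + c') (d + d')"
proof -
  assume u: "rep u c d" and v: "rep v c' d'"
  have "AE x in M. u x = val c d x" "AE x in M. v x = val c' d' x" using u v by (auto simp: rep_def)
  then have "AE x in M. (u + v) x = val (c + c') (d + d') x"
    using AE_space by eventually_elim (use u v in \<open>simp add: rep_def val_add\<close>)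
  then show ?thesis using u v by (simp add: rep_def W.wl2_add P.wl2_add)
qed

lemma rep_scale: "rep u c d \<Longrightarrow> rep (fscale k u) (k * c) (fscale k d)"
proof -
  assume u: "rep u c d"
  then have "AE x in M. u x = val c d x" by (simp add: rep_def)
  then have "AE x in M. fscale k u x = val (k * c) (fscale k d) x"
    unfolding val_scale by eventually_elim (simp add: fscale_def)
  then show ?thesis using u by (simp add: rep_def W.wl2_scale P.wl2_scale)
qed

lemma rep_diff: "rep u c d \<Longrightarrow> rep v c' d' \<Longrightarrow> rep (u - v) (c - c') (d - d')"
  using rep_add[of u c d "fscale (-1) v" "-1 * c'" "fscale (-1) d'"] rep_scale[of v c' d' "-1"]
  by (simp add: fscale_def plus_fun_def fun_diff_def)

lemma rep_zero: "rep 0 0 0"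
proof -
  have "val 0 0 x = 0" for x by (simp add: val_def zero_fun_def)
  then show ?thesis by (simp add: rep_def W.wl2_zero P.wl2_zero)
qed

lemma E_rep: "rep u c d \<Longrightarrow> rep v c' d' \<Longrightarrow> E u v = wl2_inner M p d d'"
  unfolding E_def
  by (rule P.wl2_inner_cong_AE[OF wd_eq(3) _ wd_eq(3) _ wd_eq(2) wd_eq(2)]) (assumption | simp add: rep_def)+

lemma N_rep: "rep u c d \<Longrightarrow> rep v c' d' \<Longrightarrow> N u v = N (val c d) (val c' d')"
  by (rule W.wl2_inner_cong_AE) (auto simp: rep_def intro: w_abs_le_integrable continuous_val)

text \<open>\<open>G\<close> is the natural variable of the problem: measured in it, functions of
  finite energy are Holder continuous of exponent 1/2.\<close>

definition G :: "real \<Rightarrow> real" where "G x = integral {a..x} (\<lambda>x. 1 / p x)"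
definition \<Omega> :: real where "\<Omega> = integral {a..b} w"

lemma Q_val_bound:
  assumes f: "continuous_on {a..b} f" and B: "\<And>x. x \<in> {a..b} \<Longrightarrow> (norm (f x))\<^sup>2 \<le> B"
  shows "W.Q f \<le> \<Omega> * B"
proof -
  have fw: "f \<in> wl2 M w" using f by (rule w_abs_le_integrable)
  have wi: "integrable M w" using w_integrable_ab by (simp add: absolutely_integrable_on_Icc_iff_Ioo absolutely_integrable_imp_integrable)
  have "W.Q f \<le> (LINT x|M. w x * B)"
    unfolding W.wl2_norm
  proof (rule integral_mono)
    show "w x * (cmod (f x))\<^sup>2 \<le> w x * B" if "x \<in> space M" for x
      using that W.\<rho>_pos[OF that] by (intro mult_left_mono B) auto
  qed (use fw wi in \<open>auto simp: wl2_def\<close>)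
  also have "\<dots> = (LINT x|M. w x) * B" by simp
  also have "(LINT x|M. w x) = \<Omega>"
    unfolding \<Omega>_def using wi by (simp add: lebesgue_integral_eq_integral integral_open_interval_real)
  finally show ?thesis .
qed

lemma \<Omega>_pos: "0 < \<Omega>"
proof -
  have wi: "integrable M w" using w_integrable_ab by (simp add: absolutely_integrable_on_Icc_iff_Ioo absolutely_integrable_imp_integrable)
  have eq: "\<Omega> = (LINT x|M. w x)"
    unfolding \<Omega>_def using wi by (simp add: lebesgue_integral_eq_integral integral_open_interval_real)
  have "0 \<le> \<Omega>" unfolding eq using W.\<rho>_pos by (intro integral_nonneg_AE AE_I2) (auto simp: less_imp_le)
  moreover have "\<Omega> \<noteq> 0"
  proof
    assume "\<Omega> = 0"
    then have "AE x in M. w x = 0" unfolding eq using wi W.\<rho>_pos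
      by (subst (asm) integral_nonneg_eq_0_iff_AE) (auto intro!: AE_I2 simp: less_imp_le)
    then have "AE x in M. False" using AE_space by eventually_elim (use W.\<rho>_pos in force)
    then have "AE x in lebesgue. x \<notin> J" by (simp add: AE_restrict_space_iff)
    then have "J \<in> null_sets lebesgue" by (subst AE_iff_null_sets) simp_all
    then have "negligible (box a b)" by (simp add: negligible_iff_null_sets box_real)
    then show False using negligible_interval(2)[of a b] x0_bounds(4) by (simp add: box_real)
  qed
  ultimately show ?thesis by simp
qed

lemma G_diff: "a \<le> x \<Longrightarrow> x \<le> y \<Longrightarrow> y \<le> b \<Longrightarrow> G y - G x = integral {x..y} (\<lambda>x. 1 / p x)"
proof -
  assume xy: "a \<le> x" "x \<le> y" "y \<le> b"
  have "(\<lambda>x. 1 / p x) integrable_on {a..y}" using ip_integrable xy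
    by (auto simp: absolutely_integrable_on_def intro: integrable_on_subinterval)
  from Henstock_Kurzweil_Integration.integral_combine[OF xy(1,2) this] show ?thesis by (simp add: G_def)
qed

lemma G_continuous: "continuous_on {a..b} G"
  unfolding G_def[abs_def] using ip_integrable by (intro indefinite_integral_continuous_1) (simp add: absolutely_integrable_on_def)

lemma G_mono: "a \<le> x \<Longrightarrow> x \<le> y \<Longrightarrow> y \<le> b \<Longrightarrow> G x \<le> G y"
proof -
  assume xy: "a \<le> x" "x \<le> y" "y \<le> b"
  have "0 \<le> 1 / p x" if "x \<in> {a..b}" for x using p_pos[of x] p_zero that by (cases "x = a \<or> x = b") (auto simp: less_imp_le)
  then have "0 \<le> integral {x..y} (\<lambda>x. 1 / p x)"
    using ip_integrable xy by (intro integral_nonneg) (auto simp: absolutely_integrable_on_def intro: integrable_on_subinterval)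
  then show ?thesis using G_diff[OF xy] by simp
qed

text \<open>Cauchy--Schwarz in the \<open>p\<close>-weighted space against \<open>k\<close>, the
  indicator of \<open>{x..y}\<close> divided by \<open>p\<close>: pairing with \<open>k\<close> is
  plain integration, and the squared norm of \<open>k\<close> is the increment of
  \<open>G\<close>.\<close>

lemma integral_wl2_bound:
  assumes d: "d \<in> wl2 M p" and xy: "a \<le> x" "x \<le> y" "y \<le> b"
  shows "(norm (integral {x..y} d))\<^sup>2 \<le> P.Q d * (G y - G x)"
proof -
  define k where "k z = complex_of_real (indicator {x..y} z / p z)" for z
  have km: "k \<in> borel_measurable M"
  proof -
    have "(\<lambda>z. complex_of_real (indicator {x..y} z)) \<in> borel_measurable M"
      by (rule measurable_restrict_space1, rule borel_measurable_continuous_on[OF _ borel_measurable_indicator])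
         (auto intro: continuous_intros)
    moreover have "(\<lambda>z. complex_of_real (1 / p z)) \<in> borel_measurable M"
      using continuous_on_J(1) p_pos by (intro continuous_imp_measurable_on_sets_lebesgue continuous_intros) force+
    ultimately have "(\<lambda>z. complex_of_real (indicator {x..y} z) * complex_of_real (1 / p z)) \<in> borel_measurable M" by (rule borel_measurable_times)
    then show ?thesis by (simp add: k_def[abs_def])
  qed
  note ind = LINT_indicator_eq_integral[OF ip_integrable xy(1,3)]
  have sq: "p z * (norm (k z))\<^sup>2 = indicator {x..y} z *\<^sub>R (1 / p z)" if "z \<in> space M" for z
    using p_pos[of z] that by (auto simp: k_def indicator_def norm_divide power2_eq_square)
  have k: "k \<in> wl2 M p"
  proof -
    have "integrable M (\<lambda>z. p z * (norm (k z))\<^sup>2)"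
      by (subst Bochner_Integration.integrable_cong[OF refl sq], assumption, rule ind(2))
    with km show ?thesis by (simp add: wl2_def)
  qed
  have Qk: "P.Q k = G y - G x"
    unfolding P.wl2_norm G_diff[OF xy] ind(1)[symmetric] by (rule Bochner_Integration.integral_cong[OF refl sq])
  have "wl2_inner M p d k = (LINT z|M. indicator {x..y} z *\<^sub>R d z)"
    unfolding wl2_inner_def
  proof (rule Bochner_Integration.integral_cong[OF refl])
    fix z assume "z \<in> space M"
    then show "d z * cnj (k z) * complex_of_real (p z) = indicator {x..y} z *\<^sub>R d z"
      using p_pos[of z] by (auto simp: k_def indicator_def)
  qed
  also have "\<dots> = integral {x..y} d" by (rule LINT_indicator_eq_integral(1)[OF absolutely_integrable_wl2[OF d] xy(1,3)])
  finally show ?thesis using P.Cauchy_Schwarz[OF d k] Qk by simp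
qed

lemma val_increment:
  assumes d: "d \<in> wl2 M p" and xy: "x \<in> {a..b}" "y \<in> {a..b}"
  shows "(norm (val c d x - val c d y))\<^sup>2 \<le> P.Q d * \<bar>G x - G y\<bar>"
proof -
  have *: "(norm (val c d y - val c d x))\<^sup>2 \<le> P.Q d * \<bar>G x - G y\<bar>" if "x \<in> {a..b}" "y \<in> {a..b}" "x \<le> y" for x y
  proof -
    have "integral {a..x} d + integral {x..y} d = integral {a..y} d"
      using that integrable_wl2[OF d, of y] by (intro Henstock_Kurzweil_Integration.integral_combine) auto
    then have "val c d y - val c d x = integral {x..y} d" by (simp add: val_def algebra_simps)
    moreover have "\<bar>G x - G y\<bar> = G y - G x" using G_mono[of x y] that by simp
    ultimately show ?thesis using integral_wl2_bound[OF d, of x y] that by simp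
  qed
  show ?thesis using *[of x y] *[of y x] xy by (cases "x \<le> y") (auto simp: norm_minus_commute abs_minus_commute)
qed

lemma G_left: "G a = 0" by (simp add: G_def)

lemma G_right_nonneg: "0 \<le> G b" using G_mono[of a b] x0_bounds G_left by simp

lemma integral_sup_bound:
  assumes d: "d \<in> wl2 M p" and x: "x \<in> {a..b}"
  shows "(norm (integral {a..x} d))\<^sup>2 \<le> P.Q d * G b"
proof -
  have "(norm (integral {a..x} d))\<^sup>2 \<le> P.Q d * (G x - G a)" using x by (intro integral_wl2_bound[OF d]) auto
  also have "\<dots> \<le> P.Q d * G b" using x G_mono[of x b] G_left P.nonneg[OF d] by (intro mult_left_mono) auto
  finally show ?thesis .
qed

text \<open>The coefficients arise in the next bound: splitting off the boundary value gives
  \<open>4 / \<Omega>\<close> in front of the mass, and \<open>4 * G b + 2 * G b\<close> in front of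
  the energy.\<close>

definition K :: real where "K = 4 / \<Omega> + 6 * G b + 1"

lemma K_pos: "K > 0" using \<Omega>_pos G_right_nonneg by (simp add: K_def add_nonneg_pos)

text \<open>A Sobolev embedding. The constant \<open>c\<close> is the function minus its primitive
  part; its mass is \<open>\<Omega> * (norm c)\<^sup>2\<close>, while the primitive part is bounded
  uniformly by the energy. It supplies the uniform bound for Arzela--Ascoli and the convergence of
  boundary values.\<close>

lemma val_sup_bound:
  assumes d: "d \<in> wl2 M p" and x: "x \<in> {a..b}"
  shows "(norm (val c d x))\<^sup>2 \<le> K * (P.Q d + W.Q (val c d))"
proof -
  let ?I = "\<lambda>x. integral {a..x} d"
  have Ic: "continuous_on {a..b} ?I" using continuous_val[OF d, of 0] by (simp add: val_def[abs_def])
  have Ib: "(norm (?I y))\<^sup>2 \<le> P.Q d * G b" if "y \<in> {a..b}" for y by (rule integral_sup_bound[OF d that])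
  have vw: "val c d \<in> wl2 M w" "?I \<in> wl2 M w" using continuous_val[OF d] Ic by (auto intro: w_abs_le_integrable)
  have cc: "val c d - ?I = (\<lambda>_. c)" by (auto simp: val_def fun_diff_def)
  have "\<Omega> * (norm c)\<^sup>2 = W.Q (val c d - ?I)"
  proof -
    have wi: "integrable M w" using w_integrable_ab by (simp add: absolutely_integrable_on_Icc_iff_Ioo absolutely_integrable_imp_integrable)
    then have "(LINT x|M. w x) = \<Omega>"
      unfolding \<Omega>_def by (simp add: lebesgue_integral_eq_integral integral_open_interval_real)
    then show ?thesis unfolding cc W.wl2_norm by simp
  qed
  also have "\<dots> \<le> 2 * W.Q (val c d) + 2 * W.Q ?I"
    using W.parallelogram[OF vw] W.nonneg[OF W.memI(1)[OF vw]] by linarith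
  also have "\<dots> \<le> 2 * W.Q (val c d) + 2 * (\<Omega> * (P.Q d * G b))"
    using Q_val_bound[OF Ic Ib] by simp
  finally have c: "(norm c)\<^sup>2 \<le> 2 / \<Omega> * W.Q (val c d) + 2 * (P.Q d * G b)"
    using \<Omega>_pos by (simp add: field_simps)
  have "(norm (val c d x))\<^sup>2 \<le> 2 * (norm c)\<^sup>2 + 2 * (norm (?I x))\<^sup>2"
    unfolding val_def by (rule norm_sum_square_le)
  also have "\<dots> \<le> 4 / \<Omega> * W.Q (val c d) + 6 * G b * P.Q d"
    using c Ib[OF x] by (simp add: algebra_simps)
  also have "\<dots> \<le> K * W.Q (val c d) + K * P.Q d"
    using W.nonneg[OF vw(1)] P.nonneg[OF d] \<Omega>_pos G_right_nonneg by (intro add_mono mult_right_mono) (auto simp: K_def)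
  finally show ?thesis by (simp add: algebra_simps)
qed

section \<open>Verification of the hypotheses on the two forms\<close>

lemma V_E_psd: "psd_form fscale (V_space \<epsilon>) E"
proof (intro psd_form.intro psd_form_axioms.intro vector_space_fscale)
  show "module.subspace fscale (V_space \<epsilon>)"
  proof (rule W.subspaceI)
    show "0 \<in> V_space \<epsilon>" by (rule wd_eq(4)[OF rep_zero])
    fix x y assume "x \<in> V_space \<epsilon>" "y \<in> V_space \<epsilon>"
    then obtain c c' where "rep x c (wd x)" "rep y c' (wd y)" using V_rep[of x] V_rep[of y] by blast
    from wd_eq(4)[OF rep_add[OF this]] show "x + y \<in> V_space \<epsilon>" .
  next
    fix c x assume "x \<in> V_space \<epsilon>"
    then obtain k where "rep x k (wd x)" using V_rep by blast
    from wd_eq(4)[OF rep_scale[OF this]] show "fscale c x \<in> V_space \<epsilon>" .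
  qed
next
  fix x y z assume "x \<in> V_space \<epsilon>" "y \<in> V_space \<epsilon>" "z \<in> V_space \<epsilon>"
  then obtain c c' c'' where r: "rep x c (wd x)" "rep y c' (wd y)" "rep z c'' (wd z)" using V_rep[of x] V_rep[of y] V_rep[of z] by blast
  show "E (x + y) z = E x z + E y z"
    unfolding E_rep[OF rep_add[OF r(1,2)] r(3)] E_rep[OF r(1,3)] E_rep[OF r(2,3)]
    using r by (intro P.add_left) (auto simp: rep_def)
next
  fix x z k assume "x \<in> V_space \<epsilon>" "z \<in> V_space \<epsilon>"
  then obtain c c'' where r: "rep x c (wd x)" "rep z c'' (wd z)" using V_rep[of x] V_rep[of z] by blast
  show "E (fscale k x) z = k * E x z"
    unfolding E_rep[OF rep_scale[OF r(1)] r(2)] E_rep[OF r]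
    using r by (intro P.scale_left) (auto simp: rep_def)
next
  fix x y assume "x \<in> V_space \<epsilon>" "y \<in> V_space \<epsilon>"
  then show "E y x = cnj (E x y)" unfolding E_def by (intro P.herm) (auto simp: rep_def dest!: V_rep)
next
  fix x assume "x \<in> V_space \<epsilon>"
  then show "0 \<le> Re (E x x)" unfolding E_def by (intro P.nonneg) (auto simp: rep_def dest!: V_rep)
qed

lemma V_subset: "V_space \<epsilon> \<subseteq> wl2 M w"
  using V_rep by (auto simp: rep_def)

lemma V_N_psd: "psd_form fscale (V_space \<epsilon>) N"
proof (intro psd_form.intro psd_form_axioms.intro vector_space_fscale)
  show "module.subspace fscale (V_space \<epsilon>)" by (rule psd_form.sub[OF V_E_psd])
qed (rule W.add_left W.scale_left W.herm W.nonneg; erule subsetD[OF V_subset])+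

lemma Q_rep:
  assumes "rep u c d"
  shows "Re (E u u) = P.Q d" "Re (N u u) = W.Q (val c d)" "d \<in> wl2 M p" "u \<in> V_space \<epsilon>"
  using E_rep[OF assms assms] N_rep[OF assms assms] assms wd_eq(4)[OF assms] by (auto simp: rep_def)

lemma continuous_wl2_p:
  assumes "continuous_on {a..b} d"
  shows "d \<in> wl2 M p"
proof -
  obtain C where C: "\<And>x. x \<in> {0..1} \<Longrightarrow> \<bar>p x\<bar> \<le> C" by (rule p_bounded) blast
  have dm: "d \<in> borel_measurable M"
    by (intro continuous_imp_measurable_on_sets_lebesgue continuous_on_subset[OF assms]) auto
  have "bounded (d ` {a..b})" using assms by (intro compact_imp_bounded compact_continuous_image) auto
  then obtain D where D: "\<And>x. x \<in> {a..b} \<Longrightarrow> norm (d x) \<le> D" unfolding bounded_iff by blast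
  have "integrable M (\<lambda>x. p x * (norm (d x))\<^sup>2)"
  proof (rule finite_measure.integrable_const_bound)
    show "finite_measure M" by (rule finite_measure_lebesgue_on) simp
    show "AE x in M. norm (p x * (norm (d x))\<^sup>2) \<le> C * D\<^sup>2"
    proof (rule AE_I2)
      fix x assume "x \<in> space M"
      then have x: "x \<in> {0..1}" "x \<in> {a..b}" using J_subset by auto
      have "\<bar>p x\<bar> * (norm (d x))\<^sup>2 \<le> C * D\<^sup>2"
        using C[OF x(1)] D[OF x(2)] by (intro mult_mono power_mono) auto
      then show "norm (p x * (norm (d x))\<^sup>2) \<le> C * D\<^sup>2" by (simp add: abs_mult)
    qed
    show "(\<lambda>x. p x * (norm (d x))\<^sup>2) \<in> borel_measurable M" using dm P.\<rho>_meas by auto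
  qed
  with dm show ?thesis by (simp add: wl2_def)
qed

text \<open>Cauchy--Schwarz with the weights \<open>p\<close> and \<open>1 / p\<close> bounds increments in terms of \<open>G\<close>, hence the
  continuous representatives are equicontinuous and Arzela--Ascoli applies.\<close>

lemma forms_compact:
  assumes x: "\<And>n. x n \<in> V_space \<epsilon> \<and> Re (E (x n) (x n)) \<le> C \<and> Re (N (x n) (x n)) \<le> C"
  shows "\<exists>r. strict_mono (r :: nat \<Rightarrow> nat) \<and>
        (\<forall>e>0. \<exists>m0. \<forall>m\<ge>m0. \<forall>n\<ge>m0. Re (N (x (r m) - x (r n)) (x (r m) - x (r n))) < e)"
proof -
  have "\<exists>c d. rep (x n) c d" for n using x V_rep by blast
  then obtain c d where r: "\<And>n. rep (x n) (c n) (d n)" by metis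
  have d: "d n \<in> wl2 M p" for n by (rule Q_rep(3)[OF r])
  have QC: "P.Q (d n) \<le> C" "W.Q (val (c n) (d n)) \<le> C" for n
    using x[of n] Q_rep(1,2)[OF r[of n]] by auto
  have C0: "0 \<le> C" using QC(1)[of 0] P.nonneg[OF d[of 0]] by linarith
  define v where "v n = val (c n) (d n)" for n
  have bd: "norm (v n z) \<le> sqrt (K * (2 * C))" if "z \<in> {a..b}" for n z
  proof (rule real_le_rsqrt)
    have "(norm (v n z))\<^sup>2 \<le> K * (P.Q (d n) + W.Q (val (c n) (d n)))" unfolding v_def by (rule val_sup_bound[OF d that])
    also have "\<dots> \<le> K * (2 * C)" using QC[of n] K_pos by (intro mult_left_mono) auto
    finally show "(norm (v n z))\<^sup>2 \<le> K * (2 * C)" .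
  qed
  have eqc: "\<exists>\<delta>>0. \<forall>n y. y \<in> {a..b} \<and> norm (z - y) < \<delta> \<longrightarrow> norm (v n z - v n y) < e"
    if z: "z \<in> {a..b}" and e: "0 < e" for z e :: real
  proof -
    have "0 < e\<^sup>2 / (C + 1)" using e C0 by simp
    with G_continuous z obtain \<delta> where \<delta>: "\<delta> > 0" "\<And>y. y \<in> {a..b} \<Longrightarrow> dist y z < \<delta> \<Longrightarrow> dist (G y) (G z) < e\<^sup>2 / (C + 1)"
      unfolding continuous_on_iff by blast
    have "norm (v n z - v n y) < e" if y: "y \<in> {a..b}" "norm (z - y) < \<delta>" for n y
    proof -
      have "\<bar>G z - G y\<bar> < e\<^sup>2 / (C + 1)" using \<delta>(2)[OF y(1)] y(2) by (simp add: dist_norm norm_minus_commute abs_minus_commute)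
      then have "(C + 1) * \<bar>G z - G y\<bar> < e\<^sup>2" using C0 by (simp add: field_simps)
      moreover have "(norm (v n z - v n y))\<^sup>2 \<le> P.Q (d n) * \<bar>G z - G y\<bar>"
        unfolding v_def by (rule val_increment[OF d z y(1)])
      moreover have "P.Q (d n) * \<bar>G z - G y\<bar> \<le> (C + 1) * \<bar>G z - G y\<bar>" using QC(1)[of n] by (intro mult_right_mono) auto
      ultimately have "(norm (v n z - v n y))\<^sup>2 < e\<^sup>2" by linarith
      then show ?thesis using e by (simp add: power_less_imp_less_base)
    qed
    with \<delta>(1) show ?thesis by blast
  qed
  obtain f k where k: "strict_mono (k :: nat \<Rightarrow> nat)"
    and unif: "\<And>e. 0 < e \<Longrightarrow> \<exists>m0. \<forall>n z. n \<ge> m0 \<and> z \<in> {a..b} \<longrightarrow> norm (v (k n) z - f z) < e"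
    by (rule Arzela_Ascoli[of "{a..b}" v "sqrt (K * (2 * C))"]) (use bd eqc in auto)
  have "\<exists>m0. \<forall>m\<ge>m0. \<forall>n\<ge>m0. Re (N (x (k m) - x (k n)) (x (k m) - x (k n))) < e" if e: "e > 0" for e
  proof -
    \<comment> \<open>Chosen so that \<open>\<Omega> * e'\<^sup>2 < e\<close>.\<close>
    define e' where "e' = sqrt (e / (\<Omega> + 1))"
    have e': "e' > 0" "e'\<^sup>2 = e / (\<Omega> + 1)" using e \<Omega>_pos by (auto simp: e'_def)
    then obtain m0 where m0: "\<And>n z. n \<ge> m0 \<Longrightarrow> z \<in> {a..b} \<Longrightarrow> norm (v (k n) z - f z) < e' / 2" using unif[of "e' / 2"] by auto
    have "Re (N (x (k m) - x (k n)) (x (k m) - x (k n))) < e" if mn: "m \<ge> m0" "n \<ge> m0" for m n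
    proof -
      note rd = rep_diff[OF r[of "k m"] r[of "k n"]]
      let ?v = "val (c (k m) - c (k n)) (d (k m) - d (k n))"
      have "Re (N (x (k m) - x (k n)) (x (k m) - x (k n))) = W.Q ?v" by (rule Q_rep(2)[OF rd])
      also have "\<dots> \<le> \<Omega> * e'\<^sup>2"
      proof (rule Q_val_bound)
        show "continuous_on {a..b} ?v" by (rule continuous_val) (use rd in \<open>simp add: rep_def\<close>)
        fix z assume z: "z \<in> {a..b}"
        have "?v z = (v (k m) z - f z) - (v (k n) z - f z)" unfolding v_def by (simp add: val_diff[OF d d z])
        then have "norm (?v z) \<le> norm (v (k m) z - f z) + norm (v (k n) z - f z)" by (metis norm_triangle_ineq4)
        then have "norm (?v z) \<le> e'" using m0[OF mn(1) z] m0[OF mn(2) z] by linarith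
        then show "(norm (?v z))\<^sup>2 \<le> e'\<^sup>2" by (intro power_mono) auto
      qed
      also have "\<dots> < e" using e \<Omega>_pos by (simp add: e'(2) field_simps)
      finally show ?thesis .
    qed
    then show ?thesis by blast
  qed
  with k show ?thesis by blast
qed

text \<open>The derivatives converge by completeness of the \<open>p\<close>-weighted space, and the
  boundary values at \<open>a\<close> converge because point evaluation is bounded in the energy
  norm. These two limits encode the limit function.\<close>

lemma forms_complete:
  assumes x: "\<And>n. x n \<in> V_space \<epsilon>"
    and Cau: "\<And>e. e > 0 \<Longrightarrow> \<exists>m0. \<forall>m\<ge>m0. \<forall>n\<ge>m0. Re (E (x m - x n) (x m - x n)) < e \<and> Re (N (x m - x n) (x m - x n)) < e"
  shows "\<exists>y\<in>V_space \<epsilon>. (\<lambda>n. Re (E (x n - y) (x n - y))) \<longlonglongrightarrow> 0 \<and> (\<lambda>n. Re (N (x n - y) (x n - y))) \<longlonglongrightarrow> 0"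
proof -
  have "\<exists>c d. rep (x n) c d" for n using x V_rep by blast
  then obtain c d where r: "\<And>n. rep (x n) (c n) (d n)" by metis
  have d: "d n \<in> wl2 M p" for n by (rule Q_rep(3)[OF r])
  have Q: "Re (E (x m - x n) (x m - x n)) = P.Q (d m - d n)"
    "Re (N (x m - x n) (x m - x n)) = W.Q (val (c m - c n) (d m - d n))" for m n
    using Q_rep(1,2)[OF rep_diff[OF r[of m] r[of n]]] by auto
  have "\<exists>d'\<in>wl2 M p. (\<lambda>n. P.Q (d n - d')) \<longlonglongrightarrow> 0"
  proof (rule P.wl2_complete[OF d])
    fix e :: real assume "e > 0"
    from Cau[OF this] show "\<exists>m0. \<forall>m\<ge>m0. \<forall>n\<ge>m0. P.Q (d m - d n) < e" unfolding Q by blast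
  qed
  then obtain d' where d': "d' \<in> wl2 M p" "(\<lambda>n. P.Q (d n - d')) \<longlonglongrightarrow> 0" by blast
  have "Cauchy c"
  proof (rule CauchyI)
    fix e :: real assume e: "e > 0"
    have "0 < e\<^sup>2 / (2 * K)" using e K_pos by simp
    from Cau[OF this] obtain m0 where m0: "\<And>m n. m \<ge> m0 \<Longrightarrow> n \<ge> m0 \<Longrightarrow> P.Q (d m - d n) < e\<^sup>2 / (2 * K) \<and> W.Q (val (c m - c n) (d m - d n)) < e\<^sup>2 / (2 * K)"
      unfolding Q by blast
    have "norm (c m - c n) < e" if "m \<ge> m0" "n \<ge> m0" for m n
    proof -
      have "val (c m - c n) (d m - d n) a = c m - c n" by (simp add: val_def)
      then have "(norm (c m - c n))\<^sup>2 \<le> K * (P.Q (d m - d n) + W.Q (val (c m - c n) (d m - d n)))"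
        using val_sup_bound[OF P.memI(2)[OF d d], of a "c m - c n" m n] x0_bounds by simp
      also have "\<dots> < K * (e\<^sup>2 / (2 * K) + e\<^sup>2 / (2 * K))" using m0[OF that] K_pos by (intro mult_strict_left_mono) auto
      also have "\<dots> = e\<^sup>2" using K_pos by simp
      finally show ?thesis using e by (simp add: power_less_imp_less_base)
    qed
    then show "\<exists>m0. \<forall>m\<ge>m0. \<forall>n\<ge>m0. norm (c m - c n) < e" by blast
  qed
  then obtain c' where c': "c \<longlonglongrightarrow> c'" using Cauchy_convergent convergent_def by blast
  define y where "y = val c' d'"
  have ry: "rep y c' d'" unfolding y_def by (rule rep_val[OF d'(1)])
  have Qy: "Re (E (x n - y) (x n - y)) = P.Q (d n - d')"
    "Re (N (x n - y) (x n - y)) = W.Q (val (c n - c') (d n - d'))" for n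
    using Q_rep(1,2)[OF rep_diff[OF r[of n] ry]] by auto
  have lim: "(\<lambda>n. \<Omega> * (2 * (norm (c n - c'))\<^sup>2 + 2 * (P.Q (d n - d') * G b))) \<longlonglongrightarrow> \<Omega> * (2 * 0\<^sup>2 + 2 * (0 * G b))"
    using d'(2) c' by (intro tendsto_intros LIM_zero tendsto_norm_zero)
  have "(\<lambda>n. W.Q (val (c n - c') (d n - d'))) \<longlonglongrightarrow> 0"
  proof (rule tendsto_sandwich[OF _ _ tendsto_const])
    have dd: "d n - d' \<in> wl2 M p" for n by (rule P.memI(2)[OF d d'(1)])
    show "\<forall>\<^sub>F n in sequentially. 0 \<le> W.Q (val (c n - c') (d n - d'))"
      by (intro always_eventually allI W.nonneg w_abs_le_integrable continuous_val[OF dd])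
    show "\<forall>\<^sub>F n in sequentially. W.Q (val (c n - c') (d n - d')) \<le> \<Omega> * (2 * (norm (c n - c'))\<^sup>2 + 2 * (P.Q (d n - d') * G b))"
    proof (intro always_eventually allI Q_val_bound)
      fix n show "continuous_on {a..b} (val (c n - c') (d n - d'))" by (rule continuous_val[OF dd])
      fix z assume z: "z \<in> {a..b}"
      have "(norm (val (c n - c') (d n - d') z))\<^sup>2 \<le> 2 * (norm (c n - c'))\<^sup>2 + 2 * (norm (integral {a..z} (d n - d')))\<^sup>2"
        unfolding val_def by (rule norm_sum_square_le)
      then show "(norm (val (c n - c') (d n - d') z))\<^sup>2 \<le> 2 * (norm (c n - c'))\<^sup>2 + 2 * (P.Q (d n - d') * G b)"
        using integral_sup_bound[OF dd z, of n] by linarith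
    qed
    show "(\<lambda>n. \<Omega> * (2 * (norm (c n - c'))\<^sup>2 + 2 * (P.Q (d n - d') * G b))) \<longlonglongrightarrow> 0" using lim by simp
  qed
  with d'(2) show ?thesis using Q_rep(4)[OF ry] unfolding Qy[symmetric] by blast
qed

definition monomial :: "nat \<Rightarrow> real \<Rightarrow> complex" where "monomial i x = of_real x ^ i"

lemma monomial_mem: "monomial i \<in> V_space \<epsilon>"
proof -
  define d where "d x = of_nat i * complex_of_real x ^ (i - 1)" for x
  have dw: "d \<in> wl2 M p" unfolding d_def[abs_def] by (intro continuous_wl2_p continuous_intros)
  have eqv: "monomial i x = val (monomial i a) d x" if "x \<in> {a..b}" for x
  proof -
    have "(d has_integral (monomial i x - monomial i a)) {a..x}"
    proof (rule fundamental_theorem_of_calculus)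
      show "a \<le> x" using that by simp
      fix z :: real
      have "((\<lambda>x. x ^ i) has_real_derivative of_nat i * z ^ (i - 1)) (at z within {a..x})"
        by (auto intro!: derivative_eq_intros)
      then have "((\<lambda>x. complex_of_real (x ^ i)) has_vector_derivative complex_of_real (of_nat i * z ^ (i - 1))) (at z within {a..x})"
        by (intro has_vector_derivative_of_real) (simp add: has_real_derivative_iff_has_vector_derivative)
      then show "(monomial i has_vector_derivative d z) (at z within {a..x})" by (simp add: monomial_def[abs_def] d_def)
    qed
    then show ?thesis by (simp add: val_def integral_unique)
  qed
  have "AE x in M. monomial i x = val (monomial i a) d x"
  proof (rule AE_I2)
    fix x assume "x \<in> space M"
    then have "x \<in> {a..b}" by simp
    then show "monomial i x = val (monomial i a) d x" by (rule eqv)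
  qed
  moreover have "monomial i \<in> wl2 M w"
    unfolding monomial_def[abs_def] by (intro w_abs_le_integrable continuous_intros)
  ultimately have "rep (monomial i) (monomial i a) d" using dw by (simp add: rep_def)
  then show ?thesis by (rule Q_rep(4))
qed

lemma finite_not_AE: "\<not> (AE x in M. x \<in> F)" if "finite F" for F
proof
  assume "AE x in M. x \<in> F"
  then have "AE x in lebesgue. x \<in> J \<longrightarrow> x \<in> F" by (simp add: AE_restrict_space_iff)
  moreover have "AE x in lebesgue. x \<notin> F"
    using that by (intro AE_not_in null_sets_completionI finite_imp_null_set_lborel)
  ultimately have "AE x in lebesgue. x \<notin> J" by eventually_elim blast
  then have "J \<in> null_sets lebesgue" by (subst AE_iff_null_sets) simp_all
  then have "negligible (box a b)" by (simp add: negligible_iff_null_sets box_real)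
  then show False using negligible_interval(2)[of a b] x0_bounds(4) by (simp add: box_real)
qed

text \<open>A nonzero polynomial has finitely many roots, so it cannot vanish almost everywhere on
  \<open>J\<close>.\<close>

lemma forms_infinite_dim:
  "\<exists>e :: nat \<Rightarrow> real \<Rightarrow> complex. (\<forall>i. e i \<in> V_space \<epsilon>) \<and>
      (\<forall>c. (\<exists>i<n. c i \<noteq> 0) \<longrightarrow> 0 < Re (N (\<Sum>i<n. fscale (c i) (e i)) (\<Sum>i<n. fscale (c i) (e i))))"
proof (intro exI[of _ monomial] conjI allI impI monomial_mem)
  interpret V: psd_form fscale "V_space \<epsilon>" N by (rule V_N_psd)
  fix c :: "nat \<Rightarrow> complex" assume c: "\<exists>i<n. c i \<noteq> 0"
  let ?f = "\<Sum>i<n. fscale (c i) (monomial i)"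
  have f: "?f \<in> V_space \<epsilon>" by (intro V.memI monomial_mem)
  then have fw: "?f \<in> wl2 M w" using V_subset by blast
  \<comment> \<open>The root count is for sums over \<open>i \<le> n'\<close>; a nonzero coefficient
    rules out \<open>n = 0\<close>.\<close>
  obtain n' where n: "n = Suc n'" using c by (cases n) auto
  have val: "?f x = (\<Sum>i\<le>n'. c i * of_real x ^ i)" for x
  proof -
    have "?f x = (\<Sum>i<n. (fscale (c i) (monomial i)) x)" by (induction n) (auto simp: zero_fun_def plus_fun_def)
    then show ?thesis by (simp add: fscale_def monomial_def n lessThan_Suc_atMost)
  qed
  have "finite {z. (\<Sum>i\<le>n'. c i * z ^ i) = 0}" using c by (subst polyfun_finite_roots) (auto simp: n less_Suc_eq_le)
  then have fin: "finite {x. ?f x = 0}"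
    using finite_vimageI[of "{z. (\<Sum>i\<le>n'. c i * z ^ i) = 0}" complex_of_real] by (simp add: val vimage_def inj_def)
  have "W.Q ?f \<noteq> 0"
  proof
    assume "W.Q ?f = 0"
    then have "AE x in M. x \<in> {x. ?f x = 0}" using W.wl2_norm_zero_iff[OF fw] by simp
    with finite_not_AE[OF fin] show False by blast
  qed
  then show "0 < W.Q ?f" using W.nonneg[OF fw] by simp
qed

sublocale F: compact_form_pair fscale "V_space \<epsilon>" E N
  by (intro compact_form_pair.intro compact_form_pair_axioms.intro V_E_psd V_N_psd forms_compact forms_complete forms_infinite_dim)

section \<open>Weak eigenvectors and integral equations\<close>

lemma N_formula:
  assumes U: "continuous_on {a..b} U" and e: "e \<in> wl2 M p"
  defines "F \<equiv> \<lambda>x. integral {a..x} (\<lambda>z. w z *\<^sub>R U z)"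
  shows "N U (val c e) = F b * cnj (val c e b) - integral {a..b} (\<lambda>x. F x * cnj (e x))"
proof -
  let ?f = "\<lambda>z. w z *\<^sub>R U z"
  have f: "?f absolutely_integrable_on {a..b}" by (rule absolutely_integrable_scaleR_continuous[OF w_integrable_ab U])
  have e': "(\<lambda>x. cnj (e x)) absolutely_integrable_on {a..b}" by (rule absolutely_integrable_cnj[OF absolutely_integrable_wl2[OF e]])
  \<comment> \<open>Integration by parts trades \<open>w U\<close> for its primitive
    \<open>F\<close>. As \<open>F\<close> vanishes at \<open>a\<close>, a boundary term remains only
    at \<open>b\<close>.\<close>
  note ibp = integration_by_parts_absolutely_integrable[OF f e']
  have cn: "integral {a..x} (\<lambda>x. cnj (e x)) = cnj (integral {a..x} e)" for x by (rule Henstock_Kurzweil_Integration.integral_cnj[symmetric])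
  have cai: "(\<lambda>x. ?f x * cnj c) absolutely_integrable_on {a..b}"
    using absolutely_integrable_scaleR_continuous[OF w_integrable_ab, of "\<lambda>x. U x * cnj c"] U by (simp add: continuous_intros)
  have "N U (val c e) = (LINT x|M. ?f x * cnj c + ?f x * integral {a..x} (\<lambda>x. cnj (e x)))"
    unfolding wl2_inner_def val_def[abs_def] by (rule Bochner_Integration.integral_cong) (auto simp: cn scaleR_conv_of_real algebra_simps)
  also have "\<dots> = integral {a..b} (\<lambda>x. ?f x * cnj c + ?f x * integral {a..x} (\<lambda>x. cnj (e x)))"
    by (intro LINT_eq_integral_Icc set_integral_add(1) cai ibp(2))
  also have "\<dots> = integral {a..b} (\<lambda>x. ?f x * cnj c) + integral {a..b} (\<lambda>x. ?f x * integral {a..x} (\<lambda>x. cnj (e x)))"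
    using cai ibp(2) by (intro Henstock_Kurzweil_Integration.integral_add) (auto simp: absolutely_integrable_on_def)
  also have "integral {a..b} (\<lambda>x. ?f x * cnj c) = F b * cnj c" unfolding F_def by (rule Henstock_Kurzweil_Integration.integral_mult_left)
  also have "integral {a..b} (\<lambda>x. ?f x * integral {a..x} (\<lambda>x. cnj (e x))) = F b * cnj (integral {a..b} e) - integral {a..b} (\<lambda>x. F x * cnj (e x))"
    using ibp(1) unfolding F_def cn by (simp add: eq_diff_eq)
  finally show ?thesis by (simp add: val_def[abs_def] algebra_simps)
qed

text \<open>\<open>p\<close> times the square of \<open>q / p\<close> is
  \<open>q\<^sup>2 / p\<close>, so a continuous flux has finite energy because \<open>1 / p\<close>
  is integrable.\<close>

lemma ip_wl2:
  assumes q: "continuous_on {a..b} q"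
  shows "(\<lambda>x. (1 / p x) *\<^sub>R q x) \<in> wl2 M p"
proof -
  have ai: "(\<lambda>x. (1 / p x) *\<^sub>R q x) absolutely_integrable_on {a..b}" by (rule absolutely_integrable_scaleR_continuous[OF ip_integrable q])
  then have m: "(\<lambda>x. (1 / p x) *\<^sub>R q x) \<in> borel_measurable M"
    by (simp add: absolutely_integrable_on_Icc_iff_Ioo absolutely_integrable_imp_borel_measurable)
  have "(\<lambda>x. (1 / p x) *\<^sub>R (norm (q x))\<^sup>2) absolutely_integrable_on {a..b}"
    by (rule absolutely_integrable_scaleR_continuous[OF ip_integrable]) (intro continuous_intros q)
  then have "integrable M (\<lambda>x. (1 / p x) *\<^sub>R (norm (q x))\<^sup>2)"
    by (simp add: absolutely_integrable_on_Icc_iff_Ioo absolutely_integrable_imp_integrable)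
  moreover have "(1 / p x) *\<^sub>R (norm (q x))\<^sup>2 = p x * (norm ((1 / p x) *\<^sub>R q x))\<^sup>2" if "x \<in> space M" for x
    using p_pos[of x] that by (simp add: power_divide power2_eq_square)
  ultimately have "integrable M (\<lambda>x. p x * (norm ((1 / p x) *\<^sub>R q x))\<^sup>2)"
    by (subst (asm) Bochner_Integration.integrable_cong[OF refl]) assumption+
  with m show ?thesis by (simp add: wl2_def)
qed

lemma E_formula:
  assumes q: "continuous_on {a..b} q" and e: "e \<in> wl2 M p"
  shows "wl2_inner M p (\<lambda>x. (1 / p x) *\<^sub>R q x) e = integral {a..b} (\<lambda>x. q x * cnj (e x))"
proof -
  have e': "(\<lambda>x. cnj (e x)) absolutely_integrable_on {a..b}" by (rule absolutely_integrable_cnj[OF absolutely_integrable_wl2[OF e]])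
  have "wl2_inner M p (\<lambda>x. (1 / p x) *\<^sub>R q x) e = (LINT x|M. q x * cnj (e x))"
    unfolding wl2_inner_def
  proof (rule Bochner_Integration.integral_cong[OF refl])
    fix x assume "x \<in> space M"
    then show "(1 / p x) *\<^sub>R q x * cnj (e x) * complex_of_real (p x) = q x * cnj (e x)"
      using p_pos[of x] by (simp add: scaleR_conv_of_real)
  qed
  also have "\<dots> = integral {a..b} (\<lambda>x. q x * cnj (e x))"
    using absolutely_integrable_mult_continuous[OF e' q] by (intro LINT_eq_integral_Icc) (simp add: mult.commute)
  finally show ?thesis .
qed

text \<open>Constants as test functions give \<open>\<mu> * F b = 0\<close>, which is zero flux at
  \<open>b\<close>; at \<open>a\<close> it holds by construction of \<open>q\<close>. Testing then
  with the primitive of \<open>d - q / p\<close> shows that \<open>d\<close> is \<open>q / p\<close>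
  almost everywhere.\<close>

lemma weak_imp_integral_equations:
  assumes u: "u \<in> V_space \<epsilon>" and weak: "\<And>\<eta>. \<eta> \<in> V_space \<epsilon> \<Longrightarrow> E u \<eta> = \<mu> * N u \<eta>"
  obtains U q where "continuous_on {a..b} U" "continuous_on {a..b} q" "AE x in M. u x = U x" "q a = 0" "q b = 0"
    "\<And>x. x \<in> {a..b} \<Longrightarrow> U x = U a + integral {a..x} (\<lambda>x. (1 / p x) *\<^sub>R q x)"
    "\<And>x. x \<in> {a..b} \<Longrightarrow> q x = - \<mu> * integral {a..x} (\<lambda>x. w x *\<^sub>R U x)"
proof -
  obtain c where r: "rep u c (wd u)" using V_rep[OF u] by blast
  define d where "d = wd u"
  have rd: "rep u c d" using r by (simp add: d_def)
  have d: "d \<in> wl2 M p" by (rule Q_rep(3)[OF rd])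
  define U where "U = val c d"
  have Uc: "continuous_on {a..b} U" unfolding U_def by (rule continuous_val[OF d])
  define F where "F x = integral {a..x} (\<lambda>z. w z *\<^sub>R U z)" for x
  define q where "q x = - \<mu> * F x" for x
  have Fc: "continuous_on {a..b} F" unfolding F_def[abs_def]
    using absolutely_integrable_scaleR_continuous[OF w_integrable_ab Uc]
    by (intro indefinite_integral_continuous_1) (simp add: absolutely_integrable_on_def)
  have qc: "continuous_on {a..b} q" unfolding q_def[abs_def] by (intro continuous_intros Fc)
  have key: "wl2_inner M p d e = \<mu> * (F b * cnj (val c' e b) - integral {a..b} (\<lambda>x. F x * cnj (e x)))" if e: "e \<in> wl2 M p" for c' e
  proof -
    note re = rep_val[OF e, of c']
    have "wl2_inner M p d e = E u (val c' e)" by (rule E_rep[OF rd re, symmetric])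
    also have "\<dots> = \<mu> * N u (val c' e)" by (rule weak[OF Q_rep(4)[OF re]])
    also have "N u (val c' e) = N U (val c' e)" unfolding U_def by (rule N_rep[OF rd re])
    also have "\<dots> = F b * cnj (val c' e b) - integral {a..b} (\<lambda>x. F x * cnj (e x))"
      unfolding F_def by (rule N_formula[OF Uc e])
    finally show ?thesis .
  qed
  \<comment> \<open>The constant test function 1, encoded by derivative 0.\<close>
  have z: "val 1 0 b = 1" by (simp add: val_def zero_fun_def)
  have Fb: "\<mu> * F b = 0"
    using key[OF P.wl2_zero, of 1] P.zero_right[OF d] unfolding z by (simp add: zero_fun_def)
  define q' where "q' x = (1 / p x) *\<^sub>R q x" for x
  have q': "q' \<in> wl2 M p" unfolding q'_def[abs_def] by (rule ip_wl2[OF qc])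
  have eq: "wl2_inner M p d e = wl2_inner M p q' e" if e: "e \<in> wl2 M p" for e
  proof -
    have "wl2_inner M p d e = - \<mu> * integral {a..b} (\<lambda>x. F x * cnj (e x))"
      using key[OF e, of 0] Fb by (simp add: right_diff_distrib mult.assoc[symmetric])
    also have "\<dots> = integral {a..b} (\<lambda>x. q x * cnj (e x))" by (simp add: q_def mult.assoc)
    also have "\<dots> = wl2_inner M p q' e" unfolding q'_def by (rule E_formula[OF qc e, symmetric])
    finally show ?thesis .
  qed
  have dq: "d - q' \<in> wl2 M p" by (rule P.memI(2)[OF d q'])
  have "P.Q (d - q') = 0" using eq[OF dq] P.diff_left[OF d q' dq] by simp
  then have ae: "AE x in M. d x = q' x" using P.wl2_norm_zero_iff[OF dq] by simp
  have int: "integral {a..x} d = integral {a..x} q'" if "x \<in> {a..b}" for x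
  proof -
    have "AE x in lebesgue. x \<in> J \<longrightarrow> d x = q' x" using ae by (simp add: AE_restrict_space_iff)
    then obtain Z where Z: "{x. \<not> (x \<in> J \<longrightarrow> d x = q' x)} \<subseteq> Z" "negligible Z"
      by (auto simp: eventually_ae_filter negligible_iff_null_sets)
    show ?thesis
    proof (rule integral_spike)
      show "negligible (Z \<union> {a, b})" using Z(2) by simp
      fix y assume "y \<in> {a..x} - (Z \<union> {a, b})"
      then have "y \<in> J" "y \<notin> Z" using that by auto
      with Z(1) show "q' y = d y" by auto
    qed
  qed
  show ?thesis
  proof (rule that[OF Uc qc])
    show "AE x in M. u x = U x" using rd by (simp add: rep_def U_def)
    show "q a = 0" by (simp add: q_def F_def)
    show "q b = 0" using Fb by (simp add: q_def)
    fix x assume x: "x \<in> {a..b}"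
    show "U x = U a + integral {a..x} (\<lambda>x. (1 / p x) *\<^sub>R q x)" using int[OF x] by (simp add: U_def val_def q'_def[abs_def])
    show "q x = - \<mu> * integral {a..x} (\<lambda>x. w x *\<^sub>R U x)" by (simp add: q_def F_def)
  qed
qed

lemma integral_equations_imp_weak:
  assumes U: "continuous_on {a..b} U" and q: "continuous_on {a..b} q" and qb: "q b = 0"
    and eqU: "\<And>x. x \<in> {a..b} \<Longrightarrow> U x = U a + integral {a..x} (\<lambda>x. (1 / p x) *\<^sub>R q x)"
    and eqq: "\<And>x. x \<in> {a..b} \<Longrightarrow> q x = - \<mu> * integral {a..x} (\<lambda>x. w x *\<^sub>R U x)"
  shows "U \<in> V_space \<epsilon>" "\<eta> \<in> V_space \<epsilon> \<Longrightarrow> E U \<eta> = \<mu> * N U \<eta>"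
proof -
  let ?d = "\<lambda>x. (1 / p x) *\<^sub>R q x"
  have d: "?d \<in> wl2 M p" by (rule ip_wl2[OF q])
  have r: "rep U (U a) ?d"
    unfolding rep_def
  proof (intro conjI AE_I2 d w_abs_le_integrable[OF U])
    fix x assume "x \<in> space M"
    then show "U x = val (U a) ?d x" unfolding val_def by (intro eqU) auto
  qed
  then show "U \<in> V_space \<epsilon>" by (rule Q_rep(4))
  assume "\<eta> \<in> V_space \<epsilon>"
  then obtain c where re: "rep \<eta> c (wd \<eta>)" using V_rep by blast
  then have e: "wd \<eta> \<in> wl2 M p" by (rule Q_rep(3))
  define F where "F x = integral {a..x} (\<lambda>z. w z *\<^sub>R U z)" for x
  have Fb: "\<mu> * F b = 0" using eqq[of b] qb x0_bounds by (simp add: F_def)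
  have "E U \<eta> = wl2_inner M p ?d (wd \<eta>)" by (rule E_rep[OF r re])
  also have "\<dots> = integral {a..b} (\<lambda>x. q x * cnj (wd \<eta> x))" by (rule E_formula[OF q e])
  also have "\<dots> = integral {a..b} (\<lambda>x. - \<mu> * (F x * cnj (wd \<eta> x)))"
    by (rule integral_cong) (simp add: eqq F_def)
  also have "\<dots> = - \<mu> * integral {a..b} (\<lambda>x. F x * cnj (wd \<eta> x))" by simp
  also have "\<dots> = \<mu> * (F b * cnj (val c (wd \<eta>) b) - integral {a..b} (\<lambda>x. F x * cnj (wd \<eta> x)))"
    using Fb by (simp add: right_diff_distrib mult.assoc[symmetric])
  also have "F b * cnj (val c (wd \<eta>) b) - integral {a..b} (\<lambda>x. F x * cnj (wd \<eta> x)) = N U (val c (wd \<eta>))"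
    unfolding F_def by (rule N_formula[OF U e, symmetric])
  also have "\<dots> = N U \<eta>"
  proof (rule W.wl2_inner_cong_AE)
    show "AE x in M. val c (wd \<eta>) x = \<eta> x" using re unfolding rep_def by (auto elim: eventually_mono)
  qed (use re e U in \<open>auto simp: rep_def intro: w_abs_le_integrable continuous_val\<close>)
  finally show "E U \<eta> = \<mu> * N U \<eta>" .
qed

end

section \<open>Eigenfunctions as solutions of integral equations\<close>

text \<open>In the definition of a solution the absolutely continuous \<open>q\<close> agrees with
  \<open>p u'\<close> only off a null set, whereas derivatives are known for \<open>p u'\<close>.
  The linear approximation of \<open>f\<close> at \<open>x\<close> passes to \<open>q\<close>
  because the good points are dense and \<open>q\<close> is continuous.\<close>

lemma continuous_agree_derivative:
  fixes q f :: "real \<Rightarrow> complex"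
  assumes q: "continuous_on {s..t} q" and x: "x \<in> {s<..<t}" and ae: "AE y in lebesgue_on {s..t}. q y = f y"
    and f: "(f has_vector_derivative f') (at x)"
  shows "(q has_vector_derivative f') (at x)"
proof -
  have "AE y in lebesgue. y \<in> {s..t} \<longrightarrow> q y = f y" using ae by (simp add: AE_restrict_space_iff)
  then obtain Z where Z: "{y. \<not> (y \<in> {s..t} \<longrightarrow> q y = f y)} \<subseteq> Z" "negligible Z"
    by (auto simp: eventually_ae_filter negligible_iff_null_sets)
  have eq: "q y = f y" if "y \<in> {s..t}" "y \<notin> Z" for y using Z(1) that by blast
  have dense: "\<exists>y. dist y z < \<delta> \<and> y \<notin> Z" if "\<delta> > 0" for \<delta> z :: real
  proof (rule ccontr)
    assume "\<not> ?thesis"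
    then have "ball z \<delta> \<subseteq> Z" by (auto simp: dist_commute)
    then have "negligible (ball z \<delta>)" using Z(2) negligible_subset by blast
    then show False using that by (simp add: open_not_negligible)
  qed
  define L where "L y = f x + (y - x) *\<^sub>R f'" for y
  have est: "\<exists>\<delta>>0. \<forall>y. \<bar>y - x\<bar> < \<delta> \<longrightarrow> norm (q y - L y) \<le> e * \<bar>y - x\<bar>" if e: "e > 0" for e
  proof -
    obtain \<delta>1 where \<delta>1: "\<delta>1 > 0" "\<And>y. \<bar>y - x\<bar> < \<delta>1 \<Longrightarrow> norm (f y - L y) \<le> e * \<bar>y - x\<bar>"
      using f e unfolding has_vector_derivative_def has_derivative_at_alt L_def by (force simp: dist_norm algebra_simps)
    define \<delta> where "\<delta> = min \<delta>1 (min (x - s) (t - x))"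
    have \<delta>: "\<delta> > 0" using \<delta>1 x by (simp add: \<delta>_def)
    have "norm (q y - L y) \<le> e * \<bar>y - x\<bar>" if y: "\<bar>y - x\<bar> < \<delta>" for y
    proof -
      have "\<exists>z. dist z y < min (1 / real (Suc n)) (\<delta> - \<bar>y - x\<bar>) \<and> z \<notin> Z" for n using y by (intro dense) auto
      then obtain z where z: "\<And>n. dist (z n) y < min (1 / real (Suc n)) (\<delta> - \<bar>y - x\<bar>)" "\<And>n. z n \<notin> Z" by metis
      have zl: "z \<longlonglongrightarrow> y"
      proof (rule metric_LIMSEQ_I)
        fix r :: real assume "r > 0"
        then obtain n0 where n0: "1 / real (Suc n0) < r" using nat_approx_posE by blast
        have "dist (z n) y < r" if "n \<ge> n0" for n
        proof -
          have "1 / real (Suc n) \<le> 1 / real (Suc n0)" using that by (simp add: frac_le)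
          then show ?thesis using z(1)[of n] n0 by linarith
        qed
        then show "\<exists>n0. \<forall>n\<ge>n0. dist (z n) y < r" by blast
      qed
      have zx: "\<bar>z n - x\<bar> < \<delta>" for n
      proof -
        have "\<bar>z n - y\<bar> < \<delta> - \<bar>y - x\<bar>" using z(1)[of n] by (simp add: dist_real_def)
        then show ?thesis by linarith
      qed
      have zst: "z n \<in> {s..t}" for n
      proof -
        have "\<bar>z n - x\<bar> < x - s" "\<bar>z n - x\<bar> < t - x" using zx[of n] by (simp_all add: \<delta>_def)
        then show ?thesis by (simp add: abs_less_iff)
      qed
      have yst: "y \<in> {s<..<t}" using y by (auto simp: \<delta>_def abs_less_iff)
      have "isCont q y" using q yst by (simp add: continuous_on_interior)
      then have "(\<lambda>n. q (z n)) \<longlonglongrightarrow> q y" using zl by (rule isCont_tendsto_compose)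
      then have "(\<lambda>n. norm (q (z n) - L (z n))) \<longlonglongrightarrow> norm (q y - L y)"
        unfolding L_def by (intro tendsto_intros zl)
      moreover have "(\<lambda>n. e * \<bar>z n - x\<bar>) \<longlonglongrightarrow> e * \<bar>y - x\<bar>" by (intro tendsto_intros zl)
      moreover have "norm (q (z n) - L (z n)) \<le> e * \<bar>z n - x\<bar>" for n
        using \<delta>1(2)[of "z n"] zx[of n] eq[OF zst z(2), of n] by (simp add: \<delta>_def)
      ultimately show ?thesis by (intro LIMSEQ_le) auto
    qed
    with \<delta> show ?thesis by blast
  qed
  have qx: "q x = f x" using est[of 1] by (auto simp: L_def dest!: spec[of _ x])
  show ?thesis
    unfolding has_vector_derivative_def has_derivative_at_alt
  proof (intro conjI allI impI bounded_linear_scaleR_left)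
    fix e :: real assume "e > 0"
    from est[OF this] show "\<exists>d>0. \<forall>y. norm (y - x) < d \<longrightarrow> norm (q y - q x - (y - x) *\<^sub>R f') \<le> e * norm (y - x)"
      by (simp add: L_def qx algebra_simps)
  qed
qed

context small_parameter
begin

lemma finite_sing: "finite sing" by (simp add: sing_def)

lemma AE_not_sing: "AE x in lebesgue_on {0..1}. x \<in> {0..1} - sing"
proof -
  have "AE x in lebesgue. x \<notin> sing"
    by (intro AE_not_in null_sets_completionI finite_imp_null_set_lborel finite_sing)
  then have "AE x in lebesgue. x \<in> {0..1} \<longrightarrow> x \<in> {0..1} - sing" by eventually_elim blast
  then show ?thesis by (subst AE_restrict_space_iff) auto
qed

lemma open_regular: "open ({0..1} - sing)"
proof -
  have "{0..1} - sing = {0<..<1} - sing" by (auto simp: sing_def)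
  then show ?thesis using finite_sing by (simp add: open_Diff finite_imp_closed)
qed

lemma regular_subset: "{0..1} - sing \<subseteq> {0..1} - {a, b}" by (auto simp: sing_def)

lemma frontier_M_plus: "frontier (M_plus \<epsilon>) = {a, b}"
  using x0_bounds by (simp add: M_plus_eq frontier_def closure_greaterThanLessThan interior_open)

text \<open>The first-order system for \<open>u\<close> and the flux \<open>q\<close>, stated over
  all subintervals so that it can be restarted at \<open>a\<close> or \<open>b\<close>. In
  integrated form the zeros of \<open>p\<close> are no longer special.\<close>

definition ode :: "complex \<Rightarrow> (real \<Rightarrow> complex) \<Rightarrow> (real \<Rightarrow> complex) \<Rightarrow> bool" where
  "ode \<mu> u q \<longleftrightarrow> continuous_on {0..1} u \<and> continuous_on {0..1} q \<and>
     (\<forall>s t. 0 \<le> s \<and> s \<le> t \<and> t \<le> 1 \<longrightarrow> u t - u s = integral {s..t} (\<lambda>x. (1 / p x) *\<^sub>R q x)) \<and>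
     (\<forall>s t. 0 \<le> s \<and> s \<le> t \<and> t \<le> 1 \<longrightarrow> q t - q s = - \<mu> * integral {s..t} (\<lambda>x. w x *\<^sub>R u x))"

lemma inverse_p_q_integrable: "continuous_on {0..1} q \<Longrightarrow> (\<lambda>x. (1 / p x) *\<^sub>R q x) absolutely_integrable_on {0..1}"
  for q :: "real \<Rightarrow> complex"
  by (rule absolutely_integrable_scaleR_continuous[OF inverse_p_integrable])

lemma w_u_integrable: "continuous_on {0..1} u \<Longrightarrow> (\<lambda>x. w x *\<^sub>R u x) absolutely_integrable_on {0..1}"
  for u :: "real \<Rightarrow> complex"
  by (rule absolutely_integrable_scaleR_continuous[OF w_integrable])

lemma continuous_on_inverse_p_q: "continuous_on {0..1} q \<Longrightarrow> continuous_on ({0..1} - {a, b}) (\<lambda>x. (1 / p x) *\<^sub>R q x)"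
  for q :: "real \<Rightarrow> complex"
  using p_nonzero by (intro continuous_intros continuous_on_p) (auto intro: continuous_on_subset)

lemma continuous_on_w_u: "continuous_on {0..1} u \<Longrightarrow> continuous_on ({0..1} - {a, b}) (\<lambda>x. w x *\<^sub>R u x)"
  for u :: "real \<Rightarrow> complex"
  by (intro continuous_intros continuous_on_w) (auto intro: continuous_on_subset)

lemma eigenspace_imp_ode:
  assumes u: "u \<in> eigenspace \<epsilon> \<mu>"
  obtains q where "ode \<mu> u q" "q a = 0" "q b = 0"
proof -
  from u have SL: "SL_solution \<epsilon> \<mu> u" and qN: "quasi_Neumann \<epsilon> u" by (auto simp: eigenspace_def)
  from SL obtain q where uac: "abs_continuous_on {0..1} u" and qac: "abs_continuous_on {0..1} q"
    and ae1: "AE x in lebesgue_on {0..1}. u differentiable (at x) \<and> q x = p x *\<^sub>R vderiv u x"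
    and ae2: "AE x in lebesgue_on {0..1}. vderiv u differentiable (at x) \<and> D_op \<epsilon> u x = \<mu> * u x"
    unfolding SL_solution_def by blast
  have uc: "continuous_on {0..1} u" and qc: "continuous_on {0..1} q"
    using uac qac by (auto intro: abs_continuous_on_imp_continuous_on)
  have du: "AE x in lebesgue_on {0..1}. (u has_vector_derivative (1 / p x) *\<^sub>R q x) (at x)"
    using ae1 AE_not_sing
  proof eventually_elim
    case (elim x)
    then have "p x \<noteq> 0" using p_nonzero regular_subset by blast
    then have "(1 / p x) *\<^sub>R q x = vderiv u x" using elim by simp
    with elim show ?case by (simp add: vector_derivative_works)
  qed
  have "AE x in lebesgue_on {0..1}. q x = p x *\<^sub>R vderiv u x" using ae1 by eventually_elim simp
  note agree = continuous_agree_derivative[OF qc _ this]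
  have dq: "AE x in lebesgue_on {0..1}. (q has_vector_derivative - \<mu> * (w x *\<^sub>R u x)) (at x)"
    using ae2 AE_not_sing
  proof eventually_elim
    case (elim x)
    let ?u' = "vderiv u x" and ?u'' = "vderiv (vderiv u) x"
    have x: "x \<in> {0..1} - {a, b}" using elim regular_subset by blast
    have d2: "(vderiv u has_vector_derivative ?u'') (at x)" using elim by (simp add: vector_derivative_works)
    have dp: "(p has_real_derivative p x * phi1 \<epsilon> x / phi2 \<epsilon> x) (at x)" using elim by (intro p_deriv)
    have "((\<lambda>x. p x *\<^sub>R vderiv u x) has_vector_derivative (p x *\<^sub>R ?u'' + (p x * phi1 \<epsilon> x / phi2 \<epsilon> x) *\<^sub>R ?u')) (at x)"
      by (rule has_vector_derivative_scaleR[OF dp d2])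
    \<comment> \<open>Since \<open>p' = p * phi1 / phi2\<close>, the left-hand side is
      \<open>p / phi2\<close> times \<open>D_op \<epsilon> u x\<close>.\<close>
    moreover have "p x *\<^sub>R ?u'' + (p x * phi1 \<epsilon> x / phi2 \<epsilon> x) *\<^sub>R ?u' = - \<mu> * (w x *\<^sub>R u x)"
    proof -
      have "\<mu> * u x = phi2 \<epsilon> x *\<^sub>R ?u'' + phi1 \<epsilon> x *\<^sub>R ?u'" using elim by (simp add: D_op_def)
      moreover have "- \<mu> * (w x *\<^sub>R u x) = (p x / phi2 \<epsilon> x) *\<^sub>R (\<mu> * u x)" by (simp add: w1_def)
      ultimately have "- \<mu> * (w x *\<^sub>R u x) = (p x / phi2 \<epsilon> x) *\<^sub>R (phi2 \<epsilon> x *\<^sub>R ?u'' + phi1 \<epsilon> x *\<^sub>R ?u')"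
        by simp
      also have "\<dots> = p x *\<^sub>R ?u'' + (p x * phi1 \<epsilon> x / phi2 \<epsilon> x) *\<^sub>R ?u'"
        using phi2_nonzero[OF x] by (simp add: scaleR_add_right)
      finally show ?thesis by simp
    qed
    ultimately have "((\<lambda>x. p x *\<^sub>R vderiv u x) has_vector_derivative - \<mu> * (w x *\<^sub>R u x)) (at x)" by simp
    then show ?case using elim by (intro agree) (auto simp: sing_def)
  qed
  have U: "u t - u s = integral {s..t} (\<lambda>x. (1 / p x) *\<^sub>R q x)" if "0 \<le> s" "s \<le> t" "t \<le> 1" for s t
    by (rule abs_continuous_on_eq_integral[OF uac inverse_p_q_integrable[OF qc] _ continuous_on_inverse_p_q[OF qc] du that]) simp
  have Qe: "q t - q s = - \<mu> * integral {s..t} (\<lambda>x. w x *\<^sub>R u x)" if "0 \<le> s" "s \<le> t" "t \<le> 1" for s t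
  proof -
    have ai: "(\<lambda>x. - \<mu> * (w x *\<^sub>R u x)) absolutely_integrable_on {0..1}"
      using w_u_integrable[of "\<lambda>x. - \<mu> * u x"] uc by (simp add: continuous_intros)
    have "q t - q s = integral {s..t} (\<lambda>x. - \<mu> * (w x *\<^sub>R u x))"
      by (rule abs_continuous_on_eq_integral[OF qac ai _ _ dq that, of "{a, b}"]) (simp, intro continuous_intros continuous_on_w_u uc)
    also have "\<dots> = - \<mu> * integral {s..t} (\<lambda>x. w x *\<^sub>R u x)" by (rule Henstock_Kurzweil_Integration.integral_mult_right)
    finally show ?thesis .
  qed
  \<comment> \<open>The limit of \<open>p u'\<close> is evaluated along points different from
    \<open>y\<close> and outside the exceptional null set, where \<open>p u'\<close> is
    \<open>q\<close>; continuity of \<open>q\<close> then identifies \<open>q y\<close>.\<close>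
  have qz: "q y = 0" if y: "y \<in> {a, b}" for y
  proof -
    have lim: "((\<lambda>x. p x *\<^sub>R vderiv u x) \<longlongrightarrow> 0) (at y)" using qN y by (auto simp: quasi_Neumann_def frontier_M_plus)
    have y01: "y \<in> {0<..<1}" using y x0_bounds by auto
    have "AE x in lebesgue. x \<in> {0..1} \<longrightarrow> q x = p x *\<^sub>R vderiv u x"
    proof -
      have "AE x in lebesgue_on {0..1}. q x = p x *\<^sub>R vderiv u x" using ae1 by eventually_elim simp
      then show ?thesis by (simp add: AE_restrict_space_iff)
    qed
    then obtain Z where Z: "{x. \<not> (x \<in> {0..1} \<longrightarrow> q x = p x *\<^sub>R vderiv u x)} \<subseteq> Z" "negligible Z"
      by (auto simp: eventually_ae_filter negligible_iff_null_sets)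
    have "\<exists>z. z \<in> ball y (1 / real (Suc n)) \<inter> {0<..<1} \<and> z \<notin> Z \<union> {y}" for n
    proof (rule ccontr)
      assume "\<not> ?thesis"
      then have "ball y (1 / real (Suc n)) \<inter> {0<..<1} \<subseteq> Z \<union> {y}" by blast
      moreover have "negligible (Z \<union> {y})" using Z(2) by simp
      ultimately have "negligible (ball y (1 / real (Suc n)) \<inter> {0<..<1})" using negligible_subset by blast
      moreover have "open (ball y (1 / real (Suc n)) \<inter> {0<..<1})" by (intro open_Int) auto
      moreover have "y \<in> ball y (1 / real (Suc n)) \<inter> {0<..<1}" using y01 by simp
      ultimately show False using open_not_negligible by blast
    qed
    then obtain z where z: "\<And>n. z n \<in> ball y (1 / real (Suc n))" "\<And>n. z n \<in> {0<..<1}" "\<And>n. z n \<notin> Z" "\<And>n. z n \<noteq> y"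
      by (metis IntE UnCI insertCI)
    have zl: "z \<longlonglongrightarrow> y"
    proof (rule metric_LIMSEQ_I)
      fix r :: real assume "r > 0"
      then obtain n0 where n0: "1 / real (Suc n0) < r" using nat_approx_posE by blast
      have "dist (z n) y < r" if "n \<ge> n0" for n
      proof -
        have "1 / real (Suc n) \<le> 1 / real (Suc n0)" using that by (simp add: frac_le)
        then show ?thesis using z(1)[of n] n0 by (simp add: dist_commute)
      qed
      then show "\<exists>n0. \<forall>n\<ge>n0. dist (z n) y < r" by blast
    qed
    have "isCont q y" using qc y01 by (simp add: continuous_on_interior)
    then have "(\<lambda>n. q (z n)) \<longlonglongrightarrow> q y" using zl by (rule isCont_tendsto_compose)
    moreover have "q (z n) = p (z n) *\<^sub>R vderiv u (z n)" for n
    proof -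
      have "z n \<in> {0..1}" using z(2)[of n] by simp
      then show ?thesis using Z(1) z(3)[of n] by blast
    qed
    moreover have "(\<lambda>n. p (z n) *\<^sub>R vderiv u (z n)) \<longlonglongrightarrow> 0"
    proof (rule filterlim_compose[OF lim])
      show "filterlim z (at y) sequentially" using zl z(4) by (simp add: filterlim_at)
    qed
    ultimately show ?thesis using LIMSEQ_unique by auto
  qed
  show ?thesis
    by (rule that[of q]) (use uc qc U Qe qz in \<open>auto simp: ode_def\<close>)
qed

text \<open>Off the finite set \<open>sing\<close> the equations hold classically, which settles all
  conditions required almost everywhere. The fundamental theorem with finitely many exceptions
  writes \<open>u\<close> and \<open>q\<close> as indefinite integrals, whence absolute
  continuity.\<close>

lemma ode_imp_eigenspace:
  assumes uc: "continuous_on {0..1} u" and qc: "continuous_on {0..1} q"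
    and du: "\<And>x. x \<in> {0..1} - sing \<Longrightarrow> (u has_vector_derivative (1 / p x) *\<^sub>R q x) (at x)"
    and dq: "\<And>x. x \<in> {0..1} - sing \<Longrightarrow> (q has_vector_derivative - \<mu> * (w x *\<^sub>R u x)) (at x)"
    and q0: "q a = 0" "q b = 0" and u0: "\<And>x. x \<notin> {0..1} \<Longrightarrow> u x = 0"
  shows "u \<in> eigenspace \<epsilon> \<mu>"
proof -
  have ae: "AE x in lebesgue_on {0..1}. P x" if "\<And>x. x \<in> {0..1} - sing \<Longrightarrow> P x" for P
    using AE_not_sing by eventually_elim (rule that)
  have vd: "vderiv u x = (1 / p x) *\<^sub>R q x" if "x \<in> {0..1} - sing" for x
    using du[OF that] by (rule vector_derivative_at)
  have pv: "p x *\<^sub>R vderiv u x = q x" if "x \<in> {0..1} - sing" for x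
  proof -
    have "p x \<noteq> 0" using that regular_subset by (intro p_nonzero) blast
    then show ?thesis by (simp add: vd[OF that])
  qed
  have uint: "u x = u 0 + integral {0..x} (\<lambda>x. (1 / p x) *\<^sub>R q x)" if "x \<in> {0..1}" for x
  proof -
    have "((\<lambda>x. (1 / p x) *\<^sub>R q x) has_integral (u x - u 0)) {0..x}"
      by (rule fundamental_theorem_of_calculus_interior_strong[OF finite_sing])
         (use that du in \<open>auto intro: continuous_on_subset[OF uc]\<close>)
    then show ?thesis by (simp add: integral_unique)
  qed
  have qint: "q x = q 0 + integral {0..x} (\<lambda>x. - \<mu> * (w x *\<^sub>R u x))" if "x \<in> {0..1}" for x
  proof -
    have "((\<lambda>x. - \<mu> * (w x *\<^sub>R u x)) has_integral (q x - q 0)) {0..x}"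
      by (rule fundamental_theorem_of_calculus_interior_strong[OF finite_sing])
         (use that dq in \<open>auto intro: continuous_on_subset[OF qc]\<close>)
    then show ?thesis by (subst integral_unique) auto
  qed
  have ac_cong: "abs_continuous_on {0..1} f" if "abs_continuous_on {0..1} f'" "\<And>x. x \<in> {0..1} \<Longrightarrow> f x = f' x" for f f'
    unfolding abs_continuous_on_def
  proof (intro allI impI)
    fix e :: real assume "e > 0"
    with that(1) obtain \<delta> where \<delta>: "\<delta> > 0" "\<And>\<D> T. \<D> division_of T \<Longrightarrow> T \<subseteq> {0..1} \<Longrightarrow> (\<Sum>K\<in>\<D>. Sup K - Inf K) < \<delta>
      \<Longrightarrow> (\<Sum>K\<in>\<D>. norm (f' (Sup K) - f' (Inf K))) < e" by (rule abs_continuous_onE) blast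
    show "\<exists>\<delta>>0. \<forall>\<D> T. \<D> division_of T \<and> T \<subseteq> {0..1} \<and> (\<Sum>K\<in>\<D>. Sup K - Inf K) < \<delta>
        \<longrightarrow> (\<Sum>K\<in>\<D>. norm (f (Sup K) - f (Inf K))) < e"
    proof (intro exI[of _ \<delta>] conjI allI impI \<delta>(1))
      fix \<D> T assume D: "\<D> division_of T \<and> T \<subseteq> {0..1} \<and> (\<Sum>K\<in>\<D>. Sup K - Inf K) < \<delta>"
      have "(\<Sum>K\<in>\<D>. norm (f (Sup K) - f (Inf K))) = (\<Sum>K\<in>\<D>. norm (f' (Sup K) - f' (Inf K)))"
      proof (rule sum.cong[OF refl])
        fix k assume "k \<in> \<D>"
        with division_of_real_interval[of \<D> T k 0 1] D have "0 \<le> Inf k" "Inf k \<le> Sup k" "Sup k \<le> 1" by auto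
        then show "norm (f (Sup k) - f (Inf k)) = norm (f' (Sup k) - f' (Inf k))" using that(2) by simp
      qed
      then show "(\<Sum>K\<in>\<D>. norm (f (Sup K) - f (Inf K))) < e" using \<delta>(2)[of \<D> T] D by simp
    qed
  qed
  have uac: "abs_continuous_on {0..1} u"
    by (rule ac_cong[OF abs_continuous_on_indefinite_integral[OF inverse_p_q_integrable[OF qc], of "u 0"] uint])
  have "(\<lambda>x. - \<mu> * (w x *\<^sub>R u x)) absolutely_integrable_on {0..1}"
    using w_u_integrable[of "\<lambda>x. - \<mu> * u x"] uc by (simp add: continuous_intros)
  from ac_cong[OF abs_continuous_on_indefinite_integral[OF this, of "q 0"] qint]
  have qac: "abs_continuous_on {0..1} q" by simp
  have ae1: "AE x in lebesgue_on {0..1}. u differentiable (at x) \<and> q x = p x *\<^sub>R vderiv u x"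
  proof (rule ae)
    fix x assume x: "x \<in> {0..1} - sing"
    show "u differentiable (at x) \<and> q x = p x *\<^sub>R vderiv u x"
      using du[OF x] pv[OF x] by (auto intro: differentiableI_vector)
  qed
  have ae2: "AE x in lebesgue_on {0..1}. vderiv u differentiable (at x) \<and> D_op \<epsilon> u x = \<mu> * u x"
  proof (rule ae)
    fix x assume x: "x \<in> {0..1} - sing"
    then have x': "x \<in> {0..1} - {a, b}" using regular_subset by blast
    have px: "p x \<noteq> 0" and ph: "phi2 \<epsilon> x \<noteq> 0" by (rule p_nonzero[OF x'], rule phi2_nonzero[OF x'])
    have dip: "((\<lambda>x. 1 / p x) has_real_derivative - (phi1 \<epsilon> x / (phi2 \<epsilon> x * p x))) (at x)"
      using p_deriv[OF x] px by (auto intro!: derivative_eq_intros simp: power2_eq_square)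
    define u2 where "u2 = (1 / p x) *\<^sub>R (- \<mu> * (w x *\<^sub>R u x)) + (- (phi1 \<epsilon> x / (phi2 \<epsilon> x * p x))) *\<^sub>R q x"
    have d: "((\<lambda>x. (1 / p x) *\<^sub>R q x) has_vector_derivative u2) (at x)"
      unfolding u2_def by (rule has_vector_derivative_scaleR[OF dip dq[OF x]])
    have d2: "(vderiv u has_vector_derivative u2) (at x)"
      by (rule has_vector_derivative_transform_within_open[OF d open_regular x]) (simp add: vd)
    have "D_op \<epsilon> u x = phi2 \<epsilon> x *\<^sub>R u2 + phi1 \<epsilon> x *\<^sub>R ((1 / p x) *\<^sub>R q x)"
      using vector_derivative_at[OF d2] vd[OF x] by (simp add: D_op_def)
    also have "\<dots> = (phi2 \<epsilon> x * (1 / p x) * w x) *\<^sub>R (- \<mu> * u x)"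
      using px ph unfolding u2_def by (simp add: scaleR_add_right scaleR_conv_of_real field_simps)
    also have "phi2 \<epsilon> x * (1 / p x) * w x = - 1" using px ph by (simp add: w1_def)
    finally show "vderiv u differentiable (at x) \<and> D_op \<epsilon> u x = \<mu> * u x"
      using d2 by (auto intro: differentiableI_vector)
  qed
  have "((\<lambda>x. p x *\<^sub>R vderiv u x) \<longlongrightarrow> 0) (at y)" if y: "y \<in> {a, b}" for y
  proof -
    have "isCont q y" using qc y x0_bounds by (intro continuous_on_interior[of "{0..1}"]) auto
    then have "(q \<longlongrightarrow> 0) (at y)" using q0 y by (auto simp: isCont_def)
    moreover have "\<forall>\<^sub>F x in at y. q x = p x *\<^sub>R vderiv u x"
    proof -
      \<comment> \<open>Close to \<open>y\<close> the only singular point is \<open>y\<close>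
        itself, which a punctured limit ignores.\<close>
      have op: "open ({0<..<1} - (sing - {y}))" using finite_sing by (intro open_Diff finite_imp_closed) auto
      have mem: "y \<in> {0<..<1} - (sing - {y})" using y x0_bounds by auto
      have "\<forall>\<^sub>F x in at y. x \<in> {0<..<1} - (sing - {y})" using op mem by (rule eventually_at_in_open')
      moreover have "\<forall>\<^sub>F x in at y. x \<noteq> y" by (simp add: eventually_at_filter)
      ultimately show ?thesis by eventually_elim (use pv in force)
    qed
    ultimately show ?thesis by (rule Lim_transform_eventually)
  qed
  then have "quasi_Neumann \<epsilon> u" by (simp add: quasi_Neumann_def frontier_M_plus)
  moreover have "SL_solution \<epsilon> \<mu> u" unfolding SL_solution_def using uac qac ae1 ae2 by blast
  ultimately show ?thesis using u0 by (simp add: eigenspace_def)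
qed

end

section \<open>Extension beyond the positive part\<close>

lemma integral_reflect_unit:
  fixes f :: "real \<Rightarrow> 'a::euclidean_space"
  shows "integral {s..t} (\<lambda>x. f (1 - x)) = integral {1 - t..1 - s} f"
proof -
  have "integral {s..t} (\<lambda>x. f (1 - x)) = integral {- (- s)..- (- t)} (\<lambda>x. (f \<circ> (+) 1) (- x))" by (simp add: o_def)
  also have "\<dots> = integral {- t..- s} (f \<circ> (+) 1)" by (rule Henstock_Kurzweil_Integration.integral_reflect_real)
  also have "\<dots> = integral {- t + 1..- s + 1} f" by (rule integral_shift_Icc_real)
  finally show ?thesis by (simp add: add.commute)
qed

text \<open>Once the first \<open>n\<close> values agree they are used up, so the next value of
  either sequence must appear in the other at index \<open>n\<close> or later. Identifies an
  arbitrary listing with the minimisation values.\<close>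

lemma strict_mono_same_range:
  fixes f e :: "nat \<Rightarrow> real"
  assumes f: "strict_mono f" and e: "strict_mono e" and range: "range f = range e"
  shows "f n = e n"
proof (induction n rule: less_induct)
  case (less n)
  have *: "e' n \<le> f' n" if f': "strict_mono f'" and e': "strict_mono e'" and r': "range f' = range e'"
    and IH: "\<And>k. k < n \<Longrightarrow> f' k = e' k" for f' e' :: "nat \<Rightarrow> real"
  proof -
    have "f' n \<in> range e'" unfolding r'[symmetric] by simp
    then obtain m where m: "f' n = e' m" by blast
    have "\<not> m < n"
    proof
      assume "m < n"
      then have "f' n = f' m" using m IH by simp
      with \<open>m < n\<close> f' show False by (simp add: strict_mono_eq)
    qed
    then show ?thesis using m strict_mono_less_eq[OF e', of n m] by simp
  qed
  show ?case using *[OF f e range] *[OF e f range[symmetric]] less by (simp add: antisym)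
qed

lemma has_vector_derivative_reflect_unit:
  assumes "(f has_vector_derivative f') (at (1 - x))"
  shows "((\<lambda>x. f (1 - x)) has_vector_derivative - f') (at (x::real))"
proof -
  have "((\<lambda>x::real. 1 - x) has_vector_derivative - 1) (at x)"
    by (auto intro!: derivative_eq_intros simp: has_real_derivative_iff_has_vector_derivative[symmetric])
  from vector_diff_chain_at[OF this assms] show ?thesis by (simp add: o_def)
qed

context small_parameter
begin

section \<open>Uniqueness across the zeros of \<open>p\<close>\<close>

lemma volterra_interval:
  assumes "0 \<le> s" "s \<le> t" "t \<le> 1"
  shows "volterra s t (\<lambda>x. 1 / p x) w {a, b}"
proof
  show "s \<le> t" by (rule assms)
  have sub: "{s..t} \<subseteq> {0..1}" using assms by auto
  show "(\<lambda>x. 1 / p x) absolutely_integrable_on {s..t}" "w absolutely_integrable_on {s..t}"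
    using set_integrable_subset[OF inverse_p_integrable _ sub] set_integrable_subset[OF w_integrable _ sub] by auto
  show "continuous_on ({s..t} - {a, b}) w" using sub by (intro continuous_on_subset[OF continuous_on_w]) auto
qed simp

lemma ode_zero:
  assumes ode: "ode \<mu> u q" and s: "0 \<le> s" "s \<le> 1" and z: "u s = 0" "q s = 0" and x: "x \<in> {s..1}"
  shows "u x = 0"
proof -
  interpret V: volterra s 1 "\<lambda>x. 1 / p x" w "{a, b}" by (rule volterra_interval) (use s in auto)
  have uc: "continuous_on {s..1} u" using ode s by (auto simp: ode_def intro: continuous_on_subset)
  have q: "q y = - \<mu> * V.I u y" if "y \<in> {s..1}" for y
  proof -
    have "q y - q s = - \<mu> * integral {s..y} (\<lambda>x. w x *\<^sub>R u x)"
      using ode that s unfolding ode_def by simp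
    then show ?thesis using z by (simp add: V.I_def)
  qed
  have "u y = - \<mu> * V.T u y" if y: "y \<in> {s..1}" for y
  proof -
    have "u y - u s = integral {s..y} (\<lambda>x. (1 / p x) *\<^sub>R q x)"
      using ode y s unfolding ode_def by simp
    also have "\<dots> = integral {s..y} (\<lambda>x. - \<mu> * ((1 / p x) *\<^sub>R V.I u x))"
      by (rule integral_cong) (use y q in simp)
    also have "\<dots> = - \<mu> * V.T u y" unfolding V.T_def by (rule Henstock_Kurzweil_Integration.integral_mult_right)
    finally show ?thesis using z by simp
  qed
  from V.unique_zero[OF uc this x] show ?thesis .
qed

text \<open>The Volterra argument only runs to the right of its starting point; reflection provides
  the other direction, with the flux changing sign.\<close>

lemma ode_reflect:
  assumes ode: "ode \<mu> u q"
  shows "ode \<mu> (\<lambda>x. u (1 - x)) (\<lambda>x. - q (1 - x))"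
  unfolding ode_def
proof (intro conjI allI impI)
  show "continuous_on {0..1} (\<lambda>x. u (1 - x))" "continuous_on {0..1} (\<lambda>x. - q (1 - x))"
    using ode unfolding ode_def by (auto intro!: continuous_intros elim: continuous_on_compose2)
  fix s t :: real assume st: "0 \<le> s \<and> s \<le> t \<and> t \<le> 1"
  have "integral {s..t} (\<lambda>x. (1 / p x) *\<^sub>R - q (1 - x)) = - integral {s..t} (\<lambda>x. (1 / p (1 - x)) *\<^sub>R q (1 - x))"
    by (simp add: p_symmetric)
  also have "\<dots> = - integral {1 - t..1 - s} (\<lambda>x. (1 / p x) *\<^sub>R q x)"
    by (subst integral_reflect_unit[of s t "\<lambda>x. (1 / p x) *\<^sub>R q x"]) simp
  also have "\<dots> = - (u (1 - s) - u (1 - t))" using ode st unfolding ode_def by simp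
  finally show "u (1 - t) - u (1 - s) = integral {s..t} (\<lambda>x. (1 / p x) *\<^sub>R - q (1 - x))" by simp
  have "integral {s..t} (\<lambda>x. w x *\<^sub>R u (1 - x)) = integral {s..t} (\<lambda>x. w (1 - x) *\<^sub>R u (1 - x))"
    by (simp add: w_symmetric)
  also have "\<dots> = integral {1 - t..1 - s} (\<lambda>x. w x *\<^sub>R u x)"
    by (rule integral_reflect_unit[of s t "\<lambda>x. w x *\<^sub>R u x"])
  finally have "- \<mu> * integral {s..t} (\<lambda>x. w x *\<^sub>R u (1 - x)) = - \<mu> * integral {1 - t..1 - s} (\<lambda>x. w x *\<^sub>R u x)" by simp
  also have "\<dots> = q (1 - s) - q (1 - t)" using ode st unfolding ode_def by simp
  finally show "- q (1 - t) - - q (1 - s) = - \<mu> * integral {s..t} (\<lambda>x. w x *\<^sub>R u (1 - x))" by simp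
qed

lemma ode_zero_all:
  assumes ode: "ode \<mu> u q" and z: "u a = 0" "q a = 0" and x: "x \<in> {0..1}"
  shows "u x = 0"
proof (cases "a \<le> x")
  case True
  then show ?thesis using ode_zero[OF ode _ _ z] x x0_bounds by auto
next
  case False
  have "(\<lambda>x. u (1 - x)) (1 - x) = 0"
    by (rule ode_zero[OF ode_reflect[OF ode], of b]) (use z False x x0_bounds in auto)
  then show ?thesis by simp
qed

lemma ode_diff:
  assumes "ode \<mu> u q" "ode \<mu> v r"
  shows "ode \<mu> (\<lambda>x. u x - c * v x) (\<lambda>x. q x - c * r x)"
  unfolding ode_def
proof (intro conjI allI impI)
  have cont: "continuous_on {0..1} u" "continuous_on {0..1} q" "continuous_on {0..1} v" "continuous_on {0..1} r"
    using assms by (auto simp: ode_def)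
  show "continuous_on {0..1} (\<lambda>x. u x - c * v x)" "continuous_on {0..1} (\<lambda>x. q x - c * r x)"
    by (intro continuous_intros cont)+
  fix s t :: real assume st: "0 \<le> s \<and> s \<le> t \<and> t \<le> 1"
  then have sub: "{s..t} \<subseteq> {0..1}" by auto
  have i: "(\<lambda>x. (1 / p x) *\<^sub>R f x) integrable_on {s..t}" "(\<lambda>x. w x *\<^sub>R f x) integrable_on {s..t}" if "continuous_on {0..1} f" for f :: "real \<Rightarrow> complex"
    using inverse_p_q_integrable[OF that] w_u_integrable[OF that] sub
    by (auto simp: absolutely_integrable_on_def intro: integrable_on_subinterval)
  have "integral {s..t} (\<lambda>x. (1 / p x) *\<^sub>R (q x - c * r x)) = integral {s..t} (\<lambda>x. (1 / p x) *\<^sub>R q x - c * ((1 / p x) *\<^sub>R r x))"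
    by (simp add: scaleR_diff_right)
  also have "\<dots> = integral {s..t} (\<lambda>x. (1 / p x) *\<^sub>R q x) - integral {s..t} (\<lambda>x. c * ((1 / p x) *\<^sub>R r x))"
    by (intro Henstock_Kurzweil_Integration.integral_diff i integrable_on_mult_right cont)
  also have "integral {s..t} (\<lambda>x. c * ((1 / p x) *\<^sub>R r x)) = c * integral {s..t} (\<lambda>x. (1 / p x) *\<^sub>R r x)"
    by (rule Henstock_Kurzweil_Integration.integral_mult_right)
  also have "integral {s..t} (\<lambda>x. (1 / p x) *\<^sub>R q x) - c * integral {s..t} (\<lambda>x. (1 / p x) *\<^sub>R r x) = (u t - u s) - c * (v t - v s)"
    using assms st unfolding ode_def by simp
  finally show "u t - c * v t - (u s - c * v s) = integral {s..t} (\<lambda>x. (1 / p x) *\<^sub>R (q x - c * r x))"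
    by (simp add: algebra_simps)
  have "integral {s..t} (\<lambda>x. w x *\<^sub>R (u x - c * v x)) = integral {s..t} (\<lambda>x. w x *\<^sub>R u x - c * (w x *\<^sub>R v x))"
    by (simp add: scaleR_diff_right)
  also have "\<dots> = integral {s..t} (\<lambda>x. w x *\<^sub>R u x) - integral {s..t} (\<lambda>x. c * (w x *\<^sub>R v x))"
    by (intro Henstock_Kurzweil_Integration.integral_diff i integrable_on_mult_right cont)
  also have "integral {s..t} (\<lambda>x. c * (w x *\<^sub>R v x)) = c * integral {s..t} (\<lambda>x. w x *\<^sub>R v x)"
    by (rule Henstock_Kurzweil_Integration.integral_mult_right)
  finally have eq: "integral {s..t} (\<lambda>x. w x *\<^sub>R (u x - c * v x))
     = integral {s..t} (\<lambda>x. w x *\<^sub>R u x) - c * integral {s..t} (\<lambda>x. w x *\<^sub>R v x)" .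
  have alg: "- \<mu> * (A - c * B) = - \<mu> * A - c * (- \<mu> * B)" for A B by (simp add: algebra_simps)
  have "- \<mu> * integral {s..t} (\<lambda>x. w x *\<^sub>R (u x - c * v x))
     = (- \<mu> * integral {s..t} (\<lambda>x. w x *\<^sub>R u x)) - c * (- \<mu> * integral {s..t} (\<lambda>x. w x *\<^sub>R v x))"
    unfolding eq by (rule alg)
  also have "\<dots> = (q t - q s) - c * (r t - r s)" using assms st unfolding ode_def by simp
  finally show "q t - c * r t - (q s - c * r s) = - \<mu> * integral {s..t} (\<lambda>x. w x *\<^sub>R (u x - c * v x))"
    by (simp add: algebra_simps)
qed

section \<open>Gluing solutions at the zeros of \<open>p\<close>\<close>

lemma system_derivatives:
  fixes U q :: "real \<Rightarrow> complex"
  assumes st: "0 \<le> s" "t \<le> 1" and U: "continuous_on {s..t} U" and q: "continuous_on {s..t} q"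
    and eqU: "\<And>x. x \<in> {s..t} \<Longrightarrow> U x = c + integral {s..x} (\<lambda>x. (1 / p x) *\<^sub>R q x)"
    and eqq: "\<And>x. x \<in> {s..t} \<Longrightarrow> q x = - \<mu> * integral {s..x} (\<lambda>x. w x *\<^sub>R U x)"
    and x: "x \<in> {s<..<t} - {a, b}"
  shows "(U has_vector_derivative (1 / p x) *\<^sub>R q x) (at x)" "(q has_vector_derivative - \<mu> * (w x *\<^sub>R U x)) (at x)"
proof -
  have sub: "{s..t} \<subseteq> {0..1}" using st by auto
  have op: "open ({s<..<t} - {a, b})" by (intro open_Diff finite_imp_closed) auto
  have ai: "(\<lambda>x. (1 / p x) *\<^sub>R q x) absolutely_integrable_on {s..t}" "(\<lambda>x. w x *\<^sub>R U x) absolutely_integrable_on {s..t}"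
    using set_integrable_subset[OF inverse_p_integrable _ sub] set_integrable_subset[OF w_integrable _ sub] U q
    by (auto intro: absolutely_integrable_scaleR_continuous)
  have sub2: "{s<..<t} - {a, b} \<subseteq> {0..1} - {a, b}" using sub by auto
  have "continuous_on ({s<..<t} - {a, b}) (\<lambda>x. (1 / p x) *\<^sub>R q x)"
    using p_nonzero sub2 by (intro continuous_intros continuous_on_subset[OF continuous_on_p] continuous_on_subset[OF q]) auto
  then have c1: "isCont (\<lambda>x. (1 / p x) *\<^sub>R q x) x" using op x by (simp add: continuous_on_eq_continuous_at)
  have "continuous_on ({s<..<t} - {a, b}) (\<lambda>x. w x *\<^sub>R U x)"
    using sub2 by (intro continuous_intros continuous_on_subset[OF continuous_on_w] continuous_on_subset[OF U]) auto
  then have c2: "isCont (\<lambda>x. w x *\<^sub>R U x) x" using op x by (simp add: continuous_on_eq_continuous_at)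
  have x': "x \<in> {s<..<t}" using x by simp
  have "((\<lambda>y. c + integral {s..y} (\<lambda>x. (1 / p x) *\<^sub>R q x)) has_vector_derivative 0 + (1 / p x) *\<^sub>R q x) (at x)"
    by (intro has_vector_derivative_add has_vector_derivative_const)
       (rule has_vector_derivative_integral_interior[OF _ x' c1], use ai(1) in \<open>simp add: absolutely_integrable_on_def\<close>)
  then have "((\<lambda>y. c + integral {s..y} (\<lambda>x. (1 / p x) *\<^sub>R q x)) has_vector_derivative (1 / p x) *\<^sub>R q x) (at x)" by (simp only: add_0)
  then show "(U has_vector_derivative (1 / p x) *\<^sub>R q x) (at x)"
    by (rule has_vector_derivative_transform_within_open[OF _ open_greaterThanLessThan x']) (simp add: eqU)
  have "((\<lambda>y. - \<mu> * integral {s..y} (\<lambda>x. w x *\<^sub>R U x)) has_vector_derivative - \<mu> * (w x *\<^sub>R U x)) (at x)"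
    by (intro has_vector_derivative_mult_right)
       (rule has_vector_derivative_integral_interior[OF _ x' c2], use ai(2) in \<open>simp add: absolutely_integrable_on_def\<close>)
  then show "(q has_vector_derivative - \<mu> * (w x *\<^sub>R U x)) (at x)"
    by (rule has_vector_derivative_transform_within_open[OF _ open_greaterThanLessThan x']) (simp add: eqq)
qed

text \<open>Normalised to value 1 and flux 0 at \<open>b\<close>: multiples of it match any inner
  solution there, and its reflection does the same at \<open>a\<close>.\<close>

lemma outer_solution_exists:
  obtains \<Phi> \<Psi> :: "real \<Rightarrow> complex" where "continuous_on {b..1} \<Phi>" "continuous_on {b..1} \<Psi>"
    "\<And>x. x \<in> {b..1} \<Longrightarrow> \<Phi> x = 1 + integral {b..x} (\<lambda>x. (1 / p x) *\<^sub>R \<Psi> x)"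
    "\<And>x. x \<in> {b..1} \<Longrightarrow> \<Psi> x = - \<mu> * integral {b..x} (\<lambda>x. w x *\<^sub>R \<Phi> x)"
proof -
  interpret V: volterra b 1 "\<lambda>x. 1 / p x" w "{a, b}" by (rule volterra_interval) (use x0_bounds in auto)
  obtain \<Phi> where \<Phi>: "continuous_on {b..1} \<Phi>" "\<And>x. x \<in> {b..1} \<Longrightarrow> \<Phi> x = 1 - \<mu> * V.T \<Phi> x"
    using V.solution_exists by blast
  define \<Psi> where "\<Psi> x = - \<mu> * V.I \<Phi> x" for x
  have "\<Phi> x = 1 + integral {b..x} (\<lambda>x. (1 / p x) *\<^sub>R \<Psi> x)" if "x \<in> {b..1}" for x
  proof -
    have "integral {b..x} (\<lambda>x. (1 / p x) *\<^sub>R \<Psi> x) = integral {b..x} (\<lambda>x. - \<mu> * ((1 / p x) *\<^sub>R V.I \<Phi> x))" by (simp add: \<Psi>_def)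
    also have "\<dots> = - \<mu> * V.T \<Phi> x" unfolding V.T_def by (rule Henstock_Kurzweil_Integration.integral_mult_right)
    finally show ?thesis using \<Phi>(2)[OF that] by simp
  qed
  moreover have "continuous_on {b..1} \<Psi>" unfolding \<Psi>_def[abs_def] by (intro continuous_intros V.continuous_I \<Phi>(1))
  ultimately show ?thesis using that \<Phi>(1) by (simp add: \<Psi>_def V.I_def)
qed

text \<open>Scaling the outer solutions matches the values at \<open>a\<close> and \<open>b\<close>;
  the fluxes match without further choice, as all of them vanish there. This is why no condition on
  \<mu> arises from the outer intervals.\<close>

lemma weak_extends_to_eigenspace:
  assumes u: "u \<in> V_space \<epsilon>" and weak: "\<And>\<eta>. \<eta> \<in> V_space \<epsilon> \<Longrightarrow> E u \<eta> = \<mu> * N u \<eta>"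
  obtains v where "v \<in> eigenspace \<epsilon> \<mu>" "AE x in M. u x = v x"
proof -
  obtain U q where Uc: "continuous_on {a..b} U" and qc: "continuous_on {a..b} q" and uU: "AE x in M. u x = U x"
    and q0: "q a = 0" "q b = 0"
    and eqU: "\<And>x. x \<in> {a..b} \<Longrightarrow> U x = U a + integral {a..x} (\<lambda>x. (1 / p x) *\<^sub>R q x)"
    and eqq: "\<And>x. x \<in> {a..b} \<Longrightarrow> q x = - \<mu> * integral {a..x} (\<lambda>x. w x *\<^sub>R U x)"
    using weak_imp_integral_equations[OF u weak] by blast
  obtain \<Phi> \<Psi> where \<Phi>c: "continuous_on {b..1} \<Phi>" and \<Psi>c: "continuous_on {b..1} \<Psi>"
    and eq\<Phi>: "\<And>x. x \<in> {b..1} \<Longrightarrow> \<Phi> x = 1 + integral {b..x} (\<lambda>x. (1 / p x) *\<^sub>R \<Psi> x)"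
    and eq\<Psi>: "\<And>x. x \<in> {b..1} \<Longrightarrow> \<Psi> x = - \<mu> * integral {b..x} (\<lambda>x. w x *\<^sub>R \<Phi> x)"
    using outer_solution_exists[of \<mu>] by blast
  have \<Phi>b: "\<Phi> b = 1" "\<Psi> b = 0" using eq\<Phi>[of b] eq\<Psi>[of b] x0_bounds by auto
  \<comment> \<open>On the left the reflected outer solution is used, so its flux enters with the
    opposite sign.\<close>
  define v0 where "v0 x = (if x \<le> a then U a * \<Phi> (1 - x) else if x \<le> b then U x else U b * \<Phi> x)" for x
  define r0 where "r0 x = (if x \<le> a then - (U a * \<Psi> (1 - x)) else if x \<le> b then q x else U b * \<Psi> x)" for x
  have ab: "0 < a" "a < b" "b < 1" using x0_bounds by auto
  have cL: "continuous_on {x \<in> {0..1}. x \<le> a} (\<lambda>x. \<Phi> (1 - x))" "continuous_on {x \<in> {0..1}. x \<le> a} (\<lambda>x. \<Psi> (1 - x))"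
    by (rule continuous_on_compose2[OF \<Phi>c] continuous_on_compose2[OF \<Psi>c]; force intro!: continuous_intros)+
  have cM: "continuous_on {x \<in> {x \<in> {0..1}. a \<le> x}. x \<le> b} U" "continuous_on {x \<in> {x \<in> {0..1}. a \<le> x}. x \<le> b} q"
    by (rule continuous_on_subset[OF Uc] continuous_on_subset[OF qc]; force)+
  have cR: "continuous_on {x \<in> {x \<in> {0..1}. a \<le> x}. b \<le> x} \<Phi>" "continuous_on {x \<in> {x \<in> {0..1}. a \<le> x}. b \<le> x} \<Psi>"
    by (rule continuous_on_subset[OF \<Phi>c] continuous_on_subset[OF \<Psi>c]; force)+
  have v0c: "continuous_on {0..1} v0" unfolding v0_def[abs_def]
    by (intro continuous_on_cases_le continuous_intros cL cM cR) (use ab \<Phi>b in auto)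
  have r0c: "continuous_on {0..1} r0" unfolding r0_def[abs_def]
    by (intro continuous_on_cases_le continuous_intros cL cM cR) (use ab \<Phi>b q0 in auto)
  define v where "v x = (if x \<in> {0..1} then v0 x else 0)" for x
  have vc: "continuous_on {0..1} v" by (rule continuous_on_eq[OF v0c]) (simp add: v_def)
  have der: "(v has_vector_derivative (1 / p x) *\<^sub>R r0 x) (at x) \<and> (r0 has_vector_derivative - \<mu> * (w x *\<^sub>R v x)) (at x)"
    if x: "x \<in> {0..1} - sing" for x
  proof -
    have x': "x \<noteq> 0" "x \<noteq> 1" "x \<noteq> a" "x \<noteq> b" using x by (auto simp: sing_def)
    consider "x \<in> {0<..<a}" | "x \<in> {a<..<b}" | "x \<in> {b<..<1}" using x x' by fastforce
    then show ?thesis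
    proof cases
      case 1
      note tr = has_vector_derivative_transform_within_open[OF _ open_greaterThanLessThan 1]
      have y: "1 - x \<in> {b<..<1} - {a, b}" using 1 ab by auto
      have "0 \<le> b" using ab by simp
      note D = system_derivatives[OF this order_refl \<Phi>c \<Psi>c eq\<Phi> eq\<Psi> y]
      have "((\<lambda>x. U a * \<Phi> (1 - x)) has_vector_derivative U a * - ((1 / p (1 - x)) *\<^sub>R \<Psi> (1 - x))) (at x)"
        by (intro has_vector_derivative_mult_right has_vector_derivative_reflect_unit D(1))
      then have "(v has_vector_derivative U a * - ((1 / p (1 - x)) *\<^sub>R \<Psi> (1 - x))) (at x)"
        by (rule tr) (use ab in \<open>auto simp: v_def v0_def\<close>)
      moreover have "((\<lambda>x. - (U a * \<Psi> (1 - x))) has_vector_derivative - (U a * - (- \<mu> * (w (1 - x) *\<^sub>R \<Phi> (1 - x))))) (at x)"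
        by (intro has_vector_derivative_minus has_vector_derivative_mult_right has_vector_derivative_reflect_unit D(2))
      then have "(r0 has_vector_derivative - (U a * - (- \<mu> * (w (1 - x) *\<^sub>R \<Phi> (1 - x))))) (at x)"
        by (rule tr) (auto simp: r0_def)
      ultimately show ?thesis using 1 ab by (simp add: v_def v0_def r0_def p_symmetric w_symmetric mult_ac)
    next
      case 2
      note tr = has_vector_derivative_transform_within_open[OF _ open_greaterThanLessThan 2]
      have y: "x \<in> {a<..<b} - {a, b}" using 2 by auto
      have "0 \<le> a" "b \<le> 1" using ab by auto
      note D = system_derivatives[OF this Uc qc eqU eqq y]
      have "(v has_vector_derivative (1 / p x) *\<^sub>R q x) (at x)"
        by (rule tr[OF D(1)]) (use ab in \<open>auto simp: v_def v0_def\<close>)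
      moreover have "(r0 has_vector_derivative - \<mu> * (w x *\<^sub>R U x)) (at x)"
        by (rule tr[OF D(2)]) (auto simp: r0_def)
      ultimately show ?thesis using 2 ab by (simp add: v_def v0_def r0_def)
    next
      case 3
      note tr = has_vector_derivative_transform_within_open[OF _ open_greaterThanLessThan 3]
      have y: "x \<in> {b<..<1} - {a, b}" using 3 ab by auto
      have "0 \<le> b" using ab by simp
      note D = system_derivatives[OF this order_refl \<Phi>c \<Psi>c eq\<Phi> eq\<Psi> y]
      have "((\<lambda>x. U b * \<Phi> x) has_vector_derivative U b * ((1 / p x) *\<^sub>R \<Psi> x)) (at x)"
        by (intro has_vector_derivative_mult_right D(1))
      then have "(v has_vector_derivative U b * ((1 / p x) *\<^sub>R \<Psi> x)) (at x)"
        by (rule tr) (use ab in \<open>auto simp: v_def v0_def\<close>)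
      moreover have "((\<lambda>x. U b * \<Psi> x) has_vector_derivative U b * (- \<mu> * (w x *\<^sub>R \<Phi> x))) (at x)"
        by (intro has_vector_derivative_mult_right D(2))
      then have "(r0 has_vector_derivative U b * (- \<mu> * (w x *\<^sub>R \<Phi> x))) (at x)"
        by (rule tr) (use ab in \<open>auto simp: r0_def\<close>)
      ultimately show ?thesis using 3 ab by (simp add: v_def v0_def r0_def mult_ac)
    qed
  qed
  have "v \<in> eigenspace \<epsilon> \<mu>"
    by (rule ode_imp_eigenspace[OF vc r0c]) (use der \<Phi>b q0 ab in \<open>auto simp: r0_def v_def\<close>)
  moreover have "AE x in M. u x = v x"
    using uU AE_space by eventually_elim (use ab in \<open>auto simp: v_def v0_def\<close>)
  ultimately show ?thesis using that by blast
qed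

lemma eigenspace_weak:
  assumes v: "v \<in> eigenspace \<epsilon> \<mu>"
  shows "v \<in> V_space \<epsilon>" "\<eta> \<in> V_space \<epsilon> \<Longrightarrow> E v \<eta> = \<mu> * N v \<eta>"
proof -
  obtain q where ode: "ode \<mu> v q" and q0: "q a = 0" "q b = 0" using eigenspace_imp_ode[OF v] by blast
  have c: "continuous_on {a..b} v" "continuous_on {a..b} q"
    using ode J_subset(2) by (auto simp: ode_def intro: continuous_on_subset)
  have e: "v x = v a + integral {a..x} (\<lambda>x. (1 / p x) *\<^sub>R q x)" "q x = - \<mu> * integral {a..x} (\<lambda>x. w x *\<^sub>R v x)" if "x \<in> {a..b}" for x
  proof -
    have x: "0 \<le> a" "a \<le> x" "x \<le> 1" using that x0_bounds by auto
    then have "v x - v a = integral {a..x} (\<lambda>x. (1 / p x) *\<^sub>R q x)" "q x - q a = - \<mu> * integral {a..x} (\<lambda>x. w x *\<^sub>R v x)"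
      using ode unfolding ode_def by blast+
    then show "v x = v a + integral {a..x} (\<lambda>x. (1 / p x) *\<^sub>R q x)" "q x = - \<mu> * integral {a..x} (\<lambda>x. w x *\<^sub>R v x)"
      using q0 by (auto simp: algebra_simps)
  qed
  show "v \<in> V_space \<epsilon>" by (rule integral_equations_imp_weak(1)[OF c q0(2) e])
  show "E v \<eta> = \<mu> * N v \<eta>" if "\<eta> \<in> V_space \<epsilon>" by (rule integral_equations_imp_weak(2)[OF c q0(2) e that])
qed

text \<open>Both fluxes vanish at \<open>a\<close>, so subtracting the right multiple cancels all
  initial data there, and uniqueness holds on the whole of \<open>[0,1]\<close>.\<close>

lemma eigenspace_multiple:
  assumes u: "u \<in> eigenspace \<epsilon> \<mu>" and v: "v \<in> eigenspace \<epsilon> \<mu>" and "v \<noteq> 0"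
  shows "v a \<noteq> 0" "u = fscale (u a / v a) v"
proof -
  obtain q where q: "ode \<mu> u q" "q a = 0" using eigenspace_imp_ode[OF u] by blast
  obtain r where r: "ode \<mu> v r" "r a = 0" using eigenspace_imp_ode[OF v] by blast
  have out: "u x = 0" "v x = 0" if "x \<notin> {0..1}" for x using u v that by (auto simp: eigenspace_def)
  show va: "v a \<noteq> 0"
  proof
    assume "v a = 0"
    from ode_zero_all[OF r(1) this r(2)] out(2) have "v = 0" by (auto simp: fun_eq_iff)
    with \<open>v \<noteq> 0\<close> show False by simp
  qed
  have "u x - (u a / v a) * v x = 0" if "x \<in> {0..1}" for x
    by (rule ode_zero_all[OF ode_diff[OF q(1) r(1)] _ _ that]) (use va q r in auto)
  then have "u x = (u a / v a) * v x" for x using out[of x] by (cases "x \<in> {0..1}") auto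
  then show "u = fscale (u a / v a) v" unfolding fscale_def by (rule ext)
qed

text \<open>Excludes eigenfunctions living only outside \<open>M\<^sub>+\<close>: vanishing almost
  everywhere on \<open>J\<close> gives \<open>v a = 0\<close> by continuity, and then
  \<open>v\<close> is zero everywhere.\<close>

lemma eigenspace_nonzero_norm:
  assumes v: "v \<in> eigenspace \<epsilon> \<mu>" and "v \<noteq> 0"
  shows "0 < W.Q v"
proof -
  have vw: "v \<in> wl2 M w" using eigenspace_weak(1)[OF v] V_subset by blast
  have "W.Q v \<noteq> 0"
  proof
    assume "W.Q v = 0"
    then have ae: "AE x in M. v x = 0" using W.wl2_norm_zero_iff[OF vw] by simp
    obtain q where "ode \<mu> v q" using eigenspace_imp_ode[OF v] by blast
    then have c: "continuous_on {a..b} v" using J_subset(2) by (auto simp: ode_def intro: continuous_on_subset)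
    have "v x = 0" if x: "x \<in> J" for x
    proof (rule ccontr)
      assume "v x \<noteq> 0"
      have "open (J \<inter> v -` (- {0}))"
        by (intro continuous_open_preimage continuous_on_subset[OF c]) auto
      moreover have "x \<in> J \<inter> v -` (- {0})" using x \<open>v x \<noteq> 0\<close> by simp
      ultimately have "\<not> negligible (J \<inter> v -` (- {0}))" using open_not_negligible by blast
      moreover have "AE x in lebesgue. x \<in> J \<longrightarrow> v x = 0" using ae by (simp add: AE_restrict_space_iff)
      then obtain Z where "{x. \<not> (x \<in> J \<longrightarrow> v x = 0)} \<subseteq> Z" "negligible Z"
        by (auto simp: eventually_ae_filter negligible_iff_null_sets)
      then have "negligible (J \<inter> v -` (- {0}))" by (rule_tac negligible_subset[of Z]) auto
      ultimately show False by blast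
    qed
    then have "v a = 0"
      using continuous_constant_on_closure[of J v 0 a] c x0_bounds by (simp add: closure_greaterThanLessThan)
    with eigenspace_multiple(1)[OF v v \<open>v \<noteq> 0\<close>] show False by simp
  qed
  then show ?thesis using W.nonneg[OF vw] by simp
qed

section \<open>Simplicity and the listing of eigenvalues\<close>

lemma multiplicity_one:
  assumes "is_eigenvalue \<epsilon> \<mu>"
  shows "multiplicity \<epsilon> \<mu> = 1"
proof -
  obtain v where v: "v \<in> eigenspace \<epsilon> \<mu>" "v \<noteq> 0" using assms by (auto simp: is_eigenvalue_def)
  show ?thesis unfolding multiplicity_def
  proof (rule W.dim_unique[of "{v}"])
    show "eigenspace \<epsilon> \<mu> \<subseteq> W.span {v}"
    proof
      fix u assume "u \<in> eigenspace \<epsilon> \<mu>"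
      then obtain c where "u = fscale c v" using eigenspace_multiple(2)[OF _ v] by blast
      moreover have "v \<in> W.span {v}" by (rule W.span_base) simp
      ultimately show "u \<in> W.span {v}" using W.span_scale[of v "{v}" c] by metis
    qed
    show "{v} \<subseteq> eigenspace \<epsilon> \<mu>" using v by blast
  qed (use v in \<open>simp_all add: W.dependent_single\<close>)
qed

lemma eigvec_extension:
  obtains v where "v \<in> eigenspace \<epsilon> (of_real (F.eigval n))" "AE x in M. F.eigvec n x = v x" "v \<noteq> 0"
proof -
  obtain v where v: "v \<in> eigenspace \<epsilon> (of_real (F.eigval n))" "AE x in M. F.eigvec n x = v x"
    using weak_extends_to_eigenspace[OF F.eigvec_mem F.eigvec_weak] by blast
  have "v \<noteq> 0"
  proof
    assume "v = 0"
    with v(2) have "AE x in M. F.eigvec n x = 0" by simp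
    then have "W.Q (F.eigvec n) = 0" using W.wl2_norm_zero_iff[of "F.eigvec n"] F.eigvec_mem V_subset by blast
    with F.eigvec_minimizer(2) show False by simp
  qed
  with v that show ?thesis by blast
qed

lemma is_eigenvalue_iff: "is_eigenvalue \<epsilon> \<mu> \<longleftrightarrow> (\<exists>n. \<mu> = of_real (F.eigval n))"
proof
  assume "is_eigenvalue \<epsilon> \<mu>"
  then obtain v where v: "v \<in> eigenspace \<epsilon> \<mu>" "v \<noteq> 0" by (auto simp: is_eigenvalue_def)
  show "\<exists>n. \<mu> = of_real (F.eigval n)"
    by (rule F.weak_eigenvalue_listed[OF eigenspace_weak(1)[OF v(1)] eigenspace_nonzero_norm[OF v] eigenspace_weak(2)[OF v(1)]])
next
  assume "\<exists>n. \<mu> = of_real (F.eigval n)"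
  then obtain n where "\<mu> = of_real (F.eigval n)" by blast
  moreover obtain v where "v \<in> eigenspace \<epsilon> (of_real (F.eigval n))" "v \<noteq> 0" using eigvec_extension by metis
  ultimately show "is_eigenvalue \<epsilon> \<mu>" unfolding is_eigenvalue_def by metis
qed

text \<open>Two eigenvectors with the same value would extend to proportional eigenfunctions,
  contradicting their orthogonality on \<open>M\<^sub>+\<close>.\<close>

lemma eigval_strict_mono: "strict_mono F.eigval"
proof (rule strict_monoI)
  fix i j :: nat assume ij: "i < j"
  have "F.eigval i \<noteq> F.eigval j"
  proof
    assume eq: "F.eigval i = F.eigval j"
    obtain u where u: "u \<in> eigenspace \<epsilon> (of_real (F.eigval i))" "AE x in M. F.eigvec i x = u x" "u \<noteq> 0" by (rule eigvec_extension)
    obtain v where v: "v \<in> eigenspace \<epsilon> (of_real (F.eigval j))" "AE x in M. F.eigvec j x = v x" "v \<noteq> 0" by (rule eigvec_extension)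
    obtain k where uv: "u = fscale k v" using eigenspace_multiple(2)[OF u(1) v(1,3)[folded eq]] by blast
    have mem: "u \<in> wl2 M w" "v \<in> wl2 M w" "F.eigvec i \<in> wl2 M w" "F.eigvec j \<in> wl2 M w"
      using eigenspace_weak(1)[OF u(1)] eigenspace_weak(1)[OF v(1)] F.eigvec_mem V_subset by auto
    have "0 = N (F.eigvec i) (F.eigvec j)" using ij by (simp add: F.eigvec_orthonormal)
    also have "\<dots> = N u v" by (rule W.wl2_inner_cong_AE[OF mem(3,1,4,2) u(2) v(2)])
    also have "\<dots> = k * N v v" unfolding uv by (rule W.scale_left[OF mem(2,2)])
    finally have "k = 0 \<or> N v v = 0" by auto
    moreover have "N v v \<noteq> 0" using eigenspace_nonzero_norm[OF v(1,3)] by auto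
    ultimately have "u = fscale 0 v" using uv by simp
    then have "u = 0" by (simp add: fscale_def zero_fun_def)
    with u(3) show False by simp
  qed
  with F.eigval_mono[of i j] ij show "F.eigval i < F.eigval j" by simp
qed

text \<open>Listings start at index 1, minimisation values at 0.\<close>

lemma listing_exists: "eigenvalue_listing \<epsilon> (\<lambda>j. F.eigval (j - 1))"
  unfolding eigenvalue_listing_def
proof (intro conjI allI impI)
  show "F.eigval (i - 1) \<le> F.eigval (j - 1)" if "1 \<le> i \<and> i \<le> j" for i j
    using that by (intro F.eigval_mono diff_le_mono) simp
  show "(\<lambda>j. complex_of_real (F.eigval (j - 1))) ` {1..} = {\<mu>. is_eigenvalue \<epsilon> \<mu>}"
  proof (intro equalityI subsetI)
    fix \<mu> assume "\<mu> \<in> {\<mu>. is_eigenvalue \<epsilon> \<mu>}"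
    then obtain n where "\<mu> = of_real (F.eigval n)" by (auto simp: is_eigenvalue_iff)
    then show "\<mu> \<in> (\<lambda>j. complex_of_real (F.eigval (j - 1))) ` {1..}" by (intro image_eqI[of _ _ "Suc n"]) auto
  qed (auto simp: is_eigenvalue_iff)
  fix \<mu> assume ev: "is_eigenvalue \<epsilon> \<mu>"
  then obtain n where n: "\<mu> = of_real (F.eigval n)" by (auto simp: is_eigenvalue_iff)
  have set: "{j \<in> {1..}. complex_of_real (F.eigval (j - 1)) = \<mu>} = {Suc n}"
    using strict_mono_eq[OF eigval_strict_mono] by (auto simp: n)
  show "finite {j \<in> {1..}. complex_of_real (F.eigval (j - 1)) = \<mu>}"
    "card {j \<in> {1..}. complex_of_real (F.eigval (j - 1)) = \<mu>} = multiplicity \<epsilon> \<mu>"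
    unfolding set multiplicity_one[OF ev] by simp_all
qed

text \<open>Multiplicity one makes a nondecreasing listing strictly increasing, and two strictly
  increasing enumerations of one set coincide.\<close>

lemma listing_unique:
  assumes "eigenvalue_listing \<epsilon> lam" "j \<ge> 1"
  shows "lam j = F.eigval (j - 1)"
proof -
  have mono: "lam i \<le> lam k" if "1 \<le> i" "i \<le> k" for i k using assms(1) that unfolding eigenvalue_listing_def by blast
  have img: "(\<lambda>j. complex_of_real (lam j)) ` {1..} = {\<mu>. is_eigenvalue \<epsilon> \<mu>}" using assms(1) unfolding eigenvalue_listing_def by blast
  have inj: "i = k" if "1 \<le> i" "1 \<le> k" "lam i = lam k" for i k
  proof -
    have ev: "is_eigenvalue \<epsilon> (of_real (lam i))" using img that(1) by auto
    then have "card {j \<in> {1..}. complex_of_real (lam j) = of_real (lam i)} = 1"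
      using assms(1) multiplicity_one[OF ev] unfolding eigenvalue_listing_def by auto
    then obtain m where "{j \<in> {1..}. complex_of_real (lam j) = of_real (lam i)} = {m}" by (rule card_1_singletonE)
    moreover have "i \<in> {j \<in> {1..}. complex_of_real (lam j) = of_real (lam i)}" "k \<in> {j \<in> {1..}. complex_of_real (lam j) = of_real (lam i)}"
      using that by auto
    ultimately show ?thesis by (metis singletonD)
  qed
  have "strict_mono (\<lambda>n. lam (Suc n))"
  proof (rule strict_monoI)
    fix i k :: nat assume "i < k"
    then show "lam (Suc i) < lam (Suc k)" using mono[of "Suc i" "Suc k"] inj[of "Suc i" "Suc k"] by (simp add: less_le) blast
  qed
  moreover have "range (\<lambda>n. lam (Suc n)) = range F.eigval"
  proof -
    have "complex_of_real ` range (\<lambda>n. lam (Suc n)) = (\<lambda>j. complex_of_real (lam j)) ` {1..}"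
    proof -
      have "{1..} = range Suc" by (auto simp: image_iff Suc_le_D)
      then show ?thesis by (simp add: image_image)
    qed
    also have "\<dots> = complex_of_real ` range F.eigval" unfolding img by (auto simp: is_eigenvalue_iff)
    finally show ?thesis by (simp add: inj_image_eq_iff inj_of_real)
  qed
  ultimately have "lam (Suc n) = F.eigval n" for n using strict_mono_same_range[OF _ eigval_strict_mono] by blast
  from this[of "j - 1"] show ?thesis using assms(2) by simp
qed

section \<open>The max--min formula\<close>

lemma functional_wl2:
  assumes "k \<in> wl2 M w"
  shows "F.functional (\<lambda>x. N x k)"
  unfolding F.functional_def
proof (intro conjI ballI allI exI)
  fix x y assume "x \<in> V_space \<epsilon>" "y \<in> V_space \<epsilon>"
  then show "N (x + y) k = N x k + N y k" using assms V_subset by (intro W.add_left) auto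
next
  fix x c assume "x \<in> V_space \<epsilon>"
  then show "N (fscale c x) k = c * N x k" using assms V_subset by (intro W.scale_left) auto
next
  fix x assume "x \<in> V_space \<epsilon>"
  then show "(cmod (N x k))\<^sup>2 \<le> W.Q k * W.Q x" using assms V_subset W.Cauchy_Schwarz[of x k] by (auto simp: mult.commute)
qed

abbreviation "inner_functionals A \<equiv> (\<lambda>k x. N x k) ` A"

text \<open>Translates the admissible set into the abstract setting: a nonzero class is one of
  positive norm, and orthogonality is the kernel of the constraint functionals.\<close>

lemma admissible_eq:
  assumes "A \<subseteq> wl2 M w"
  shows "{v \<in> V_space \<epsilon> \<inter> L2_perp \<epsilon> A. \<not> L2_eq \<epsilon> v (\<lambda>x. 0)} = {v \<in> F.ker (inner_functionals A). 0 < W.Q v}"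
proof -
  have "\<not> L2_eq \<epsilon> v (\<lambda>x. 0) \<longleftrightarrow> 0 < W.Q v" if "v \<in> wl2 M w" for v
    using W.wl2_norm_zero_iff[OF that] W.nonneg[OF that] unfolding L2_eq_def M_plus_eq by auto
  then show ?thesis using V_subset by (auto simp: F.ker_def L2_perp_def L2w_eq L2_inner_eq)
qed

lemma rayleigh_eq: "rayleigh \<epsilon> v = Re (E v v) / W.Q v"
  unfolding rayleigh_def W.wl2_norm E_def P.wl2_norm wd_def M_plus_eq ..

lemma min_rayleigh_exists:
  assumes A: "A \<in> L2_subsets \<epsilon> n"
  shows "\<exists>m. is_minimum (rayleigh \<epsilon> ` {v \<in> V_space \<epsilon> \<inter> L2_perp \<epsilon> A. \<not> L2_eq \<epsilon> v (\<lambda>x. 0)}) m"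
proof -
  have Aw: "A \<subseteq> wl2 M w" and fin: "finite A" using A by (auto simp: L2_subsets_def L2w_eq)
  obtain v where v: "v \<in> F.ker (inner_functionals A)" "W.Q v = 1" "\<And>u. u \<in> F.ker (inner_functionals A) \<Longrightarrow> Re (E v v) * W.Q u \<le> Re (E u u)"
    using F.minimizer_exists[of "inner_functionals A"] functional_wl2 Aw fin by blast
  have "is_minimum (rayleigh \<epsilon> ` {v \<in> F.ker (inner_functionals A). 0 < W.Q v}) (rayleigh \<epsilon> v)"
    unfolding is_minimum_def
  proof (intro conjI ballI)
    show "rayleigh \<epsilon> v \<in> rayleigh \<epsilon> ` {v \<in> F.ker (inner_functionals A). 0 < W.Q v}" using v by (intro imageI) simp
    fix s assume "s \<in> rayleigh \<epsilon> ` {v \<in> F.ker (inner_functionals A). 0 < W.Q v}"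
    then obtain u where u: "u \<in> F.ker (inner_functionals A)" "0 < W.Q u" "s = rayleigh \<epsilon> u" by blast
    have "Re (E v v) \<le> Re (E u u) / W.Q u" using v(3)[OF u(1)] u(2) by (simp add: pos_le_divide_eq)
    then show "rayleigh \<epsilon> v \<le> s" using u(3) v(2) by (simp only: rayleigh_eq div_by_1)
  qed
  then show ?thesis unfolding admissible_eq[OF Aw] by blast
qed

text \<open>Different constraint vectors might induce the same functional on the form domain, so
  their number is only bounded by \<open>n\<close>; for \<open>minmax_upper\<close> that is
  enough.\<close>

lemma min_rayleigh_le:
  assumes A: "A \<in> L2_subsets \<epsilon> n"
    and m: "is_minimum (rayleigh \<epsilon> ` {v \<in> V_space \<epsilon> \<inter> L2_perp \<epsilon> A. \<not> L2_eq \<epsilon> v (\<lambda>x. 0)}) m"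
  shows "m \<le> F.eigval n"
proof -
  have Aw: "A \<subseteq> wl2 M w" and fin: "finite A" "card A = n" using A by (auto simp: L2_subsets_def L2w_eq)
  have "card (inner_functionals A) \<le> n" using card_image_le[OF fin(1)] fin(2) by blast
  then obtain x where x: "x \<in> F.ker (inner_functionals A)" "0 < W.Q x" "Re (E x x) \<le> F.eigval n * W.Q x"
    using F.minmax_upper[of "inner_functionals A" n] functional_wl2 Aw fin(1) by blast
  have "m \<le> rayleigh \<epsilon> x" using m x(1,2) unfolding admissible_eq[OF Aw] is_minimum_def by blast
  also have "\<dots> \<le> F.eigval n" using x(2,3) by (simp only: rayleigh_eq pos_divide_le_eq)
  finally show ?thesis .
qed

text \<open>The maximum is attained at the first \<open>n\<close> eigenvectors; being orthonormal,
  they form exactly \<open>n\<close> distinct classes.\<close>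

lemma eigvec_subsets: "F.eigvec ` {..<n} \<in> L2_subsets \<epsilon> n"
proof -
  have ne: "\<not> L2_eq \<epsilon> (F.eigvec i) (F.eigvec j)" if "i \<noteq> j" for i j
  proof
    assume "L2_eq \<epsilon> (F.eigvec i) (F.eigvec j)"
    then have ae: "AE x in M. F.eigvec i x = F.eigvec j x" unfolding L2_eq_def M_plus_eq .
    have mem: "F.eigvec k \<in> wl2 M w" for k using F.eigvec_mem V_subset by blast
    have "N (F.eigvec i) (F.eigvec j) = N (F.eigvec j) (F.eigvec j)"
      by (rule W.wl2_inner_cong_AE[OF mem mem mem mem ae]) simp
    then show False using that by (simp add: F.eigvec_orthonormal)
  qed
  have "inj_on F.eigvec {..<n}"
  proof (rule inj_onI, rule ccontr)
    fix i j assume "F.eigvec i = F.eigvec j" "i \<noteq> j"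
    with ne[of i j] show False by (simp add: L2_eq_def)
  qed
  then have "card (F.eigvec ` {..<n}) = n" by (simp add: card_image)
  moreover have "F.eigvec ` {..<n} \<subseteq> L2w \<epsilon>" using F.eigvec_mem V_subset by (auto simp: L2w_eq)
  moreover have "pairwise (\<lambda>u v. \<not> L2_eq \<epsilon> u v) (F.eigvec ` {..<n})"
    unfolding pairwise_def
  proof (intro ballI impI)
    fix u v assume "u \<in> F.eigvec ` {..<n}" "v \<in> F.eigvec ` {..<n}" "u \<noteq> v"
    then obtain i j where "u = F.eigvec i" "v = F.eigvec j" "i \<noteq> j" by blast
    then show "\<not> L2_eq \<epsilon> u v" using ne by blast
  qed
  ultimately show ?thesis by (simp add: L2_subsets_def)
qed

lemma min_rayleigh_eigvec:
  "is_minimum (rayleigh \<epsilon> ` {v \<in> V_space \<epsilon> \<inter> L2_perp \<epsilon> (F.eigvec ` {..<n}). \<not> L2_eq \<epsilon> v (\<lambda>x. 0)}) (F.eigval n)"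
proof -
  have Aw: "F.eigvec ` {..<n} \<subseteq> wl2 M w" using F.eigvec_mem V_subset by auto
  show ?thesis
    unfolding admissible_eq[OF Aw] F.orth_def[symmetric] is_minimum_def
  proof (intro conjI ballI)
    have "rayleigh \<epsilon> (F.eigvec n) = F.eigval n"
      by (simp only: rayleigh_eq F.eigvec_minimizer(2) F.eigval_def div_by_1)
    then show "F.eigval n \<in> rayleigh \<epsilon> ` {v \<in> F.orth (F.eigvec ` {..<n}). 0 < W.Q v}"
      using F.eigvec_minimizer(1)[of n] F.eigvec_minimizer(2)[of n] by (intro image_eqI[of _ _ "F.eigvec n"]) auto
    fix s assume "s \<in> rayleigh \<epsilon> ` {v \<in> F.orth (F.eigvec ` {..<n}). 0 < W.Q v}"
    then obtain u where u: "u \<in> F.orth (F.eigvec ` {..<n})" "0 < W.Q u" "s = rayleigh \<epsilon> u" by blast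
    have "F.eigval n * W.Q u \<le> Re (E u u)" by (rule F.eigvec_minimizer(3)[OF u(1)])
    then show "F.eigval n \<le> s" using u(2,3) by (simp only: rayleigh_eq pos_le_divide_eq)
  qed
qed

lemma max_min_principle:
  assumes lam: "eigenvalue_listing \<epsilon> lam" and j: "j \<ge> 1"
  shows "\<exists>\<mu>. (\<forall>Vj \<in> L2_subsets \<epsilon> (j - 1).
            is_minimum (rayleigh \<epsilon> ` {v \<in> V_space \<epsilon> \<inter> L2_perp \<epsilon> Vj. \<not> L2_eq \<epsilon> v (\<lambda>x. 0)}) (\<mu> Vj)) \<and>
         is_maximum (\<mu> ` L2_subsets \<epsilon> (j - 1)) (lam j)"
proof -
  let ?R = "\<lambda>A. rayleigh \<epsilon> ` {v \<in> V_space \<epsilon> \<inter> L2_perp \<epsilon> A. \<not> L2_eq \<epsilon> v (\<lambda>x. 0)}"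
  \<comment> \<open>Meaningful on admissible sets only, where a minimum exists; the other values are
    arbitrary.\<close>
  define \<mu> where "\<mu> A = (SOME m. is_minimum (?R A) m)" for A
  have \<mu>: "is_minimum (?R A) (\<mu> A)" if "A \<in> L2_subsets \<epsilon> (j - 1)" for A
    unfolding \<mu>_def by (rule someI_ex[OF min_rayleigh_exists[OF that]])
  have lj: "lam j = F.eigval (j - 1)" by (rule listing_unique[OF lam j])
  have "\<mu> (F.eigvec ` {..<j - 1}) = F.eigval (j - 1)"
    using \<mu>[OF eigvec_subsets] min_rayleigh_eigvec[of "j - 1"] unfolding is_minimum_def by (meson antisym)
  then have "is_maximum (\<mu> ` L2_subsets \<epsilon> (j - 1)) (lam j)"
    unfolding is_maximum_def lj using eigvec_subsets[of "j - 1"] min_rayleigh_le[OF _ \<mu>] by force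
  with \<mu> show ?thesis by blast
qed

end

theorem theorem1p3:
  shows "\<forall>\<^sub>F \<epsilon>::real in at_right 0.
    (\<exists>lam. eigenvalue_listing \<epsilon> lam) \<and>
    (\<forall>lam. eigenvalue_listing \<epsilon> lam \<longrightarrow>
      (\<forall>j\<ge>1. \<exists>\<mu> :: (real \<Rightarrow> complex) set \<Rightarrow> real.
         (\<forall>Vj \<in> L2_subsets \<epsilon> (j - 1).
            is_minimum
              (rayleigh \<epsilon> ` {v \<in> V_space \<epsilon> \<inter> L2_perp \<epsilon> Vj. \<not> L2_eq \<epsilon> v (\<lambda>x. 0)})
              (\<mu> Vj)) \<and>
         is_maximum (\<mu> ` L2_subsets \<epsilon> (j - 1)) (lam j)))"
proof -
  have "\<forall>\<^sub>F \<epsilon>::real in at_right 0. \<epsilon> \<in> {0<..<1/8}" by (rule eventually_at_right_real) simp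
  then show ?thesis
  proof eventually_elim
    case (elim \<epsilon>)
    then interpret small_parameter \<epsilon> by unfold_locales auto
    show ?case using listing_exists max_min_principle by blast
  qed
qed

end
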